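(* Let $(N^n,g)$ be a complete Riemannian manifold with finite volume. Assume that: (1) the integral $\int_{SN}\mathrm{Ric}^-(p,\theta)\,d\mu_{SN}(p,\theta)$ is finite, where $\mathrm{Ric}^-(p,\theta)=\max\{-\mathrm{Ric}(p,\theta),0\}$ denotes the negative part of the Ricci curvature; (2) the average scalar curvature $\overline R$ is at least $n(n-1)$. Then the conjugate radius of $N$ is at most $\pi$. Moreover, the conjugate radius equals $\pi$ if and only if $N$ has constant sectional curvature $1$.
   Context: All Riemannian manifolds are complete, smooth and oriented, with smooth metric. $SN=\{(p,\theta):p\in N,\ \theta\in T_pN,\ |\theta|=1\}$ is the unit sphere bundle, with canonical measure $d\mu_{SN}=d\theta\,d\mu_N$, where $d\theta$ is the standard measure on $S_pN\cong\mathbb S^{n-1}$. $\mathrm{Ric}(p,\theta)=\mathrm{Ric}_p(\theta,\theta)$ for $\theta\in S_pN$. $R$ is the scalar curvature and $\overline R=\frac1{|N|}\int_N R\,d\mu_N$, where $|N|$ is the volume of $N$; under hypothesis (1) this average exists in $(-\infty,\infty]$. The conjugate radius $\mathrm{conj}(N)$ is the supremum of all $r$ such that for any unit speed geodesic, any two conjugate points along it are at least $r$ units apart; equivalently, the supremum of all $r$ such that for every $p\in N$ the exponential map $\exp_p$ has nonsingular derivative at every point of the ball $B_0(r)\subset T_pN$.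
   Formalization: The dimension n is assumed to be at least 2; for n = 1 the claim is false (a circle has finite volume, Ric = 0, average scalar curvature 0 = n(n−1), and infinite conjugate radius). *)

theory Defs
  imports "HOL-Analysis.Analysis"
begin

section \<open>Smooth maps\<close>

text \<open>Meant for open \<open>S\<close>: all iterated directional derivatives up to order \<open>k\<close>
  exist on \<open>S\<close> and are continuous there.\<close>

primrec Ck_on :: "nat \<Rightarrow> 'a::real_normed_vector set \<Rightarrow> ('a \<Rightarrow> 'b::real_normed_vector) \<Rightarrow> bool" where
  "Ck_on 0 S f \<longleftrightarrow> continuous_on S f"
| "Ck_on (Suc k) S f \<longleftrightarrow>
     (\<forall>x\<in>S. f differentiable (at x)) \<and> (\<forall>v. Ck_on k S (\<lambda>x. frechet_derivative f (at x) v))"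

definition smooth_on :: "'a::real_normed_vector set \<Rightarrow> ('a \<Rightarrow> 'b::real_normed_vector) \<Rightarrow> bool" where
  "smooth_on S f \<longleftrightarrow> (\<forall>k. Ck_on k S f)"

definition partial_deriv :: "'n::finite \<Rightarrow> (real^'n \<Rightarrow> real) \<Rightarrow> real^'n \<Rightarrow> real" where
  "partial_deriv i f x = frechet_derivative f (at x) (axis i 1)"


section \<open>Oriented smooth manifolds\<close>

text \<open>The manifold is a whole type \<open>'a\<close> of class \<open>{t2_space, second_countable_topology}\<close>,
  and its dimension is \<open>CARD('n)\<close>.  A chart is a domain together with a coordinate map, of which
  only the values on the domain matter.  Connectedness is not required.\<close>

type_synonym ('a, 'n) chart = "'a set \<times> ('a \<Rightarrow> real^'n)"

abbreviation cdom :: "('a, 'n::finite) chart \<Rightarrow> 'a set" where "cdom c \<equiv> fst c"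
abbreviation cmap :: "('a, 'n::finite) chart \<Rightarrow> 'a \<Rightarrow> real^'n" where "cmap c \<equiv> snd c"
abbreviation cinv :: "('a, 'n::finite) chart \<Rightarrow> real^'n \<Rightarrow> 'a" where
  "cinv c \<equiv> inv_into (cdom c) (cmap c)"
abbreviation cimg :: "('a, 'n::finite) chart \<Rightarrow> (real^'n) set" where
  "cimg c \<equiv> cmap c ` cdom c"

definition is_chart :: "('a::topological_space, 'n::finite) chart \<Rightarrow> bool" where
  "is_chart c \<longleftrightarrow> open (cdom c) \<and> open (cimg c) \<and> homeomorphism (cdom c) (cimg c) (cmap c) (cinv c)"

definition transition :: "('a, 'n::finite) chart \<Rightarrow> ('a, 'n) chart \<Rightarrow> real^'n \<Rightarrow> real^'n" where
  "transition c d = (\<lambda>x. cmap d (cinv c x))"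

definition transition_deriv ::
    "('a, 'n::finite) chart \<Rightarrow> ('a, 'n) chart \<Rightarrow> 'a \<Rightarrow> real^'n \<Rightarrow> real^'n" where
  "transition_deriv c d p = frechet_derivative (transition c d) (at (cmap c p))"

definition oriented_smooth_atlas ::
    "('a::{t2_space, second_countable_topology}, 'n::finite) chart set \<Rightarrow> bool" where
  "oriented_smooth_atlas A \<longleftrightarrow>
     (\<forall>c\<in>A. is_chart c) \<and>
     (\<Union>c\<in>A. cdom c) = UNIV \<and>
     (\<forall>c\<in>A. \<forall>d\<in>A.
        smooth_on (cmap c ` (cdom c \<inter> cdom d)) (transition c d) \<and>
        (\<forall>p \<in> cdom c \<inter> cdom d. det (matrix (transition_deriv c d p)) > 0))"


section \<open>Tangent vectors\<close>

text \<open>A tangent vector at \<open>p\<close> is the family of its components with respect to all charts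
  around \<open>p\<close>, related by the Jacobians of the coordinate changes.  The components at charts
  that do not contain \<open>p\<close> are set to zero, so that the vector space operations are pointwise.\<close>

type_synonym ('a, 'n) tvec = "('a, 'n) chart \<Rightarrow> real^'n"

definition tangent_space :: "('a, 'n::finite) chart set \<Rightarrow> 'a \<Rightarrow> ('a, 'n) tvec set" where
  "tangent_space A p =
     {v. (\<forall>c\<in>A. \<forall>d\<in>A. p \<in> cdom c \<and> p \<in> cdom d \<longrightarrow> v d = transition_deriv c d p (v c)) \<and>
         (\<forall>c. \<not> (c \<in> A \<and> p \<in> cdom c) \<longrightarrow> v c = 0)}"

text \<open>The tangent vector at \<open>p\<close> with components \<open>y\<close> in the chart \<open>c\<close>.\<close>

definition tvec_of ::
    "('a, 'n::finite) chart set \<Rightarrow> ('a, 'n) chart \<Rightarrow> 'a \<Rightarrow> real^'n \<Rightarrow> ('a, 'n) tvec" where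
  "tvec_of A c p y = (\<lambda>d. if d \<in> A \<and> p \<in> cdom d then transition_deriv c d p y else 0)"

definition lincomb2 :: "real \<Rightarrow> ('a, 'n::finite) tvec \<Rightarrow> real \<Rightarrow> ('a, 'n) tvec \<Rightarrow> ('a, 'n) tvec" where
  "lincomb2 a u b v = (\<lambda>c. a *\<^sub>R u c + b *\<^sub>R v c)"


section \<open>Riemannian metrics\<close>

type_synonym ('a, 'n) metric = "'a \<Rightarrow> ('a, 'n) tvec \<Rightarrow> ('a, 'n) tvec \<Rightarrow> real"

text \<open>The Gram matrix of the coordinate fields of \<open>c\<close>, as a function of the coordinates.\<close>

definition gram ::
    "('a, 'n::finite) chart set \<Rightarrow> ('a, 'n) metric \<Rightarrow> ('a, 'n) chart \<Rightarrow> real^'n \<Rightarrow> real^'n^'n" where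
  "gram A g c x =
     (\<chi> i j. g (cinv c x) (tvec_of A c (cinv c x) (axis i 1)) (tvec_of A c (cinv c x) (axis j 1)))"

definition riemannian_metric :: "('a, 'n::finite) chart set \<Rightarrow> ('a, 'n) metric \<Rightarrow> bool" where
  "riemannian_metric A g \<longleftrightarrow>
     (\<forall>p. \<forall>u\<in>tangent_space A p. \<forall>v\<in>tangent_space A p.
        g p u v = g p v u \<and>
        (\<forall>w\<in>tangent_space A p. \<forall>a b. g p (lincomb2 a u b w) v = a * g p u v + b * g p w v) \<and>
        (v \<noteq> (\<lambda>_. 0) \<longrightarrow> g p v v > 0)) \<and>
     (\<forall>c\<in>A. \<forall>i j. smooth_on (cimg c) (\<lambda>x. gram A g c x $ i $ j))"

definition orthonormal_frame ::
    "('a, 'n::finite) chart set \<Rightarrow> ('a, 'n) metric \<Rightarrow> 'a \<Rightarrow> ('n \<Rightarrow> ('a, 'n) tvec) \<Rightarrow> bool" where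
  "orthonormal_frame A g p e \<longleftrightarrow>
     (\<forall>i. e i \<in> tangent_space A p) \<and> (\<forall>i j. g p (e i) (e j) = (if i = j then 1 else 0))"

text \<open>An arbitrary orthonormal basis of the tangent space at \<open>p\<close>.  It is only used in
  expressions (traces, the measure of the unit sphere) that do not depend on the choice.\<close>

definition frame ::
    "('a, 'n::finite) chart set \<Rightarrow> ('a, 'n) metric \<Rightarrow> 'a \<Rightarrow> 'n \<Rightarrow> ('a, 'n) tvec" where
  "frame A g p = (SOME e. orthonormal_frame A g p e)"

definition from_frame ::
    "('a, 'n::finite) chart set \<Rightarrow> ('a, 'n) metric \<Rightarrow> 'a \<Rightarrow> real^'n \<Rightarrow> ('a, 'n) tvec" where
  "from_frame A g p x = (\<lambda>c. \<Sum>i\<in>UNIV. (x $ i) *\<^sub>R frame A g p i c)"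


section \<open>Levi-Civita connection and curvature\<close>

text \<open>\<open>christoffel A g c k i j\<close> is the symbol with upper index \<open>k\<close> and lower indices \<open>i, j\<close>.\<close>

definition christoffel ::
    "('a, 'n::finite) chart set \<Rightarrow> ('a, 'n) metric \<Rightarrow> ('a, 'n) chart \<Rightarrow>
     'n \<Rightarrow> 'n \<Rightarrow> 'n \<Rightarrow> real^'n \<Rightarrow> real" where
  "christoffel A g c k i j x =
     (1/2) * (\<Sum>l\<in>UNIV. matrix_inv (gram A g c x) $ k $ l *
        (partial_deriv i (\<lambda>y. gram A g c y $ j $ l) x
         + partial_deriv j (\<lambda>y. gram A g c y $ i $ l) x
         - partial_deriv l (\<lambda>y. gram A g c y $ i $ j) x))"

text \<open>The vector \<open>R(u,v)w\<close>, with the sign convention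
  \<open>R(X,Y)Z = \<nabla>\<^sub>X \<nabla>\<^sub>Y Z - \<nabla>\<^sub>Y \<nabla>\<^sub>X Z - \<nabla>\<^bsub>[X,Y]\<^esub> Z\<close>.\<close>

definition curvature ::
    "('a, 'n::finite) chart set \<Rightarrow> ('a, 'n) metric \<Rightarrow> 'a \<Rightarrow>
     ('a, 'n) tvec \<Rightarrow> ('a, 'n) tvec \<Rightarrow> ('a, 'n) tvec \<Rightarrow> ('a, 'n) tvec" where
  "curvature A g p u v w =
     (\<lambda>c. if c \<in> A \<and> p \<in> cdom c then
        (let x = cmap c p; \<Gamma> = christoffel A g c in
         \<chi> l. \<Sum>i\<in>UNIV. \<Sum>j\<in>UNIV. \<Sum>k\<in>UNIV.
           (partial_deriv i (\<Gamma> l j k) x - partial_deriv j (\<Gamma> l i k) x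
            + (\<Sum>m\<in>UNIV. \<Gamma> l i m x * \<Gamma> m j k x - \<Gamma> l j m x * \<Gamma> m i k x))
           * (u c $ i) * (v c $ j) * (w c $ k))
      else 0)"

definition sectional_curvature ::
    "('a, 'n::finite) chart set \<Rightarrow> ('a, 'n) metric \<Rightarrow> 'a \<Rightarrow>
     ('a, 'n) tvec \<Rightarrow> ('a, 'n) tvec \<Rightarrow> real" where
  "sectional_curvature A g p u v =
     g p (curvature A g p u v v) u / (g p u u * g p v v - (g p u v)\<^sup>2)"

definition constant_sectional_curvature ::
    "('a, 'n::finite) chart set \<Rightarrow> ('a, 'n) metric \<Rightarrow> real \<Rightarrow> bool" where
  "constant_sectional_curvature A g \<kappa> \<longleftrightarrow>
     (\<forall>p. \<forall>u\<in>tangent_space A p. \<forall>v\<in>tangent_space A p.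
        (\<forall>a b. lincomb2 a u b v = (\<lambda>_. 0) \<longrightarrow> a = 0 \<and> b = 0) \<longrightarrow>
        sectional_curvature A g p u v = \<kappa>)"

definition ricci ::
    "('a, 'n::finite) chart set \<Rightarrow> ('a, 'n) metric \<Rightarrow> 'a \<Rightarrow>
     ('a, 'n) tvec \<Rightarrow> ('a, 'n) tvec \<Rightarrow> real" where
  "ricci A g p v w = (\<Sum>i\<in>UNIV. g p (curvature A g p (frame A g p i) v w) (frame A g p i))"

definition scalar_curvature ::
    "('a, 'n::finite) chart set \<Rightarrow> ('a, 'n) metric \<Rightarrow> 'a \<Rightarrow> real" where
  "scalar_curvature A g p = (\<Sum>i\<in>UNIV. ricci A g p (frame A g p i) (frame A g p i))"


section \<open>Geodesics, completeness and conjugate points\<close>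

text \<open>Below, a vector field \<open>V\<close> along a continuous curve \<open>\<gamma>\<close> satisfies \<open>V s c = 0\<close> whenever
  \<open>\<gamma> s\<close> is outside the chart \<open>c\<close>; derivatives of \<open>\<lambda>s. V s c\<close> are only used at parameters where
  \<open>\<gamma>\<close> is inside the (open) chart domain, hence depend only on the actual components.\<close>

definition velocity ::
    "('a, 'n::finite) chart set \<Rightarrow> (real \<Rightarrow> 'a) \<Rightarrow> real \<Rightarrow> ('a, 'n) tvec" where
  "velocity A \<gamma> t =
     (\<lambda>c. if c \<in> A \<and> \<gamma> t \<in> cdom c then vector_derivative (cmap c \<circ> \<gamma>) (at t) else 0)"

definition differentiable_curve ::
    "('a::topological_space, 'n::finite) chart set \<Rightarrow> (real \<Rightarrow> 'a) \<Rightarrow> bool" where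
  "differentiable_curve A \<gamma> \<longleftrightarrow> continuous_on UNIV \<gamma> \<and>
     (\<forall>t. \<forall>c\<in>A. \<gamma> t \<in> cdom c \<longrightarrow> (cmap c \<circ> \<gamma>) differentiable (at t))"

definition differentiable_field_along ::
    "('a, 'n::finite) chart set \<Rightarrow> (real \<Rightarrow> 'a) \<Rightarrow> (real \<Rightarrow> ('a, 'n) tvec) \<Rightarrow> bool" where
  "differentiable_field_along A \<gamma> V \<longleftrightarrow>
     (\<forall>t. V t \<in> tangent_space A (\<gamma> t) \<and>
          (\<forall>c\<in>A. \<gamma> t \<in> cdom c \<longrightarrow> (\<lambda>s. V s c) differentiable (at t)))"

definition covariant_derivative ::
    "('a, 'n::finite) chart set \<Rightarrow> ('a, 'n) metric \<Rightarrow> (real \<Rightarrow> 'a) \<Rightarrow>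
     (real \<Rightarrow> ('a, 'n) tvec) \<Rightarrow> real \<Rightarrow> ('a, 'n) tvec" where
  "covariant_derivative A g \<gamma> V t =
     (\<lambda>c. if c \<in> A \<and> \<gamma> t \<in> cdom c then
        vector_derivative (\<lambda>s. V s c) (at t) +
        (\<chi> k. \<Sum>i\<in>UNIV. \<Sum>j\<in>UNIV. christoffel A g c k i j (cmap c (\<gamma> t))
                 * (velocity A \<gamma> t c $ i) * (V t c $ j))
      else 0)"

text \<open>Geodesics parametrized by the whole real line.\<close>

definition geodesic ::
    "('a::topological_space, 'n::finite) chart set \<Rightarrow> ('a, 'n) metric \<Rightarrow> (real \<Rightarrow> 'a) \<Rightarrow> bool" where
  "geodesic A g \<gamma> \<longleftrightarrow>
     differentiable_curve A \<gamma> \<and> differentiable_field_along A \<gamma> (velocity A \<gamma>) \<and>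
     (\<forall>t. covariant_derivative A g \<gamma> (velocity A \<gamma>) t = (\<lambda>_. 0))"

definition complete_metric ::
    "('a::topological_space, 'n::finite) chart set \<Rightarrow> ('a, 'n) metric \<Rightarrow> bool" where
  "complete_metric A g \<longleftrightarrow>
     (\<forall>p. \<forall>v\<in>tangent_space A p. \<exists>\<gamma>. geodesic A g \<gamma> \<and> \<gamma> 0 = p \<and> velocity A \<gamma> 0 = v)"

definition unit_speed_geodesic ::
    "('a::topological_space, 'n::finite) chart set \<Rightarrow> ('a, 'n) metric \<Rightarrow> (real \<Rightarrow> 'a) \<Rightarrow> bool" where
  "unit_speed_geodesic A g \<gamma> \<longleftrightarrow>
     geodesic A g \<gamma> \<and> (\<forall>t. g (\<gamma> t) (velocity A \<gamma> t) (velocity A \<gamma> t) = 1)"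

definition jacobi_field ::
    "('a, 'n::finite) chart set \<Rightarrow> ('a, 'n) metric \<Rightarrow> (real \<Rightarrow> 'a) \<Rightarrow>
     (real \<Rightarrow> ('a, 'n) tvec) \<Rightarrow> bool" where
  "jacobi_field A g \<gamma> J \<longleftrightarrow>
     (let DJ = covariant_derivative A g \<gamma> J in
        differentiable_field_along A \<gamma> J \<and> differentiable_field_along A \<gamma> DJ \<and>
        (\<forall>t c. covariant_derivative A g \<gamma> DJ t c
               + curvature A g (\<gamma> t) (J t) (velocity A \<gamma> t) (velocity A \<gamma> t) c = 0))"

definition conjugate_along ::
    "('a, 'n::finite) chart set \<Rightarrow> ('a, 'n) metric \<Rightarrow> (real \<Rightarrow> 'a) \<Rightarrow> real \<Rightarrow> real \<Rightarrow> bool" where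
  "conjugate_along A g \<gamma> s t \<longleftrightarrow> s \<noteq> t \<and>
     (\<exists>J. jacobi_field A g \<gamma> J \<and> J s = (\<lambda>_. 0) \<and> J t = (\<lambda>_. 0) \<and> (\<exists>u. J u \<noteq> (\<lambda>_. 0)))"

text \<open>Intended for complete metrics, where every geodesic extends to the real line.  The value
  is \<open>\<infinity>\<close> when there are no conjugate points.\<close>

definition conjugate_radius ::
    "('a::topological_space, 'n::finite) chart set \<Rightarrow> ('a, 'n) metric \<Rightarrow> ereal" where
  "conjugate_radius A g =
     Sup {ereal r | r. \<forall>\<gamma>. unit_speed_geodesic A g \<gamma> \<longrightarrow>
                         (\<forall>s t. conjugate_along A g \<gamma> s t \<longrightarrow> r \<le> \<bar>s - t\<bar>)}"


section \<open>Riemannian volume and the measure on the unit sphere bundle\<close>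

text \<open>Unique since countably many charts cover the manifold; it exists by the change of
  variables formula.\<close>

definition riemannian_volume ::
    "('a::topological_space, 'n::finite) chart set \<Rightarrow> ('a, 'n) metric \<Rightarrow> 'a measure" where
  "riemannian_volume A g =
     (THE M. sets M = sets borel \<and>
        (\<forall>c\<in>A. \<forall>E\<in>sets borel. E \<subseteq> cdom c \<longrightarrow>
           emeasure M E = (\<integral>\<^sup>+ x \<in> cmap c ` E. ennreal (sqrt (det (gram A g c x))) \<partial>lborel)))"

text \<open>Surface measure of the unit sphere of \<open>real^'n\<close>, as a measure on the ambient space: by
  integration in polar coordinates, the area of \<open>E\<close> is \<open>n\<close> times the volume of the cone over
  \<open>E\<close> inside the unit ball (\<open>sgn x = x / norm x\<close>).\<close>

definition sphere_measure :: "(real^'n::finite) measure" where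
  "sphere_measure =
     scale_measure (of_nat CARD('n)) (distr (restrict_space lborel (ball 0 1 - {0})) borel sgn)"

definition unit_sphere_bundle ::
    "('a, 'n::finite) chart set \<Rightarrow> ('a, 'n) metric \<Rightarrow> ('a \<times> ('a, 'n) tvec) set" where
  "unit_sphere_bundle A g = {(p, \<theta>). \<theta> \<in> tangent_space A p \<and> g p \<theta> \<theta> = 1}"

text \<open>The Borel \<open>\<sigma>\<close>-algebra, read off in the bundle charts induced by the atlas.\<close>

definition usb_sets ::
    "('a, 'n::finite) chart set \<Rightarrow> ('a, 'n) metric \<Rightarrow> ('a \<times> ('a, 'n) tvec) set set" where
  "usb_sets A g =
     {E. E \<subseteq> unit_sphere_bundle A g \<and>
         (\<forall>c\<in>A. {(x, y). x \<in> cimg c \<and> (cinv c x, tvec_of A c (cinv c x) y) \<in> E}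
                  \<in> sets (borel :: ((real^'n) \<times> (real^'n)) measure))}"

text \<open>\<open>d\<mu> = d\<theta> d\<mu>\<^sub>N\<close>: the unit sphere at \<open>p\<close> is identified with that of \<open>real^'n\<close> by the linear
  isometry \<open>from_frame A g p\<close>.\<close>

definition usb_measure ::
    "('a::topological_space, 'n::finite) chart set \<Rightarrow> ('a, 'n) metric \<Rightarrow>
     ('a \<times> ('a, 'n) tvec) measure" where
  "usb_measure A g =
     measure_of (unit_sphere_bundle A g) (usb_sets A g)
       (\<lambda>E. \<integral>\<^sup>+ p. emeasure sphere_measure {x \<in> sphere 0 1. (p, from_frame A g p x) \<in> E}
              \<partial>riemannian_volume A g)"

text \<open>The value is meaningful if the volume is finite and the negative part of the scalar curvature
  has finite integral; note that \<open>\<infinity> - \<infinity> = \<infinity>\<close> in \<^typ>\<open>ereal\<close>.  The coercion \<^const>\<open>ennreal\<close>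
  sends negative numbers to \<open>0\<close>.\<close>

definition average_scalar_curvature ::
    "('a::topological_space, 'n::finite) chart set \<Rightarrow> ('a, 'n) metric \<Rightarrow> ereal" where
  "average_scalar_curvature A g =
     (enn2ereal (\<integral>\<^sup>+ p. ennreal (scalar_curvature A g p) \<partial>riemannian_volume A g)
      - enn2ereal (\<integral>\<^sup>+ p. ennreal (- scalar_curvature A g p) \<partial>riemannian_volume A g))
     / enn2ereal (emeasure (riemannian_volume A g) UNIV)"

end

theory Submission
  imports Defs "HOL-Combinatorics.Permutations"
begin

text \<open>If no unit speed geodesic has conjugate points at distance less than \<open>\<pi>\<close>, then along each
  of them the index form is nonnegative on the fields \<open>sin t E\<close> with \<open>E\<close> parallel and orthogonal to
  the geodesic; summing over an orthonormal frame gives \<open>\<integral>\<^sub>0\<^sup>\<pi> sin\<^sup>2 t Ric \<le> (n - 1) \<pi> / 2\<close>.  The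
  geodesic flow preserves the measure of the tangent bundle, so averaging this inequality over all
  unit vectors bounds the average of \<open>Ric\<close> by \<open>n - 1\<close>, that is, the average scalar curvature by
  \<open>n (n - 1)\<close>; finiteness of the integral of \<open>Ric\<^sup>-\<close> is what justifies the exchange of integrals.
  If the average is at least \<open>n (n - 1)\<close>, equality holds along almost all geodesics.  Then the fields
  \<open>sin t E\<close> minimise the index form, hence are Jacobi fields, and by continuity the sectional
  curvature is 1.  Applied to a conjugate radius of at least \<open>\<pi>\<close>, this leaves constant curvature 1,
  where the conjugate radius is exactly \<open>\<pi>\<close>.

  The flow is shown to preserve the measure \<open>det G dx dy\<close> without differentiating it in the initial
  conditions: it is compared with one explicit Euler step of length \<open>h\<close>, whose weighted Jacobian
  determinant differs from \<open>det G\<close> by \<open>o(h)\<close>.\<close>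

section \<open>Change of variables\<close>

text \<open>At length \<pi> itself the end points may be conjugate. So the matrix of Jacobi fields
  starts slightly before the interval, and the critical length is reached as a limit of rescaled
  equations. Invariance of the measure rests on one cancellation: by metric compatibility the
  logarithmic derivative of \<open>det G\<close> along \<open>y\<close> is twice the trace of the
  Christoffel map of \<open>y\<close>, and the velocity update of the Euler step has as Jacobian
  trace minus the same amount. Lipschitz dependence on initial values then suffices, and the
  one-sided bound o(h), used in both time directions, gives derivative zero. Unit vectors are traded
  for the punctured unit ball bundle, whose measure has a density in bundle charts; Ric becomes
  homogeneous of degree 0 and time is rescaled by the speed, which the flow preserves. Positive and
  negative parts stay apart throughout, since only the negative one is known in advance to have a
  finite integral. Almost all geodesics suffice in the equality case because a nonempty open set of
  the bundle has positive measure.\<close>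

text \<open>The library proves the change of variables formula only for index types that are
  well-ordered; \<open>'n pos\<close> is such a copy of \<open>'n\<close>.\<close>

typedef ('n::finite) pos = "{..<CARD('n)}" by (rule exI[of _ 0]) simp

setup_lifting type_definition_pos

instantiation pos :: (finite) linorder
begin
lift_definition less_eq_pos :: "'a pos \<Rightarrow> 'a pos \<Rightarrow> bool" is "(\<le>)" .
lift_definition less_pos :: "'a pos \<Rightarrow> 'a pos \<Rightarrow> bool" is "(<)" .
instance by standard (transfer; auto)+
end

instance pos :: (finite) finite
proof
  show "finite (UNIV :: 'a pos set)"
    unfolding type_definition.univ[OF type_definition_pos] by (rule finite_imageI) simp
qed

instance pos :: (finite) wellorder
proof
  fix P :: "'a pos \<Rightarrow> bool" and a
  assume *: "\<And>x. (\<And>y. y < x \<Longrightarrow> P y) \<Longrightarrow> P x"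
  show "P a"
  proof (induction "Rep_pos a" arbitrary: a rule: less_induct)
    case less
    then show ?case by (rule *) (simp add: less_pos.rep_eq)
  qed
qed

lemma card_pos: "CARD('n::finite pos) = CARD('n)"
  using type_definition.card[OF type_definition_pos] by simp

lemma ex_pos_bij: "\<exists>h :: 'n::finite pos \<Rightarrow> 'n. bij h"
  using card_pos[where 'n='n] by (metis finite_same_card_bij finite_class.finite_UNIV)

text \<open>Conjugation by \<open>h\<close> is a sign-preserving bijection between the permutations
  of the two index types, so the Leibniz sums agree term by term.\<close>

lemma det_reindex:
  fixes M :: "real^'n::finite^'n" and h :: "'m::finite \<Rightarrow> 'n"
  assumes h: "bij h"
  shows "det (\<chi> i j. M $ h i $ h j) = det M"
proof -
  have hi: "inj h" "bij_betw h UNIV UNIV" using h by (auto simp: bij_def bij_betw_def)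
  have *: "bij_betw (map_permutation UNIV h) {p. p permutes UNIV} {p. p permutes UNIV}"
  proof -
    have "map_permutation UNIV h = (\<lambda>\<pi> x. if x \<in> UNIV then h (\<pi> (inv_into UNIV h x)) else x)"
      using h by (auto simp: map_permutation_def restrict_id_def bij_is_surj fun_eq_iff)
    then show ?thesis using bij_betw_permutations[OF hi(2)] by simp
  qed
  have mp: "map_permutation UNIV h p (h i) = h (p i)" for p i
    using hi h by (simp add: map_permutation_def restrict_id_def bij_is_surj)
  have pr: "(\<Prod>i\<in>UNIV. M $ i $ map_permutation UNIV h p i) = (\<Prod>i\<in>UNIV. M $ h i $ h (p i))" for p
    by (rule prod.reindex_bij_betw[OF hi(2), symmetric, of "\<lambda>i. M $ i $ map_permutation UNIV h p i", unfolded mp])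
  have "det M = (\<Sum>p | p permutes (UNIV :: 'm set). of_int (sign (map_permutation UNIV h p)) *
     (\<Prod>i\<in>UNIV. M $ i $ map_permutation UNIV h p i))"
    unfolding det_def by (rule sum.reindex_bij_betw[OF *, symmetric])
  also have "\<dots> = (\<Sum>p | p permutes (UNIV :: 'm set). of_int (sign p) * (\<Prod>i\<in>UNIV. M $ h i $ h (p i)))"
    by (rule sum.cong) (auto simp: pr sign_map_permutation[OF hi(1)])
  finally show ?thesis by (simp add: det_def)
qed

text \<open>\<open>has_measure_differentiable_image\<close> is an equivalence between finite measure
  \<open>m\<close> of the image and integral \<open>m\<close> of the Jacobian. One direction gives
  the value when the image has finite measure; the other rules out a finite integral when it does
  not.\<close>

lemma emeasure_diff_image_wellorder:
  fixes f :: "real^'n::{finite,wellorder} \<Rightarrow> real^'n::_"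
  assumes S: "open S" and der: "\<And>x. x \<in> S \<Longrightarrow> (f has_derivative f' x) (at x)" and inj: "inj_on f S"
    and E: "E \<in> sets borel"
  shows "emeasure lborel (f ` S \<inter> E) = (\<integral>\<^sup>+x. ennreal \<bar>det (matrix (f' x))\<bar> * indicator (S \<inter> f -` E) x \<partial>lborel)"
proof -
  let ?S = "S \<inter> f -` E" let ?D = "\<lambda>x. \<bar>det (matrix (f' x))\<bar>"
  have cont: "continuous_on S f"
    using der by (meson continuous_at_imp_continuous_on has_derivative_continuous)
  have Sb: "?S \<in> sets borel"
  proof -
    have "f \<in> borel_measurable (restrict_space borel S)"
      using cont by (rule borel_measurable_continuous_on_restrict)
    from measurable_sets[OF this E] have "f -` E \<inter> S \<in> sets (restrict_space borel S)"
      by (simp add: space_restrict_space)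
    then show ?thesis using S by (subst (asm) sets_restrict_space_iff) (auto simp: Int_commute)
  qed
  then have Sl: "?S \<in> sets lebesgue" by simp
  have eq: "f ` S \<inter> E = f ` ?S" by auto
  have "open (f ` S)" using invariance_of_domain[OF cont S inj] .
  then have fb: "f ` ?S \<in> sets borel" unfolding eq[symmetric] using E by auto
  have *: "f ` ?S \<in> lmeasurable \<and> measure lebesgue (f ` ?S) = m \<longleftrightarrow> (?D has_integral m) ?S" for m
    by (rule has_measure_differentiable_image[OF Sl])
       (use der inj in \<open>auto intro: has_derivative_at_withinI inj_on_subset\<close>)
  have meas: "(\<lambda>x. ?D x * indicator ?S x) \<in> borel_measurable lebesgue"
  proof -
    have "(\<lambda>x. det (matrix (f' x))) \<in> borel_measurable (lebesgue_on ?S)"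
      by (rule borel_measurable_det_Jacobian[OF Sl]) (use der in \<open>auto intro: has_derivative_at_withinI\<close>)
    then have "(\<lambda>x. ?D x) \<in> borel_measurable (lebesgue_on ?S)" by measurable
    then have "(\<lambda>x. if x \<in> ?S then ?D x else 0) \<in> borel_measurable lebesgue"
      using Sl by (rule borel_measurable_if_I)
    moreover have "(\<lambda>x. if x \<in> ?S then ?D x else 0) = (\<lambda>x. ?D x * indicator ?S x)"
      by (auto simp: indicator_def)
    ultimately show ?thesis by simp
  qed
  show ?thesis unfolding eq
  proof (cases "emeasure lborel (f ` ?S) < \<infinity>")
    case True
    then have "f ` ?S \<in> lmeasurable" using fb by (intro fmeasurableI) auto
    with * have "(?D has_integral measure lebesgue (f ` ?S)) ?S" by blast
    then have "(\<integral>\<^sup>+x. ennreal (?D x) * indicator ?S x \<partial>lborel) = ennreal (measure lebesgue (f ` ?S))"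
      by (intro nn_integral_has_integral_lebesgue') auto
    then show "emeasure lborel (f ` ?S) = (\<integral>\<^sup>+x. ennreal (?D x) * indicator ?S x \<partial>lborel)"
      using True fb by (simp add: emeasure_eq_ennreal_measure)
  next
    case False
    then have inf: "emeasure lborel (f ` ?S) = \<infinity>" by (metis infinity_ennreal_def less_top)
    have "(\<integral>\<^sup>+x. ennreal (?D x) * indicator ?S x \<partial>lborel) = \<infinity>"
    proof (rule ccontr)
      assume "\<not> ?thesis"
      then obtain m where m: "0 \<le> m" "(\<integral>\<^sup>+x. ennreal (?D x) * indicator ?S x \<partial>lborel) = ennreal m"
        by (cases "\<integral>\<^sup>+x. ennreal (?D x) * indicator ?S x \<partial>lborel" rule: ennreal_cases) auto
      then have "((\<lambda>x. ?D x * indicator ?S x) has_integral m) UNIV"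
        by (subst has_integral_iff_nn_integral_lebesgue)
           (use meas in \<open>auto simp: nn_integral_completion ennreal_mult'' ennreal_indicator\<close>)
      moreover have "(\<lambda>x. ?D x * indicator ?S x) = (\<lambda>x. if x \<in> ?S then ?D x else 0)"
        by (auto simp: indicator_def)
      ultimately have "(?D has_integral m) ?S" by (simp only: has_integral_restrict_UNIV)
      with * have "f ` ?S \<in> lmeasurable" by blast
      then have "emeasure lebesgue (f ` ?S) < \<infinity>" unfolding fmeasurable_def by blast
      moreover have "emeasure lebesgue (f ` ?S) = emeasure lborel (f ` ?S)"
        using fb main_part[of "f ` ?S" lborel] emeasure_completion[of "f ` ?S" lborel] by auto
      ultimately show False using inf by simp
    qed
    with inf show "emeasure lborel (f ` ?S) = (\<integral>\<^sup>+x. ennreal (?D x) * indicator ?S x \<partial>lborel)" by simp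
  qed
qed

definition reidx :: "('n \<Rightarrow> 'm) \<Rightarrow> real^'m::finite \<Rightarrow> real^'n::finite" where
  "reidx h x = (\<chi> i. x $ h i)"

lemma linear_reidx: "linear (reidx h)"
  by (intro linearI) (auto simp: reidx_def vec_eq_iff)

lemma continuous_on_reidx: "continuous_on S (reidx h)"
  by (simp add: linear_continuous_on linear_reidx linear_linear)

lemma measurable_reidx [measurable]: "reidx h \<in> borel_measurable borel"
  by (intro borel_measurable_continuous_onI continuous_on_reidx)

lemma reidx_inverse: "bij h \<Longrightarrow> reidx h (reidx (inv h) x) = x" "bij h \<Longrightarrow> reidx (inv h) (reidx h y) = y"
  by (auto simp: reidx_def vec_eq_iff bij_is_inj bij_is_surj surj_f_inv_f)

text \<open>Relabelling coordinates maps boxes to boxes with the same side lengths, and boxes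
  determine \<open>lborel\<close>.\<close>

lemma lborel_reidx:
  assumes h: "bij (h :: 'n::finite \<Rightarrow> 'm::finite)"
  shows "distr lborel borel (reidx h) = lborel"
proof (rule lborel_eqI[symmetric])
  fix l u :: "real^'n" assume le: "\<And>b. b \<in> Basis \<Longrightarrow> l \<bullet> b \<le> u \<bullet> b"
  have comp: "l $ i \<le> u $ i" for i using le[of "axis i 1"] by (simp add: inner_axis axis_in_Basis_iff)
  have bh: "bij_betw h UNIV UNIV" using h by (simp add: bij_betw_def bij_def)
  have "reidx h -` box l u = box (reidx (inv h) l) (reidx (inv h) u)"
  proof (safe)
    fix x assume "reidx h x \<in> box l u"
    then have "l $ i < x $ h i" "x $ h i < u $ i" for i by (auto simp: mem_box_cart reidx_def)
    from this[of "inv h _"] show "x \<in> box (reidx (inv h) l) (reidx (inv h) u)"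
      using h by (auto simp: mem_box_cart reidx_def bij_is_surj surj_f_inv_f)
  next
    fix x assume "x \<in> box (reidx (inv h) l) (reidx (inv h) u)"
    then have "l $ inv h i < x $ i" "x $ i < u $ inv h i" for i by (auto simp: mem_box_cart reidx_def)
    from this[of "h _"] show "x \<in> reidx h -` box l u"
      using h by (auto simp: mem_box_cart reidx_def bij_is_inj)
  qed
  then have "emeasure (distr lborel borel (reidx h)) (box l u) = emeasure lborel (box (reidx (inv h) l) (reidx (inv h) u))"
    by (subst emeasure_distr) auto
  also have "\<dots> = ennreal (\<Prod>i\<in>UNIV. (u - l) $ inv h i)"
    using comp
    by (subst emeasure_lborel_box_eq)
       (auto simp: reidx_def Basis_vec_def inner_axis axis_eq_axis cart_eq_inner_axis[symmetric]
         prod.UNION_disjoint image_iff intro!: arg_cong[where f=ennreal] prod.reindex_cong[of "\<lambda>i. axis i 1"] inj_onI)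
  also have "(\<Prod>i\<in>UNIV. (u - l) $ inv h i) = (\<Prod>i\<in>UNIV. (u - l) $ inv h (h i))"
    by (rule prod.reindex_bij_betw[OF bh, symmetric])
  also have "\<dots> = (\<Prod>i\<in>UNIV. (u - l) $ i)" using h by (simp add: bij_is_inj)
  also have "\<dots> = (\<Prod>b\<in>Basis. (u - l) \<bullet> b)"
    by (auto simp: Basis_vec_def inner_axis axis_eq_axis
         intro!: prod.reindex_cong[of "\<lambda>i. axis i 1", symmetric] inj_onI)
  finally show "emeasure (distr lborel borel (reidx h)) (box l u) = ennreal (\<Prod>b\<in>Basis. (u - l) \<bullet> b)" .
qed simp
lemma matrix_reidx:
  fixes f' :: "real^'n::finite \<Rightarrow> real^'n" and h :: "'m::finite \<Rightarrow> 'n"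
  assumes h: "bij h"
  shows "det (matrix (\<lambda>x. reidx h (f' (reidx (inv h) x)))) = det (matrix f')"
proof -
  have "reidx (inv h) (axis j 1) = axis (h j) (1::real)" for j
    using h by (auto simp: reidx_def axis_def vec_eq_iff bij_is_surj bij_is_inj surj_f_inv_f)
  then show ?thesis
    by (subst det_reindex[OF h, symmetric]) (simp add: matrix_def reidx_def)
qed

text \<open>Conjugation with \<open>reidx\<close> carries the formula over from
  \<open>'n pos\<close>. Continuity of the determinant makes the integrand Borel, as the transport
  of the integral along \<open>reidx\<close> requires.\<close>

lemma emeasure_diff_image:
  fixes f :: "real^'n::finite \<Rightarrow> real^'n"
  assumes S: "open S" and der: "\<And>x. x \<in> S \<Longrightarrow> (f has_derivative f' x) (at x)" and inj: "inj_on f S"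
    and cont': "continuous_on S (\<lambda>x. det (matrix (f' x)))" and E: "E \<in> sets borel"
  shows "emeasure lborel (f ` S \<inter> E) = (\<integral>\<^sup>+x. ennreal \<bar>det (matrix (f' x))\<bar> * indicator (S \<inter> f -` E) x \<partial>lborel)"
proof -
  have cont: "continuous_on S f"
    using der by (meson continuous_at_imp_continuous_on has_derivative_continuous)
  obtain h :: "'n pos \<Rightarrow> 'n" where h: "bij h" using ex_pos_bij by blast
  have h': "bij (inv h)" using h by (rule bij_imp_bij_inv)
  have inv_inv: "inv (inv h) = h" using h by (simp add: inv_inv_eq)
  let ?i = "reidx (inv h)" and ?j = "reidx h"
  note [simp] = reidx_inverse[OF h]
  have lb: "lborel = distr lborel borel ?i" "lborel = distr lborel borel ?j"
    using lborel_reidx[OF h'] lborel_reidx[OF h] by simp_all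
  let ?f = "\<lambda>x. ?j (f (?i x))" and ?f' = "\<lambda>x v. ?j (f' (?i x) (?i v))"
  have "emeasure lborel (f ` S \<inter> E) = emeasure lborel (?i -` (f ` S \<inter> E))"
  proof -
    have "open (f ` S)"
      by (rule invariance_of_domain[OF cont S inj])
    then show ?thesis
      using E by (subst lb(1), subst emeasure_distr) auto
  qed
  also have "?i -` (f ` S \<inter> E) = ?f ` (?i -` S) \<inter> ?i -` E"
  proof safe
    fix x s assume "?i x = f s" "s \<in> S"
    then have "x = ?f (?j s)" "?j s \<in> ?i -` S" by (auto dest: arg_cong[where f="?j"])
    then show "x \<in> ?f ` (?i -` S)" by blast
  qed auto
  also have "emeasure lborel \<dots> = (\<integral>\<^sup>+x. ennreal \<bar>det (matrix (?f' x))\<bar> * indicator (?i -` S \<inter> ?f -` (?i -` E)) x \<partial>lborel)"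
  proof (rule emeasure_diff_image_wellorder)
    show "open (?i -` S)" using S continuous_on_reidx by (intro open_vimage) auto
    show "(?f has_derivative ?f' x) (at x)" if "x \<in> ?i -` S" for x
    proof -
      have 1: "(?i has_derivative ?i) (at x)" using linear_reidx by (intro linear_imp_has_derivative)
      have 2: "(?j has_derivative ?j) (at y)" for y using linear_reidx by (intro linear_imp_has_derivative)
      have "(f has_derivative f' (?i x)) (at (?i x))" using der that by simp
      from has_derivative_compose[OF has_derivative_compose[OF 1 this] 2] show ?thesis .
    qed
    show "inj_on ?f (?i -` S)"
    proof (rule inj_onI)
      fix x y assume *: "x \<in> ?i -` S" "y \<in> ?i -` S" "?f x = ?f y"
      from arg_cong[OF this(3), of "?i"] have "f (?i x) = f (?i y)" by simp
      with inj * have "?i x = ?i y" by (auto dest: inj_onD)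
      from arg_cong[OF this, of "?j"] show "x = y" by simp
    qed
    show "?i -` E \<in> sets borel" using measurable_sets[OF measurable_reidx, of E "inv h"] E by simp
  qed
  also have "\<dots> = (\<integral>\<^sup>+x. ennreal \<bar>det (matrix (f' (?i x)))\<bar> * indicator (S \<inter> f -` E) (?i x) \<partial>lborel)"
    by (intro nn_integral_cong) (auto simp: matrix_reidx[OF h] indicator_def)
  also have "\<dots> = (\<integral>\<^sup>+x. ennreal \<bar>det (matrix (f' x))\<bar> * indicator (S \<inter> f -` E) x \<partial>lborel)"
  proof -
    let ?g = "\<lambda>x. indicator S x * \<bar>det (matrix (f' x))\<bar>" and ?F = "\<lambda>x. indicator S x *\<^sub>R f x"
    have [measurable]: "?g \<in> borel_measurable borel" "?F \<in> borel_measurable borel"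
      using borel_measurable_continuous_on_indicator[OF _ continuous_on_rabs[OF cont']]
      borel_measurable_continuous_on_indicator[OF _ cont] S by auto
    have [measurable]: "S \<in> sets borel" "E \<in> sets borel" using S E by auto
    have eq: "ennreal \<bar>det (matrix (f' x))\<bar> * indicator (S \<inter> f -` E) x = ennreal (?g x) * (indicator S x * indicator E (?F x))" for x
      by (auto simp: indicator_def)
    show ?thesis unfolding eq
      by (subst nn_integral_distr[of ?i lborel borel, symmetric]) (auto simp: lborel_reidx[OF h'])
  qed
  finally show ?thesis .
qed

text \<open>Formulated for measures: Lebesgue measure restricted to the image is the push-forward of
  the Jacobian density. Two equal measures have equal integrals for every Borel function
  \<open>u\<close>.\<close>

theorem nn_integral_change_of_variables:
  fixes f :: "real^'n::finite \<Rightarrow> real^'n"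
  assumes S: "open S" and der: "\<And>x. x \<in> S \<Longrightarrow> (f has_derivative f' x) (at x)" and inj: "inj_on f S"
    and cont': "continuous_on S (\<lambda>x. det (matrix (f' x)))" and u [measurable]: "u \<in> borel_measurable borel"
  shows "(\<integral>\<^sup>+x. u x * indicator (f ` S) x \<partial>lborel) =
         (\<integral>\<^sup>+x. u (f x) * ennreal \<bar>det (matrix (f' x))\<bar> * indicator S x \<partial>lborel)"
proof -
  have cont: "continuous_on S f"
    using der by (meson continuous_at_imp_continuous_on has_derivative_continuous)
  \<comment> \<open>Extension by 0 outside \<open>S\<close> turns maps that are continuous on an
    open set into Borel maps on the whole space.\<close>
  let ?g = "\<lambda>x. indicator S x * \<bar>det (matrix (f' x))\<bar>" and ?F = "\<lambda>x. indicator S x *\<^sub>R f x"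
  have [measurable]: "?g \<in> borel_measurable borel" "?F \<in> borel_measurable borel"
    using borel_measurable_continuous_on_indicator[OF _ continuous_on_rabs[OF cont']]
      borel_measurable_continuous_on_indicator[OF _ cont] S by auto
  have [measurable]: "S \<in> sets borel" "f ` S \<in> sets borel"
    using S invariance_of_domain[OF cont S inj] by auto
  have "density lborel (indicator (f ` S)) = distr (density lborel (\<lambda>x. ennreal (?g x))) borel ?F" (is "?M = ?N")
  proof (rule measure_eqI)
    fix E assume "E \<in> sets ?M"
    then have E [measurable]: "E \<in> sets borel" by simp
    have "emeasure ?M E = emeasure lborel (f ` S \<inter> E)"
      by (subst emeasure_density) (auto simp: indicator_inter_arith[symmetric] simp flip: nn_integral_indicator)
    also have "\<dots> = (\<integral>\<^sup>+x. ennreal (?g x) * indicator (?F -` E) x \<partial>lborel)"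
      unfolding emeasure_diff_image[OF S der inj cont' E, simplified]
      by (intro nn_integral_cong) (auto simp: indicator_def)
    also have "\<dots> = emeasure ?N E"
      using measurable_sets[of ?F borel borel E]
      by (subst emeasure_distr; simp) (subst emeasure_density; simp)
    finally show "emeasure ?M E = emeasure ?N E" .
  qed simp
  then have "(\<integral>\<^sup>+x. u x \<partial>?M) = (\<integral>\<^sup>+x. u x \<partial>?N)" by simp
  also have "(\<integral>\<^sup>+x. u x \<partial>?M) = (\<integral>\<^sup>+x. u x * indicator (f ` S) x \<partial>lborel)"
    by (subst nn_integral_density) (auto simp: mult.commute)
  also have "(\<integral>\<^sup>+x. u x \<partial>?N) = (\<integral>\<^sup>+x. ennreal (?g x) * u (?F x) \<partial>lborel)"
    by (simp add: nn_integral_distr nn_integral_density)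
  also have "\<dots> = (\<integral>\<^sup>+x. u (f x) * ennreal \<bar>det (matrix (f' x))\<bar> * indicator S x \<partial>lborel)"
    by (intro nn_integral_cong) (auto simp: indicator_def mult.commute)
  finally show ?thesis .
qed

section \<open>Continuously differentiable maps\<close>

abbreviation fd :: "('a::real_normed_vector \<Rightarrow> 'b::real_normed_vector) \<Rightarrow> 'a \<Rightarrow> 'a \<Rightarrow> 'b" where
  "fd f x \<equiv> frechet_derivative f (at x)"

lemmas DERIV_iff_vector = has_real_derivative_iff_has_vector_derivative

lemma fd_worksI: "f differentiable (at x) \<Longrightarrow> (f has_derivative fd f x) (at x)"
  by (simp add: frechet_derivative_works)

lemma fd_eqI: "(f has_derivative f') (at x) \<Longrightarrow> fd f x = f'"
  by (simp add: frechet_derivative_at[symmetric])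

lemma fd_line:
  assumes "f differentiable (at (x + s *\<^sub>R v))"
  shows "((\<lambda>s. f (x + s *\<^sub>R v)) has_vector_derivative fd f (x + s *\<^sub>R v) v) (at s)"
proof -
  have "((\<lambda>s. x + s *\<^sub>R v) has_derivative (\<lambda>t. t *\<^sub>R v)) (at s)"
    by (auto intro!: derivative_eq_intros)
  from has_derivative_compose[OF this fd_worksI[OF assms]]
  show ?thesis
    by (simp add: has_vector_derivative_def linear_cmul[OF linear_frechet_derivative[OF assms]])
qed

text \<open>Two applications of the mean value theorem: in direction \<open>v\<close> to the
  increment of \<open>f\<close> by \<open>h w\<close>, then in direction \<open>w\<close> to the
  derivative so obtained.\<close>

lemma second_difference:
  fixes f :: "'a::real_normed_vector \<Rightarrow> real"
  assumes U: "\<And>s t. 0 \<le> s \<Longrightarrow> s \<le> h \<Longrightarrow> 0 \<le> t \<Longrightarrow> t \<le> h \<Longrightarrow> x + s *\<^sub>R v + t *\<^sub>R w \<in> U" and h: "0 < h"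
    and d1: "\<And>y. y \<in> U \<Longrightarrow> f differentiable (at y)"
    and d2: "\<And>y. y \<in> U \<Longrightarrow> (\<lambda>z. fd f z v) differentiable (at y)"
  shows "\<exists>s t. 0 < s \<and> s < h \<and> 0 < t \<and> t < h \<and>
    f (x + h *\<^sub>R v + h *\<^sub>R w) - f (x + h *\<^sub>R v) - f (x + h *\<^sub>R w) + f x = h\<^sup>2 * fd (\<lambda>z. fd f z v) (x + s *\<^sub>R v + t *\<^sub>R w) w"
proof -
  let ?p = "\<lambda>s. f (x + h *\<^sub>R w + s *\<^sub>R v) - f (x + s *\<^sub>R v)"
  have der: "DERIV ?p s :> fd f (x + h *\<^sub>R w + s *\<^sub>R v) v - fd f (x + s *\<^sub>R v) v" if "0 \<le> s" "s \<le> h" for s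
    unfolding DERIV_iff_vector
    using U[OF that, of h] U[OF that, of 0] h d1
    by (intro has_vector_derivative_diff fd_line) (auto simp: algebra_simps)
  obtain s where s: "0 < s" "s < h" "?p h - ?p 0 = (h - 0) * (fd f (x + h *\<^sub>R w + s *\<^sub>R v) v - fd f (x + s *\<^sub>R v) v)"
    using MVT2[OF h der] by blast
  have "DERIV (\<lambda>t. fd f (x + s *\<^sub>R v + t *\<^sub>R w) v) t :> fd (\<lambda>z. fd f z v) (x + s *\<^sub>R v + t *\<^sub>R w) w"
    if "0 \<le> t" "t \<le> h" for t
    unfolding DERIV_iff_vector
    using U[of s t] that s by (intro fd_line d2) auto
  from MVT2[OF h this] obtain t where t: "0 < t" "t < h"
    "fd f (x + s *\<^sub>R v + h *\<^sub>R w) v - fd f (x + s *\<^sub>R v) v = h * fd (\<lambda>z. fd f z v) (x + s *\<^sub>R v + t *\<^sub>R w) w"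
    by auto
  have "f (x + h *\<^sub>R v + h *\<^sub>R w) - f (x + h *\<^sub>R v) - f (x + h *\<^sub>R w) + f x = ?p h - ?p 0"
    by (simp add: algebra_simps)
  also have "\<dots> = h * (fd f (x + s *\<^sub>R v + h *\<^sub>R w) v - fd f (x + s *\<^sub>R v) v)"
    using s(3) by (simp add: algebra_simps)
  also have "\<dots> = h\<^sup>2 * fd (\<lambda>z. fd f z v) (x + s *\<^sub>R v + t *\<^sub>R w) w"
    by (simp add: t(3) power2_eq_square)
  finally show ?thesis using s t by blast
qed

text \<open>The second difference is symmetric in \<open>v\<close> and \<open>w\<close>. Hence the
  two mixed derivatives agree at some pair of points of every small parallelogram, and continuity
  brings both points to \<open>x\<close>.\<close>

lemma symmetric_second_derivative_real:
  fixes f :: "'a::real_normed_vector \<Rightarrow> real"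
  assumes U: "open U" "x \<in> U"
    and d1: "\<And>y. y \<in> U \<Longrightarrow> f differentiable (at y)"
    and d2: "\<And>y v. y \<in> U \<Longrightarrow> (\<lambda>z. fd f z v) differentiable (at y)"
    and c: "\<And>v w. continuous_on U (\<lambda>y. fd (\<lambda>z. fd f z v) y w)"
  shows "fd (\<lambda>z. fd f z v) x w = fd (\<lambda>z. fd f z w) x v"
proof -
  let ?A = "\<lambda>v w y. fd (\<lambda>z. fd f z v) y w"
  have "dist (?A v w x) (?A w v x) \<le> e" if e: "0 < e" for e
  proof -
    have "\<forall>\<^sub>F y in nhds x. dist (?A v w y) (?A v w x) < e/2" for v w
    proof -
      have "isCont (?A v w) x" using c[of v w] U by (simp add: continuous_on_eq_continuous_at)
      then have "(?A v w \<longlongrightarrow> ?A v w x) (nhds x)" by (simp add: isCont_def tendsto_at_iff_tendsto_nhds[of "?A v w" x, THEN iffD1])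
      then show ?thesis using e by (auto simp only: tendsto_iff half_gt_zero)
    qed
    then have "\<forall>\<^sub>F y in nhds x. dist (?A v w y) (?A v w x) < e/2 \<and> dist (?A w v y) (?A w v x) < e/2 \<and> y \<in> U"
      using U by (intro eventually_conj eventually_nhds_in_open) auto
    then obtain d where d: "0 < d" "\<And>y. dist y x < d \<Longrightarrow> dist (?A v w y) (?A v w x) < e/2 \<and> dist (?A w v y) (?A w v x) < e/2 \<and> y \<in> U"
      unfolding eventually_nhds_metric by blast
    \<comment> \<open>This size keeps the parallelogram spanned by \<open>h v\<close> and
      \<open>h w\<close> within distance \<open>d / 2\<close> of \<open>x\<close>; the summand 1
      covers \<open>v = w = 0\<close>.\<close>
    define h where "h = d / (2 * (norm v + norm w + 1))"
    have h: "0 < h" using d by (simp add: h_def add_nonneg_pos)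
    have near: "dist (x + s *\<^sub>R v + t *\<^sub>R w) x < d" if "0 \<le> s" "s \<le> h" "0 \<le> t" "t \<le> h" for s t
    proof -
      have "norm (s *\<^sub>R v + t *\<^sub>R w) \<le> s * norm v + t * norm w"
        using that norm_triangle_ineq[of "s *\<^sub>R v" "t *\<^sub>R w"] by simp
      also have "\<dots> \<le> h * norm v + h * norm w" using that by (intro add_mono mult_right_mono) auto
      also have "\<dots> < h * (norm v + norm w + 1)" using h by (simp add: algebra_simps)
      also have "\<dots> = d / 2"
      proof -
        have "norm v + norm w + 1 \<noteq> 0" using norm_ge_zero[of v] norm_ge_zero[of w] by linarith
        then show ?thesis unfolding h_def by (simp add: divide_simps)
      qed
      also have "\<dots> < d" using d by simp
      finally show ?thesis by (simp add: dist_norm add.assoc)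
    qed
    obtain s t where 1: "0 < s" "s < h" "0 < t" "t < h"
      "f (x + h *\<^sub>R v + h *\<^sub>R w) - f (x + h *\<^sub>R v) - f (x + h *\<^sub>R w) + f x = h\<^sup>2 * ?A v w (x + s *\<^sub>R v + t *\<^sub>R w)"
      using second_difference[of h x v w U f] h near d d1 d2 by blast
    have near': "x + s *\<^sub>R w + t *\<^sub>R v \<in> U" if "0 \<le> s" "s \<le> h" "0 \<le> t" "t \<le> h" for s t
      using near[of t s] that d(2)[of "x + s *\<^sub>R w + t *\<^sub>R v"] by (simp add: algebra_simps)
    obtain s' t' where 2: "0 < s'" "s' < h" "0 < t'" "t' < h"
      "f (x + h *\<^sub>R w + h *\<^sub>R v) - f (x + h *\<^sub>R w) - f (x + h *\<^sub>R v) + f x = h\<^sup>2 * ?A w v (x + s' *\<^sub>R w + t' *\<^sub>R v)"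
      using second_difference[of h x w v U f] h near' d1 d2 by blast
    have "h\<^sup>2 * ?A v w (x + s *\<^sub>R v + t *\<^sub>R w) = h\<^sup>2 * ?A w v (x + t' *\<^sub>R v + s' *\<^sub>R w)"
      using 1(5) 2(5) by (simp add: algebra_simps)
    then have eq: "?A v w (x + s *\<^sub>R v + t *\<^sub>R w) = ?A w v (x + t' *\<^sub>R v + s' *\<^sub>R w)"
      using h by simp
    have "dist (?A v w (x + s *\<^sub>R v + t *\<^sub>R w)) (?A v w x) < e/2" "dist (?A w v (x + t' *\<^sub>R v + s' *\<^sub>R w)) (?A w v x) < e/2"
      using d(2)[OF near[of s t]] d(2)[OF near[of t' s']] 1 2 by auto
    then show ?thesis using eq unfolding dist_real_def by linarith
  qed
  then show ?thesis
    using field_le_epsilon[of "dist (?A v w x) (?A w v x)" 0] by simp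
qed

lemma fd_inner:
  assumes "f differentiable (at x)"
  shows "fd (\<lambda>x. f x \<bullet> e) x v = fd f x v \<bullet> e"
  by (rule fun_cong[OF fd_eqI, THEN trans])
     (use fd_worksI[OF assms] in \<open>auto intro!: has_derivative_inner_left\<close>)

lemma symmetric_second_derivative:
  fixes f :: "'a::real_normed_vector \<Rightarrow> 'b::real_inner"
  assumes U: "open U" "x \<in> U"
    and d1: "\<And>y. y \<in> U \<Longrightarrow> f differentiable (at y)"
    and d2: "\<And>y v. y \<in> U \<Longrightarrow> (\<lambda>z. fd f z v) differentiable (at y)"
    and c: "\<And>v w. continuous_on U (\<lambda>y. fd (\<lambda>z. fd f z v) y w)"
  shows "fd (\<lambda>z. fd f z v) x w = fd (\<lambda>z. fd f z w) x v"
proof (rule vector_eq_rdot[THEN iffD1], rule allI)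
  fix e :: 'b
  let ?f = "\<lambda>x. f x \<bullet> e"
  have D1: "?f differentiable (at y)" if "y \<in> U" for y
    using d1[OF that] by (auto intro!: differentiable_inner)
  have tr: "(\<lambda>z. fd ?f z v) differentiable (at y) \<and> fd (\<lambda>z. fd ?f z v) y w = fd (\<lambda>z. fd f z v) y w \<bullet> e"
    if "y \<in> U" for y v w
  proof -
    have "((\<lambda>z. fd f z v \<bullet> e) has_derivative (\<lambda>w. fd (\<lambda>z. fd f z v) y w \<bullet> e)) (at y)"
      using fd_worksI[OF d2[OF that]] by (rule has_derivative_inner_left)
    then have "((\<lambda>z. fd ?f z v) has_derivative (\<lambda>w. fd (\<lambda>z. fd f z v) y w \<bullet> e)) (at y)"
      by (rule has_derivative_transform_within_open[OF _ U(1) that]) (simp add: fd_inner d1)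
    then show ?thesis using fd_eqI differentiableI by metis
  qed
  have "fd (\<lambda>z. fd ?f z v) x w = fd (\<lambda>z. fd ?f z w) x v"
  proof (rule symmetric_second_derivative_real[OF U D1])
    show "continuous_on U (\<lambda>y. fd (\<lambda>z. fd ?f z v) y w)" for v w
      using tr by (subst continuous_on_cong[OF refl, of _ _ "\<lambda>y. fd (\<lambda>z. fd f z v) y w \<bullet> e"])
        (auto intro!: continuous_intros c)
  qed (use tr in auto)
  then show "fd (\<lambda>z. fd f z v) x w \<bullet> e = fd (\<lambda>z. fd f z w) x v \<bullet> e"
    using tr U(2) by simp
qed

section \<open>Calculus of continuously differentiable maps\<close>

definition C1_on :: "'a::real_normed_vector set \<Rightarrow> ('a \<Rightarrow> 'b::real_normed_vector) \<Rightarrow> bool" where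
  "C1_on U f \<longleftrightarrow> (\<forall>x\<in>U. f differentiable (at x)) \<and> (\<forall>v. continuous_on U (\<lambda>x. fd f x v))"

lemma C1_onI:
  assumes "\<And>x. x \<in> U \<Longrightarrow> (f has_derivative f' x) (at x)" "\<And>v. continuous_on U (\<lambda>x. f' x v)"
  shows "C1_on U f"
  unfolding C1_on_def
proof (intro conjI ballI allI)
  show "f differentiable at x" if "x \<in> U" for x using assms(1)[OF that] by (auto simp: differentiable_def)
  show "continuous_on U (\<lambda>x. fd f x v)" for v
    using assms(2)[of v] by (rule continuous_on_eq) (simp add: fd_eqI[OF assms(1)])
qed

lemma C1_onD:
  assumes "C1_on U f"
  shows "\<And>x. x \<in> U \<Longrightarrow> f differentiable (at x)" "\<And>x. x \<in> U \<Longrightarrow> (f has_derivative fd f x) (at x)"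
    "continuous_on U (\<lambda>x. fd f x v)" "continuous_on U f"
  using assms by (auto simp: C1_on_def fd_worksI intro!: continuous_at_imp_continuous_on differentiable_imp_continuous_within)

lemma C1_on_subset: "C1_on U f \<Longrightarrow> V \<subseteq> U \<Longrightarrow> C1_on V f"
  by (auto simp: C1_on_def intro: continuous_on_subset)

lemma C1_on_cong:
  assumes "open U" "\<And>x. x \<in> U \<Longrightarrow> f x = g x" "C1_on U f"
  shows "C1_on U g"
proof (rule C1_onI)
  show "(g has_derivative fd f x) (at x)" if "x \<in> U" for x
    using C1_onD(2)[OF assms(3) that] assms(1) that assms(2) by (rule has_derivative_transform_within_open)
qed (rule C1_onD(3)[OF assms(3)])

lemma C1_on_const [intro!]: "C1_on U (\<lambda>x. c)"
  by (rule C1_onI[where f'="\<lambda>x v. 0"]) auto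

lemma C1_on_linear: "bounded_linear f \<Longrightarrow> C1_on U f"
  by (rule C1_onI[where f'="\<lambda>x v. f v"]) (auto intro: bounded_linear_imp_has_derivative)

lemma C1_on_add [intro!]:
  assumes "C1_on U f" "C1_on U g" shows "C1_on U (\<lambda>x. f x + g x)"
  by (rule C1_onI[where f'="\<lambda>x v. fd f x v + fd g x v"])
     (use assms in \<open>auto intro!: derivative_eq_intros C1_onD(2) continuous_intros C1_onD(3)\<close>)

lemma C1_on_diff [intro!]:
  assumes "C1_on U f" "C1_on U g" shows "C1_on U (\<lambda>x. f x - g x)"
  by (rule C1_onI[where f'="\<lambda>x v. fd f x v - fd g x v"])
     (use assms in \<open>auto intro!: derivative_eq_intros C1_onD(2) continuous_intros C1_onD(3)\<close>)

lemma C1_on_minus [intro!]: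
  assumes "C1_on U f" shows "C1_on U (\<lambda>x. - f x)"
  using C1_on_diff[OF C1_on_const[of U 0] assms] by simp

lemma C1_on_mult [intro!]:
  fixes f g :: "'a::real_normed_vector \<Rightarrow> real"
  assumes "C1_on U f" "C1_on U g" shows "C1_on U (\<lambda>x. f x * g x)"
  by (rule C1_onI[where f'="\<lambda>x v. f x * fd g x v + fd f x v * g x"])
     (auto intro!: derivative_eq_intros continuous_intros C1_onD(2-)[OF assms(1)] C1_onD(2-)[OF assms(2)])

lemma C1_on_inverse [intro!]:
  fixes f :: "'a::real_normed_vector \<Rightarrow> real"
  assumes "C1_on U f" "\<And>x. x \<in> U \<Longrightarrow> f x \<noteq> 0" shows "C1_on U (\<lambda>x. inverse (f x))"
  by (rule C1_onI[where f'="\<lambda>x v. - (inverse (f x) * fd f x v * inverse (f x))"])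
     (use assms(2) in \<open>auto intro!: derivative_eq_intros continuous_intros C1_onD(2-)[OF assms(1)]\<close>)

lemma C1_on_sum [intro!]:
  assumes "\<And>i. i \<in> I \<Longrightarrow> C1_on U (f i)" shows "C1_on U (\<lambda>x. \<Sum>i\<in>I. f i x)"
  using assms by (induction I rule: infinite_finite_induct) auto

lemma C1_on_prod [intro!]:
  fixes f :: "'i \<Rightarrow> 'a::real_normed_vector \<Rightarrow> real"
  assumes "\<And>i. i \<in> I \<Longrightarrow> C1_on U (f i)" shows "C1_on U (\<lambda>x. \<Prod>i\<in>I. f i x)"
  using assms by (induction I rule: infinite_finite_induct) auto

lemma vec_lambda_sum_axis: "(\<chi> i. c i) = (\<Sum>i\<in>UNIV. c i *\<^sub>R axis i (1::real))"
  by (simp add: vec_eq_iff axis_def if_distrib cong: if_cong)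

lemma has_derivative_vec_lambda:
  fixes f :: "'i::finite \<Rightarrow> 'a::real_normed_vector \<Rightarrow> real"
  assumes "\<And>i. (f i has_derivative f' i) F"
  shows "((\<lambda>x. \<chi> i. f i x) has_derivative (\<lambda>v. \<chi> i. f' i v)) F"
  unfolding vec_lambda_sum_axis by (intro has_derivative_sum has_derivative_scaleR_left assms)

lemma C1_on_vec [intro!]:
  fixes f :: "'i::finite \<Rightarrow> 'a::real_normed_vector \<Rightarrow> real"
  assumes "\<And>i. C1_on U (f i)" shows "C1_on U (\<lambda>x. \<chi> i. f i x)"
  by (rule C1_onI[where f'="\<lambda>x v. \<chi> i. fd (f i) x v"])
     (use assms in \<open>auto intro!: has_derivative_vec_lambda C1_onD(2) continuous_intros C1_onD(3)\<close>)

lemma C1_on_Pair [intro!]: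
  assumes "C1_on U f" "C1_on U g" shows "C1_on U (\<lambda>x. (f x, g x))"
  by (rule C1_onI[where f'="\<lambda>x v. (fd f x v, fd g x v)"])
     (use assms in \<open>auto intro!: has_derivative_Pair C1_onD(2) continuous_intros C1_onD(3)\<close>)

text \<open>Continuity of \<open>fd g\<close> is known only in fixed directions. The moving vector
  \<open>fd f x v\<close> is therefore expanded in \<open>Basis\<close>, which is why the
  intermediate space is Euclidean.\<close>

lemma C1_on_compose:
  fixes f :: "'a::euclidean_space \<Rightarrow> 'b::euclidean_space" and g :: "'b \<Rightarrow> 'c::real_normed_vector"
  assumes f: "C1_on U f" and g: "C1_on V g" and sub: "\<And>x. x \<in> U \<Longrightarrow> f x \<in> V"
  shows "C1_on U (\<lambda>x. g (f x))"
proof (rule C1_onI[where f'="\<lambda>x v. fd g (f x) (fd f x v)"])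
  show "((\<lambda>x. g (f x)) has_derivative (\<lambda>v. fd g (f x) (fd f x v))) (at x)" if "x \<in> U" for x
    using has_derivative_compose[OF C1_onD(2)[OF f that] C1_onD(2)[OF g sub[OF that]]] .
  show "continuous_on U (\<lambda>x. fd g (f x) (fd f x v))" for v
  proof -
    have "continuous_on U (\<lambda>x. \<Sum>b\<in>Basis. (fd f x v \<bullet> b) *\<^sub>R fd g (f x) b)"
      using continuous_on_compose2[OF C1_onD(3)[OF g] C1_onD(4)[OF f]] sub
      by (intro continuous_intros C1_onD(3)[OF f]) auto
    then show ?thesis
    proof (rule continuous_on_eq)
      fix x assume x: "x \<in> U"
      have lin: "linear (fd g (f x))" using C1_onD(1)[OF g sub[OF x]] by (rule linear_frechet_derivative)
      have "fd g (f x) (fd f x v) = fd g (f x) (\<Sum>b\<in>Basis. (fd f x v \<bullet> b) *\<^sub>R b)"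
        by (simp add: euclidean_representation)
      then show "(\<Sum>b\<in>Basis. (fd f x v \<bullet> b) *\<^sub>R fd g (f x) b) = fd g (f x) (fd f x v)"
        by (simp add: linear_sum[OF lin] linear_cmul[OF lin])
    qed
  qed
qed

lemma linear_norm_le_Basis:
  fixes f :: "'a::euclidean_space \<Rightarrow> 'b::real_normed_vector"
  assumes f: "linear f" and B: "\<And>b. b \<in> Basis \<Longrightarrow> norm (f b) \<le> B b"
  shows "norm (f v) \<le> (\<Sum>b\<in>Basis. B b) * norm v"
proof -
  have "f v = f (\<Sum>b\<in>Basis. (v \<bullet> b) *\<^sub>R b)" by (simp add: euclidean_representation)
  also have "\<dots> = (\<Sum>b\<in>Basis. (v \<bullet> b) *\<^sub>R f b)" by (simp add: linear_sum[OF f] linear_cmul[OF f])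
  also have "norm \<dots> \<le> (\<Sum>b\<in>Basis. norm v * B b)"
    by (rule sum_norm_le) (auto intro!: mult_mono B Basis_le_norm)
  finally show ?thesis by (simp add: sum_distrib_left mult.commute)
qed

text \<open>Compactness bounds \<open>M x b\<close> for each of the finitely many basis vectors
  \<open>b\<close>; linearity turns these bounds into a uniform operator bound.\<close>

lemma linear_family_bounded:
  fixes M :: "'x::topological_space \<Rightarrow> 'a::euclidean_space \<Rightarrow> 'b::real_normed_vector"
  assumes K: "compact K" and lin: "\<And>x. x \<in> K \<Longrightarrow> linear (M x)" and cont: "\<And>v. continuous_on K (\<lambda>x. M x v)"
  obtains L where "0 < L" "\<And>x v. x \<in> K \<Longrightarrow> norm (M x v) \<le> L * norm v"
proof -
  have "\<exists>B. \<forall>x\<in>K. norm (M x b) \<le> B" for b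
    using compact_imp_bounded[OF compact_continuous_image[OF cont K]] by (auto simp: bounded_iff)
  then obtain B where B: "\<And>x b. x \<in> K \<Longrightarrow> norm (M x b) \<le> B b" by metis
  show ?thesis
  proof (rule that)
    show "0 < (\<Sum>b\<in>Basis. \<bar>B b\<bar>) + 1" by (simp add: add_nonneg_pos sum_nonneg)
    have *: "norm (M x v) \<le> (\<Sum>b\<in>Basis. \<bar>B b\<bar>) * norm v" if x: "x \<in> K" for x v
      by (intro linear_norm_le_Basis lin x order_trans[OF B[OF x]] abs_ge_self)
    show "norm (M x v) \<le> ((\<Sum>b\<in>Basis. \<bar>B b\<bar>) + 1) * norm v" if "x \<in> K" for x v
      by (rule order_trans[OF *[OF that]]) (simp add: distrib_right)
  qed
qed

lemma C1_on_Lipschitz: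
  fixes f :: "'a::euclidean_space \<Rightarrow> 'b::real_normed_vector"
  assumes f: "C1_on U f" and K: "compact K" "convex K" "K \<subseteq> U"
  obtains L where "0 < L" "\<And>x y. x \<in> K \<Longrightarrow> y \<in> K \<Longrightarrow> norm (f x - f y) \<le> L * norm (x - y)"
proof -
  have lin: "linear (fd f x)" if "x \<in> K" for x
    using C1_onD(1)[OF f] K(3) that by (auto intro: linear_frechet_derivative)
  obtain L where L: "0 < L" "\<And>x v. x \<in> K \<Longrightarrow> norm (fd f x v) \<le> L * norm v"
    using linear_family_bounded[of K "fd f", OF K(1) lin continuous_on_subset[OF C1_onD(3)[OF f] K(3)]] by blast
  have "norm (f x - f y) \<le> L * norm (x - y)" if "x \<in> K" "y \<in> K" for x y
    using K(2) C1_onD(2)[OF f] K(3) L that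
    by (intro differentiable_bound[of K f "fd f"]) (auto intro: has_derivative_at_withinI onorm_bound)
  with L(1) show ?thesis by (rule that)
qed

lemma smooth_on_imp_C1_on: "smooth_on U f \<Longrightarrow> C1_on U f"
  using Ck_on.simps(2)[of 0 U f] by (auto simp: smooth_on_def C1_on_def simp del: Ck_on.simps(2))

lemma smooth_on_fd: "smooth_on U f \<Longrightarrow> smooth_on U (\<lambda>x. fd f x v)"
  unfolding smooth_on_def using Ck_on.simps(2) by blast

lemma C1_on_det [intro!]:
  fixes M :: "'a::real_normed_vector \<Rightarrow> real^'n^'n"
  assumes "\<And>i j. C1_on U (\<lambda>x. M x $ i $ j)"
  shows "C1_on U (\<lambda>x. det (M x))"
  unfolding det_def by (intro C1_on_sum C1_on_mult C1_on_const C1_on_prod assms)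

lemma matrix_inv_mult:
  fixes M :: "real^'n^'n"
  assumes "det M \<noteq> 0"
  shows "M ** matrix_inv M = mat 1" "matrix_inv M ** M = mat 1"
proof -
  have "\<exists>M'. M ** M' = mat 1 \<and> M' ** M = mat 1"
    using assms by (simp add: invertible_det_nz[symmetric] invertible_def)
  then have "M ** matrix_inv M = mat 1 \<and> matrix_inv M ** M = mat 1"
    unfolding matrix_inv_def by (rule someI_ex)
  then show "M ** matrix_inv M = mat 1" "matrix_inv M ** M = mat 1" by auto
qed

text \<open>Cramer's rule writes the entries of the inverse as quotients of determinants, through
  which C1 regularity passes to \<open>matrix_inv\<close>.\<close>

lemma matrix_inv_cramer:
  fixes M :: "real^'n^'n"
  assumes "det M \<noteq> 0"
  shows "matrix_inv M $ k $ l = det (\<chi> i j. if j = k then axis l 1 $ i else M $ i $ j) * inverse (det M)"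
proof -
  let ?x = "column l (matrix_inv M)"
  have "M *v ?x = axis l 1"
  proof -
    have "M *v ?x = column l (M ** matrix_inv M)"
      by (simp add: vec_eq_iff column_def matrix_matrix_mult_def matrix_vector_mult_def)
    also have "\<dots> = axis l 1" by (auto simp: matrix_inv_mult(1)[OF assms] vec_eq_iff column_def mat_def axis_def)
    finally show ?thesis .
  qed
  then have "?x = (\<chi> k. det (\<chi> i j. if j = k then axis l 1 $ i else M $ i $ j) / det M)"
    using cramer[OF assms] by blast
  then have "?x $ k = det (\<chi> i j. if j = k then axis l 1 $ i else M $ i $ j) / det M" by simp
  then show ?thesis by (simp add: column_def divide_inverse)
qed

lemma C1_on_matrix_inv [intro!]:
  fixes M :: "'a::real_normed_vector \<Rightarrow> real^'n^'n"
  assumes U: "open U" and M: "\<And>i j. C1_on U (\<lambda>x. M x $ i $ j)" and nz: "\<And>x. x \<in> U \<Longrightarrow> det (M x) \<noteq> 0"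
  shows "C1_on U (\<lambda>x. matrix_inv (M x) $ k $ l)"
proof -
  have "C1_on U (\<lambda>x. (\<chi> i j. if j = k then axis l 1 $ i else M x $ i $ j) $ i $ j)" for i j
    by (cases "j = k") (simp_all add: M C1_on_const)
  then have "C1_on U (\<lambda>x. det (\<chi> i j. if j = k then axis l 1 $ i else M x $ i $ j) * inverse (det (M x)))"
    using M nz by (intro C1_on_mult C1_on_inverse C1_on_det) blast+
  then show ?thesis by (rule C1_on_cong[OF U, rotated]) (simp add: matrix_inv_cramer nz)
qed

section \<open>Linear differential equations\<close>

text \<open>The squared norm is differentiable also where \<open>x\<close> vanishes, and the weight
  exp(-2 L r) makes it nonincreasing.\<close>

lemma gronwall_forward:
  fixes x :: "real \<Rightarrow> 'b::real_inner"
  assumes st: "s \<le> t"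
    and der: "\<And>r. s \<le> r \<Longrightarrow> r \<le> t \<Longrightarrow> (x has_vector_derivative x' r) (at r)"
    and bnd: "\<And>r. s \<le> r \<Longrightarrow> r \<le> t \<Longrightarrow> norm (x' r) \<le> L * norm (x r)"
  shows "norm (x t) \<le> exp (L * (t - s)) * norm (x s)"
proof -
  let ?u = "\<lambda>r. (x r \<bullet> x r) * exp (- (2 * L * r))"
  have "?u t \<le> ?u s"
  proof (rule DERIV_nonpos_imp_nonincreasing[OF st])
    fix r assume r: "s \<le> r" "r \<le> t"
    have "((\<lambda>r. x r \<bullet> x r) has_vector_derivative x r \<bullet> x' r + x' r \<bullet> x r) (at r)"
      by (rule bounded_bilinear.has_vector_derivative[OF bounded_bilinear_inner der[OF r] der[OF r]])
    then have "DERIV (\<lambda>r. x r \<bullet> x r) r :> 2 * (x r \<bullet> x' r)"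
      by (simp add: DERIV_iff_vector inner_commute)
    then have "DERIV ?u r :> (2 * (x r \<bullet> x' r) - 2 * L * (x r \<bullet> x r)) * exp (- (2 * L * r))"
      by (auto intro!: derivative_eq_intros simp: algebra_simps)
    moreover have "2 * (x r \<bullet> x' r) - 2 * L * (x r \<bullet> x r) \<le> 0"
    proof -
      have "x r \<bullet> x' r \<le> norm (x r) * norm (x' r)" by (rule norm_cauchy_schwarz)
      also have "\<dots> \<le> norm (x r) * (L * norm (x r))" by (intro mult_left_mono bnd r) auto
      finally show ?thesis by (simp add: power2_norm_eq_inner[symmetric] power2_eq_square algebra_simps)
    qed
    ultimately show "\<exists>y. DERIV ?u r :> y \<and> y \<le> 0"
      by (intro exI conjI) (auto simp: mult_le_0_iff)
  qed
  then have "(norm (x t))\<^sup>2 * exp (- (2 * L * t)) * exp (2 * L * t) \<le> (norm (x s))\<^sup>2 * exp (- (2 * L * s)) * exp (2 * L * t)"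
    by (intro mult_right_mono) (auto simp: power2_norm_eq_inner)
  then have "(norm (x t))\<^sup>2 \<le> (norm (x s))\<^sup>2 * exp (2 * L * (t - s))"
    by (simp add: mult.assoc exp_add[symmetric] algebra_simps)
  also have "\<dots> = (exp (L * (t - s)) * norm (x s))\<^sup>2"
    by (simp add: power_mult_distrib exp_double[symmetric] mult.assoc)
  finally show ?thesis by (rule power2_le_imp_le) simp
qed

lemma gronwall:
  fixes x :: "real \<Rightarrow> 'b::real_inner"
  assumes der: "\<And>r. r \<in> closed_segment s t \<Longrightarrow> (x has_vector_derivative x' r) (at r)"
    and bnd: "\<And>r. r \<in> closed_segment s t \<Longrightarrow> norm (x' r) \<le> L * norm (x r)"
  shows "norm (x t) \<le> exp (L * \<bar>t - s\<bar>) * norm (x s)"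
proof (cases "s \<le> t")
  case True
  then show ?thesis using gronwall_forward[of s t x x' L] der bnd by (auto simp: closed_segment_eq_real_ivl)
next
  case False
  have "norm ((\<lambda>r. x (- r)) (- t)) \<le> exp (L * (- t - - s)) * norm ((\<lambda>r. x (- r)) (- s))"
  proof (rule gronwall_forward[of _ _ _ "\<lambda>r. - x' (- r)"])
    fix r assume "- s \<le> r" "r \<le> - t"
    then have r: "- r \<in> closed_segment s t" using False by (auto simp: closed_segment_eq_real_ivl)
    have "((\<lambda>r. - r) has_vector_derivative -1) (at r)" by (auto intro!: derivative_eq_intros)
    from vector_diff_chain_at[OF this der[OF r]]
    show "((\<lambda>r. x (- r)) has_vector_derivative - x' (- r)) (at r)" by (simp add: o_def)
    show "norm (- x' (- r)) \<le> L * norm (x (- r))" using bnd[OF r] by simp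
  qed (use False in simp)
  then show ?thesis using False by simp
qed

text \<open>Picard iteration as a contraction of bounded continuous functions. The length
  \<open>e\<close> depends only on the size of \<open>M\<close> near \<open>t0\<close>, neither on
  the initial time \<open>s\<close> nor on the value \<open>v\<close>; the gluing in
  \<open>global_solution\<close> relies on this uniformity.\<close>

lemma linear_ode_local:
  fixes M :: "real \<Rightarrow> 'b::euclidean_space \<Rightarrow> 'b"
  assumes lin: "\<And>t. linear (M t)" and d: "0 < d"
    and cont: "\<And>v. continuous_on {t0 - d..t0 + d} (\<lambda>t. M t v)"
  obtains e where "0 < e" "e \<le> d"
    "\<And>s v. s \<in> {t0 - e<..<t0 + e} \<Longrightarrow> \<exists>x. x s = v \<and> (\<forall>t\<in>{t0 - e<..<t0 + e}. (x has_vector_derivative M t (x t)) (at t))"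
proof -
  let ?I = "{t0 - d..t0 + d}"
  have Mrep: "M t v = (\<Sum>b\<in>Basis. (v \<bullet> b) *\<^sub>R M t b)" for t v
    by (metis (no_types, lifting) euclidean_representation linear_cmul[OF lin] linear_sum[OF lin] sum.cong)
  obtain L where L: "0 < L" and Mbd: "\<And>t v. t \<in> ?I \<Longrightarrow> norm (M t v) \<le> L * norm v"
    using linear_family_bounded[OF compact_Icc lin cont] by metis
  \<comment> \<open>With this bound the integral operator over an interval of length
    \<open>2 * e\<close> has Lipschitz constant at most 1/2.\<close>
  define e where "e = min d (1 / (4 * L))"
  have e: "0 < e" "e \<le> d" "2 * e * L \<le> 1/2" using d L by (auto simp: e_def min_def field_simps)
  define a b where "a = t0 - e" "b = t0 + e"
  have ab: "a < b" "b - a = 2 * e" "{a..b} \<subseteq> ?I" using e by (auto simp: a_b_def)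
  show ?thesis
  proof (rule that[OF e(1,2)])
    fix s v assume s: "s \<in> {t0 - e<..<t0 + e}"
    then have s': "s \<in> {a..b}" by (simp add: a_b_def)
    \<comment> \<open>The primitive of \<open>f\<close> that vanishes at \<open>s\<close>, written
      so that it is valid on both sides of \<open>s\<close>.\<close>
    define P where "P f t = integral {a..t} f - integral {a..s} f" for f :: "real \<Rightarrow> 'b" and t
    have Pder: "(P f has_vector_derivative f t) (at t within {a..b})" if "continuous_on {a..b} f" "t \<in> {a..b}" for f t
      unfolding P_def using integral_has_vector_derivative[OF that] by (auto intro!: derivative_eq_intros)
    have Pb: "norm (P f t) \<le> 2 * e * C" if "continuous_on {a..b} f" "t \<in> {a..b}" "\<And>t. t \<in> {a..b} \<Longrightarrow> norm (f t) \<le> C" for f t C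
    proof -
      have C: "0 \<le> C" using that(3)[OF s'] norm_ge_zero order_trans by blast
      have "norm (P f t - P f s) \<le> C * norm (t - s)"
        using that s' Pder[OF that(1)] C
        by (intro differentiable_bound[of "{a..b}" "P f" "\<lambda>t h. h *\<^sub>R f t"])
           (auto simp: has_vector_derivative_def mult.commute[of C] intro!: onorm_bound mult_left_mono)
      also have "\<dots> \<le> C * (2 * e)" using that(2) s' ab C by (intro mult_left_mono) auto
      finally show ?thesis by (simp add: P_def algebra_simps)
    qed
    \<comment> \<open>Clamping time to \<open>{a..b}\<close> extends the integral operator to
      functions on the whole line, as \<open>bcontfun\<close> demands.\<close>
    let ?c = "\<lambda>t. max a (min b t)"
    have cI: "?c t \<in> {a..b}" for t using ab by auto
    let ?G = "\<lambda>\<phi>::real \<Rightarrow>\<^sub>C 'b. \<lambda>t. v + P (\<lambda>r. M r (apply_bcontfun \<phi> r)) (?c t)"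
    have contM: "continuous_on {a..b} (\<lambda>r. M r (apply_bcontfun \<phi> r))" for \<phi> :: "real \<Rightarrow>\<^sub>C 'b"
      by (subst Mrep) (intro continuous_intros continuous_on_subset[OF cont ab(3)] continuous_on_apply_bcontfun)
    have G: "?G \<phi> \<in> bcontfun" for \<phi>
    proof -
      have cP: "continuous_on {a..b} (P (\<lambda>r. M r (apply_bcontfun \<phi> r)))"
        using Pder[OF contM] by (intro continuous_on_vector_derivative)
      then have c: "continuous_on UNIV (?G \<phi>)"
        by (intro continuous_intros continuous_on_compose2[OF cP]) (use cI in auto)
      have "compact ((\<lambda>t. v + P (\<lambda>r. M r (apply_bcontfun \<phi> r)) t) ` {a..b})"
        using cP by (intro compact_continuous_image continuous_intros) auto
      then have "bounded (range (?G \<phi>))"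
        by (rule bounded_subset[OF compact_imp_bounded]) (use cI in auto)
      with c show ?thesis by (simp add: bcontfun_def)
    qed
    define F where "F \<phi> = Bcontfun (?G \<phi>)" for \<phi>
    have F: "apply_bcontfun (F \<phi>) t = ?G \<phi> t" for \<phi> t
      using G by (simp add: F_def Bcontfun_inverse)
    have "\<exists>!\<phi>. F \<phi> = \<phi>"
    proof (rule banach_fix_type[where c="1/2"])
      show "\<forall>x y. dist (F x) (F y) \<le> 1/2 * dist x y"
      proof (intro allI)
        fix x y :: "real \<Rightarrow>\<^sub>C 'b"
        show "dist (F x) (F y) \<le> 1/2 * dist x y"
        proof (rule dist_bound)
          fix t
          let ?f = "\<lambda>r. M r (apply_bcontfun x r) - M r (apply_bcontfun y r)"
          have "P (\<lambda>r. M r (apply_bcontfun x r)) (?c t) - P (\<lambda>r. M r (apply_bcontfun y r)) (?c t) = P ?f (?c t)"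
            unfolding P_def using cI[of t] s' contM
            by (subst (1 2) integral_diff)
               (auto intro!: integrable_continuous_interval continuous_on_subset[OF contM])
          moreover have "norm (P ?f (?c t)) \<le> 2 * e * (L * dist x y)"
          proof (rule Pb[OF _ cI])
            show "continuous_on {a..b} ?f" by (intro continuous_intros contM)
            fix r assume r: "r \<in> {a..b}"
            have "norm (?f r) = norm (M r (apply_bcontfun x r - apply_bcontfun y r))"
              by (simp add: linear_diff[OF lin])
            also have "\<dots> \<le> L * norm (apply_bcontfun x r - apply_bcontfun y r)" using r ab by (intro Mbd) auto
            also have "\<dots> \<le> L * dist x y" using dist_bounded[of x r y] L by (simp add: dist_norm)
            finally show "norm (?f r) \<le> L * dist x y" .
          qed
          moreover have "2 * e * (L * dist x y) \<le> 1/2 * dist x y"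
            using mult_right_mono[OF e(3), of "dist x y"] by (simp add: mult.assoc)
          ultimately show "dist (apply_bcontfun (F x) t) (apply_bcontfun (F y) t) \<le> 1/2 * dist x y"
            by (simp add: F dist_norm)
        qed
      qed
    qed auto
    then obtain \<phi> where \<phi>: "F \<phi> = \<phi>" by blast
    let ?x = "apply_bcontfun \<phi>"
    have xe: "?x t = v + P (\<lambda>r. M r (?x r)) t" if "t \<in> {a..b}" for t
    proof -
      have "?c t = t" using that by auto
      then show ?thesis using F[of \<phi> t] \<phi> by simp
    qed
    show "\<exists>x. x s = v \<and> (\<forall>t\<in>{t0 - e<..<t0 + e}. (x has_vector_derivative M t (x t)) (at t))"
    proof (intro exI[of _ ?x] conjI ballI)
      show "?x s = v" using xe[OF s'] by (simp add: P_def)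
      fix t assume t: "t \<in> {t0 - e<..<t0 + e}"
      then have t': "t \<in> {a<..<b}" "t \<in> {a..b}" by (auto simp: a_b_def)
      have "((\<lambda>t. v + P (\<lambda>r. M r (?x r)) t) has_vector_derivative M t (?x t)) (at t within {a..b})"
        using Pder[OF contM t'(2)] by (auto intro!: derivative_eq_intros)
      then have "((\<lambda>t. v + P (\<lambda>r. M r (?x r)) t) has_vector_derivative M t (?x t)) (at t)"
        using t' by (simp add: at_within_Icc_at)
      then show "(?x has_vector_derivative M t (?x t)) (at t)"
        by (rule has_vector_derivative_transform_within_open[of _ _ _ "{a<..<b}"]) (use t' xe in auto)
    qed
  qed
qed

text \<open>Here \<open>D x t\<close> stands for \<open>x\<close> solving the equation at time \<open>t\<close>, and \<open>Adm t v\<close> for \<open>v\<close> being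
  an admissible value at time \<open>t\<close>.\<close>

lemma global_solution:
  fixes D :: "(real \<Rightarrow> 'c) \<Rightarrow> real \<Rightarrow> bool"
  assumes germ: "\<And>x y t U. D x t \<Longrightarrow> open U \<Longrightarrow> t \<in> U \<Longrightarrow> (\<And>s. s \<in> U \<Longrightarrow> x s = y s) \<Longrightarrow> D y t"
    and adm: "\<And>x t. D x t \<Longrightarrow> Adm t (x t)"
    and uniq: "\<And>x y a b s t. (\<And>r. r \<in> {a<..<b} \<Longrightarrow> D x r) \<Longrightarrow> (\<And>r. r \<in> {a<..<b} \<Longrightarrow> D y r) \<Longrightarrow>
      s \<in> {a<..<b} \<Longrightarrow> x s = y s \<Longrightarrow> t \<in> {a<..<b} \<Longrightarrow> x t = y t"
    and loc: "\<And>t0. \<exists>e>0. \<forall>s\<in>{t0 - e<..<t0 + e}. \<forall>v. Adm s v \<longrightarrow>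
      (\<exists>x. x s = v \<and> (\<forall>t\<in>{t0 - e<..<t0 + e}. D x t))"
    and v: "Adm s v"
  shows "\<exists>x. x s = v \<and> (\<forall>t. D x t)"
proof -
  \<comment> \<open>Solvability from every initial time in the interval, not just from one, is the
    property that survives the union of overlapping intervals.\<close>
  define Sol where "Sol a b \<longleftrightarrow> (\<forall>s\<in>{a<..<b}. \<forall>v. Adm s v \<longrightarrow> (\<exists>x. x s = v \<and> (\<forall>t\<in>{a<..<b}. D x t)))" for a b
  have mono: "Sol a' b'" if "Sol a b" "a \<le> a'" "b' \<le> b" for a b a' b'
    unfolding Sol_def
  proof (intro ballI allI impI)
    fix s v assume "s \<in> {a'<..<b'}" "Adm s v"
    moreover have "{a'<..<b'} \<subseteq> {a<..<b}" using that by auto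
    ultimately show "\<exists>x. x s = v \<and> (\<forall>t\<in>{a'<..<b'}. D x t)" using that(1) unfolding Sol_def by (meson subsetD)
  qed
  \<comment> \<open>The solution on the interval containing \<open>s\<close> is continued from the
    common time \<open>m\<close> with the value reached there. Uniqueness on the overlap makes the
    pasted function a solution at \<open>m\<close> itself.\<close>
  have join: "Sol a c" if S: "Sol a b" "Sol b' c" and o: "a \<le> b'" "b' < m" "m < b" "b \<le> c" for a b b' c m
    unfolding Sol_def
  proof (intro ballI allI impI)
    fix s v assume s: "s \<in> {a<..<c}" and v: "Adm s v"
    have m: "m \<in> {a<..<b}" "m \<in> {b'<..<c}" using o by auto
    obtain x y where x: "\<And>t. t \<in> {a<..<b} \<Longrightarrow> D x t" and y: "\<And>t. t \<in> {b'<..<c} \<Longrightarrow> D y t"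
      and xy: "x m = y m" "(if s \<le> m then x s else y s) = v"
    proof (cases "s \<le> m")
      case True
      then have "s \<in> {a<..<b}" using s o by auto
      then obtain x where x: "x s = v" "\<And>t. t \<in> {a<..<b} \<Longrightarrow> D x t" using S(1) v unfolding Sol_def by blast
      then obtain y where "y m = x m" "\<And>t. t \<in> {b'<..<c} \<Longrightarrow> D y t"
        using S(2) adm m unfolding Sol_def by blast
      then show ?thesis using that[of x y] x True by simp
    next
      case False
      then have "s \<in> {b'<..<c}" using s o by auto
      then obtain y where y: "y s = v" "\<And>t. t \<in> {b'<..<c} \<Longrightarrow> D y t" using S(2) v unfolding Sol_def by blast
      then obtain x where "x m = y m" "\<And>t. t \<in> {a<..<b} \<Longrightarrow> D x t"
        using S(1) adm m unfolding Sol_def by blast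
      then show ?thesis using that[of x y] y False by simp
    qed
    let ?z = "\<lambda>t. if t \<le> m then x t else y t"
    have J: "x t = y t" if "t \<in> {b'<..<b}" for t
      by (rule uniq[of b' b x y m]) (use x y xy o that in auto)
    have "D ?z t" if t: "t \<in> {a<..<c}" for t
    proof -
      consider "t < m" | "t > m" | "t = m" by linarith
      then show ?thesis
      proof cases
        case 1 then show ?thesis using t o by (intro germ[OF x, of _ "{..<m}"]) auto
      next
        case 2 then show ?thesis using t o by (intro germ[OF y, of _ "{m<..}"]) auto
      next
        case 3 then show ?thesis using o J by (intro germ[OF x, of _ "{b'<..<b}"]) auto
      qed
    qed
    with xy(2) show "\<exists>x. x s = v \<and> (\<forall>t\<in>{a<..<c}. D x t)" by (intro exI[of _ ?z]) auto
  qed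
  \<comment> \<open>Solvability near a closed interval passes to unions of adjacent intervals and
    holds near each point, the two hypotheses of \<open>Bolzano\<close>.\<close>
  have P: "\<exists>e>0. Sol (a - e) (b + e)" if "a \<le> b" for a b
    using that
  proof (induction rule: Bolzano)
    case (trans a b c)
    then obtain e e' where e: "e > 0" "Sol (a - e) (b + e)" "e' > 0" "Sol (b - e') (c + e')" by blast
    have "Sol (a - min e e') (c + min e e')"
      by (rule join[of _ "b + min e e'" "b - min e e'" _ b]) (use e trans(3,4) in \<open>auto intro: mono\<close>)
    then show ?case using e by (metis min_less_iff_conj)
  next
    case (local t0)
    obtain e where e: "e > 0" "Sol (t0 - e) (t0 + e)" using loc[of t0] unfolding Sol_def by blast
    then show ?case by (intro exI[of _ "e / 2"]) (auto intro!: exI[of _ "e / 2"] mono[OF e(2)])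
  qed
  have ex: "\<exists>z. z s = v \<and> (\<forall>t\<in>{s - real n<..<s + real n}. D z t)" for n
  proof -
    obtain e where "e > 0" "Sol (s - real n - e) (s + real n + e)" using P[of "s - real n" "s + real n"] by auto
    moreover have "{s - real n<..<s + real n} \<subseteq> {s - real n - e<..<s + real n + e}" using \<open>e > 0\<close> by auto
    moreover have "s \<in> {s - real n - e<..<s + real n + e}" using \<open>e > 0\<close> by auto
    ultimately show ?thesis using v unfolding Sol_def by (meson subsetD)
  qed
  then obtain z where z: "\<And>n. z n s = v" "\<And>n t. t \<in> {s - real n<..<s + real n} \<Longrightarrow> D (z n) t" by metis
  \<comment> \<open>By uniqueness the value at \<open>t\<close> may be read off from any interval
    containing \<open>t\<close>; the summand 1 puts \<open>t\<close> strictly inside the chosen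
    one.\<close>
  define N where "N t = nat \<lceil>\<bar>t - s\<bar>\<rceil> + 1" for t
  have N: "t \<in> {s - real (N t)<..<s + real (N t)}" for t unfolding N_def by simp linarith
  have agree: "z n t = z m t" if "t \<in> {s - real n<..<s + real n}" "n \<le> m" for n m t
    by (rule uniq[of "s - real n" "s + real n" "z n" "z m" s]) (use z that in auto)
  have agree': "z (N t) t = z m t" if "t \<in> {s - real m<..<s + real m}" for t m
  proof (cases "m \<le> N t")
    case True
    then show ?thesis using agree[OF that] by simp
  next
    case False
    then show ?thesis using agree[OF N[of t], of m] by simp
  qed
  let ?x = "\<lambda>t. z (N t) t"
  have D: "D ?x t" for t
    by (rule germ[of "z (N t)" t "{s - real (N t)<..<s + real (N t)}"]) (use N z agree' in auto)
  show ?thesis by (rule exI[of _ ?x]) (use z(1) D in blast)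
qed

lemma linear_ode_unique:
  fixes M :: "real \<Rightarrow> 'b::euclidean_space \<Rightarrow> 'b"
  assumes lin: "\<And>t. linear (M t)" and cont: "\<And>v. continuous_on {a<..<b} (\<lambda>t. M t v)"
    and x: "\<And>t. t \<in> {a<..<b} \<Longrightarrow> (x has_vector_derivative M t (x t)) (at t)"
    and y: "\<And>t. t \<in> {a<..<b} \<Longrightarrow> (y has_vector_derivative M t (y t)) (at t)"
    and s: "s \<in> {a<..<b}" "x s = y s" and t: "t \<in> {a<..<b}"
  shows "x t = y t"
proof -
  let ?S = "closed_segment s t"
  have S: "?S \<subseteq> {a<..<b}" using s t by (auto simp: closed_segment_eq_real_ivl)
  obtain L where L: "\<And>t v. t \<in> ?S \<Longrightarrow> norm (M t v) \<le> L * norm v"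
    using linear_family_bounded[OF compact_segment lin continuous_on_subset[OF cont S]] by metis
  have "norm (x t - y t) \<le> exp (L * \<bar>t - s\<bar>) * norm (x s - y s)"
  proof (rule gronwall[of _ _ _ "\<lambda>t. M t (x t) - M t (y t)"])
    fix r assume r: "r \<in> ?S"
    show "((\<lambda>r. x r - y r) has_vector_derivative M r (x r) - M r (y r)) (at r)"
      using x y S r by (intro has_vector_derivative_diff) auto
    show "norm (M r (x r) - M r (y r)) \<le> L * norm (x r - y r)"
      using L[OF r, of "x r - y r"] by (simp add: linear_diff[OF lin])
  qed
  then show ?thesis using s by simp
qed

lemma linear_ode_global:
  fixes M :: "real \<Rightarrow> 'b::euclidean_space \<Rightarrow> 'b"
  assumes lin: "\<And>t. linear (M t)" and cont: "\<And>v. continuous_on UNIV (\<lambda>t. M t v)"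
  shows "\<exists>x. x s = v \<and> (\<forall>t. (x has_vector_derivative M t (x t)) (at t))"
proof (rule global_solution[where Adm="\<lambda>_ _. True"])
  show "(y has_vector_derivative M t (y t)) (at t)"
    if "(x has_vector_derivative M t (x t)) (at t)" "open U" "t \<in> U" "\<And>s. s \<in> U \<Longrightarrow> x s = y s" for x y t U
    using has_vector_derivative_transform_within_open[OF that] that(4)[OF that(3)] by simp
  show "x t = y t" if "\<And>r. r \<in> {a<..<b} \<Longrightarrow> (x has_vector_derivative M r (x r)) (at r)"
    "\<And>r. r \<in> {a<..<b} \<Longrightarrow> (y has_vector_derivative M r (y r)) (at r)"
    "s \<in> {a<..<b}" "x s = y s" "t \<in> {a<..<b}" for x y a b s t
    using linear_ode_unique[OF lin continuous_on_subset[OF cont] that] by simp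
  show "\<exists>e>0. \<forall>s\<in>{t0 - e<..<t0 + e}. \<forall>v. True \<longrightarrow>
      (\<exists>x. x s = v \<and> (\<forall>t\<in>{t0 - e<..<t0 + e}. (x has_vector_derivative M t (x t)) (at t)))" for t0
    using linear_ode_local[OF lin zero_less_one continuous_on_subset[OF cont subset_UNIV], of t0] by metis
qed auto

section \<open>Jacobi equation and index form\<close>

text \<open>The Jacobi equation in a parallel frame, with \<open>K\<close> the matrix of the
  curvature operator along the geodesic and \<open>y'\<close> the velocity of
  \<open>y\<close>.\<close>

definition jacobi_solution :: "(real \<Rightarrow> real^'n^'n) \<Rightarrow> (real \<Rightarrow> real^'n) \<Rightarrow> (real \<Rightarrow> real^'n) \<Rightarrow> bool" where
  "jacobi_solution K y y' \<longleftrightarrow> (\<forall>t. (y has_vector_derivative y' t) (at t) \<and>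
     (y' has_vector_derivative - (K t *v y t)) (at t))"

definition no_conjugate :: "(real \<Rightarrow> real^'n^'n) \<Rightarrow> real \<Rightarrow> bool" where
  "no_conjugate K \<rho> \<longleftrightarrow> (\<forall>y y' s t. jacobi_solution K y y' \<longrightarrow> s \<noteq> t \<longrightarrow> y s = 0 \<longrightarrow> y t = 0 \<longrightarrow>
     (\<exists>u. y u \<noteq> 0) \<longrightarrow> \<rho> \<le> \<bar>s - t\<bar>)"

lemma continuous_matrix_vector_mult [continuous_intros]:
  fixes K :: "'a::topological_space \<Rightarrow> real^'n::finite^'m::finite"
  assumes "continuous_on S K" "continuous_on S v"
  shows "continuous_on S (\<lambda>x. K x *v v x)"
  unfolding matrix_vector_mult_def by (intro continuous_intros assms)

lemma jacobi_solution_exists: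
  fixes K :: "real \<Rightarrow> real^'n^'n"
  assumes K: "continuous_on UNIV K"
  shows "\<exists>y y'. jacobi_solution K y y' \<and> y s = a \<and> y' s = b"
proof -
  let ?M = "\<lambda>t (p :: (real^'n) \<times> (real^'n)). (snd p, - (K t *v fst p))"
  have "linear (?M t)" for t
    by (intro linearI) (auto simp: matrix_vector_right_distrib matrix_vector_mult_scaleR)
  moreover have "continuous_on UNIV (\<lambda>t. ?M t p)" for p
    by (intro continuous_intros K)
  ultimately obtain x where x: "x s = (a, b)" "\<And>t. (x has_vector_derivative ?M t (x t)) (at t)"
    using linear_ode_global[of ?M s "(a, b)"] by blast
  have "((\<lambda>t. fst (x t)) has_vector_derivative snd (x t)) (at t)" for t
    using bounded_linear.has_vector_derivative[OF bounded_linear_fst x(2)] by simp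
  moreover have "((\<lambda>t. snd (x t)) has_vector_derivative - (K t *v fst (x t))) (at t)" for t
    using bounded_linear.has_vector_derivative[OF bounded_linear_snd x(2)] by simp
  ultimately show ?thesis using x(1) unfolding jacobi_solution_def
    by (intro exI[of _ "\<lambda>t. fst (x t)"] exI[of _ "\<lambda>t. snd (x t)"]) auto
qed

lemma has_vector_derivative_sum_scaleR:
  fixes f :: "'i \<Rightarrow> real \<Rightarrow> real" and g :: "'i \<Rightarrow> real \<Rightarrow> 'b::real_normed_vector"
  assumes "\<And>i. i \<in> I \<Longrightarrow> (f i has_vector_derivative f' i) (at t)" "\<And>i. i \<in> I \<Longrightarrow> (g i has_vector_derivative g' i) (at t)"
  shows "((\<lambda>t. \<Sum>i\<in>I. f i t *\<^sub>R g i t) has_vector_derivative (\<Sum>i\<in>I. f' i *\<^sub>R g i t) + (\<Sum>i\<in>I. f i t *\<^sub>R g' i)) (at t)"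
proof -
  have "((\<lambda>t. f i t *\<^sub>R g i t) has_vector_derivative f i t *\<^sub>R g' i + f' i *\<^sub>R g i t) (at t)" if "i \<in> I" for i
    using assms[OF that] by (auto intro!: has_vector_derivative_scaleR simp: DERIV_iff_vector)
  then have "((\<lambda>t. \<Sum>i\<in>I. f i t *\<^sub>R g i t) has_vector_derivative (\<Sum>i\<in>I. f i t *\<^sub>R g' i + f' i *\<^sub>R g i t)) (at t)"
    by (intro has_vector_derivative_sum) auto
  then show ?thesis by (simp add: sum.distrib add.commute)
qed

lemma has_vector_derivative_inner:
  assumes "(f has_vector_derivative f') (at t)" "(g has_vector_derivative g') (at t)"
  shows "((\<lambda>t. f t \<bullet> g t) has_vector_derivative f t \<bullet> g' + f' \<bullet> g t) (at t)"
  using bounded_bilinear.has_vector_derivative[OF bounded_bilinear_inner assms] .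

lemma has_vector_derivative_vec_nth:
  assumes "(f has_vector_derivative f') (at t)"
  shows "((\<lambda>t. f t $ i) has_vector_derivative f' $ i) (at t)"
  using bounded_linear.has_vector_derivative[OF bounded_linear_vec_nth assms] .

text \<open>Jacobi's argument. The solutions that vanish at \<open>- \<delta>\<close> form a matrix
  \<open>A\<close> that is invertible on all of \<open>{0..r}\<close>. Writing \<open>z\<close> as
  \<open>A\<close> times \<open>w\<close> turns the index form into the integral of the square of
  \<open>A\<close> times \<open>w'\<close> plus a boundary term, which is 0. Starting before 0 keeps
  the left end away from the singularity of \<open>A\<close>.\<close>

lemma index_form_nonneg_strict:
  fixes K :: "real \<Rightarrow> real^'n^'n"
  assumes K: "continuous_on UNIV K" and sym: "\<And>t a b. (K t *v a) \<bullet> b = a \<bullet> (K t *v b)"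
    and nc: "no_conjugate K \<rho>" and r: "0 < r" "r < \<rho>"
    and z: "\<And>t. t \<in> {0..r} \<Longrightarrow> (z has_vector_derivative z' t) (at t)" and z': "continuous_on {0..r} z'"
    and bd: "z 0 = 0" "z r = 0"
  shows "0 \<le> integral {0..r} (\<lambda>t. z' t \<bullet> z' t - z t \<bullet> (K t *v z t))"
proof -
  \<comment> \<open>Half of the spare length: \<open>- \<delta>\<close> and every point of
    \<open>{0..r}\<close> are still less than \<open>\<rho>\<close> apart.\<close>
  define \<delta> where "\<delta> = (\<rho> - r) / 2"
  have \<delta>: "0 < \<delta>" "r + \<delta> < \<rho>" using r by (auto simp: \<delta>_def field_simps)
  have "\<forall>j. \<exists>y y'. jacobi_solution K y y' \<and> y (- \<delta>) = 0 \<and> y' (- \<delta>) = axis j 1"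
    using jacobi_solution_exists[OF K] by blast
  then obtain Y Y' where Y: "\<And>j. jacobi_solution K (Y j) (Y' j)" "\<And>j. Y j (- \<delta>) = 0" "\<And>j. Y' j (- \<delta>) = axis j (1::real)"
    by metis
  have dY: "(Y j has_vector_derivative Y' j t) (at t)" "(Y' j has_vector_derivative - (K t *v Y j t)) (at t)" for j t
    using Y(1)[of j] by (auto simp: jacobi_solution_def)
  define B where "B t c = (\<Sum>j\<in>UNIV. c $ j *\<^sub>R Y j t)" for t and c :: "real^'n"
  define B' where "B' t c = (\<Sum>j\<in>UNIV. c $ j *\<^sub>R Y' j t)" for t and c :: "real^'n"
  have KB: "K t *v B t c = (\<Sum>j\<in>UNIV. c $ j *\<^sub>R (K t *v Y j t))" for t c
    by (simp add: B_def linear_sum[OF matrix_vector_mul_linear] matrix_vector_mult_scaleR)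
  have dBc: "((\<lambda>t. B t (c t)) has_vector_derivative B t c' + B' t (c t)) (at t)"
     "((\<lambda>t. B' t (c t)) has_vector_derivative B' t c' - K t *v B t (c t)) (at t)"
    if "(c has_vector_derivative c') (at t)" for c c' t
  proof -
    show "((\<lambda>t. B t (c t)) has_vector_derivative B t c' + B' t (c t)) (at t)"
      unfolding B_def B'_def by (intro has_vector_derivative_sum_scaleR has_vector_derivative_vec_nth that dY)
    show "((\<lambda>t. B' t (c t)) has_vector_derivative B' t c' - K t *v B t (c t)) (at t)"
      using has_vector_derivative_sum_scaleR[where I=UNIV and f="\<lambda>i t. c t $ i" and g=Y', OF has_vector_derivative_vec_nth[OF that] dY(2)]
      by (simp add: KB B'_def sum_negf)
  qed
  have sol: "jacobi_solution K (\<lambda>t. B t c) (\<lambda>t. B' t c)" for c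
    using dBc[of "\<lambda>_. c" 0] by (auto simp: jacobi_solution_def B_def[of _ 0] B'_def[of _ 0])
  have B0: "B (- \<delta>) c = 0" "B' (- \<delta>) c = c" for c
    by (auto simp: B_def B'_def Y vec_eq_iff axis_def if_distrib cong: if_cong)
  \<comment> \<open>A zero here would be a second zero closer than \<open>\<rho>\<close> to
    \<open>- \<delta>\<close>, for a solution that is nontrivial because its derivative at
    \<open>- \<delta>\<close> is \<open>c\<close>.\<close>
  have nz: "B t c \<noteq> 0" if c: "c \<noteq> 0" and t: "- \<delta> < t" "t < \<rho> - \<delta>" for c t
  proof
    assume "B t c = 0"
    moreover have "\<exists>u. B u c \<noteq> 0"
    proof (rule ccontr)
      assume "\<not> ?thesis"
      then have "(\<lambda>t. B t c) = (\<lambda>_. 0)" by auto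
      then have "((\<lambda>_. 0) has_vector_derivative B' (- \<delta>) c) (at (- \<delta>))"
        using sol[of c] unfolding jacobi_solution_def by metis
      then have "B' (- \<delta>) c = 0"
        using has_vector_derivative_const vector_derivative_unique_at by blast
      then show False using B0 c by simp
    qed
    ultimately have "\<rho> \<le> \<bar>- \<delta> - t\<bar>" using nc sol B0 t unfolding no_conjugate_def by (metis less_irrefl)
    then show False using t by simp
  qed
  define A where "A t = (\<chi> i j. Y j t $ i)" for t
  have AB: "A t *v c = B t c" for t c
    by (simp add: A_def B_def vec_eq_iff matrix_vector_mult_def mult.commute)
  define U where "U = {- \<delta><..<\<rho> - \<delta>}"
  have U: "open U" "{0..r} \<subseteq> U" using \<delta> by (auto simp: U_def)
  have detA: "det (A t) \<noteq> 0" if "t \<in> U" for t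
    using nz[of _ t] that by (subst invertible_det_nz[symmetric], subst invertible_left_inverse, subst matrix_left_invertible_ker)
      (auto simp: AB U_def)
  have "C1_on U (\<lambda>t. A t $ i $ j)" for i j
  proof (rule C1_onI)
    show "((\<lambda>t. A t $ i $ j) has_derivative (\<lambda>h. h *\<^sub>R Y' j t $ i)) (at t)" for t
      using has_vector_derivative_vec_nth[OF dY(1), of j i t] by (simp add: A_def has_vector_derivative_def)
    have "continuous_on U (Y' j)"
      using dY(2) by (intro continuous_on_vector_derivative) (auto intro: has_vector_derivative_at_within)
    then show "continuous_on U (\<lambda>x. v *\<^sub>R Y' j x $ i)" for v by (intro continuous_intros)
  qed
  then have Cinv: "C1_on U (\<lambda>t. matrix_inv (A t) $ k $ l)" for k l
    by (intro C1_on_matrix_inv U detA)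
  define w where "w t = matrix_inv (A t) *v z t" for t
  define w' where "w' t = vector_derivative w (at t)" for t
  have dw: "(w has_vector_derivative w' t) (at t)" if t: "t \<in> {0..r}" for t
  proof -
    have "(\<lambda>t. matrix_inv (A t) $ k $ l) differentiable (at t)" for k l
      using C1_onD(1)[OF Cinv] U t by blast
    moreover have "(\<lambda>t. z t $ l) differentiable (at t)" for l
      using has_vector_derivative_vec_nth[OF z[OF t]] by (auto simp: differentiable_def has_vector_derivative_def)
    ultimately have "(\<lambda>t. \<Sum>l\<in>UNIV. matrix_inv (A t) $ k $ l * z t $ l) differentiable (at t)" for k
      by (intro differentiable_sum differentiable_mult) auto
    then have "(w has_derivative (\<lambda>h. \<chi> k. fd (\<lambda>t. \<Sum>l\<in>UNIV. matrix_inv (A t) $ k $ l * z t $ l) t h)) (at t)"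
      unfolding w_def matrix_vector_mult_def by (intro has_derivative_vec_lambda fd_worksI)
    then have "w differentiable (at t)" by (auto simp: differentiable_def)
    then show ?thesis by (simp add: w'_def vector_derivative_works)
  qed
  have Bw: "B t (w t) = z t" if "t \<in> U" for t
    using matrix_inv_mult(1)[OF detA[OF that]]
    by (simp add: w_def AB[symmetric] matrix_vector_mul_assoc)
  have z'eq: "z' t = B t (w' t) + B' t (w t)" if t: "t \<in> {0..r}" for t
  proof -
    have "(z has_vector_derivative B t (w' t) + B' t (w t)) (at t)"
      by (rule has_vector_derivative_transform_within_open[OF dBc(1)[OF dw[OF t]] U(1)]) (use U t Bw in auto)
    then show ?thesis using z[OF t] vector_derivative_unique_at by blast
  qed
  \<comment> \<open>Constant by symmetry of \<open>K\<close>, and zero at \<open>- \<delta>\<close>,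
    where all these solutions vanish. It removes the cross terms when the square is
    completed.\<close>
  have wronskian: "B' t a \<bullet> B t b = B t a \<bullet> B' t b" for t a b
  proof -
    let ?g = "\<lambda>t. B' t a \<bullet> B t b - B t a \<bullet> B' t b"
    have "(?g has_vector_derivative 0) (at t)" for t
    proof -
      have d: "((\<lambda>t. B t c) has_vector_derivative B' t c) (at t)" "((\<lambda>t. B' t c) has_vector_derivative - (K t *v B t c)) (at t)" for c
        using sol[of c] by (auto simp: jacobi_solution_def)
      have "(?g has_vector_derivative (B' t a \<bullet> B' t b + - (K t *v B t a) \<bullet> B t b) - (B t a \<bullet> - (K t *v B t b) + B' t a \<bullet> B' t b)) (at t)"
        by (intro has_vector_derivative_diff has_vector_derivative_inner d)
      then show ?thesis by (simp add: sym)
    qed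
    then obtain c where "\<And>t. ?g t = c"
      using has_vector_derivative_zero_constant[of UNIV ?g] by auto
    from this[of t] this[of "- \<delta>"] show ?thesis by (simp add: B0)
  qed
  let ?f = "\<lambda>t. B' t (w t) \<bullet> z t"
  let ?q = "\<lambda>t. z' t \<bullet> z' t - z t \<bullet> (K t *v z t)" and ?h = "\<lambda>t. B t (w' t) \<bullet> B t (w' t)"
  \<comment> \<open>Completing the square: the index integrand is a total derivative plus the square
    \<open>?h\<close>.\<close>
  have "(?f has_vector_derivative (?q t - ?h t)) (at t)" if t: "t \<in> {0..r}" for t
  proof -
    have tU: "t \<in> U" using U t by auto
    have "(?f has_vector_derivative (B' t (w t) \<bullet> z' t + (B' t (w' t) - K t *v B t (w t)) \<bullet> z t)) (at t)"
      by (rule has_vector_derivative_inner[OF dBc(2)[OF dw[OF t]] z[OF t]])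
    moreover have "B' t (w t) \<bullet> z' t + (B' t (w' t) - K t *v B t (w t)) \<bullet> z t = ?q t - ?h t"
      using wronskian[of t "w' t" "w t"]
      by (simp add: Bw[OF tU] z'eq[OF t] inner_diff_left inner_add_left inner_add_right inner_diff_right inner_commute)
    ultimately show ?thesis by simp
  qed
  then have "((\<lambda>t. ?q t - ?h t) has_integral (?f r - ?f 0)) {0..r}"
    using r by (intro fundamental_theorem_of_calculus) (auto intro: has_vector_derivative_at_within)
  then have f: "((\<lambda>t. ?q t - ?h t) has_integral 0) {0..r}" using bd by simp
  have "continuous_on {0..r} z"
    using z by (intro continuous_on_vector_derivative) (auto intro: has_vector_derivative_at_within)
  then have "continuous_on {0..r} ?q" by (intro continuous_intros z' continuous_on_subset[OF K]) auto
  then have "(?q has_integral integral {0..r} ?q) {0..r}"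
    by (intro integrable_integral integrable_continuous_interval)
  from has_integral_diff[OF this f] have "(?h has_integral integral {0..r} ?q) {0..r}" by simp
  then show ?thesis by (rule has_integral_nonneg) simp
qed

text \<open>Running through a solution at speed \<open>\<mu>\<close> multiplies the coefficient
  matrix by the square of \<open>\<mu>\<close>; zeros move together by the factor
  \<open>\<mu>\<close>.\<close>

lemma jacobi_solution_rescale:
  assumes "0 < \<mu>" "jacobi_solution (\<lambda>t. (1 / \<mu>\<^sup>2) *\<^sub>R K (t / \<mu>)) y y'"
  shows "jacobi_solution K (\<lambda>t. y (\<mu> * t)) (\<lambda>t. \<mu> *\<^sub>R y' (\<mu> * t))"
  unfolding jacobi_solution_def
proof (intro allI conjI)
  fix t
  have l: "((\<lambda>t. \<mu> * t) has_vector_derivative \<mu>) (at t)"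
    by (auto intro!: derivative_eq_intros simp: DERIV_iff_vector[symmetric])
  have y: "(y has_vector_derivative y' (\<mu> * t)) (at (\<mu> * t))"
    "(y' has_vector_derivative - (((1 / \<mu>\<^sup>2) *\<^sub>R K (\<mu> * t / \<mu>)) *v y (\<mu> * t))) (at (\<mu> * t))"
    using assms(2) unfolding jacobi_solution_def by blast+
  show "((\<lambda>t. y (\<mu> * t)) has_vector_derivative \<mu> *\<^sub>R y' (\<mu> * t)) (at t)"
    using vector_diff_chain_at[OF l y(1)] by (simp add: o_def)
  have "((\<lambda>t. \<mu> *\<^sub>R y' (\<mu> * t)) has_vector_derivative \<mu> *\<^sub>R \<mu> *\<^sub>R - (((1 / \<mu>\<^sup>2) *\<^sub>R K (\<mu> * t / \<mu>)) *v y (\<mu> * t))) (at t)"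
    using vector_diff_chain_at[OF l y(2)]
    by (intro bounded_linear.has_vector_derivative[OF bounded_linear_scaleR_right]) (simp add: o_def)
  then show "((\<lambda>t. \<mu> *\<^sub>R y' (\<mu> * t)) has_vector_derivative - (K t *v y (\<mu> * t))) (at t)"
    using assms(1) by (simp add: scaleR_matrix_vector_assoc[symmetric] power2_eq_square)
qed

text \<open>Squaring makes the positive part differentiable at 0, which yields the cut-off function
  of \<open>index_form_zero\<close>.\<close>

lemma has_real_derivative_pos_part_square:
  "((\<lambda>t. (max 0 t)\<^sup>2) has_real_derivative 2 * max 0 t) (at (t::real))"
proof -
  consider "t < 0" | "t > 0" | "t = 0" by linarith
  then show ?thesis
  proof cases
    case 1
    show ?thesis
      by (rule has_field_derivative_transform_within_open[of "\<lambda>_. 0" _ _ "{..<0}"]) (use 1 in auto)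
  next
    case 2
    have "((\<lambda>t. t\<^sup>2) has_real_derivative 2 * t) (at t)" by (auto intro!: derivative_eq_intros)
    from has_field_derivative_transform_within_open[OF this, of "{0<..}"] show ?thesis using 2 by auto
  next
    case 3
    have "((\<lambda>h. (max 0 h)\<^sup>2 / h) \<longlongrightarrow> 0) (at (0::real))"
    proof (rule Lim_null_comparison)
      show "\<forall>\<^sub>F h in at 0. norm ((max 0 h)\<^sup>2 / h) \<le> \<bar>h::real\<bar>"
        by (intro always_eventually allI) (auto simp: max_def power2_eq_square)
      show "((\<lambda>h::real. \<bar>h\<bar>) \<longlongrightarrow> 0) (at 0)" by (rule tendsto_rabs_zero) (rule tendsto_ident_at)
    qed
    then show ?thesis using 3 by (simp add: DERIV_def)
  qed
qed

lemma index_form_expand: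
  fixes K :: "real^'n^'n"
  assumes "b \<bullet> (K *v c) = c \<bullet> (K *v b)"
  shows "(a + (e * p') *\<^sub>R c) \<bullet> (a + (e * p') *\<^sub>R c) - (b + (e * p) *\<^sub>R c) \<bullet> (K *v (b + (e * p) *\<^sub>R c)) =
    (a \<bullet> a - b \<bullet> (K *v b)) + (2 * e * (p' * (c \<bullet> a) - p * (c \<bullet> (K *v b))) + e\<^sup>2 * (p'\<^sup>2 * (c \<bullet> c) - p\<^sup>2 * (c \<bullet> (K *v c))))"
  using assms inner_commute[of a c]
  by (simp add: matrix_vector_right_distrib matrix_vector_mult_scaleR inner_add_left inner_add_right
      power2_eq_square algebra_simps)

lemma has_integral_sin_cos_square:
  "((\<lambda>t. (cos t)\<^sup>2) has_integral pi / 2) {0..pi}" "((\<lambda>t. (sin t)\<^sup>2) has_integral pi / 2) {0..pi}"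
proof -
  have "((\<lambda>t. (cos t)\<^sup>2) has_integral ((pi + sin pi * cos pi) / 2 - (0 + sin 0 * cos 0) / 2)) {0..pi}"
    by (rule fundamental_theorem_of_calculus)
       (auto intro!: derivative_eq_intros simp: DERIV_iff_vector[symmetric]
          power2_eq_square cos_squared_eq[unfolded power2_eq_square] field_simps)
  then show "((\<lambda>t. (cos t)\<^sup>2) has_integral pi / 2) {0..pi}" by simp
  from has_integral_diff[OF has_integral_const_real[of 1] this]
  show "((\<lambda>t. (sin t)\<^sup>2) has_integral pi / 2) {0..pi}" by (simp add: sin_squared_eq)
qed

context
  fixes K :: "real \<Rightarrow> real^'n^'n"
  assumes K: "continuous_on UNIV K" and sym: "\<And>t a b. (K t *v a) \<bullet> b = a \<bullet> (K t *v b)"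
begin

text \<open>At length exactly \<open>r\<close> the end points may be conjugate and the strict
  version fails to apply. Stretching time by \<open>\<mu> > 1\<close> separates conjugate points to
  at least \<open>\<mu> * r\<close>; the inequality then survives the limit of \<open>\<mu>\<close>
  to 1.\<close>

lemma index_form_nonneg:
  assumes nc: "no_conjugate K r" and r: "0 < r"
    and z: "\<And>t. t \<in> {0..r} \<Longrightarrow> (z has_vector_derivative z' t) (at t)" and z': "continuous_on {0..r} z'"
    and bd: "z 0 = 0" "z r = 0"
  shows "0 \<le> integral {0..r} (\<lambda>t. z' t \<bullet> z' t - z t \<bullet> (K t *v z t))"
proof -
  let ?K = "\<lambda>\<mu> t. (1 / \<mu>\<^sup>2) *\<^sub>R K (t / \<mu>)"
  let ?J = "\<lambda>\<mu>. integral {0..r} (\<lambda>t. z' t \<bullet> z' t - z t \<bullet> (?K \<mu> t *v z t))"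
  have cz: "continuous_on {0..r} z"
    using z by (intro continuous_on_vector_derivative) (auto intro: has_vector_derivative_at_within)
  have pos: "0 \<le> ?J \<mu>" if l: "1 < \<mu>" for \<mu>
  proof (rule index_form_nonneg_strict[OF _ _ _ r _ z z' bd])
    show "continuous_on UNIV (?K \<mu>)"
      by (intro continuous_intros continuous_on_compose2[OF K]) (use l in auto)
    show "(?K \<mu> t *v a) \<bullet> b = a \<bullet> (?K \<mu> t *v b)" for t a b
      by (simp add: scaleR_matrix_vector_assoc[symmetric] sym)
    show "no_conjugate (?K \<mu>) (\<mu> * r)"
      unfolding no_conjugate_def
    proof (intro allI impI)
      fix y y' s t assume *: "jacobi_solution (?K \<mu>) y y'" "s \<noteq> t" "y s = 0" "y t = 0" "\<exists>u. y u \<noteq> 0"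
      then obtain u where u: "y u \<noteq> 0" by blast
      have "jacobi_solution K (\<lambda>t. y (\<mu> * t)) (\<lambda>t. \<mu> *\<^sub>R y' (\<mu> * t))"
        using l * by (intro jacobi_solution_rescale) auto
      moreover have "s / \<mu> \<noteq> t / \<mu>" "y (\<mu> * (s / \<mu>)) = 0" "y (\<mu> * (t / \<mu>)) = 0" "y (\<mu> * (u / \<mu>)) \<noteq> 0"
        using l * u by auto
      ultimately have "r \<le> \<bar>s / \<mu> - t / \<mu>\<bar>" using nc unfolding no_conjugate_def by metis
      also have "\<dots> = \<bar>s - t\<bar> / \<mu>" using l by (simp add: diff_divide_distrib[symmetric])
      finally show "\<mu> * r \<le> \<bar>s - t\<bar>" using l by (simp add: field_simps)
    qed
    show "r < \<mu> * r" using l r by simp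
  qed
  have "continuous_on {1..2} ?J"
    unfolding cbox_interval[symmetric]
  proof (rule integral_continuous_on_param)
    show "continuous_on (cbox 1 2 \<times> cbox 0 r) (\<lambda>(\<mu>, t). z' t \<bullet> z' t - z t \<bullet> (?K \<mu> t *v z t))"
      unfolding split_beta cbox_interval
      by (intro continuous_intros continuous_on_compose2[OF K] continuous_on_compose2[OF cz] continuous_on_compose2[OF z'])
         auto
  qed
  \<comment> \<open>The open interval carries the inequality \<open>pos\<close>, and continuity
    extends it to the end point 1 of its closure.\<close>
  then have "continuous_on (closure {1<..<2::real}) ?J" by (simp add: closure_greaterThanLessThan)
  then have "0 \<le> ?J 1"
    by (rule continuous_ge_on_closure) (use pos in \<open>auto simp: closure_greaterThanLessThan\<close>)
  then show ?thesis by simp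
qed

text \<open>A zero of the nonnegative index form is a minimiser, so its first variation vanishes. If
  the Jacobi operator took a value \<open>c \<noteq> 0\<close> at \<open>t0\<close>, a bump around
  \<open>t0\<close> in direction \<open>c\<close> would have a nonzero first variation after
  integration by parts.\<close>

lemma index_form_zero:
  assumes nc: "no_conjugate K r" and r: "0 < r"
    and z: "\<And>t. t \<in> {0..r} \<Longrightarrow> (z has_vector_derivative z' t) (at t)"
    and z'': "\<And>t. t \<in> {0..r} \<Longrightarrow> (z' has_vector_derivative z'' t) (at t)"
    and cz'': "continuous_on {0..r} z''"
    and bd: "z 0 = 0" "z r = 0"
    and I0: "integral {0..r} (\<lambda>t. z' t \<bullet> z' t - z t \<bullet> (K t *v z t)) = 0"
    and t0: "0 < t0" "t0 < r"
  shows "z'' t0 + K t0 *v z t0 = 0"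
proof (rule ccontr)
  let ?E = "\<lambda>t. z'' t + K t *v z t"
  assume nE: "?E t0 \<noteq> 0"
  define c where "c = ?E t0"
  have cz: "continuous_on {0..r} z" "continuous_on {0..r} z'"
    by (rule continuous_on_vector_derivative, rule has_vector_derivative_at_within, erule z,
        rule continuous_on_vector_derivative, rule has_vector_derivative_at_within, erule z'')
  note cK = continuous_on_subset[OF K subset_UNIV]
  have cE: "continuous_on {0..r} (\<lambda>t. c \<bullet> ?E t)" by (intro continuous_intros cz cz'' cK)
  have "0 < c \<bullet> ?E t0" using nE by (simp add: c_def)
  then have "\<forall>\<^sub>F t in at t0 within {0..r}. 0 < c \<bullet> ?E t"
    using cE t0 by (intro order_tendstoD(1)[of _ "c \<bullet> ?E t0"]) (auto simp: continuous_on_def)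
  then obtain \<eta> where \<eta>: "0 < \<eta>" "\<And>t. t \<in> {0..r} \<Longrightarrow> t \<noteq> t0 \<Longrightarrow> dist t t0 < \<eta> \<Longrightarrow> 0 < c \<bullet> ?E t"
    unfolding eventually_at by blast
  define m where "m = min \<eta> (min t0 (r - t0))"
  have m: "0 < m" "m \<le> \<eta>" "m \<le> t0" "m \<le> r - t0" using \<eta> t0 by (auto simp: m_def)
  \<comment> \<open>A C1 bump supported within distance \<open>m\<close> of \<open>t0\<close>. The
    choice of \<open>m\<close> makes it vanish at both ends and keeps its support where the Jacobi
    operator has positive product with \<open>c\<close>.\<close>
  define \<phi> where "\<phi> t = (max 0 (m\<^sup>2 - (t - t0)\<^sup>2))\<^sup>2" for t
  define \<phi>' where "\<phi>' t = 2 * max 0 (m\<^sup>2 - (t - t0)\<^sup>2) * (- 2 * (t - t0))" for t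
  have "(\<phi> has_real_derivative \<phi>' t) (at t)" for t
  proof -
    have "((\<lambda>t. m\<^sup>2 - (t - t0)\<^sup>2) has_real_derivative (- 2 * (t - t0))) (at t)"
      by (auto intro!: derivative_eq_intros)
    from DERIV_chain2[OF has_real_derivative_pos_part_square this] show ?thesis
      unfolding \<phi>_def \<phi>'_def .
  qed
  then have d\<phi>: "(\<phi> has_vector_derivative \<phi>' t) (at t)" for t
    by (simp add: DERIV_iff_vector)
  have c\<phi>: "continuous_on S \<phi>" "continuous_on S \<phi>'" for S
    unfolding \<phi>_def \<phi>'_def by (intro continuous_intros)+
  have bd\<phi>: "\<phi> 0 = 0" "\<phi> r = 0"
    using m t0 by (auto simp: \<phi>_def power_mono)
  have \<phi>0: "0 \<le> \<phi> t" for t by (simp add: \<phi>_def)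
  have \<phi>p: "\<bar>t - t0\<bar> < m" if "\<phi> t \<noteq> 0" for t
  proof (rule ccontr)
    assume "\<not> ?thesis"
    then have "m\<^sup>2 \<le> (t - t0)\<^sup>2" using m by (auto simp: abs_le_square_iff[symmetric])
    then show False using that by (simp add: \<phi>_def)
  qed
  let ?q = "\<lambda>t. z' t \<bullet> z' t - z t \<bullet> (K t *v z t)" and ?p = "\<lambda>t. \<phi>' t * (c \<bullet> z' t) - \<phi> t * (c \<bullet> (K t *v z t))"
    and ?r = "\<lambda>t. (\<phi>' t)\<^sup>2 * (c \<bullet> c) - (\<phi> t)\<^sup>2 * (c \<bullet> (K t *v c))"
  define P Q where "P = integral {0..r} ?p" and "Q = integral {0..r} ?r"
  \<comment> \<open>The index form of \<open>z\<close> perturbed by \<open>e\<close> times the bump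
    is a quadratic polynomial in \<open>e\<close> without constant term, by
    \<open>I0\<close>.\<close>
  have quad: "0 \<le> 2 * e * P + e\<^sup>2 * Q" for e
  proof -
    let ?z = "\<lambda>t. z t + (e * \<phi> t) *\<^sub>R c" and ?z' = "\<lambda>t. z' t + (e * \<phi>' t) *\<^sub>R c"
    have nonneg: "0 \<le> integral {0..r} (\<lambda>t. ?z' t \<bullet> ?z' t - ?z t \<bullet> (K t *v ?z t))"
    proof (rule index_form_nonneg[OF nc r])
      show "(?z has_vector_derivative ?z' t) (at t)" if "t \<in> {0..r}" for t
        using d\<phi> by (intro has_vector_derivative_add z that bounded_linear.has_vector_derivative[OF bounded_linear_scaleR_left]
           bounded_linear.has_vector_derivative[OF bounded_linear_mult_right])
      show "continuous_on {0..r} ?z'" by (intro continuous_intros cz c\<phi>)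
    qed (use bd bd\<phi> in auto)
    have eq: "(\<lambda>t. ?z' t \<bullet> ?z' t - ?z t \<bullet> (K t *v ?z t)) = (\<lambda>t. ?q t + (2 * e * ?p t + e\<^sup>2 * ?r t))"
      using sym by (intro ext index_form_expand) (simp add: inner_commute)
    have i: "?q integrable_on {0..r}" "?p integrable_on {0..r}" "?r integrable_on {0..r}"
      by (intro integrable_continuous_interval continuous_intros cz cK c\<phi>)+
    have "(?q has_integral 0) {0..r}" "(?p has_integral P) {0..r}" "(?r has_integral Q) {0..r}"
      using integrable_integral[OF i(1)] I0 integrable_integral[OF i(2)] integrable_integral[OF i(3)]
      unfolding P_def Q_def by auto
    then have "((\<lambda>t. ?z' t \<bullet> ?z' t - ?z t \<bullet> (K t *v ?z t)) has_integral 0 + (2 * e * P + e\<^sup>2 * Q)) {0..r}"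
      unfolding eq by (rule has_integral_add[OF _ has_integral_add[OF has_integral_mult_right has_integral_mult_right]])
    then have "integral {0..r} (\<lambda>t. ?z' t \<bullet> ?z' t - ?z t \<bullet> (K t *v ?z t)) = 2 * e * P + e\<^sup>2 * Q"
      by (simp add: integral_unique)
    with nonneg show ?thesis by simp
  qed
  have "P = 0"
  proof (rule ccontr)
    assume "P \<noteq> 0"
    \<comment> \<open>Taking \<open>e = - P * k\<close> in \<open>quad\<close> gives
      \<open>P\<^sup>2 * k * (k * Q - 2)\<close>, which is negative as soon as
      \<open>k * Q < 2\<close>.\<close>
    define k where "k = 1 / (\<bar>Q\<bar> + 1)"
    have k: "0 < k" "k * Q < 2" by (auto simp: k_def field_simps)
    have "0 \<le> (P\<^sup>2 * k) * (k * Q - 2)" using quad[of "- P * k"] by (simp add: power2_eq_square algebra_simps)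
    moreover have "(P\<^sup>2 * k) * (k * Q - 2) < 0" using k \<open>P \<noteq> 0\<close> by (intro mult_pos_neg) auto
    ultimately show False by simp
  qed
  \<comment> \<open>Integration by parts moves the derivative from the bump to \<open>z'\<close>;
    the boundary terms vanish with the bump.\<close>
  have "((\<lambda>t. \<phi> t * (c \<bullet> z'' t) + \<phi>' t * (c \<bullet> z' t)) has_integral (\<phi> r * (c \<bullet> z' r) - \<phi> 0 * (c \<bullet> z' 0))) {0..r}"
  proof (rule fundamental_theorem_of_calculus)
    show "((\<lambda>t. \<phi> t * (c \<bullet> z' t)) has_vector_derivative \<phi> t * (c \<bullet> z'' t) + \<phi>' t * (c \<bullet> z' t)) (at t within {0..r})" if "t \<in> {0..r}" for t
      by (rule has_vector_derivative_at_within[OF has_vector_derivative_mult[OF d\<phi>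
        bounded_linear.has_vector_derivative[OF bounded_linear_inner_right z''[OF that]]]])
  qed (use r in simp)
  then have ibp: "integral {0..r} (\<lambda>t. \<phi> t * (c \<bullet> z'' t) + \<phi>' t * (c \<bullet> z' t)) = 0"
    using bd\<phi> by (simp add: integral_unique)
  have "integral {0..r} (\<lambda>t. \<phi> t * (c \<bullet> ?E t)) =
        integral {0..r} (\<lambda>t. (\<phi> t * (c \<bullet> z'' t) + \<phi>' t * (c \<bullet> z' t)) - ?p t)"
    by (simp add: inner_add_right algebra_simps)
  also have "\<dots> = integral {0..r} (\<lambda>t. \<phi> t * (c \<bullet> z'' t) + \<phi>' t * (c \<bullet> z' t)) - P" unfolding P_def
    by (intro integral_diff integrable_continuous_interval continuous_intros cz cz'' cK c\<phi>)
  finally have int0: "integral {0..r} (\<lambda>t. \<phi> t * (c \<bullet> ?E t)) = 0" using \<open>P = 0\<close> ibp by simp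
  have "\<phi> t0 * (c \<bullet> ?E t0) = 0"
  proof -
    have "0 \<le> \<phi> t * (c \<bullet> ?E t)" if t: "t \<in> {0..r}" for t
    proof (cases "\<phi> t = 0 \<or> t = t0")
      case False
      then have "dist t t0 < \<eta>" using \<phi>p[of t] m by (simp add: dist_real_def)
      then show ?thesis using \<eta>(2)[OF t] False \<phi>0[of t] by (simp add: less_imp_le)
    qed (use \<phi>0[of t] \<open>0 < c \<bullet> ?E t0\<close> in auto)
    moreover have "continuous_on {0..r} (\<lambda>t. \<phi> t * (c \<bullet> ?E t))" by (intro continuous_intros cE c\<phi>)
    ultimately show ?thesis using int0 t0 r by (subst (asm) integral_eq_0_iff) auto
  qed
  then show False using \<open>0 < c \<bullet> ?E t0\<close> m by (simp add: \<phi>_def)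
qed

text \<open>The test fields are sin t times the projections \<open>p i\<close> of all coordinate
  vectors off \<open>u\<close>. No basis of the complement has to be chosen: since
  \<open>K t\<close> kills \<open>u\<close>, the forms at \<open>p i\<close> add up to the trace,
  and the squared lengths of the \<open>p i\<close> add up to n - 1. In the equality case every
  single index form is 0, so \<open>index_form_zero\<close> gives that \<open>K t\<close> fixes each
  \<open>p i\<close>; these span the complement of \<open>u\<close>.\<close>

lemma index_trace:
  assumes nc: "no_conjugate K pi" and u: "norm u = 1" and Ku: "\<And>t. K t *v u = 0"
  shows "integral {0..pi} (\<lambda>t. (sin t)\<^sup>2 * trace (K t)) \<le> (real CARD('n) - 1) * pi / 2" (is "?I \<le> ?c")
    and "integral {0..pi} (\<lambda>t. (sin t)\<^sup>2 * trace (K t)) = (real CARD('n) - 1) * pi / 2 \<Longrightarrow>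
      w \<bullet> u = 0 \<Longrightarrow> K 0 *v w = w"
proof -
  have uu: "u \<bullet> u = 1" using u by (simp add: norm_eq_1)
  define p where "p i = axis i 1 - u $ i *\<^sub>R u" for i
  have pp: "p i \<bullet> p i = 1 - (u $ i)\<^sup>2" for i
    by (simp add: p_def inner_diff_left inner_diff_right inner_axis' inner_axis inner_axis_axis uu power2_eq_square)
  have sum_u: "(\<Sum>i\<in>UNIV. (u $ i)\<^sup>2) = 1"
    using uu by (simp add: inner_vec_def power2_eq_square)
  have Kp: "K t *v p i = K t *v axis i 1" for t i
    by (simp add: p_def matrix_vector_mult_diff_distrib matrix_vector_mult_scaleR Ku)
  have pKp: "p i \<bullet> (K t *v p i) = K t $ i $ i" for t i
  proof -
    have "p i \<bullet> (K t *v p i) = (K t *v p i) \<bullet> axis i 1" by (subst sym[symmetric]) (simp add: sym Kp)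
    then show ?thesis by (simp add: Kp inner_axis matrix_vector_mult_basis column_def)
  qed
  have tr: "trace (K t) = (\<Sum>i\<in>UNIV. p i \<bullet> (K t *v p i))" for t by (simp add: pKp trace_def)
  define J where "J i = integral {0..pi} (\<lambda>t. (cos t *\<^sub>R p i) \<bullet> (cos t *\<^sub>R p i) - (sin t *\<^sub>R p i) \<bullet> (K t *v (sin t *\<^sub>R p i)))" for i
  have d: "((\<lambda>t. sin t *\<^sub>R p i) has_vector_derivative cos t *\<^sub>R p i) (at t)"
    "((\<lambda>t. cos t *\<^sub>R p i) has_vector_derivative - sin t *\<^sub>R p i) (at t)" for i t
    by (auto intro!: derivative_eq_intros simp: DERIV_iff_vector[symmetric])
  have J0: "0 \<le> J i" for i
    unfolding J_def by (rule index_form_nonneg[OF nc _ d(1)]) (auto intro!: continuous_intros)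
  note cK = continuous_on_subset[OF K subset_UNIV]
  have i1: "((\<lambda>t. (sin t)\<^sup>2 * (p i \<bullet> (K t *v p i))) has_integral integral {0..pi} (\<lambda>t. (sin t)\<^sup>2 * (p i \<bullet> (K t *v p i)))) {0..pi}" for i
    by (intro integrable_integral integrable_continuous_interval continuous_intros cK)
  have "J i = (pi / 2) * (p i \<bullet> p i) - integral {0..pi} (\<lambda>t. (sin t)\<^sup>2 * (p i \<bullet> (K t *v p i)))" for i
  proof -
    have "((\<lambda>t. (cos t)\<^sup>2 * (p i \<bullet> p i) - (sin t)\<^sup>2 * (p i \<bullet> (K t *v p i))) has_integral
      (pi / 2) * (p i \<bullet> p i) - integral {0..pi} (\<lambda>t. (sin t)\<^sup>2 * (p i \<bullet> (K t *v p i)))) {0..pi}"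
      by (rule has_integral_diff[OF has_integral_mult_left[OF has_integral_sin_cos_square(1)] i1])
    then show ?thesis
      by (simp add: J_def integral_unique matrix_vector_mult_scaleR power2_eq_square mult.assoc)
  qed
  then have "(\<Sum>i\<in>UNIV. J i) = (pi / 2) * (\<Sum>i\<in>UNIV. p i \<bullet> p i) - (\<Sum>i\<in>UNIV. integral {0..pi} (\<lambda>t. (sin t)\<^sup>2 * (p i \<bullet> (K t *v p i))))"
    by (simp add: sum_subtractf sum_distrib_left)
  also have "(\<Sum>i\<in>UNIV. p i \<bullet> p i) = real CARD('n) - 1"
    by (simp add: pp sum_subtractf sum_u)
  also have "(\<Sum>i\<in>UNIV. integral {0..pi} (\<lambda>t. (sin t)\<^sup>2 * (p i \<bullet> (K t *v p i)))) = ?I"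
    by (rule integral_unique[symmetric]) (unfold tr sum_distrib_left, intro has_integral_sum i1 finite_class.finite_UNIV)
  finally have sumJ: "(\<Sum>i\<in>UNIV. J i) = ?c - ?I" by simp
  have "0 \<le> (\<Sum>i\<in>UNIV. J i)" by (intro sum_nonneg J0)
  then show "?I \<le> ?c" using sumJ by simp
  assume eq: "?I = ?c" and w: "w \<bullet> u = 0"
  have Ji: "J i = 0" for i
    using sumJ eq J0 by (simp add: sum_nonneg_eq_0_iff)
  have Kpi: "K 0 *v p i = p i" for i
  proof -
    have "K t *v p i = p i" if t: "0 < t" "t < pi" for t
    proof -
      have "- sin t *\<^sub>R p i + K t *v (sin t *\<^sub>R p i) = 0"
        by (rule index_form_zero[OF nc _ d(1) d(2)])
           (use Ji[of i] t in \<open>auto intro!: continuous_intros simp: J_def\<close>)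
      then have "sin t *\<^sub>R (K t *v p i - p i) = 0" by (simp add: matrix_vector_mult_scaleR scaleR_diff_right)
      then show ?thesis using sin_gt_zero[OF t] by simp
    qed
    then have "\<forall>\<^sub>F t in at_right 0. K t *v p i = p i"
      using eventually_at_right_real[OF pi_gt_zero] by (auto elim: eventually_mono)
    \<comment> \<open>The factor sin t vanishes at 0, so the identity at time 0 is obtained as a
      limit from the right.\<close>
    moreover have "((\<lambda>t. K t *v p i) \<longlongrightarrow> K 0 *v p i) (at_right 0)"
    proof -
      have "continuous_on UNIV (\<lambda>t. K t *v p i)" by (intro continuous_intros K)
      then have "isCont (\<lambda>t. K t *v p i) 0" by (simp add: continuous_on_eq_continuous_at)
      then show ?thesis unfolding isCont_def by (rule filterlim_mono) (auto simp: at_le)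
    qed
    ultimately show ?thesis
      using tendsto_unique[of "at_right (0::real)" "\<lambda>t. K t *v p i" "K 0 *v p i" "p i"]
      by (simp add: tendsto_eventually)
  qed
  have "w = (\<Sum>i\<in>UNIV. w $ i *\<^sub>R axis i 1)" by (simp add: vec_eq_iff axis_def if_distrib cong: if_cong)
  also have "\<dots> = (\<Sum>i\<in>UNIV. w $ i *\<^sub>R p i + (w $ i * u $ i) *\<^sub>R u)" by (simp add: p_def scaleR_diff_right)
  also have "\<dots> = (\<Sum>i\<in>UNIV. w $ i *\<^sub>R p i) + (w \<bullet> u) *\<^sub>R u"
    by (simp add: sum.distrib scaleR_sum_left[symmetric] inner_vec_def)
  finally have "w = (\<Sum>i\<in>UNIV. w $ i *\<^sub>R p i)" using w by simp
  moreover have "K 0 *v (\<Sum>i\<in>UNIV. w $ i *\<^sub>R p i) = (\<Sum>i\<in>UNIV. w $ i *\<^sub>R p i)"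
    by (simp add: linear_sum[OF matrix_vector_mul_linear] matrix_vector_mult_scaleR Kpi)
  ultimately show "K 0 *v w = w" by simp
qed

end

section \<open>Metric, connection and curvature in charts\<close>

type_synonym 'n phase = "(real^'n) \<times> (real^'n)"

lemma linear_derivative_family:
  assumes F: "\<And>x. linear (F x)" "\<And>u. ((\<lambda>x. F x u) has_derivative F' u) (at x)"
  shows "linear (\<lambda>u. F' u w)"
proof (rule linearI)
  fix a b and r :: real
  show "F' (a + b) w = F' a w + F' b w"
    using has_derivative_unique[OF F(2)[of "a + b", unfolded linear_add[OF F(1)]] has_derivative_add[OF F(2) F(2)]] by metis
  show "F' (r *\<^sub>R a) w = r *\<^sub>R F' a w"
    using has_derivative_unique[OF F(2)[of "r *\<^sub>R a", unfolded linear_cmul[OF F(1)]] has_derivative_scaleR_right[OF F(2)]] by metis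
qed

lemma linear_axis_sum:
  fixes f :: "real^'n \<Rightarrow> 'b::real_vector"
  assumes "linear f" shows "f v = (\<Sum>i\<in>UNIV. v $ i *\<^sub>R f (axis i 1))"
proof -
  have "v = (\<Sum>i\<in>UNIV. v $ i *\<^sub>R axis i 1)" by (simp add: vec_eq_iff axis_def if_distrib cong: if_cong)
  then have "f v = f (\<Sum>i\<in>UNIV. v $ i *\<^sub>R axis i 1)" by simp
  then show ?thesis by (simp add: linear_sum[OF assms] linear_cmul[OF assms])
qed

lemma sum_axis: "(\<Sum>a\<in>UNIV. axis j (1::real) $ a * F a) = F j"
  by (subst sum.cong[OF refl, of _ _ "\<lambda>a. if a = j then F a else 0"]) (auto simp: axis_def)

text \<open>Product rule for a linear map and a vector that both depend on the point, when the
  derivative of the map is known only on fixed vectors. Expansion in coordinate vectors reduces it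
  to products with scalar functions.\<close>

lemma has_derivative_linear_family:
  fixes L :: "'x::real_normed_vector \<Rightarrow> real^'m::finite \<Rightarrow> 'c::real_normed_vector"
  assumes S: "open S" "x \<in> S" and lin: "\<And>y. y \<in> S \<Longrightarrow> linear (L y)"
    and L: "\<And>u. ((\<lambda>y. L y u) has_derivative (\<lambda>h. L' h u)) (at x)"
    and a: "(a has_derivative a') (at x)"
  shows "((\<lambda>y. L y (a y)) has_derivative (\<lambda>h. L' h (a x) + L x (a' h))) (at x)"
proof -
  have ai: "((\<lambda>y. a y $ i) has_derivative (\<lambda>h. a' h $ i)) (at x)" for i
    by (rule bounded_linear.has_derivative[OF bounded_linear_vec_nth a])
  have "((\<lambda>y. \<Sum>i\<in>UNIV. a y $ i *\<^sub>R L y (axis i 1)) has_derivative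
     (\<lambda>h. \<Sum>i\<in>UNIV. a x $ i *\<^sub>R L' h (axis i 1) + a' h $ i *\<^sub>R L x (axis i 1))) (at x)"
    by (intro has_derivative_sum has_derivative_scaleR ai L)
  then have 1: "((\<lambda>y. L y (a y)) has_derivative
     (\<lambda>h. \<Sum>i\<in>UNIV. a x $ i *\<^sub>R L' h (axis i 1) + a' h $ i *\<^sub>R L x (axis i 1))) (at x)"
    by (rule has_derivative_transform_within_open[OF _ S]) (simp add: linear_axis_sum[OF lin, symmetric])
  have "((\<lambda>y. \<Sum>i\<in>UNIV. u $ i *\<^sub>R L y (axis i 1)) has_derivative
     (\<lambda>h. \<Sum>i\<in>UNIV. u $ i *\<^sub>R L' h (axis i 1))) (at x)" for u
    by (intro has_derivative_sum has_derivative_scaleR_right L)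
  then have "((\<lambda>y. L y u) has_derivative (\<lambda>h. \<Sum>i\<in>UNIV. u $ i *\<^sub>R L' h (axis i 1))) (at x)" for u
    by (rule has_derivative_transform_within_open[OF _ S]) (simp add: linear_axis_sum[OF lin, symmetric])
  then have "(\<lambda>h. L' h u) = (\<lambda>h. \<Sum>i\<in>UNIV. u $ i *\<^sub>R L' h (axis i 1))" for u
    using L has_derivative_unique by blast
  then have eq: "(\<Sum>i\<in>UNIV. u $ i *\<^sub>R L' h (axis i 1)) = L' h u" for h u by (metis fun_cong)
  have "(\<Sum>i\<in>UNIV. a x $ i *\<^sub>R L' h (axis i 1) + a' h $ i *\<^sub>R L x (axis i 1)) = L' h (a x) + L x (a' h)" for h
    by (simp only: sum.distrib eq linear_axis_sum[OF lin[OF S(2)], symmetric])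
  then show ?thesis using 1 by simp
qed

lemma has_derivative_bilinear_family:
  fixes B :: "'x::real_normed_vector \<Rightarrow> real^'m::finite \<Rightarrow> real^'k::finite \<Rightarrow> 'c::real_normed_vector"
  assumes lin: "\<And>y u. linear (B y u)" "\<And>y v. linear (\<lambda>u. B y u v)"
    and B: "\<And>u v. ((\<lambda>y. B y u v) has_derivative (\<lambda>h. B' h u v)) (at x)"
    and a: "(a has_derivative a') (at x)" and b: "(b has_derivative b') (at x)"
  shows "((\<lambda>y. B y (a y) (b y)) has_derivative (\<lambda>h. B' h (a x) (b x) + B x (a' h) (b x) + B x (a x) (b' h))) (at x)"
proof -
  have 1: "((\<lambda>y. B y (a y) v) has_derivative (\<lambda>h. B' h (a x) v + B x (a' h) v)) (at x)" for v
    by (rule has_derivative_linear_family[of UNIV, OF _ _ lin(2) B a]) auto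
  show ?thesis
    using has_derivative_linear_family[of UNIV x "\<lambda>y. B y (a y)", OF _ _ lin(1) 1 b] by simp
qed

section \<open>Charts, coordinate changes and tangent vectors\<close>

lemma inv_into_chart:
  assumes "is_chart c"
  shows "open (cdom c)" "open (cimg c)" "p \<in> cdom c \<Longrightarrow> cinv c (cmap c p) = p"
    "x \<in> cimg c \<Longrightarrow> cmap c (cinv c x) = x" "x \<in> cimg c \<Longrightarrow> cinv c x \<in> cdom c"
    "continuous_on (cdom c) (cmap c)" "continuous_on (cimg c) (cinv c)"
  using assms unfolding is_chart_def
  by (auto simp: homeomorphism_def f_inv_into_f inv_into_into)

locale atlas =
  fixes A :: "('a::{t2_space, second_countable_topology}, 'n::finite) chart set"
  assumes atlas: "oriented_smooth_atlas A"
begin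

abbreviation "\<tau> \<equiv> transition"
abbreviation "dtau c d x \<equiv> fd (transition c d) x"
abbreviation "TS \<equiv> tangent_space A"
abbreviation "tv \<equiv> tvec_of A"
abbreviation "vel \<equiv> velocity A"
definition overlap :: "('a, 'n) chart \<Rightarrow> ('a, 'n) chart \<Rightarrow> (real^'n) set" where
  "overlap c d = cmap c ` (cdom c \<inter> cdom d)"

lemma chart: "c \<in> A \<Longrightarrow> is_chart c"
  using atlas by (simp add: oriented_smooth_atlas_def)

lemmas chartD = inv_into_chart[OF chart]

lemma chart_around: obtains c where "c \<in> A" "p \<in> cdom c"
  using atlas unfolding oriented_smooth_atlas_def by blast

lemma overlap_iff:
  assumes "c \<in> A" shows "x \<in> overlap c d \<longleftrightarrow> x \<in> cimg c \<and> cinv c x \<in> cdom d"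
  using chartD[OF assms] by (auto simp: overlap_def image_iff)

lemma overlapI: "p \<in> cdom c \<Longrightarrow> p \<in> cdom d \<Longrightarrow> cmap c p \<in> overlap c d"
  by (auto simp: overlap_def)

lemma open_overlap: assumes "c \<in> A" "d \<in> A" shows "open (overlap c d)"
proof -
  have "overlap c d = cimg c \<inter> cinv c -` cdom d" using overlap_iff[OF assms(1), of _ d] by blast
  then show ?thesis
    using chartD(2,7)[OF assms(1)] chartD(1)[OF assms(2)] by (metis continuous_on_open_vimage Int_commute)
qed

lemma transition_smooth: "c \<in> A \<Longrightarrow> d \<in> A \<Longrightarrow> smooth_on (overlap c d) (\<tau> c d)"
  using atlas by (simp add: oriented_smooth_atlas_def overlap_def)

lemma transition_cmap: "c \<in> A \<Longrightarrow> p \<in> cdom c \<Longrightarrow> \<tau> c d (cmap c p) = cmap d p"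
  by (simp add: transition_def chartD)

lemma transition_in: "c \<in> A \<Longrightarrow> d \<in> A \<Longrightarrow> x \<in> overlap c d \<Longrightarrow> \<tau> c d x \<in> overlap d c"
  by (auto simp: overlap_iff transition_def chartD)

lemma cinv_transition: "c \<in> A \<Longrightarrow> d \<in> A \<Longrightarrow> x \<in> overlap c d \<Longrightarrow> cinv d (\<tau> c d x) = cinv c x"
  by (auto simp: overlap_iff transition_def chartD)

lemma transition_inverse: "c \<in> A \<Longrightarrow> d \<in> A \<Longrightarrow> x \<in> overlap c d \<Longrightarrow> \<tau> d c (\<tau> c d x) = x"
  by (simp add: cinv_transition transition_def[of d c] overlap_iff chartD)

lemma transition_C1: "c \<in> A \<Longrightarrow> d \<in> A \<Longrightarrow> C1_on (overlap c d) (\<tau> c d)"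
  by (simp add: smooth_on_imp_C1_on transition_smooth)

lemma dtau_C1: "c \<in> A \<Longrightarrow> d \<in> A \<Longrightarrow> C1_on (overlap c d) (\<lambda>x. dtau c d x v)"
  by (simp add: smooth_on_imp_C1_on smooth_on_fd transition_smooth)

lemma ddtau_C1: "c \<in> A \<Longrightarrow> d \<in> A \<Longrightarrow> C1_on (overlap c d) (\<lambda>x. fd (\<lambda>x. dtau c d x v) x w)"
  by (simp add: smooth_on_imp_C1_on smooth_on_fd transition_smooth)

lemma has_derivative_transition:
  "c \<in> A \<Longrightarrow> d \<in> A \<Longrightarrow> x \<in> overlap c d \<Longrightarrow> (\<tau> c d has_derivative dtau c d x) (at x)"
  using transition_C1 C1_onD(2) by blast

lemma linear_dtau: "c \<in> A \<Longrightarrow> d \<in> A \<Longrightarrow> x \<in> overlap c d \<Longrightarrow> linear (dtau c d x)"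
  using has_derivative_transition has_derivative_linear by blast

lemma transition_deriv_eq: "transition_deriv c d p = dtau c d (cmap c p)"
  by (simp add: transition_deriv_def)

text \<open>Chain rule. The composed and the direct transition agree on all of
  \<open>overlap c d\<close>, as both evaluate \<open>cmap e\<close> at the same point of the
  manifold.\<close>

lemma dtau_cocycle:
  assumes "c \<in> A" "d \<in> A" "e \<in> A" "p \<in> cdom c" "p \<in> cdom d" "p \<in> cdom e"
  shows "dtau d e (cmap d p) (dtau c d (cmap c p) v) = dtau c e (cmap c p) v"
proof -
  let ?x = "cmap c p"
  have x: "?x \<in> overlap c d" "?x \<in> overlap c e" "\<tau> c d ?x = cmap d p" "cmap d p \<in> overlap d e"
    using assms by (auto simp: transition_cmap intro: overlapI)
  have "((\<lambda>x. \<tau> d e (\<tau> c d x)) has_derivative (\<lambda>v. dtau d e (cmap d p) (dtau c d ?x v))) (at ?x)"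
    using has_derivative_compose[OF has_derivative_transition[of c d ?x] has_derivative_transition[of d e "\<tau> c d ?x"]] assms x
    by simp
  then have "(\<tau> c e has_derivative (\<lambda>v. dtau d e (cmap d p) (dtau c d ?x v))) (at ?x)"
    by (rule has_derivative_transform_within_open[where s="overlap c d"])
       (use assms x in \<open>auto simp: open_overlap cinv_transition transition_def[of d e] transition_def[of c e]\<close>)
  then show ?thesis using fd_eqI by metis
qed

lemma dtau_id:
  assumes "c \<in> A" "x \<in> cimg c" shows "dtau c c x = (\<lambda>v. v)"
proof (rule fd_eqI, rule has_derivative_transform_within_open[OF has_derivative_ident])
  show "open (cimg c)" "x \<in> cimg c" using assms by (auto simp: chartD)
  show "y = \<tau> c c y" if "y \<in> cimg c" for y using that assms by (simp add: transition_def chartD)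
qed

lemma dtau_inverse:
  assumes "c \<in> A" "d \<in> A" "p \<in> cdom c" "p \<in> cdom d"
  shows "dtau d c (cmap d p) (dtau c d (cmap c p) v) = v"
  using dtau_cocycle[OF assms(1,2,1,3,4,3)] dtau_id[OF assms(1)] assms(3) by simp

lemma tangent_change:
  "v \<in> TS p \<Longrightarrow> c \<in> A \<Longrightarrow> d \<in> A \<Longrightarrow> p \<in> cdom c \<Longrightarrow> p \<in> cdom d \<Longrightarrow> v d = dtau c d (cmap c p) (v c)"
  unfolding tangent_space_def transition_deriv_eq by blast

lemma tangent_outside: "v \<in> TS p \<Longrightarrow> \<not> (c \<in> A \<and> p \<in> cdom c) \<Longrightarrow> v c = 0"
  unfolding tangent_space_def by blast

lemma tvec_of_apply: "d \<in> A \<Longrightarrow> p \<in> cdom d \<Longrightarrow> tv c p y d = dtau c d (cmap c p) y"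
  by (simp add: tvec_of_def transition_deriv_eq)

lemma tvec_of_self [simp]: "c \<in> A \<Longrightarrow> p \<in> cdom c \<Longrightarrow> tv c p y c = y"
  by (simp add: tvec_of_apply dtau_id)

lemma tvec_of_tangent [simp]:
  "c \<in> A \<Longrightarrow> p \<in> cdom c \<Longrightarrow> tv c p y \<in> TS p"
  unfolding tangent_space_def by (auto simp: tvec_of_def transition_deriv_eq dtau_cocycle)

lemma tvec_of_comp: "v \<in> TS p \<Longrightarrow> c \<in> A \<Longrightarrow> p \<in> cdom c \<Longrightarrow> tv c p (v c) = v"
  unfolding tvec_of_def transition_deriv_eq fun_eq_iff
  using tangent_change tangent_outside by metis

lemma tangent_eqI:
  "u \<in> TS p \<Longrightarrow> v \<in> TS p \<Longrightarrow> c \<in> A \<Longrightarrow> p \<in> cdom c \<Longrightarrow> u c = v c \<Longrightarrow> u = v"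
  using tvec_of_comp by metis

lemma tvec_of_change:
  assumes "c \<in> A" "d \<in> A" "p \<in> cdom c" "p \<in> cdom d"
  shows "tv c p y = tv d p (dtau c d (cmap c p) y)"
  using tvec_of_comp[of "tv c p y" p d] assms by (simp add: tvec_of_apply)

lemma zero_tangent [simp]: "(\<lambda>_. 0) \<in> TS p"
  unfolding tangent_space_def transition_deriv_eq
  using linear_0[OF linear_dtau] overlapI by fastforce

lemma lincomb2_tangent [simp]:
  assumes "u \<in> TS p" "v \<in> TS p" shows "lincomb2 a u b v \<in> TS p"
proof -
  obtain c where c: "c \<in> A" "p \<in> cdom c" by (rule chart_around)
  have "lincomb2 a u b v = tv c p (a *\<^sub>R u c + b *\<^sub>R v c)"
  proof (rule ext)
    fix d
    show "lincomb2 a u b v d = tv c p (a *\<^sub>R u c + b *\<^sub>R v c) d"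
    proof (cases "d \<in> A \<and> p \<in> cdom d")
      case True
      note lin = linear_dtau[of c d "cmap c p"]
      show ?thesis using True assms c lin
        by (simp add: lincomb2_def tvec_of_apply tangent_change[of _ p c d] linear_add linear_cmul overlapI)
    next
      case False
      then show ?thesis using tangent_outside[OF assms(1), of d] tangent_outside[OF assms(2), of d]
        by (auto simp: lincomb2_def tvec_of_def)
    qed
  qed
  then show ?thesis using c by simp
qed

lemma tvec_of_lincomb:
  assumes "c \<in> A" "p \<in> cdom c"
  shows "tv c p (a *\<^sub>R x + b *\<^sub>R y) = lincomb2 a (tv c p x) b (tv c p y)"
  by (rule tangent_eqI[OF tvec_of_tangent[OF assms] lincomb2_tangent[OF tvec_of_tangent[OF assms] tvec_of_tangent[OF assms]] assms])
     (use assms in \<open>simp add: lincomb2_def\<close>)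

end

section \<open>Metric, Levi-Civita connection and curvature as multilinear maps in a chart\<close>

locale riem = atlas A for A :: "('a::{t2_space, second_countable_topology}, 'n::finite) chart set" +
  fixes g :: "('a, 'n) metric"
  assumes metric: "riemannian_metric A g"
begin

abbreviation "fr \<equiv> frame A g"
abbreviation "ff \<equiv> from_frame A g"
abbreviation "curv \<equiv> curvature A g"
abbreviation "covd \<equiv> covariant_derivative A g"
abbreviation "geod \<equiv> geodesic A g"
abbreviation "ugeod \<equiv> unit_speed_geodesic A g"
definition G :: "('a, 'n) chart \<Rightarrow> real^'n \<Rightarrow> real^'n^'n" where "G c x = gram A g c x"
definition ip :: "('a, 'n) chart \<Rightarrow> real^'n \<Rightarrow> real^'n \<Rightarrow> real^'n \<Rightarrow> real" where
  "ip c x u v = u \<bullet> (gram A g c x *v v)"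
definition dip where "dip c x w u v = fd (\<lambda>x. ip c x u v) x w"
definition Gam :: "('a, 'n) chart \<Rightarrow> real^'n \<Rightarrow> real^'n \<Rightarrow> real^'n \<Rightarrow> real^'n" where
  "Gam c x u v = (\<chi> k. \<Sum>i\<in>UNIV. \<Sum>j\<in>UNIV. christoffel A g c k i j x * u $ i * v $ j)"
definition dGam where "dGam c x w u v = fd (\<lambda>x. Gam c x u v) x w"
text \<open>R(u,v)w for fields with constant components, whose bracket vanishes. With the
  Christoffel symbols as the bilinear map \<open>Gam\<close> instead of an array, the curvature
  identities become algebra of multilinear maps.\<close>

definition Rm where
  "Rm c x u v w = dGam c x u v w - dGam c x v u w + Gam c x u (Gam c x v w) - Gam c x v (Gam c x u w)"

lemma g_sym: "u \<in> TS p \<Longrightarrow> v \<in> TS p \<Longrightarrow> g p u v = g p v u"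
  using metric unfolding riemannian_metric_def by blast

lemma g_pos: "v \<in> TS p \<Longrightarrow> v \<noteq> (\<lambda>_. 0) \<Longrightarrow> g p v v > 0"
  using metric unfolding riemannian_metric_def by blast

lemma g_lincomb:
  "u \<in> TS p \<Longrightarrow> v \<in> TS p \<Longrightarrow> w \<in> TS p \<Longrightarrow>
    g p (lincomb2 a u b w) v = a * g p u v + b * g p w v"
  using metric unfolding riemannian_metric_def by blast

lemma gram_smooth: "c \<in> A \<Longrightarrow> smooth_on (cimg c) (\<lambda>x. G c x $ i $ j)"
  using metric unfolding riemannian_metric_def G_def by blast

text \<open>Linearity on the right follows from linearity on the left by symmetry; expansion in
  coordinate vectors then produces the Gram matrix.\<close>

lemma g_tvec_of:
  assumes c: "c \<in> A" "p \<in> cdom c"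
  shows "g p (tv c p u) (tv c p v) = ip c (cmap c p) u v"
proof -
  let ?t = "tv c p"
  have 1: "linear (\<lambda>u. g p (?t u) w)" if "w \<in> TS p" for w
  proof (rule linearI)
    show "g p (?t (a + b)) w = g p (?t a) w + g p (?t b) w" for a b
      using tvec_of_lincomb[OF c, of 1 a 1 b] g_lincomb[of "?t a" p w "?t b" 1 1] that c by simp
    show "g p (?t (r *\<^sub>R a)) w = r *\<^sub>R g p (?t a) w" for r a
      using tvec_of_lincomb[OF c, of r a 0 a] g_lincomb[of "?t a" p w "?t a" r 0] that c by simp
  qed
  have "linear (\<lambda>v. g p (?t v) (?t u))" for u using 1 c by simp
  then have 2: "linear (\<lambda>v. g p (?t u) (?t v))" for u
    using g_sym[of "?t u" p] c by simp
  have "g p (?t u) (?t v) = (\<Sum>i\<in>UNIV. u $ i * (\<Sum>j\<in>UNIV. v $ j * g p (?t (axis i 1)) (?t (axis j 1))))"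
    using linear_axis_sum[OF 1, of "?t v" u] linear_axis_sum[OF 2, of _ v] c by simp
  also have "\<dots> = ip c (cmap c p) u v"
    using c by (simp add: ip_def inner_vec_def matrix_vector_mult_def gram_def chartD mult.commute)
  finally show ?thesis .
qed

lemma g_eq_ip:
  "c \<in> A \<Longrightarrow> p \<in> cdom c \<Longrightarrow> u \<in> TS p \<Longrightarrow> v \<in> TS p \<Longrightarrow> g p u v = ip c (cmap c p) (u c) (v c)"
  using g_tvec_of[of c p "u c" "v c"] by (simp add: tvec_of_comp)

lemma ip_linear: "linear (ip c x u)" "linear (\<lambda>u. ip c x u v)"
  by (auto intro!: linearI simp: ip_def matrix_vector_right_distrib matrix_vector_mult_scaleR inner_add_right inner_add_left)

lemmas ip_simps = linear_add[OF ip_linear(1)] linear_add[OF ip_linear(2)] linear_diff[OF ip_linear(1)]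
  linear_diff[OF ip_linear(2)] linear_cmul[OF ip_linear(1)] linear_cmul[OF ip_linear(2)]
  linear_0[OF ip_linear(1)] linear_0[OF ip_linear(2)] linear_neg[OF ip_linear(1)] linear_neg[OF ip_linear(2)]
  linear_sum[OF ip_linear(1)] linear_sum[OF ip_linear(2)]

lemma ip_sym: assumes "c \<in> A" "x \<in> cimg c" shows "ip c x u v = ip c x v u"
  using g_tvec_of[of c "cinv c x" u v] g_tvec_of[of c "cinv c x" v u] g_sym assms by (simp add: chartD)

lemma ip_pos: assumes "c \<in> A" "x \<in> cimg c" "v \<noteq> 0" shows "ip c x v v > 0"
proof -
  have p: "cinv c x \<in> cdom c" using assms by (simp add: chartD)
  have "tv c (cinv c x) v \<noteq> (\<lambda>_. 0)"
    using assms p tvec_of_self[of c "cinv c x" v] by metis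
  then show ?thesis
    using g_tvec_of[of c "cinv c x" v v] g_pos[of "tv c (cinv c x) v" "cinv c x"] assms p by (simp add: chartD)
qed

lemma ip_eqI: assumes "c \<in> A" "x \<in> cimg c" "\<And>w. ip c x u w = ip c x v w" shows "u = v"
  using ip_pos[OF assms(1,2), of "u - v"] assms(3)[of "u - v"] by (auto simp: ip_simps)

lemma ip_transition:
  assumes "c \<in> A" "d \<in> A" "x \<in> overlap c d"
  shows "ip c x u v = ip d (\<tau> c d x) (dtau c d x u) (dtau c d x v)"
proof -
  let ?p = "cinv c x"
  have p: "?p \<in> cdom c" "?p \<in> cdom d" "cmap c ?p = x" "cmap d ?p = \<tau> c d x"
    using assms by (auto simp: overlap_iff chartD transition_def)
  show ?thesis
    using g_tvec_of[of c ?p u v] g_tvec_of[of d ?p "dtau c d x u" "dtau c d x v"]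
      tvec_of_change[of c d ?p u] tvec_of_change[of c d ?p v] assms p by simp
qed

lemma det_G_nz: assumes "c \<in> A" "x \<in> cimg c" shows "det (G c x) \<noteq> 0"
proof -
  have "\<forall>v. G c x *v v = 0 \<longrightarrow> v = 0"
  proof (intro allI impI)
    fix v assume "G c x *v v = 0"
    then have "ip c x v v = 0" by (simp add: ip_def G_def)
    then show "v = 0" using ip_pos[OF assms, of v] by (cases "v = 0") auto
  qed
  then show ?thesis
    by (subst invertible_det_nz[symmetric], subst invertible_left_inverse, subst matrix_left_invertible_ker)
qed

lemma G_C1: "c \<in> A \<Longrightarrow> C1_on (cimg c) (\<lambda>x. G c x $ i $ j)"
  by (simp add: gram_smooth smooth_on_imp_C1_on)

lemma ip_expand: "ip c x u v = (\<Sum>i\<in>UNIV. \<Sum>j\<in>UNIV. u $ i * v $ j * G c x $ i $ j)"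
  by (simp add: ip_def G_def inner_vec_def matrix_vector_mult_def sum_distrib_left mult_ac)

lemma has_derivative_ip:
  assumes "c \<in> A" "x \<in> cimg c"
  shows "((\<lambda>x. ip c x u v) has_derivative (\<lambda>w. dip c x w u v)) (at x)"
    and "dip c x w u v = (\<Sum>i\<in>UNIV. \<Sum>j\<in>UNIV. u $ i * v $ j * fd (\<lambda>x. G c x $ i $ j) x w)"
proof -
  have *: "((\<lambda>x. ip c x u v) has_derivative (\<lambda>w. \<Sum>i\<in>UNIV. \<Sum>j\<in>UNIV. u $ i * v $ j * fd (\<lambda>x. G c x $ i $ j) x w)) (at x)"
    unfolding ip_expand
    by (intro has_derivative_sum has_derivative_mult_right C1_onD(2)[OF G_C1] assms)
  from fd_eqI[OF this] show eq: "dip c x w u v = (\<Sum>i\<in>UNIV. \<Sum>j\<in>UNIV. u $ i * v $ j * fd (\<lambda>x. G c x $ i $ j) x w)" for w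
    by (simp add: dip_def)
  show "((\<lambda>x. ip c x u v) has_derivative (\<lambda>w. dip c x w u v)) (at x)" using * by (simp add: eq)
qed

lemma ip_smooth2:
  assumes "c \<in> A"
  shows "C1_on (cimg c) (\<lambda>x. ip c x u v)" "C1_on (cimg c) (\<lambda>x. dip c x w u v)"
proof -
  show "C1_on (cimg c) (\<lambda>x. ip c x u v)"
    unfolding ip_expand by (intro C1_on_sum C1_on_mult C1_on_const G_C1 assms)
  have "C1_on (cimg c) (\<lambda>x. \<Sum>i\<in>UNIV. \<Sum>j\<in>UNIV. u $ i * v $ j * fd (\<lambda>x. G c x $ i $ j) x w)"
    by (intro C1_on_sum C1_on_mult C1_on_const smooth_on_imp_C1_on smooth_on_fd gram_smooth assms)
  then show "C1_on (cimg c) (\<lambda>x. dip c x w u v)"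
    by (rule C1_on_cong[rotated 2]) (auto simp: has_derivative_ip assms chartD)
qed

lemma dip_symmetric_second:
  assumes "c \<in> A" "x \<in> cimg c"
  shows "fd (\<lambda>x. dip c x w u v) x z = fd (\<lambda>x. dip c x z u v) x w"
  unfolding dip_def
  by (rule symmetric_second_derivative_real[of "cimg c"])
     (use assms C1_onD(1,3)[OF ip_smooth2(1)] C1_onD(1,3)[OF ip_smooth2(2)] in \<open>auto simp: chartD dip_def\<close>)

lemma dip_sym: assumes "c \<in> A" "x \<in> cimg c" shows "dip c x w u v = dip c x w v u"
proof -
  have "((\<lambda>x. ip c x u v) has_derivative (\<lambda>w. dip c x w v u)) (at x)"
    by (rule has_derivative_transform_within_open[OF has_derivative_ip(1)[OF assms], of "cimg c"])
      (use assms in \<open>auto simp: chartD intro: ip_sym\<close>)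
  then show ?thesis using has_derivative_ip(1)[OF assms] has_derivative_unique by (metis (no_types))
qed

lemma christoffel_C1: assumes c: "c \<in> A" shows "C1_on (cimg c) (christoffel A g c k i j)"
proof -
  have "C1_on (cimg c) (\<lambda>x. (1/2) * (\<Sum>l\<in>UNIV. matrix_inv (G c x) $ k $ l *
        (fd (\<lambda>y. G c y $ j $ l) x (axis i 1) + fd (\<lambda>y. G c y $ i $ l) x (axis j 1) - fd (\<lambda>y. G c y $ i $ j) x (axis l 1))))"
    by (intro C1_on_mult C1_on_sum C1_on_const C1_on_add C1_on_diff C1_on_matrix_inv smooth_on_imp_C1_on smooth_on_fd gram_smooth c)
       (use c in \<open>auto simp: chartD det_G_nz\<close>)
  then show ?thesis by (simp add: christoffel_def[abs_def] partial_deriv_def G_def)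
qed

lemma Gam_C1: "c \<in> A \<Longrightarrow> C1_on (cimg c) (\<lambda>x. Gam c x u v)"
  unfolding Gam_def by (intro C1_on_vec C1_on_sum C1_on_mult C1_on_const christoffel_C1)

lemma has_derivative_Gam:
  "c \<in> A \<Longrightarrow> x \<in> cimg c \<Longrightarrow> ((\<lambda>x. Gam c x u v) has_derivative (\<lambda>w. dGam c x w u v)) (at x)"
  unfolding dGam_def using C1_onD(2)[OF Gam_C1] by simp

lemma Gam_linear: "linear (Gam c x u)" "linear (\<lambda>u. Gam c x u v)"
  by (auto intro!: linearI simp: Gam_def vec_eq_iff sum.distrib[symmetric] sum_distrib_left algebra_simps)

lemmas Gam_simps = linear_add[OF Gam_linear(1)] linear_add[OF Gam_linear(2)] linear_diff[OF Gam_linear(1)]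
  linear_diff[OF Gam_linear(2)] linear_cmul[OF Gam_linear(1)] linear_cmul[OF Gam_linear(2)]
  linear_0[OF Gam_linear(1)] linear_0[OF Gam_linear(2)] linear_neg[OF Gam_linear(1)] linear_neg[OF Gam_linear(2)]

lemma dip_linear:
  assumes c: "c \<in> A" "x \<in> cimg c"
  shows "linear (\<lambda>w. dip c x w u v)" "linear (dip c x w u)" "linear (\<lambda>u. dip c x w u v)"
proof -
  show "linear (\<lambda>w. dip c x w u v)" using has_derivative_ip(1)[OF c] by (rule has_derivative_linear)
  show "linear (dip c x w u)" "linear (\<lambda>u. dip c x w u v)"
    by (auto intro!: linearI simp: has_derivative_ip(2)[OF c] sum.distrib[symmetric] sum_distrib_left algebra_simps)
qed

lemma trilinear_eqI:
  fixes f h :: "real^'m::finite \<Rightarrow> real^'k::finite \<Rightarrow> real^'l::finite \<Rightarrow> real"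
  assumes "\<And>u v. linear (\<lambda>w. f w u v)" "\<And>w v. linear (\<lambda>u. f w u v)" "\<And>w u. linear (f w u)"
    and "\<And>u v. linear (\<lambda>w. h w u v)" "\<And>w v. linear (\<lambda>u. h w u v)" "\<And>w u. linear (h w u)"
    and eq: "\<And>i j k. f (axis i 1) (axis j 1) (axis k 1) = h (axis i 1) (axis j 1) (axis k 1)"
  shows "f w u v = h w u v"
proof -
  have 1: "f (axis i 1) (axis j 1) v = h (axis i 1) (axis j 1) v" for i j
    by (subst linear_axis_sum[OF assms(3)], subst linear_axis_sum[OF assms(6)]) (simp add: eq)
  have 2: "f (axis i 1) u v = h (axis i 1) u v" for i
    by (subst linear_axis_sum[OF assms(2)], subst linear_axis_sum[OF assms(5)]) (simp add: 1)
  show ?thesis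
    by (subst linear_axis_sum[OF assms(1)], subst linear_axis_sum[OF assms(4)]) (simp add: 2)
qed

lemma Gam_axis: "Gam c x (axis i 1) (axis j 1) $ k = christoffel A g c k i j x"
proof -
  have "Gam c x (axis i 1) (axis j 1) $ k = (\<Sum>a\<in>UNIV. axis i 1 $ a * (\<Sum>b\<in>UNIV. axis j 1 $ b * christoffel A g c k a b x))"
    by (simp add: Gam_def sum_distrib_left mult_ac)
  then show ?thesis by (simp add: sum_axis)
qed

text \<open>On coordinate vectors this is the definition of \<open>christoffel\<close> multiplied by
  the Gram matrix; both sides are trilinear. All further properties of the connection are derived
  from it.\<close>

lemma koszul:
  assumes c: "c \<in> A" "x \<in> cimg c"
  shows "2 * ip c x (Gam c x w u) v = dip c x w u v + dip c x u w v - dip c x v w u"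
proof (rule trilinear_eqI[of "\<lambda>w u v. 2 * ip c x (Gam c x w u) v" "\<lambda>w u v. dip c x w u v + dip c x u w v - dip c x v w u"])
  fix i j l :: 'n
  have dax: "dip c x (axis i 1) (axis j 1) (axis k 1) = fd (\<lambda>y. G c y $ j $ k) x (axis i 1)" for i j k
    by (simp add: has_derivative_ip(2)[OF c] mult.assoc sum_distrib_left[symmetric] sum_axis)
  \<comment> \<open>The Christoffel symbols with the index lowered; the Gram matrix cancels the
    \<open>matrix_inv\<close> in \<open>christoffel\<close>.\<close>
  define q where "q = (\<chi> l. (1/2) * (dip c x (axis i 1) (axis j 1) (axis l 1) + dip c x (axis j 1) (axis i 1) (axis l 1) - dip c x (axis l 1) (axis i 1) (axis j 1)))"
  have "Gam c x (axis i 1) (axis j 1) = matrix_inv (G c x) *v q"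
    by (simp add: vec_eq_iff Gam_axis christoffel_def partial_deriv_def G_def[symmetric] dax q_def
        matrix_vector_mult_def sum_distrib_left mult.left_commute)
  then have "G c x *v Gam c x (axis i 1) (axis j 1) = q"
    by (simp add: matrix_vector_mul_assoc matrix_inv_mult(1)[OF det_G_nz[OF c]])
  then have "ip c x (Gam c x (axis i 1) (axis j 1)) (axis l 1) = q $ l"
    by (subst ip_sym[OF c]) (simp add: ip_def G_def inner_axis')
  then show "2 * ip c x (Gam c x (axis i 1) (axis j 1)) (axis l 1) =
     dip c x (axis i 1) (axis j 1) (axis l 1) + dip c x (axis j 1) (axis i 1) (axis l 1) - dip c x (axis l 1) (axis i 1) (axis j 1)"
    by (simp add: q_def)
qed (auto intro!: linearI simp: ip_simps Gam_simps linear_add[OF dip_linear(1)[OF c]] linear_add[OF dip_linear(2)[OF c]]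
   linear_add[OF dip_linear(3)[OF c]] linear_cmul[OF dip_linear(1)[OF c]] linear_cmul[OF dip_linear(2)[OF c]]
   linear_cmul[OF dip_linear(3)[OF c]] algebra_simps)

lemma Gam_sym: assumes c: "c \<in> A" "x \<in> cimg c" shows "Gam c x u v = Gam c x v u"
proof (rule ip_eqI[OF c])
  fix w show "ip c x (Gam c x u v) w = ip c x (Gam c x v u) w"
    using koszul[OF c, of u v w] koszul[OF c, of v u w] dip_sym[OF c, of w u v] by simp
qed

text \<open>Metric compatibility. In the sum of the Koszul formulas for \<open>w, u, v\<close> and
  \<open>w, v, u\<close> only twice the derivative in direction \<open>w\<close> is left.\<close>

lemma dip_compat:
  assumes c: "c \<in> A" "x \<in> cimg c"
  shows "dip c x w u v = ip c x (Gam c x w u) v + ip c x u (Gam c x w v)"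
proof -
  have "2 * (ip c x (Gam c x w u) v + ip c x u (Gam c x w v)) = 2 * ip c x (Gam c x w u) v + 2 * ip c x (Gam c x w v) u"
    using ip_sym[OF c, of u "Gam c x w v"] by simp
  also have "\<dots> = 2 * dip c x w u v"
    unfolding koszul[OF c] using dip_sym[OF c, of w u v] dip_sym[OF c, of u w v] dip_sym[OF c, of v w u] by simp
  finally show ?thesis by simp
qed

lemma dGam_linear:
  assumes c: "c \<in> A" "x \<in> cimg c"
  shows "linear (\<lambda>w. dGam c x w u v)" "linear (dGam c x w u)" "linear (\<lambda>u. dGam c x w u v)"
proof -
  note d = has_derivative_Gam[OF c]
  show "linear (\<lambda>w. dGam c x w u v)" using d by (rule has_derivative_linear)
  show "linear (dGam c x w u)"
    by (rule linear_derivative_family[OF _ d]) (auto intro!: linearI simp: Gam_simps)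
  show "linear (\<lambda>u. dGam c x w u v)"
    by (rule linear_derivative_family[of "\<lambda>x u. Gam c x u v", OF _ d]) (auto intro!: linearI simp: Gam_simps)
qed

lemma dGam_sym: assumes c: "c \<in> A" "x \<in> cimg c" shows "dGam c x w u v = dGam c x w v u"
proof -
  have "((\<lambda>x. Gam c x v u) has_derivative (\<lambda>w. dGam c x w u v)) (at x)"
    by (rule has_derivative_transform_within_open[OF has_derivative_Gam[OF c], of "cimg c"])
      (use c in \<open>auto simp: chartD intro: Gam_sym\<close>)
  then show ?thesis using has_derivative_Gam[OF c] has_derivative_unique by (metis (no_types))
qed

section \<open>Symmetries of the curvature tensor\<close>

lemma Rm_antisym: "Rm c x u v w = - Rm c x v u w"
  by (simp add: Rm_def)

lemma Rm_bianchi: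
  assumes c: "c \<in> A" "x \<in> cimg c"
  shows "Rm c x u v w + Rm c x v w u + Rm c x w u v = 0"
  using Gam_sym[OF c, of u v] Gam_sym[OF c, of u w] Gam_sym[OF c, of v w]
    dGam_sym[OF c, of u v w] dGam_sym[OF c, of v u w] dGam_sym[OF c, of w u v]
  by (simp add: Rm_def)

text \<open>Differentiating metric compatibility expresses the second derivatives of
  \<open>ip\<close> by \<open>Gam\<close> and \<open>dGam\<close>. Their symmetry in the two
  directions is the skew symmetry claimed.\<close>

lemma Rm_skew:
  assumes c: "c \<in> A" "x \<in> cimg c"
  shows "ip c x (Rm c x z w u) v = - ip c x u (Rm c x z w v)"
proof -
  have d2: "fd (\<lambda>x. dip c x w u v) x z =
      dip c x z (Gam c x w u) v + ip c x (dGam c x z w u) v + (dip c x z u (Gam c x w v) + ip c x u (dGam c x z w v))" for w u v z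
  proof -
    have "((\<lambda>x. ip c x (Gam c x w u) v + ip c x u (Gam c x w v)) has_derivative (\<lambda>z.
       (dip c x z (Gam c x w u) v + ip c x (dGam c x z w u) v + ip c x (Gam c x w u) 0)
      + (dip c x z u (Gam c x w v) + ip c x 0 (Gam c x w v) + ip c x u (dGam c x z w v)))) (at x)"
      by (intro has_derivative_add has_derivative_bilinear_family ip_linear has_derivative_ip(1)[OF c] has_derivative_Gam[OF c] has_derivative_const)
    then have "((\<lambda>x. dip c x w u v) has_derivative (\<lambda>z.
       (dip c x z (Gam c x w u) v + ip c x (dGam c x z w u) v + ip c x (Gam c x w u) 0)
      + (dip c x z u (Gam c x w v) + ip c x 0 (Gam c x w v) + ip c x u (dGam c x z w v)))) (at x)"
      by (rule has_derivative_transform_within_open[where s="cimg c"]) (use c in \<open>auto simp: chartD dip_compat\<close>)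
    from fd_eqI[OF this] show ?thesis by (simp add: ip_simps)
  qed
  show ?thesis
    using dip_symmetric_second[OF c, of w u v z] unfolding d2 dip_compat[OF c]
    by (simp add: Rm_def ip_simps)
qed

text \<open>The octahedron argument: the first Bianchi identity for four triples, together with both
  skew symmetries, is a linear system with this consequence.\<close>

lemma Rm_pair_sym:
  assumes c: "c \<in> A" "x \<in> cimg c"
  shows "ip c x (Rm c x u v w) z = ip c x (Rm c x w z u) v"
proof -
  define Q where "Q a b d e = ip c x (Rm c x a b d) e" for a b d e
  have 1: "Q a b d e = - Q b a d e" for a b d e
    unfolding Q_def by (subst Rm_antisym) (simp add: ip_simps)
  have 2: "Q a b d e = - Q a b e d" for a b d e
    unfolding Q_def using Rm_skew[OF c, of a b d e] ip_sym[OF c, of d "Rm c x a b e"] by simp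
  have 3: "Q a b d e + Q b d a e + Q d a b e = 0" for a b d e
    using arg_cong[OF Rm_bianchi[OF c, of a b d], of "\<lambda>r. ip c x r e"] by (simp add: Q_def ip_simps)
  have "Q u v w z = Q w z u v"
  proof -
    have "Q u v w z + Q v w u z + Q w u v z = 0" by (rule 3)
    moreover have "Q u v w z + Q u z v w + Q v z w u = 0"
      using 3[of u v z w] 2[of u v z w] 2[of v z u w] 1[of z u v w] by linarith
    moreover have "Q w u v z + Q w z u v + Q u z v w = 0"
      using 3[of u w z v] 1[of u w z v] 2[of w u z v] 1[of z u w v] 2[of u z w v] by linarith
    moreover have "Q v w u z + Q w z u v + Q v z w u = 0"
      using 3[of v w z u] 2[of v w z u] 2[of w z v u] 1[of z v w u] by linarith
    ultimately show ?thesis by linarith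
  qed
  then show ?thesis by (simp add: Q_def)
qed

text \<open>Self-adjointness of the Jacobi operator of \<open>b\<close>; it makes
  \<open>Kmat\<close> symmetric.\<close>

lemma Rm_swap: assumes c: "c \<in> A" "x \<in> cimg c" shows "ip c x (Rm c x a b b) w = ip c x (Rm c x w b b) a"
  using Rm_pair_sym[OF c, of a b b w] Rm_skew[OF c, of b w a b] Rm_antisym[of c x b w b]
    ip_sym[OF c, of a "Rm c x w b b"] by (simp add: ip_simps)

lemma Rm_linear:
  assumes c: "c \<in> A" "x \<in> cimg c"
  shows "linear (\<lambda>u. Rm c x u v w)" "linear (\<lambda>v. Rm c x u v w)" "linear (Rm c x u v)"
  unfolding Rm_def
  by (auto intro!: linearI simp: Gam_simps linear_add[OF dGam_linear(1)[OF c]] linear_add[OF dGam_linear(2)[OF c]]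
   linear_add[OF dGam_linear(3)[OF c]] linear_cmul[OF dGam_linear(1)[OF c]] linear_cmul[OF dGam_linear(2)[OF c]]
   linear_cmul[OF dGam_linear(3)[OF c]] algebra_simps)

text \<open>Both sides are trilinear, so coordinate vectors suffice. There \<open>dGam\<close>
  consists of the partial derivatives of the Christoffel symbols.\<close>

lemma curvature_eq_Rm:
  assumes c: "c \<in> A" "p \<in> cdom c"
  shows "curv p u v w c = Rm c (cmap c p) (u c) (v c) (w c)"
proof -
  let ?x = "cmap c p"
  have x: "?x \<in> cimg c" using c by simp
  note cx = c(1) x
  have dax: "dGam c ?x (axis i 1) (axis j 1) (axis k 1) $ l = partial_deriv i (christoffel A g c l j k) ?x" for i j k l
  proof -
    have "((\<lambda>x. Gam c x (axis j 1) (axis k 1) $ l) has_derivative (\<lambda>w. dGam c ?x w (axis j 1) (axis k 1) $ l)) (at ?x)"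
      by (rule bounded_linear.has_derivative[OF bounded_linear_vec_nth has_derivative_Gam[OF cx]])
    from fd_eqI[OF this] show ?thesis by (simp add: Gam_axis partial_deriv_def)
  qed
  have GG: "Gam c ?x (axis i 1) (Gam c ?x (axis j 1) (axis k 1)) $ l = (\<Sum>m\<in>UNIV. christoffel A g c l i m ?x * christoffel A g c m j k ?x)" for i j k l
  proof -
    have "Gam c ?x (axis i 1) (Gam c ?x (axis j 1) (axis k 1)) $ l = (\<Sum>a\<in>UNIV. axis i 1 $ a * (\<Sum>m\<in>UNIV. christoffel A g c l a m ?x * Gam c ?x (axis j 1) (axis k 1) $ m))"
      by (simp add: Gam_def sum_distrib_left mult_ac)
    then show ?thesis by (simp add: sum_axis Gam_axis)
  qed
  have Rax: "Rm c ?x (axis i 1) (axis j 1) (axis k 1) $ l =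
    partial_deriv i (christoffel A g c l j k) ?x - partial_deriv j (christoffel A g c l i k) ?x
      + (\<Sum>m\<in>UNIV. christoffel A g c l i m ?x * christoffel A g c m j k ?x - christoffel A g c l j m ?x * christoffel A g c m i k ?x)" for i j k l
    by (simp add: Rm_def dax GG sum_subtractf)
  show ?thesis
  proof (subst vec_eq_iff, rule allI)
    fix l
    have "Rm c ?x (u c) (v c) (w c) $ l = (\<Sum>i\<in>UNIV. u c $ i * (\<Sum>j\<in>UNIV. v c $ j * (\<Sum>k\<in>UNIV. w c $ k * Rm c ?x (axis i 1) (axis j 1) (axis k 1) $ l)))"
      by (subst linear_axis_sum[OF Rm_linear(1)[OF cx]], subst linear_axis_sum[OF Rm_linear(2)[OF cx]],
          subst linear_axis_sum[OF Rm_linear(3)[OF cx]]) simp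
    then show "curv p u v w c $ l = Rm c ?x (u c) (v c) (w c) $ l"
      using c by (simp add: curvature_def Let_def Rax sum_distrib_left mult_ac)
  qed
qed

section \<open>Transformation of connection and curvature under coordinate changes\<close>

lemma ddtau_sym:
  assumes "c \<in> A" "d \<in> A" "x \<in> overlap c d"
  shows "fd (\<lambda>x. dtau c d x u) x w = fd (\<lambda>x. dtau c d x w) x u"
  by (rule symmetric_second_derivative[OF open_overlap[OF assms(1,2)] assms(3)])
    (use assms C1_onD(1)[OF transition_C1] C1_onD(1)[OF dtau_C1] C1_onD(3)[OF dtau_C1] in auto)

text \<open>Differentiating \<open>ip_transition\<close> expresses \<open>dip\<close> in the chart
  \<open>c\<close> by \<open>dip\<close> in \<open>d\<close> and second derivatives \<open>H\<close>
  of the coordinate change. In the Koszul formula the symmetry of \<open>H\<close> leaves a single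
  such term.\<close>

lemma Gam_transition:
  assumes c: "c \<in> A" "d \<in> A" "x \<in> overlap c d"
  shows "dtau c d x (Gam c x w u) = Gam d (\<tau> c d x) (dtau c d x w) (dtau c d x u) + fd (\<lambda>x. dtau c d x u) x w"
proof -
  let ?T = "dtau c d x" and ?y = "\<tau> c d x"
  define H where "H w u = fd (\<lambda>x. dtau c d x u) x w" for w u
  have Hsym: "H w u = H u w" for w u unfolding H_def by (rule ddtau_sym[OF c])
  have dH: "((\<lambda>x. dtau c d x u) has_derivative (\<lambda>w. H w u)) (at x)" for u
    unfolding H_def using C1_onD(2)[OF dtau_C1[OF c(1,2)] c(3)] .
  have xc: "x \<in> cimg c" using c overlap_iff by blast
  have yd: "?y \<in> cimg d" using transition_in[OF c] overlap_iff[OF c(2)] by blast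
  have dip: "dip c x w u v = dip d ?y (?T w) (?T u) (?T v) + ip d ?y (H w u) (?T v) + ip d ?y (?T u) (H w v)" for w u v
  proof -
    let ?D = "\<lambda>w. dip d ?y (?T w) (?T u) (?T v) + ip d ?y (H w u) (?T v) + ip d ?y (?T u) (H w v)"
    have "((\<lambda>x. ip d (\<tau> c d x) u v) has_derivative (\<lambda>w. dip d ?y (?T w) u v)) (at x)" for u v
      by (rule has_derivative_compose[OF has_derivative_transition[OF c] has_derivative_ip(1)[OF c(2) yd]])
    then have "((\<lambda>x. ip d (\<tau> c d x) (dtau c d x u) (dtau c d x v)) has_derivative ?D) (at x)"
      by (intro has_derivative_bilinear_family ip_linear dH)
    then have "((\<lambda>x. ip c x u v) has_derivative ?D) (at x)"
      by (rule has_derivative_transform_within_open[where s="overlap c d"]) (use c in \<open>auto simp: open_overlap ip_transition\<close>)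
    from fd_eqI[OF this] show ?thesis by (simp add: dip_def)
  qed
  have surj: "\<exists>v. ?T v = z" for z
  proof
    have p: "cinv c x \<in> cdom c" "cinv c x \<in> cdom d" "cmap c (cinv c x) = x" using c by (auto simp: overlap_iff chartD)
    show "?T (dtau d c (cmap d (cinv c x)) z) = z" using dtau_inverse[OF c(2,1) p(2,1), of z] p(3) by simp
  qed
  show ?thesis unfolding H_def[symmetric]
  proof (rule ip_eqI[OF c(2) yd])
    fix z
    obtain v where v: "z = ?T v" using surj by metis
    have "2 * ip d ?y (?T (Gam c x w u)) (?T v) = 2 * ip c x (Gam c x w u) v"
      using ip_transition[OF c] by simp
    also have "\<dots> = dip c x w u v + dip c x u w v - dip c x v w u" by (rule koszul[OF c(1) xc])
    also have "\<dots> = 2 * ip d ?y (Gam d ?y (?T w) (?T u)) (?T v) + 2 * ip d ?y (H w u) (?T v)"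
      unfolding dip koszul[OF c(2) yd]
      using ip_sym[OF c(2) yd, of "?T u" "H w v"] ip_sym[OF c(2) yd, of "?T w" "H u v"]
        Hsym[of u w] Hsym[of v w] Hsym[of v u] by simp
    finally show "ip d ?y (?T (Gam c x w u)) z = ip d ?y (Gam d ?y (?T w) (?T u) + H w u) z"
      by (simp add: v ip_simps)
  qed
qed

text \<open>The law for \<open>Gam\<close> is differentiated once more. Third derivatives of the
  coordinate change are symmetric and cancel in the skew part, and so do the remaining terms with
  \<open>H\<close>.\<close>

lemma Rm_transition:
  assumes c: "c \<in> A" "d \<in> A" "x \<in> overlap c d"
  shows "dtau c d x (Rm c x u v w) = Rm d (\<tau> c d x) (dtau c d x u) (dtau c d x v) (dtau c d x w)"
proof -
  let ?T = "dtau c d x" and ?y = "\<tau> c d x"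
  have xc: "x \<in> cimg c" using c overlap_iff by blast
  have yd: "?y \<in> cimg d" using transition_in[OF c] overlap_iff[OF c(2)] by blast
  define H where "H w u = fd (\<lambda>x. dtau c d x u) x w" for w u
  define H3 where "H3 u w z = fd (\<lambda>x. fd (\<lambda>x. dtau c d x z) x w) x u" for u w z
  have dH: "((\<lambda>x. dtau c d x u) has_derivative (\<lambda>w. H w u)) (at x)" for u
    unfolding H_def using C1_onD(2)[OF dtau_C1[OF c(1,2)] c(3)] .
  have H3sym: "H3 u w z = H3 w u z" for u w z
    unfolding H3_def by (rule symmetric_second_derivative[OF open_overlap[OF c(1,2)] c(3)])
      (use c C1_onD(1)[OF dtau_C1] C1_onD(1)[OF ddtau_C1] C1_onD(3)[OF ddtau_C1] in auto)
  note lin = linear_dtau[OF c]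
  \<comment> \<open>Both sides of \<open>Gam_transition\<close> are differentiated in the direction
    \<open>u\<close>; uniqueness of the derivative equates the results.\<close>
  have key: "H u (Gam c x w z) + ?T (dGam c x u w z) =
     dGam d ?y (?T u) (?T w) (?T z) + Gam d ?y (H u w) (?T z) + Gam d ?y (?T w) (H u z) + H3 u w z" for u w z
  proof -
    let ?D = "\<lambda>u. (dGam d ?y (?T u) (?T w) (?T z) + Gam d ?y (H u w) (?T z) + Gam d ?y (?T w) (H u z)) + H3 u w z"
    have L: "((\<lambda>x. dtau c d x (Gam c x w z)) has_derivative (\<lambda>u. H u (Gam c x w z) + ?T (dGam c x u w z))) (at x)"
      by (rule has_derivative_linear_family[OF open_overlap[OF c(1,2)] c(3) linear_dtau[OF c(1,2)] dH has_derivative_Gam[OF c(1) xc]])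
    have "((\<lambda>x. Gam d (\<tau> c d x) u v) has_derivative (\<lambda>w. dGam d ?y (?T w) u v)) (at x)" for u v
      by (rule has_derivative_compose[OF has_derivative_transition[OF c] has_derivative_Gam[OF c(2) yd]])
    moreover have "((\<lambda>x. fd (\<lambda>x. dtau c d x z) x w) has_derivative (\<lambda>u. H3 u w z)) (at x)"
      unfolding H3_def by (rule C1_onD(2)[OF ddtau_C1[OF c(1,2)] c(3)])
    ultimately have "((\<lambda>x. Gam d (\<tau> c d x) (dtau c d x w) (dtau c d x z) + fd (\<lambda>x. dtau c d x z) x w) has_derivative ?D) (at x)"
      by (intro has_derivative_add has_derivative_bilinear_family Gam_linear dH)
    then have "((\<lambda>x. dtau c d x (Gam c x w z)) has_derivative ?D) (at x)"
      by (rule has_derivative_transform_within_open[where s="overlap c d"]) (use c in \<open>auto simp: open_overlap Gam_transition\<close>)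
    from has_derivative_unique[OF L this] show ?thesis by metis
  qed
  have Hsym: "H w u = H u w" for w u unfolding H_def by (rule ddtau_sym[OF c])
  have T: "?T (Gam c x w u) = Gam d ?y (?T w) (?T u) + H w u" for w u
    unfolding H_def by (rule Gam_transition[OF c])
  have dT: "?T (dGam c x u w z) =
     dGam d ?y (?T u) (?T w) (?T z) + Gam d ?y (H u w) (?T z) + Gam d ?y (?T w) (H u z) + H3 u w z - H u (Gam c x w z)" for u w z
    using key[of u w z] by (simp add: algebra_simps)
  show ?thesis
    unfolding Rm_def linear_add[OF lin] linear_diff[OF lin] dT T Gam_simps
    using H3sym[of u v w] Hsym[of u v] by simp
qed

lemma curvature_tangent [simp]:
  assumes "u \<in> TS p" "v \<in> TS p" "w \<in> TS p"
  shows "curv p u v w \<in> TS p"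
  unfolding tangent_space_def transition_deriv_eq
proof (intro CollectI conjI ballI impI allI)
  fix c d assume c: "c \<in> A" "d \<in> A" and p: "p \<in> cdom c \<and> p \<in> cdom d"
  then show "curv p u v w d = dtau c d (cmap c p) (curv p u v w c)"
    using Rm_transition[OF c overlapI[of p c d]] assms
    by (simp add: curvature_eq_Rm transition_cmap tangent_change[of _ p c d])
next
  fix c assume "\<not> (c \<in> A \<and> p \<in> cdom c)"
  then show "curv p u v w c = 0" by (auto simp: curvature_def)
qed

lemma g_curvature:
  assumes "c \<in> A" "p \<in> cdom c" "u \<in> TS p" "v \<in> TS p" "w \<in> TS p" "z \<in> TS p"
  shows "g p (curv p u v w) z = ip c (cmap c p) (Rm c (cmap c p) (u c) (v c) (w c)) (z c)"
  using assms by (simp add: g_eq_ip[of c] curvature_eq_Rm)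
end

section \<open>Frames and covariant derivatives\<close>

lemma matrix_mult_linear:
  fixes f :: "real^'n::finite \<Rightarrow> real^'m::finite"
  assumes "linear f" shows "matrix f *v x = f x"
  by (subst linear_axis_sum[OF assms, of x]) (simp add: vec_eq_iff matrix_def matrix_vector_mult_def mult.commute)

context atlas
begin

lemma tangent_sum:
  assumes "\<And>i. i \<in> I \<Longrightarrow> e i \<in> TS p"
  shows "(\<lambda>c. \<Sum>i\<in>I. a i *\<^sub>R e i c) \<in> TS p"
  using assms
proof (induction I rule: infinite_finite_induct)
  case (insert i I)
  have "lincomb2 (a i) (e i) 1 (\<lambda>c. \<Sum>i\<in>I. a i *\<^sub>R e i c) \<in> TS p"
    using insert by (intro lincomb2_tangent) auto
  then show ?case using insert by (simp add: lincomb2_def)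
qed auto

end

context riem
begin

lemma g_linear_left:
  assumes v: "v \<in> TS p" and e: "\<And>i. i \<in> I \<Longrightarrow> e i \<in> TS p"
  shows "g p (\<lambda>c. \<Sum>i\<in>I. a i *\<^sub>R e i c) v = (\<Sum>i\<in>I. a i * g p (e i) v)"
proof -
  obtain c where c: "c \<in> A" "p \<in> cdom c" by (rule chart_around)
  show ?thesis using c v e tangent_sum[of I e p a]
    by (simp add: g_eq_ip[of c] ip_simps)
qed

lemma g_zero [simp]: "v \<in> TS p \<Longrightarrow> g p (\<lambda>_. 0) v = 0" "v \<in> TS p \<Longrightarrow> g p v (\<lambda>_. 0) = 0"
  using g_linear_left[of v p "{}"] g_sym[of v p "\<lambda>_. 0"] by auto

text \<open>Gram-Schmidt by induction over finite sets of indices: fewer than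
  \<open>CARD('n)\<close> vectors do not span, so a vector outside the span exists and can be made
  orthogonal to the earlier ones.\<close>

lemma orthonormal_matrix_exists:
  assumes c: "c \<in> A" "x \<in> cimg c"
  shows "\<exists>e :: 'n \<Rightarrow> real^'n. \<forall>i j. ip c x (e i) (e j) = (if i = j then 1 else 0)"
proof -
  have "\<exists>e :: 'n \<Rightarrow> real^'n. \<forall>i\<in>S. \<forall>j\<in>S. ip c x (e i) (e j) = (if i = j then 1 else 0)" if "finite S" for S :: "'n set"
    using that
  proof (induction S rule: finite_induct)
    case (insert a S)
    then obtain e where e: "\<And>i j. i \<in> S \<Longrightarrow> j \<in> S \<Longrightarrow> ip c x (e i) (e j) = (if i = j then 1 else 0)" by blast
    have "dim (e ` S) \<le> card (e ` S)" by (rule dim_le_card') (use insert in simp)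
    also have "\<dots> \<le> card S" using insert by (intro card_image_le)
    also have "\<dots> < CARD('n)" using insert by (intro psubset_card_mono) auto
    finally have "span (e ` S) \<noteq> UNIV" by (metis DIM_cart DIM_real dim_UNIV dim_span mult.right_neutral less_irrefl)
    then obtain v where v: "v \<notin> span (e ` S)" by blast
    define w where "w = v - (\<Sum>j\<in>S. ip c x v (e j) *\<^sub>R e j)"
    have "(\<Sum>j\<in>S. ip c x v (e j) *\<^sub>R e j) \<in> span (e ` S)"
      by (intro span_sum span_scale span_base) auto
    then have w0: "w \<noteq> 0" using v by (auto simp: w_def)
    have we: "ip c x w (e i) = 0" if "i \<in> S" for i
    proof -
      have "(\<Sum>j\<in>S. ip c x v (e j) * ip c x (e j) (e i)) = (\<Sum>j\<in>S. if j = i then ip c x v (e i) else 0)"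
        by (rule sum.cong) (use e that in auto)
      then show ?thesis using that insert by (simp add: w_def ip_simps)
    qed
    have pos: "ip c x w w > 0" by (rule ip_pos[OF c w0])
    define u where "u = (1 / sqrt (ip c x w w)) *\<^sub>R w"
    have uu: "ip c x u u = 1" using pos by (simp add: u_def ip_simps)
    have ue: "ip c x u (e i) = 0" "ip c x (e i) u = 0" if "i \<in> S" for i
      using we[OF that] ip_sym[OF c, of "e i" w] by (auto simp: u_def ip_simps)
    show ?case
      using e uu ue insert by (intro exI[of _ "e(a := u)"]) auto
  qed auto
  from this[of UNIV] show ?thesis by simp
qed

lemma orthonormal_frame_exists: "\<exists>e. orthonormal_frame A g p e"
proof -
  obtain c where c: "c \<in> A" "p \<in> cdom c" by (rule chart_around)
  obtain e :: "'n \<Rightarrow> real^'n" where e: "\<And>i j. ip c (cmap c p) (e i) (e j) = (if i = j then 1 else 0)"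
    using orthonormal_matrix_exists[of c "cmap c p"] c by auto
  then have "orthonormal_frame A g p (\<lambda>i. tv c p (e i))"
    using c by (simp add: orthonormal_frame_def g_tvec_of)
  then show ?thesis by blast
qed

lemma frame_orthonormal: "orthonormal_frame A g p (fr p)"
  unfolding frame_def using orthonormal_frame_exists by (rule someI_ex)

lemma orthonormal_frameD:
  assumes "orthonormal_frame A g p e"
  shows "e i \<in> TS p" "g p (e i) (e j) = (if i = j then 1 else 0)"
  using assms by (auto simp: orthonormal_frame_def)

definition fmat :: "('n \<Rightarrow> ('a, 'n) tvec) \<Rightarrow> ('a, 'n) chart \<Rightarrow> real^'n^'n" where
  "fmat e c = (\<chi> a i. e i c $ a)"

lemma fmat_mult: "fmat e c *v x = (\<Sum>i\<in>UNIV. x $ i *\<^sub>R e i c)"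
  by (simp add: fmat_def vec_eq_iff matrix_vector_mult_def mult.commute)

lemma fmat_transpose: "(transpose (fmat e c) *v z) $ i = e i c \<bullet> z"
  by (simp add: matrix_vector_mult_def inner_vec_def transpose_def fmat_def del: transpose_matrix_vector)

lemma fmat_orthonormal:
  assumes e: "orthonormal_frame A g p e" and c: "c \<in> A" "p \<in> cdom c"
  shows "transpose (fmat e c) ** G c (cmap c p) ** fmat e c = mat 1"
    "fmat e c ** (transpose (fmat e c) ** G c (cmap c p)) = mat 1" "det (fmat e c) \<noteq> 0"
proof -
  let ?B = "fmat e c" and ?G = "G c (cmap c p)"
  have "(transpose ?B ** ?G ** ?B) $ i $ j = ip c (cmap c p) (e i c) (e j c)" for i j
    unfolding matrix_mul_assoc[symmetric]
    by (simp add: ip_def G_def matrix_matrix_mult_def matrix_vector_mult_def inner_vec_def transpose_def fmat_def)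
  also have "\<dots> i j = (if i = j then 1 else 0)" for i j
    using orthonormal_frameD[OF e] g_eq_ip[OF c] by metis
  finally show 1: "transpose ?B ** ?G ** ?B = mat 1" by (simp add: vec_eq_iff mat_def)
  then show "?B ** (transpose ?B ** ?G) = mat 1" using matrix_left_right_inverse by blast
  then show "det ?B \<noteq> 0"
    by (metis det_I det_mul mult_zero_left zero_neq_one)
qed

lemma frame_expansion:
  assumes e: "orthonormal_frame A g p e" and v: "v \<in> TS p"
  shows "v = (\<lambda>c. \<Sum>i\<in>UNIV. g p v (e i) *\<^sub>R e i c)"
proof -
  obtain c where c: "c \<in> A" "p \<in> cdom c" by (rule chart_around)
  let ?B = "fmat e c" and ?G = "G c (cmap c p)"
  have "(transpose ?B *v (?G *v v c)) $ i = g p v (e i)" for i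
    unfolding fmat_transpose
    using g_eq_ip[OF c orthonormal_frameD(1)[OF e] v, of i] g_sym[OF v orthonormal_frameD(1)[OF e], of i]
    by (simp only: ip_def G_def)
  then have y: "transpose ?B *v (?G *v v c) = (\<chi> i. g p v (e i))" by (simp add: vec_eq_iff)
  have "v c = ?B *v (transpose ?B *v (?G *v v c))"
    using fmat_orthonormal(2)[OF e c] by (simp only: matrix_vector_mul_assoc matrix_mul_assoc) simp
  then have vc: "v c = (\<Sum>i\<in>UNIV. g p v (e i) *\<^sub>R e i c)" by (simp only: y fmat_mult vec_lambda_beta)
  have "(\<lambda>c. \<Sum>i\<in>UNIV. g p v (e i) *\<^sub>R e i c) \<in> TS p"
    by (rule tangent_sum) (rule orthonormal_frameD(1)[OF e])
  from tangent_eqI[OF v this c vc] show ?thesis .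
qed

lemma frame_inner:
  assumes e: "orthonormal_frame A g p e"
  shows "g p (\<lambda>c. \<Sum>i\<in>UNIV. a i *\<^sub>R e i c) (e j) = a j"
  using g_linear_left[of "e j" p UNIV e a] orthonormal_frameD[OF e] by (simp add: if_distrib cong: if_cong)

text \<open>If \<open>B\<close> holds the frame as columns, the sum is the trace of B^T G M B, and B
  B^T G is the identity. This shows independence of the choice made in \<open>frame\<close>.\<close>

lemma frame_trace:
  assumes e: "orthonormal_frame A g p e" and c: "c \<in> A" "p \<in> cdom c"
    and T: "\<And>v. v \<in> TS p \<Longrightarrow> F v \<in> TS p" "\<And>v. v \<in> TS p \<Longrightarrow> F v c = M *v v c"
  shows "(\<Sum>i\<in>UNIV. g p (F (e i)) (e i)) = trace M"
proof -
  let ?B = "fmat e c" and ?G = "G c (cmap c p)"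
  have "g p (F (e i)) (e i) = (transpose ?B ** ?G ** (M ** ?B)) $ i $ i" for i
  proof -
    note ei = orthonormal_frameD(1)[OF e]
    have "g p (F (e i)) (e i) = ip c (cmap c p) (e i c) (M *v e i c)"
      using g_sym[OF T(1)[OF ei] ei, of i] g_eq_ip[OF c ei T(1)[OF ei], of i] T(2)[OF ei] by metis
    then show ?thesis unfolding matrix_mul_assoc[symmetric]
      by (simp add: ip_def G_def matrix_matrix_mult_def matrix_vector_mult_def inner_vec_def transpose_def fmat_def)
  qed
  then have "(\<Sum>i\<in>UNIV. g p (F (e i)) (e i)) = trace ((transpose ?B ** ?G) ** (M ** ?B))"
    by (simp add: trace_def)
  also have "\<dots> = trace (M ** (?B ** (transpose ?B ** ?G)))"
    by (subst trace_mul_sym) (simp add: matrix_mul_assoc)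
  finally show ?thesis by (simp add: fmat_orthonormal(2)[OF e c])
qed

text \<open>Ricci curvature as a trace in coordinates. No frame enters, so continuity in position
  and velocity can be read off.\<close>

definition Ricm where "Ricm c x y = (\<Sum>i\<in>UNIV. Rm c x (axis i 1) y y $ i)"

lemma Rm_matrix:
  assumes "c \<in> A" "x \<in> cimg c"
  shows "Rm c x w y y = matrix (\<lambda>w. Rm c x w y y) *v w"
  using matrix_mult_linear[OF Rm_linear(1)[OF assms], of y y w] by simp

lemma ricci_frame:
  assumes e: "orthonormal_frame A g p e" and c: "c \<in> A" "p \<in> cdom c" and v: "v \<in> TS p"
  shows "(\<Sum>i\<in>UNIV. g p (curv p (e i) v v) (e i)) = Ricm c (cmap c p) (v c)"
proof -
  have x: "cmap c p \<in> cimg c" using c by simp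
  have "(\<Sum>i\<in>UNIV. g p (curv p (e i) v v) (e i)) = trace (matrix (\<lambda>w. Rm c (cmap c p) w (v c) (v c)))"
    using v by (intro frame_trace[OF e c]) (simp_all add: curvature_eq_Rm[OF c] Rm_matrix[OF c(1) x, symmetric])
  then show ?thesis by (simp add: trace_def matrix_def Ricm_def)
qed

lemma ricci_eq: "c \<in> A \<Longrightarrow> p \<in> cdom c \<Longrightarrow> v \<in> TS p \<Longrightarrow> ricci A g p v v = Ricm c (cmap c p) (v c)"
  unfolding ricci_def using ricci_frame[OF frame_orthonormal] .

lemma continuous_on_Gam:
  assumes c: "c \<in> A" and x: "continuous_on S x" "\<And>s. s \<in> S \<Longrightarrow> x s \<in> cimg c" and u: "continuous_on S u" and v: "continuous_on S v"
  shows "continuous_on S (\<lambda>s. Gam c (x s) (u s) (v s))"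
proof -
  have "x ` S \<subseteq> cimg c" using x(2) by auto
  note continuous_on_compose2[OF C1_onD(4)[OF christoffel_C1[OF c]] x(1) this]
  then show ?thesis unfolding Gam_def by (intro continuous_intros u v)
qed

lemma continuous_on_Rm:
  assumes c: "c \<in> A" and x: "continuous_on S x" "\<And>s. s \<in> S \<Longrightarrow> x s \<in> cimg c"
    and u: "continuous_on S u" and v: "continuous_on S v" and w: "continuous_on S w"
  shows "continuous_on S (\<lambda>s. Rm c (x s) (u s) (v s) (w s))"
proof -
  have 1: "continuous_on S (\<lambda>s. Rm c (x s) (axis i 1) (axis j 1) (axis k 1))" for i j k
  proof -
    have "continuous_on S (\<lambda>s. dGam c (x s) (axis i 1) (axis j 1) (axis k 1))" for i j k
      unfolding dGam_def using continuous_on_compose2[OF C1_onD(3)[OF Gam_C1[OF c]] x(1)] x(2) by blast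
    then show ?thesis unfolding Rm_def by (intro continuous_intros continuous_on_Gam c x)
  qed
  have "Rm c (x s) (u s) (v s) (w s) = (\<Sum>i\<in>UNIV. u s $ i *\<^sub>R (\<Sum>j\<in>UNIV. v s $ j *\<^sub>R (\<Sum>k\<in>UNIV. w s $ k *\<^sub>R Rm c (x s) (axis i 1) (axis j 1) (axis k 1))))"
    if "s \<in> S" for s
    by (subst linear_axis_sum[OF Rm_linear(1)[OF c x(2)[OF that]]], subst linear_axis_sum[OF Rm_linear(2)[OF c x(2)[OF that]]],
          subst linear_axis_sum[OF Rm_linear(3)[OF c x(2)[OF that]]]) simp
  then show ?thesis
    by (subst continuous_on_cong[OF refl]) (auto intro!: continuous_intros 1 u v w)
qed

lemma continuous_on_ip:
  assumes c: "c \<in> A" and x: "continuous_on S x" "\<And>s. s \<in> S \<Longrightarrow> x s \<in> cimg c"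
    and u: "continuous_on S u" and v: "continuous_on S v"
  shows "continuous_on S (\<lambda>s. ip c (x s) (u s) (v s))"
proof -
  have "x ` S \<subseteq> cimg c" using x(2) by auto
  note G = continuous_on_compose2[OF C1_onD(4)[OF G_C1[OF c]] x(1) this]
  have "continuous_on S (\<lambda>s. u s $ i)" "continuous_on S (\<lambda>s. v s $ i)" for i
    by (intro continuous_intros u v)+
  then show ?thesis unfolding ip_expand by (intro continuous_on_sum continuous_on_mult G)
qed

section \<open>Covariant derivatives along a geodesic\<close>

lemma geodesicD:
  assumes \<gamma>: "geod \<gamma>"
  shows "continuous_on UNIV \<gamma>" "vel \<gamma> t \<in> TS (\<gamma> t)"
    "c \<in> A \<Longrightarrow> \<gamma> t \<in> cdom c \<Longrightarrow> ((\<lambda>t. cmap c (\<gamma> t)) has_vector_derivative vel \<gamma> t c) (at t)"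
    "c \<in> A \<Longrightarrow> \<gamma> t \<in> cdom c \<Longrightarrow> ((\<lambda>t. vel \<gamma> t c) has_vector_derivative
       - Gam c (cmap c (\<gamma> t)) (vel \<gamma> t c) (vel \<gamma> t c)) (at t)"
proof -
  have d: "differentiable_curve A \<gamma>" "differentiable_field_along A \<gamma> (vel \<gamma>)"
    "covd \<gamma> (vel \<gamma>) t = (\<lambda>_. 0)"
    using \<gamma> by (auto simp: geodesic_def)
  show "continuous_on UNIV \<gamma>" using d(1) by (simp add: differentiable_curve_def)
  show "vel \<gamma> t \<in> TS (\<gamma> t)" using d(2) by (simp add: differentiable_field_along_def)
  show "((\<lambda>t. cmap c (\<gamma> t)) has_vector_derivative vel \<gamma> t c) (at t)" if "c \<in> A" "\<gamma> t \<in> cdom c"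
    using d(1) that unfolding differentiable_curve_def velocity_def
    by (simp add: vector_derivative_works[symmetric] o_def)
  show "((\<lambda>t. vel \<gamma> t c) has_vector_derivative
       - Gam c (cmap c (\<gamma> t)) (vel \<gamma> t c) (vel \<gamma> t c)) (at t)" if "c \<in> A" "\<gamma> t \<in> cdom c"
  proof -
    have "vector_derivative (\<lambda>s. vel \<gamma> s c) (at t) + Gam c (cmap c (\<gamma> t)) (vel \<gamma> t c) (vel \<gamma> t c) = 0"
      using fun_cong[OF d(3), of c] that by (simp add: covariant_derivative_def Gam_def)
    moreover have "((\<lambda>s. vel \<gamma> s c) has_vector_derivative vector_derivative (\<lambda>s. vel \<gamma> s c) (at t)) (at t)"
      using d(2) that unfolding differentiable_field_along_def by (simp add: vector_derivative_works[symmetric])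
    ultimately show ?thesis by (simp add: eq_neg_iff_add_eq_0[symmetric])
  qed
qed

text \<open>\<open>cov_at \<gamma> V W t\<close>: the covariant derivative of \<open>V\<close> along \<open>\<gamma>\<close> exists at \<open>t\<close> and equals \<open>W\<close>.\<close>

definition cov_at where
  "cov_at \<gamma> V W t \<longleftrightarrow> (\<exists>U. open U \<and> t \<in> U \<and> (\<forall>s\<in>U. V s \<in> TS (\<gamma> s))) \<and> W \<in> TS (\<gamma> t) \<and>
     (\<forall>c\<in>A. \<gamma> t \<in> cdom c \<longrightarrow>
        ((\<lambda>s. V s c) has_vector_derivative W c - Gam c (cmap c (\<gamma> t)) (vel \<gamma> t c) (V t c)) (at t))"

lemma cov_atD:
  assumes "cov_at \<gamma> V W t"
  shows "V t \<in> TS (\<gamma> t)" "W \<in> TS (\<gamma> t)"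
    "c \<in> A \<Longrightarrow> \<gamma> t \<in> cdom c \<Longrightarrow> ((\<lambda>s. V s c) has_vector_derivative W c - Gam c (cmap c (\<gamma> t)) (vel \<gamma> t c) (V t c)) (at t)"
  using assms by (auto simp: cov_at_def)

text \<open>One chart around the point is enough: differentiating the coordinate change along the
  geodesic creates a second derivative term, and \<open>Gam_transition\<close> absorbs exactly this
  term.\<close>

lemma cov_atI:
  assumes \<gamma>: "geod \<gamma>" and U: "open U" "t \<in> U" and V: "\<And>s. s \<in> U \<Longrightarrow> V s \<in> TS (\<gamma> s)"
    and c: "c \<in> A" "\<gamma> t \<in> cdom c" and W: "W \<in> TS (\<gamma> t)"
    and d: "((\<lambda>s. V s c) has_vector_derivative W c - Gam c (cmap c (\<gamma> t)) (vel \<gamma> t c) (V t c)) (at t)"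
  shows "cov_at \<gamma> V W t"
  unfolding cov_at_def
proof (intro conjI ballI impI)
  show "\<exists>U. open U \<and> t \<in> U \<and> (\<forall>s\<in>U. V s \<in> TS (\<gamma> s))" using U V by blast
  fix e assume e: "e \<in> A" "\<gamma> t \<in> cdom e"
  let ?S = "U \<inter> \<gamma> -` (cdom c \<inter> cdom e)" and ?x = "cmap c (\<gamma> t)" and ?v = "vel \<gamma> t c"
  let ?a = "W c - Gam c ?x ?v (V t c)"
  have S: "open ?S" "t \<in> ?S"
    using U c e chartD(1)[OF c(1)] chartD(1)[OF e(1)] geodesicD(1)[OF \<gamma>] by (auto intro!: open_Int open_vimage)
  have ov: "cmap c (\<gamma> s) \<in> overlap c e" if "s \<in> ?S" for s using that by (auto intro: overlapI)
  have 1: "((\<lambda>s. dtau c e (cmap c (\<gamma> s)) u) has_derivative (\<lambda>h. fd (\<lambda>x. dtau c e x u) ?x (h *\<^sub>R ?v))) (at t)" for u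
    by (rule has_derivative_compose[OF geodesicD(3)[OF \<gamma> c, unfolded has_vector_derivative_def]
         C1_onD(2)[OF dtau_C1[OF c(1) e(1)] ov[OF S(2)]]])
  have "((\<lambda>s. dtau c e (cmap c (\<gamma> s)) (V s c)) has_derivative
      (\<lambda>h. fd (\<lambda>x. dtau c e x (V t c)) ?x (h *\<^sub>R ?v) + dtau c e ?x (h *\<^sub>R ?a))) (at t)"
    by (rule has_derivative_linear_family[OF S linear_dtau[OF c(1) e(1) ov] 1 d[unfolded has_vector_derivative_def]])
  then have "((\<lambda>s. V s e) has_derivative
      (\<lambda>h. fd (\<lambda>x. dtau c e x (V t c)) ?x (h *\<^sub>R ?v) + dtau c e ?x (h *\<^sub>R ?a))) (at t)"
    by (rule has_derivative_transform_within_open[OF _ S]) (use V c e in \<open>auto intro!: tangent_change[symmetric]\<close>)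
  moreover have "fd (\<lambda>x. dtau c e x (V t c)) ?x (h *\<^sub>R ?v) + dtau c e ?x (h *\<^sub>R ?a) =
     h *\<^sub>R (W e - Gam e (cmap e (\<gamma> t)) (vel \<gamma> t e) (V t e))" for h
  proof -
    note x = ov[OF S(2)]
    have "dtau c e ?x ?a = W e - (Gam e (cmap e (\<gamma> t)) (vel \<gamma> t e) (V t e) + fd (\<lambda>x. dtau c e x (V t c)) ?x ?v)"
      using Gam_transition[OF c(1) e(1) x, of ?v "V t c"] tangent_change[OF W c(1) e(1) c(2) e(2)]
        tangent_change[OF V[OF U(2)] c(1) e(1) c(2) e(2)] tangent_change[OF geodesicD(2)[OF \<gamma>] c(1) e(1) c(2) e(2)]
      by (simp add: linear_diff[OF linear_dtau[OF c(1) e(1) x]] transition_cmap c)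
    then have "fd (\<lambda>x. dtau c e x (V t c)) ?x ?v + dtau c e ?x ?a = W e - Gam e (cmap e (\<gamma> t)) (vel \<gamma> t e) (V t e)"
      by simp
    then show ?thesis
      by (simp only: linear_cmul[OF linear_dtau[OF c(1) e(1) x]] scaleR_add_right[symmetric]
         linear_cmul[OF has_derivative_linear[OF C1_onD(2)[OF dtau_C1[OF c(1) e(1)] x]]])
  qed
  ultimately show "((\<lambda>s. V s e) has_vector_derivative W e - Gam e (cmap e (\<gamma> t)) (vel \<gamma> t e) (V t e)) (at t)"
    by (simp add: has_vector_derivative_def)
qed (rule W)

lemma cov_at_velocity:
  assumes \<gamma>: "geod \<gamma>" shows "cov_at \<gamma> (vel \<gamma>) (\<lambda>_. 0) t"
proof -
  obtain c where c: "c \<in> A" "\<gamma> t \<in> cdom c" by (rule chart_around)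
  show ?thesis
    by (rule cov_atI[OF \<gamma> open_UNIV _ _ c]) (use geodesicD[OF \<gamma>] c in auto)
qed

lemma cov_at_covd: assumes V: "cov_at \<gamma> V W t" shows "covd \<gamma> V t = W"
proof
  fix c
  show "covd \<gamma> V t c = W c"
  proof (cases "c \<in> A \<and> \<gamma> t \<in> cdom c")
    case True
    then have "vector_derivative (\<lambda>s. V s c) (at t) = W c - Gam c (cmap c (\<gamma> t)) (vel \<gamma> t c) (V t c)"
      using cov_atD(3)[OF V] vector_derivative_at by blast
    then show ?thesis using True by (simp add: covariant_derivative_def Gam_def)
  next
    case False
    then show ?thesis using tangent_outside[OF cov_atD(2)[OF V]] by (auto simp: covariant_derivative_def)
  qed
qed

lemma cov_at_all:
  assumes "\<And>t. cov_at \<gamma> V (W t) t"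
  shows "differentiable_field_along A \<gamma> V" "covd \<gamma> V = W"
  unfolding differentiable_field_along_def
  using cov_atD(1)[OF assms] cov_atD(3)[OF assms] cov_at_covd[OF assms]
  unfolding differentiable_def has_vector_derivative_def by blast+

lemma differentiable_field_cov_at:
  assumes \<gamma>: "geod \<gamma>" and V: "differentiable_field_along A \<gamma> V"
  shows "cov_at \<gamma> V (covd \<gamma> V t) t"
proof -
  obtain c where c: "c \<in> A" "\<gamma> t \<in> cdom c" by (rule chart_around)
  define a where "a = vector_derivative (\<lambda>s. V s c) (at t) + Gam c (cmap c (\<gamma> t)) (vel \<gamma> t c) (V t c)"
  have Vt: "V s \<in> TS (\<gamma> s)" for s using V by (simp add: differentiable_field_along_def)
  have "((\<lambda>s. V s c) has_vector_derivative vector_derivative (\<lambda>s. V s c) (at t)) (at t)"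
    using V c unfolding differentiable_field_along_def by (simp add: vector_derivative_works[symmetric])
  then have W: "cov_at \<gamma> V (tv c (\<gamma> t) a) t"
    using c Vt by (intro cov_atI[OF \<gamma> open_UNIV _ _ c]) (auto simp: a_def)
  then show ?thesis by (simp add: cov_at_covd[OF W])
qed

text \<open>The product rule for the metric along a geodesic; \<open>dip_compat\<close> cancels the
  Christoffel terms.\<close>

lemma cov_at_metric:
  assumes \<gamma>: "geod \<gamma>" and V: "cov_at \<gamma> V V' t" and W: "cov_at \<gamma> W W' t"
  shows "((\<lambda>s. g (\<gamma> s) (V s) (W s)) has_real_derivative (g (\<gamma> t) V' (W t) + g (\<gamma> t) (V t) W')) (at t)"
proof -
  obtain c where c: "c \<in> A" "\<gamma> t \<in> cdom c" by (rule chart_around)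
  obtain U1 where U1: "open U1" "t \<in> U1" "\<And>s. s \<in> U1 \<Longrightarrow> V s \<in> TS (\<gamma> s)" using V by (auto simp: cov_at_def)
  obtain U2 where U2: "open U2" "t \<in> U2" "\<And>s. s \<in> U2 \<Longrightarrow> W s \<in> TS (\<gamma> s)" using W by (auto simp: cov_at_def)
  let ?S = "U1 \<inter> U2 \<inter> \<gamma> -` cdom c" and ?x = "cmap c (\<gamma> t)" and ?v = "vel \<gamma> t c"
  let ?D = "\<lambda>h. dip c ?x (h *\<^sub>R ?v) (V t c) (W t c) + ip c ?x (h *\<^sub>R (V' c - Gam c ?x ?v (V t c))) (W t c)
      + ip c ?x (V t c) (h *\<^sub>R (W' c - Gam c ?x ?v (W t c)))"
  have S: "open ?S" "t \<in> ?S"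
    using U1 U2 c chartD(1)[OF c(1)] geodesicD(1)[OF \<gamma>] by (auto intro!: open_Int open_vimage)
  have x: "?x \<in> cimg c" using c by simp
  have "((\<lambda>s. ip c (cmap c (\<gamma> s)) u v) has_derivative (\<lambda>h. dip c ?x (h *\<^sub>R ?v) u v)) (at t)" for u v
    by (rule has_derivative_compose[OF geodesicD(3)[OF \<gamma> c, unfolded has_vector_derivative_def] has_derivative_ip(1)[OF c(1) x]])
  then have "((\<lambda>s. ip c (cmap c (\<gamma> s)) (V s c) (W s c)) has_derivative ?D) (at t)"
    by (intro has_derivative_bilinear_family ip_linear cov_atD(3)[OF V c, unfolded has_vector_derivative_def]
        cov_atD(3)[OF W c, unfolded has_vector_derivative_def])
  then have "((\<lambda>s. g (\<gamma> s) (V s) (W s)) has_derivative ?D) (at t)"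
    by (rule has_derivative_transform_within_open[OF _ S]) (use U1 U2 c in \<open>auto simp: g_eq_ip[of c]\<close>)
  moreover have "?D h = (g (\<gamma> t) V' (W t) + g (\<gamma> t) (V t) W') * h" for h
    using cov_atD(1,2)[OF V] cov_atD(1,2)[OF W] c
    by (simp add: dip_compat[OF c(1) x] g_eq_ip[OF c] Gam_simps ip_simps algebra_simps)
  ultimately show ?thesis by (simp add: has_field_derivative_def)
qed

lemma cov_at_lincomb:
  assumes \<gamma>: "geod \<gamma>" and E: "\<And>i. i \<in> I \<Longrightarrow> cov_at \<gamma> (E i) (E' i) t" and I: "finite I"
    and y: "\<And>i. i \<in> I \<Longrightarrow> (y i has_real_derivative y' i) (at t)"
  shows "cov_at \<gamma> (\<lambda>s c. \<Sum>i\<in>I. y i s *\<^sub>R E i s c) (\<lambda>c. (\<Sum>i\<in>I. y' i *\<^sub>R E i t c) + (\<Sum>i\<in>I. y i t *\<^sub>R E' i c)) t"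
proof -
  obtain c where c: "c \<in> A" "\<gamma> t \<in> cdom c" by (rule chart_around)
  have "\<forall>i\<in>I. \<exists>U. open U \<and> t \<in> U \<and> (\<forall>s\<in>U. E i s \<in> TS (\<gamma> s))" using E by (auto simp: cov_at_def)
  then obtain U where U: "\<And>i. i \<in> I \<Longrightarrow> open (U i) \<and> t \<in> U i \<and> (\<forall>s\<in>U i. E i s \<in> TS (\<gamma> s))" by metis
  show ?thesis
  proof (rule cov_atI[OF \<gamma> _ _ _ c])
    show "open (\<Inter>i\<in>I. U i)" "t \<in> (\<Inter>i\<in>I. U i)" using U I by auto
    show "(\<lambda>c. \<Sum>i\<in>I. y i s *\<^sub>R E i s c) \<in> TS (\<gamma> s)" if "s \<in> (\<Inter>i\<in>I. U i)" for s
      using that U by (intro tangent_sum) auto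
    have "lincomb2 1 (\<lambda>c. \<Sum>i\<in>I. y' i *\<^sub>R E i t c) 1 (\<lambda>c. \<Sum>i\<in>I. y i t *\<^sub>R E' i c) \<in> TS (\<gamma> t)"
      using cov_atD(1,2)[OF E] by (intro lincomb2_tangent tangent_sum) auto
    then show "(\<lambda>c. (\<Sum>i\<in>I. y' i *\<^sub>R E i t c) + (\<Sum>i\<in>I. y i t *\<^sub>R E' i c)) \<in> TS (\<gamma> t)"
      by (simp add: lincomb2_def)
    have "((\<lambda>s. \<Sum>i\<in>I. y i s *\<^sub>R E i s c) has_vector_derivative (\<Sum>i\<in>I. y' i *\<^sub>R E i t c) +
       (\<Sum>i\<in>I. y i t *\<^sub>R (E' i c - Gam c (cmap c (\<gamma> t)) (vel \<gamma> t c) (E i t c)))) (at t)"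
      using y cov_atD(3)[OF E c] by (intro has_vector_derivative_sum_scaleR) (auto simp: DERIV_iff_vector)
    then show "((\<lambda>s. \<Sum>i\<in>I. y i s *\<^sub>R E i s c) has_vector_derivative (\<Sum>i\<in>I. y' i *\<^sub>R E i t c) + (\<Sum>i\<in>I. y i t *\<^sub>R E' i c) -
       Gam c (cmap c (\<gamma> t)) (vel \<gamma> t c) (\<Sum>i\<in>I. y i t *\<^sub>R E i t c)) (at t)"
      by (simp add: linear_sum[OF Gam_linear(1)] Gam_simps scaleR_diff_right sum_subtractf add_diff_eq)
  qed
qed

text \<open>An instance of \<open>global_solution\<close>. Uniqueness holds because the difference
  of two parallel fields has constant length; local existence is a linear equation in one
  chart.\<close>

lemma parallel_exists:
  assumes \<gamma>: "geod \<gamma>" and v: "v \<in> TS (\<gamma> s)"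
  shows "\<exists>V. V s = v \<and> (\<forall>t. cov_at \<gamma> V (\<lambda>_. 0) t)"
proof (rule global_solution[where Adm="\<lambda>t v. v \<in> TS (\<gamma> t)"])
  show "cov_at \<gamma> W (\<lambda>_. 0) t" if V: "cov_at \<gamma> V (\<lambda>_. 0) t" and U: "open U" "t \<in> U" "\<And>s. s \<in> U \<Longrightarrow> V s = W s" for V W t U
  proof -
    obtain U1 where U1: "open U1" "t \<in> U1" "\<And>s. s \<in> U1 \<Longrightarrow> V s \<in> TS (\<gamma> s)" using V by (auto simp: cov_at_def)
    obtain c where c: "c \<in> A" "\<gamma> t \<in> cdom c" by (rule chart_around)
    show ?thesis
    proof (rule cov_atI[OF \<gamma> _ _ _ c])
      show "open (U \<inter> U1)" "t \<in> U \<inter> U1" using U U1 by auto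
      show "W s \<in> TS (\<gamma> s)" if "s \<in> U \<inter> U1" for s using that U(3)[of s] U1(3)[of s] by auto
      show "((\<lambda>s. W s c) has_vector_derivative 0 - Gam c (cmap c (\<gamma> t)) (vel \<gamma> t c) (W t c)) (at t)"
        using has_vector_derivative_transform_within_open[OF cov_atD(3)[OF V c] U(1,2), of "\<lambda>s. W s c"] U(2,3) by simp
    qed simp
  qed
  show "V t = W t" if V: "\<And>r. r \<in> {a<..<b} \<Longrightarrow> cov_at \<gamma> V (\<lambda>_. 0) r" and W: "\<And>r. r \<in> {a<..<b} \<Longrightarrow> cov_at \<gamma> W (\<lambda>_. 0) r"
    and s: "s \<in> {a<..<b}" "V s = W s" and t: "t \<in> {a<..<b}" for V W a b s t
  proof -
    \<comment> \<open>The difference of \<open>V\<close> and \<open>W\<close>, written as a sum over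
      \<open>bool\<close> to fit \<open>cov_at_lincomb\<close>.\<close>
    let ?Z = "\<lambda>s c. \<Sum>i\<in>UNIV. (if i then 1 else - 1) *\<^sub>R (if i then V else W) s c"
    have Z: "cov_at \<gamma> ?Z (\<lambda>_. 0) r" if "r \<in> {a<..<b}" for r
      using cov_at_lincomb[OF \<gamma>, of UNIV "\<lambda>i. if i then V else W" "\<lambda>_ _. 0" r "\<lambda>i s. if i then 1 else - 1" "\<lambda>_. 0"] V[OF that] W[OF that]
      by simp
    have "((\<lambda>s. g (\<gamma> s) (?Z s) (?Z s)) has_real_derivative 0) (at r within {a<..<b})" if "r \<in> {a<..<b}" for r
    proof -
      show ?thesis
        using cov_at_metric[OF \<gamma> Z[OF that] Z[OF that]] cov_atD(1)[OF Z[OF that]] by (auto intro: has_field_derivative_at_within)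
    qed
    then have "\<exists>k. \<forall>r\<in>{a<..<b}. g (\<gamma> r) (?Z r) (?Z r) = k"
      by (intro has_field_derivative_zero_constant) auto
    then obtain k where "\<forall>r\<in>{a<..<b}. g (\<gamma> r) (?Z r) (?Z r) = k" ..
    then have "g (\<gamma> t) (?Z t) (?Z t) = g (\<gamma> s) (?Z s) (?Z s)" using s t by (simp only:)
    also have "?Z s = (\<lambda>_. 0)" using s by (simp add: UNIV_bool)
    also have "g (\<gamma> s) (\<lambda>_. 0) (\<lambda>_. 0) = 0" by simp
    finally have "?Z t = (\<lambda>_. 0)"
      using g_pos[OF cov_atD(1)[OF Z[OF t]]] by (metis less_irrefl)
    then show ?thesis by (auto simp: UNIV_bool fun_eq_iff)
  qed
  show "\<exists>e>0. \<forall>s\<in>{t0 - e<..<t0 + e}. \<forall>v. v \<in> TS (\<gamma> s) \<longrightarrow>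
      (\<exists>V. V s = v \<and> (\<forall>t\<in>{t0 - e<..<t0 + e}. cov_at \<gamma> V (\<lambda>_. 0) t))" for t0
  proof -
    obtain c where c: "c \<in> A" "\<gamma> t0 \<in> cdom c" by (rule chart_around)
    have "open (\<gamma> -` cdom c)" using chartD(1)[OF c(1)] geodesicD(1)[OF \<gamma>] by (intro open_vimage)
    then obtain d where d: "d > 0" "cball t0 d \<subseteq> \<gamma> -` cdom c"
      using c by (meson open_contains_cball vimageI)
    have I: "\<gamma> t \<in> cdom c" if "t \<in> {t0 - d..t0 + d}" for t
      using d(2) that by (auto simp: cball_eq_atLeastAtMost)
    let ?M = "\<lambda>t x. - Gam c (cmap c (\<gamma> t)) (vel \<gamma> t c) x"
    have lin: "linear (?M t)" for t by (auto intro!: linearI simp: Gam_simps)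
    have cont: "continuous_on {t0 - d..t0 + d} (\<lambda>t. ?M t x)" for x
    proof (intro continuous_intros continuous_on_Gam c(1))
      show "continuous_on {t0 - d..t0 + d} (\<lambda>t. cmap c (\<gamma> t))"
        by (rule continuous_on_vector_derivative, rule has_vector_derivative_at_within, rule geodesicD(3)[OF \<gamma> c(1) I])
      show "continuous_on {t0 - d..t0 + d} (\<lambda>t. vel \<gamma> t c)"
        by (rule continuous_on_vector_derivative, rule has_vector_derivative_at_within, rule geodesicD(4)[OF \<gamma> c(1) I])
    qed (use I in auto)
    obtain e where e: "0 < e" "e \<le> d" "\<And>s v. s \<in> {t0 - e<..<t0 + e} \<Longrightarrow>
       \<exists>x. x s = v \<and> (\<forall>t\<in>{t0 - e<..<t0 + e}. (x has_vector_derivative ?M t (x t)) (at t))"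
      using linear_ode_local[OF lin d(1) cont] by metis
    have Ie: "\<gamma> t \<in> cdom c" if "t \<in> {t0 - e<..<t0 + e}" for t using I[of t] that e by auto
    show ?thesis
    proof (intro exI[of _ e] conjI ballI allI impI e(1))
      fix s v assume s: "s \<in> {t0 - e<..<t0 + e}" and v: "v \<in> TS (\<gamma> s)"
      obtain x where x: "x s = v c" "\<And>t. t\<in>{t0 - e<..<t0 + e} \<Longrightarrow> (x has_vector_derivative ?M t (x t)) (at t)"
        using e(3)[OF s, of "v c"] by blast
      let ?V = "\<lambda>t. tv c (\<gamma> t) (x t)"
      have "cov_at \<gamma> ?V (\<lambda>_. 0) t" if t: "t \<in> {t0 - e<..<t0 + e}" for t
      proof (rule cov_atI[OF \<gamma> _ t _ c(1) Ie[OF t]])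
        show "?V s \<in> TS (\<gamma> s)" if "s \<in> {t0 - e<..<t0 + e}" for s using c Ie[OF that] by simp
        have "((\<lambda>s. ?V s c) has_vector_derivative ?M t (x t)) (at t)"
          by (rule has_vector_derivative_transform_within_open[OF x(2)[OF t] _ t]) (use Ie c in auto)
        then show "((\<lambda>s. ?V s c) has_vector_derivative 0 - Gam c (cmap c (\<gamma> t)) (vel \<gamma> t c) (?V t c)) (at t)"
          using c Ie[OF t] by simp
      qed auto
      moreover have "?V s = v" using tvec_of_comp[OF v c(1) Ie[OF s]] x by simp
      ultimately show "\<exists>V. V s = v \<and> (\<forall>t\<in>{t0 - e<..<t0 + e}. cov_at \<gamma> V (\<lambda>_. 0) t)"
        by (intro exI[of _ ?V]) auto
    qed
  qed
qed (use v cov_atD(1) in auto)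

section \<open>Parallel frames\<close>

definition parallel_frame where
  "parallel_frame \<gamma> E \<longleftrightarrow> (\<forall>i t. cov_at \<gamma> (E i) (\<lambda>_. 0) t) \<and> (\<forall>t. orthonormal_frame A g (\<gamma> t) (\<lambda>i. E i t))"

lemma parallel_inner_const:
  assumes \<gamma>: "geod \<gamma>" and V: "\<And>t. cov_at \<gamma> V (\<lambda>_. 0) t" and W: "\<And>t. cov_at \<gamma> W (\<lambda>_. 0) t"
  shows "g (\<gamma> t) (V t) (W t) = g (\<gamma> s) (V s) (W s)"
proof -
  have "((\<lambda>s. g (\<gamma> s) (V s) (W s)) has_real_derivative 0) (at t within UNIV)" for t
    using cov_at_metric[OF \<gamma> V W, of t] cov_atD(1)[OF V] cov_atD(1)[OF W] by simp
  then obtain k where "\<forall>t\<in>UNIV. g (\<gamma> t) (V t) (W t) = k"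
    using has_field_derivative_zero_constant[of UNIV "\<lambda>s. g (\<gamma> s) (V s) (W s)"] by auto
  then show ?thesis by (simp only: UNIV_I)
qed

lemma parallel_frame_exists:
  assumes \<gamma>: "geod \<gamma>" shows "\<exists>E. parallel_frame \<gamma> E"
proof -
  let ?e = "fr (\<gamma> 0)"
  note e = orthonormal_frameD[OF frame_orthonormal, of "\<gamma> 0"]
  have "\<forall>i. \<exists>V. V 0 = ?e i \<and> (\<forall>t. cov_at \<gamma> V (\<lambda>_. 0) t)" using parallel_exists[OF \<gamma> e(1)] by blast
  then obtain E where E: "\<And>i. E i 0 = ?e i" "\<And>i t. cov_at \<gamma> (E i) (\<lambda>_. 0) t" by metis
  have "g (\<gamma> t) (E i t) (E j t) = (if i = j then 1 else 0)" for i j t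
    using parallel_inner_const[where V="E i" and W="E j" and t=t and s=0, OF \<gamma> E(2) E(2)] e(2) E(1) by simp
  then show ?thesis
    using E cov_atD(1)[OF E(2)] unfolding parallel_frame_def orthonormal_frame_def by blast
qed

lemma parallel_frameD:
  assumes "parallel_frame \<gamma> E"
  shows "cov_at \<gamma> (E i) (\<lambda>_. 0) t" "orthonormal_frame A g (\<gamma> t) (\<lambda>i. E i t)" "E i t \<in> TS (\<gamma> t)"
  using assms by (auto simp: parallel_frame_def orthonormal_frame_def)

lemma curvature_linear:
  assumes e: "\<And>i. e i \<in> TS p" and v: "v \<in> TS p"
  shows "curv p (\<lambda>c. \<Sum>i\<in>I. a i *\<^sub>R e i c) v v = (\<lambda>c. \<Sum>i\<in>I. a i *\<^sub>R curv p (e i) v v c)"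
proof -
  obtain c where c: "c \<in> A" "p \<in> cdom c" by (rule chart_around)
  have x: "cmap c p \<in> cimg c" using c by simp
  have T: "(\<lambda>c. \<Sum>i\<in>I. a i *\<^sub>R e i c) \<in> TS p" using e by (intro tangent_sum)
  have T2: "(\<lambda>c. \<Sum>i\<in>I. a i *\<^sub>R curv p (e i) v v c) \<in> TS p" using e v by (intro tangent_sum) auto
  show ?thesis
    by (rule tangent_eqI[OF curvature_tangent[OF T v v] T2 c])
       (simp add: curvature_eq_Rm[OF c] linear_sum[OF Rm_linear(1)[OF c(1) x]] linear_cmul[OF Rm_linear(1)[OF c(1) x]])
qed

lemma g_curvature_sym:
  assumes "u \<in> TS p" "v \<in> TS p" "w \<in> TS p"
  shows "g p (curv p u v v) w = g p (curv p w v v) u"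
proof -
  obtain c where c: "c \<in> A" "p \<in> cdom c" by (rule chart_around)
  then show ?thesis using assms Rm_swap[OF c(1)] by (simp add: g_curvature[of c])
qed

section \<open>The Jacobi equation in a parallel frame\<close>

definition Kmat where
  "Kmat \<gamma> E t = (\<chi> i j. g (\<gamma> t) (curv (\<gamma> t) (E j t) (vel \<gamma> t) (vel \<gamma> t)) (E i t))"

text \<open>The velocity is itself parallel, so its components in a parallel frame are those at time
  0; see \<open>velocity_expand\<close>.\<close>

definition ucomp where "ucomp \<gamma> E = (\<chi> i. g (\<gamma> 0) (vel \<gamma> 0) (E i 0))"

context
  fixes \<gamma> E
  assumes \<gamma>: "geod \<gamma>" and E: "parallel_frame \<gamma> E"
begin

lemma velocity_expand: "vel \<gamma> t = (\<lambda>c. \<Sum>i\<in>UNIV. ucomp \<gamma> E $ i *\<^sub>R E i t c)"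
  using frame_expansion[OF parallel_frameD(2)[OF E] geodesicD(2)[OF \<gamma>], of t]
    parallel_inner_const[OF \<gamma> cov_at_velocity[OF \<gamma>] parallel_frameD(1)[OF E], of t _ 0]
  by (simp add: ucomp_def)

lemma curvature_components:
  "curv (\<gamma> t) (\<lambda>c. \<Sum>i\<in>UNIV. y $ i *\<^sub>R E i t c) (vel \<gamma> t) (vel \<gamma> t) =
   (\<lambda>c. \<Sum>i\<in>UNIV. (Kmat \<gamma> E t *v y) $ i *\<^sub>R E i t c)"
proof -
  note v = geodesicD(2)[OF \<gamma>] and e = parallel_frameD(3)[OF E]
  let ?R = "\<lambda>w. curv (\<gamma> t) w (vel \<gamma> t) (vel \<gamma> t)"
  let ?Y = "\<lambda>c. \<Sum>i\<in>UNIV. y $ i *\<^sub>R E i t c"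
  have Y: "?Y \<in> TS (\<gamma> t)" using e by (intro tangent_sum)
  have "g (\<gamma> t) (?R ?Y) (E i t) = (Kmat \<gamma> E t *v y) $ i" for i
    unfolding curvature_linear[of "\<lambda>i. E i t", OF e v]
    using v e by (simp add: g_linear_left Kmat_def matrix_vector_mult_def mult.commute)
  then show ?thesis
    using frame_expansion[OF parallel_frameD(2)[OF E] curvature_tangent[OF Y v v]] by simp
qed

lemma Kmat_sym: "(Kmat \<gamma> E t *v a) \<bullet> b = a \<bullet> (Kmat \<gamma> E t *v b)"
proof -
  have "transpose (Kmat \<gamma> E t) = Kmat \<gamma> E t"
    using g_curvature_sym[OF parallel_frameD(3)[OF E] geodesicD(2)[OF \<gamma>] parallel_frameD(3)[OF E]]
    by (simp add: vec_eq_iff transpose_def Kmat_def)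
  then show ?thesis by (metis dot_lmul_matrix inner_commute transpose_matrix_vector)
qed

lemma frame_comb_inj:
  assumes "(\<lambda>c. \<Sum>i\<in>UNIV. x $ i *\<^sub>R E i t c) = (\<lambda>c. \<Sum>i\<in>UNIV. y $ i *\<^sub>R E i t c)" shows "x = y"
  using arg_cong[OF assms, of "\<lambda>w. g (\<gamma> t) w (E j t)" for j] frame_inner[OF parallel_frameD(2)[OF E]]
  by (simp add: vec_eq_iff)

lemma frame_comb_eq_0: "(\<lambda>c. \<Sum>i\<in>UNIV. y $ i *\<^sub>R E i t c) = (\<lambda>_. 0) \<Longrightarrow> y = 0"
  using frame_comb_inj[of y t 0] by simp

lemma Kmat_ucomp: "Kmat \<gamma> E t *v ucomp \<gamma> E = 0"
proof -
  note v = geodesicD(2)[OF \<gamma>]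
  have "curv (\<gamma> t) (vel \<gamma> t) (vel \<gamma> t) (vel \<gamma> t) = (\<lambda>_. 0)"
  proof -
    obtain c where c: "c \<in> A" "\<gamma> t \<in> cdom c" by (rule chart_around)
    show ?thesis
      by (rule tangent_eqI[OF curvature_tangent[OF v v v] zero_tangent c]) (simp add: curvature_eq_Rm[OF c] Rm_def)
  qed
  then show ?thesis
    using curvature_components[of t "ucomp \<gamma> E"] velocity_expand[of t] by (intro frame_comb_eq_0[of _ t]) simp
qed

lemma Kmat_trace: "trace (Kmat \<gamma> E t) = ricci A g (\<gamma> t) (vel \<gamma> t) (vel \<gamma> t)"
proof -
  obtain c where c: "c \<in> A" "\<gamma> t \<in> cdom c" by (rule chart_around)
  show ?thesis
    unfolding ricci_eq[OF c geodesicD(2)[OF \<gamma>]] ricci_frame[OF parallel_frameD(2)[OF E] c geodesicD(2)[OF \<gamma>], symmetric]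
    by (simp add: trace_def Kmat_def)
qed

lemma Kmat_continuous: "continuous_on UNIV (Kmat \<gamma> E)"
proof -
  let ?k = "\<lambda>i j t. g (\<gamma> t) (curv (\<gamma> t) (E j t) (vel \<gamma> t) (vel \<gamma> t)) (E i t)"
  have "isCont (?k i j) t0" for i j t0
  proof -
    obtain c where c: "c \<in> A" "\<gamma> t0 \<in> cdom c" by (rule chart_around)
    let ?S = "\<gamma> -` cdom c"
    have S: "open ?S" "t0 \<in> ?S" using chartD(1)[OF c(1)] geodesicD(1)[OF \<gamma>] c by (auto intro!: open_vimage)
    have x: "continuous_on ?S (\<lambda>t. cmap c (\<gamma> t))" "continuous_on ?S (\<lambda>t. vel \<gamma> t c)" "continuous_on ?S (\<lambda>t. E k t c)" for k
      using geodesicD(3)[OF \<gamma> c(1)] geodesicD(4)[OF \<gamma> c(1)] cov_atD(3)[OF parallel_frameD(1)[OF E] c(1)]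
      by (intro continuous_on_vector_derivative[OF has_vector_derivative_at_within]; force)+
    have "continuous_on ?S (\<lambda>t. ip c (cmap c (\<gamma> t)) (Rm c (cmap c (\<gamma> t)) (E j t c) (vel \<gamma> t c) (vel \<gamma> t c)) (E i t c))"
      by (intro continuous_on_ip continuous_on_Rm c(1) x) auto
    then have "continuous_on ?S (?k i j)"
      by (rule continuous_on_eq) (use c geodesicD(2)[OF \<gamma>] parallel_frameD(3)[OF E] in \<open>auto simp: g_curvature[of c]\<close>)
    then show ?thesis using S continuous_on_eq_continuous_at by blast
  qed
  then have "continuous_on UNIV (?k i j)" for i j
    by (simp add: continuous_on_eq_continuous_at)
  then show ?thesis unfolding Kmat_def[abs_def] by (intro continuous_intros)
qed

text \<open>In a parallel frame covariant differentiation acts on the components only, so the Jacobi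
  field equation is the matrix equation with \<open>Kmat\<close>.\<close>

lemma jacobi_solution_field:
  assumes y: "jacobi_solution (Kmat \<gamma> E) y y'"
  shows "jacobi_field A g \<gamma> (\<lambda>t c. \<Sum>i\<in>UNIV. y t $ i *\<^sub>R E i t c)"
proof -
  let ?J = "\<lambda>y t c. \<Sum>i\<in>UNIV. y t $ i *\<^sub>R E i t c"
  have d: "((\<lambda>t. y t $ i) has_real_derivative y' t $ i) (at t)" "((\<lambda>t. y' t $ i) has_real_derivative - (Kmat \<gamma> E t *v y t) $ i) (at t)" for i t
    using y has_vector_derivative_vec_nth[of y] has_vector_derivative_vec_nth[of y']
    unfolding jacobi_solution_def DERIV_iff_vector by (blast, metis vector_uminus_component)
  have 1: "cov_at \<gamma> (?J y) (?J y' t) t" for t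
    using cov_at_lincomb[OF \<gamma>, of UNIV E "\<lambda>_ _. 0" t "\<lambda>i t. y t $ i" "\<lambda>i. y' t $ i"] parallel_frameD(1)[OF E] d by simp
  have 2: "cov_at \<gamma> (?J y') (\<lambda>c. \<Sum>i\<in>UNIV. - (Kmat \<gamma> E t *v y t) $ i *\<^sub>R E i t c) t" for t
    using cov_at_lincomb[OF \<gamma>, of UNIV E "\<lambda>_ _. 0" t "\<lambda>i t. y' t $ i" "\<lambda>i. - (Kmat \<gamma> E t *v y t) $ i"] parallel_frameD(1)[OF E] d by simp
  show ?thesis
    unfolding jacobi_field_def Let_def cov_at_all(2)[of \<gamma> "?J y", OF 1] cov_at_all(2)[of \<gamma> "?J y'", OF 2] curvature_components
    using cov_at_all(1)[of \<gamma> "?J y", OF 1] cov_at_all(1)[of \<gamma> "?J y'", OF 2] by (simp add: sum_negf)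
qed

lemma jacobi_field_solution:
  assumes J: "jacobi_field A g \<gamma> J"
  shows "jacobi_solution (Kmat \<gamma> E) (\<lambda>t. \<chi> i. g (\<gamma> t) (J t) (E i t)) (\<lambda>t. \<chi> i. g (\<gamma> t) (covd \<gamma> J t) (E i t))"
proof -
  let ?D = "covd \<gamma>" and ?v = "vel \<gamma>"
  let ?y = "\<lambda>t. \<chi> i. g (\<gamma> t) (J t) (E i t)" and ?y' = "\<lambda>t. \<chi> i. g (\<gamma> t) (?D J t) (E i t)"
  have j: "differentiable_field_along A \<gamma> J" "differentiable_field_along A \<gamma> (?D J)"
    "\<And>t c. ?D (?D J) t c + curv (\<gamma> t) (J t) (?v t) (?v t) c = 0"
    using J by (auto simp: jacobi_field_def Let_def)
  note v = geodesicD(2)[OF \<gamma>] and e = parallel_frameD(3)[OF E]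
  note c1 = differentiable_field_cov_at[OF \<gamma> j(1)] and c2 = differentiable_field_cov_at[OF \<gamma> j(2)]
  have vd: "((\<lambda>t. \<chi> i. f i t) has_vector_derivative (\<chi> i. f' i)) (at t)"
    if "\<And>i::'n. (f i has_real_derivative f' i) (at t)" for f f' t
  proof -
    have "((\<lambda>t. \<chi> i. f i t) has_derivative (\<lambda>h. \<chi> i. f' i * h)) (at t)"
      using that by (intro has_derivative_vec_lambda) (simp add: has_field_derivative_def)
    moreover have "(\<lambda>h. \<chi> i. f' i * h) = (\<lambda>h. h *\<^sub>R (\<chi> i. f' i))" by (auto simp: vec_eq_iff)
    ultimately show ?thesis by (simp add: has_vector_derivative_def)
  qed
  show ?thesis unfolding jacobi_solution_def
  proof (intro allI conjI)
    fix t
    show "(?y has_vector_derivative ?y' t) (at t)"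
    proof (rule vd)
      show "((\<lambda>t. g (\<gamma> t) (J t) (E i t)) has_real_derivative g (\<gamma> t) (?D J t) (E i t)) (at t)" for i
        using cov_at_metric[OF \<gamma> c1[of t] parallel_frameD(1)[OF E, of i t]] cov_atD(1)[OF c1[of t]] by simp
    qed
    have Jt: "J t \<in> TS (\<gamma> t)" using c1 by (rule cov_atD(1))
    have "J t = (\<lambda>c. \<Sum>i\<in>UNIV. ?y t $ i *\<^sub>R E i t c)"
      using frame_expansion[OF parallel_frameD(2)[OF E] Jt] by simp
    then have R: "curv (\<gamma> t) (J t) (?v t) (?v t) =
       (\<lambda>c. \<Sum>i\<in>UNIV. (Kmat \<gamma> E t *v ?y t) $ i *\<^sub>R E i t c)"
      using curvature_components[of t "?y t"] by simp
    have "?D (?D J) t = (\<lambda>c. \<Sum>i\<in>UNIV. (- (Kmat \<gamma> E t *v ?y t)) $ i *\<^sub>R E i t c)"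
      using j(3)[of t] unfolding R by (simp add: eq_neg_iff_add_eq_0 fun_eq_iff sum_negf)
    then have "g (\<gamma> t) (?D (?D J) t) (E i t) = (- (Kmat \<gamma> E t *v ?y t)) $ i" for i
      by (simp only: frame_inner[OF parallel_frameD(2)[OF E]])
    then have K: "- (Kmat \<gamma> E t *v ?y t) = (\<chi> i. g (\<gamma> t) (?D (?D J) t) (E i t))"
      by (simp add: vec_eq_iff)
    show "(?y' has_vector_derivative
       - (Kmat \<gamma> E t *v ?y t)) (at t)"
      unfolding K
    proof (rule vd)
      show "((\<lambda>t. g (\<gamma> t) (?D J t) (E i t)) has_real_derivative g (\<gamma> t) (?D (?D J) t) (E i t)) (at t)" for i
        using cov_at_metric[OF \<gamma> c2[of t] parallel_frameD(1)[OF E, of i t]] cov_atD(1)[OF c2[of t]] by simp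
    qed
  qed
qed

end

lemma norm_ucomp:
  assumes \<gamma>: "ugeod \<gamma>" and E: "parallel_frame \<gamma> E"
  shows "norm (ucomp \<gamma> E) = 1"
proof -
  have geo: "geod \<gamma>" using \<gamma> by (simp add: unit_speed_geodesic_def)
  let ?v = "vel \<gamma> 0" and ?w = "\<lambda>c. \<Sum>i\<in>UNIV. ucomp \<gamma> E $ i *\<^sub>R E i 0 c"
  have "1 = g (\<gamma> 0) ?v ?v" using \<gamma> by (simp add: unit_speed_geodesic_def)
  also have "\<dots> = g (\<gamma> 0) ?w ?v" by (rule arg_cong[OF velocity_expand[OF geo E, of 0], of "\<lambda>w. g (\<gamma> 0) w ?v"])
  also have "\<dots> = (\<Sum>i\<in>UNIV. ucomp \<gamma> E $ i * g (\<gamma> 0) (E i 0) ?v)"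
    by (rule g_linear_left[OF geodesicD(2)[OF geo] parallel_frameD(3)[OF E]])
  also have "\<dots> = ucomp \<gamma> E \<bullet> ucomp \<gamma> E"
    using g_sym[OF geodesicD(2)[OF geo] parallel_frameD(3)[OF E]] by (simp add: ucomp_def inner_vec_def)
  finally show ?thesis by (simp add: norm_eq_1)
qed

section \<open>Index inequality along geodesics and constant curvature\<close>

definition conj_free where
  "conj_free \<longleftrightarrow> (\<forall>\<gamma> s t. ugeod \<gamma> \<longrightarrow> conjugate_along A g \<gamma> s t \<longrightarrow> pi \<le> \<bar>s - t\<bar>)"

lemma index_inequality:
  assumes cf: conj_free and \<gamma>: "ugeod \<gamma>"
  shows "continuous_on UNIV (\<lambda>t. ricci A g (\<gamma> t) (vel \<gamma> t) (vel \<gamma> t))"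
    and "integral {0..pi} (\<lambda>t. (sin t)\<^sup>2 * ricci A g (\<gamma> t) (vel \<gamma> t) (vel \<gamma> t)) \<le> (real CARD('n) - 1) * pi / 2" (is "?I \<le> ?c")
    and "integral {0..pi} (\<lambda>t. (sin t)\<^sup>2 * ricci A g (\<gamma> t) (vel \<gamma> t) (vel \<gamma> t)) = (real CARD('n) - 1) * pi / 2 \<Longrightarrow>
      w \<in> TS (\<gamma> 0) \<Longrightarrow> g (\<gamma> 0) w (vel \<gamma> 0) = 0 \<Longrightarrow>
      curv (\<gamma> 0) w (vel \<gamma> 0) (vel \<gamma> 0) = w"
proof -
  have geo: "geod \<gamma>" using \<gamma> by (simp add: unit_speed_geodesic_def)
  obtain E where E: "parallel_frame \<gamma> E" using parallel_frame_exists[OF geo] by blast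
  let ?K = "Kmat \<gamma> E"
  note K = Kmat_continuous[OF geo E]
  have nc: "no_conjugate ?K pi"
    unfolding no_conjugate_def
  proof (intro allI impI)
    fix y y' s t assume *: "jacobi_solution ?K y y'" "s \<noteq> t" "y s = 0" "y t = 0" "\<exists>u. y u \<noteq> 0"
    let ?J = "\<lambda>t c. \<Sum>i\<in>UNIV. y t $ i *\<^sub>R E i t c"
    have "jacobi_field A g \<gamma> ?J" using jacobi_solution_field[OF geo E *(1)] .
    moreover have "?J s = (\<lambda>_. 0)" "?J t = (\<lambda>_. 0)" using * by auto
    moreover have "\<exists>u. ?J u \<noteq> (\<lambda>_. 0)" using *(5) frame_comb_eq_0[OF geo E] by blast
    ultimately have "conjugate_along A g \<gamma> s t" using *(2) unfolding conjugate_along_def by blast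
    then show "pi \<le> \<bar>s - t\<bar>" using cf \<gamma> unfolding conj_free_def by blast
  qed
  note tr = Kmat_trace[OF geo E]
  have "continuous_on UNIV (\<lambda>t. trace (?K t))" unfolding trace_def by (intro continuous_intros K)
  then show "continuous_on UNIV (\<lambda>t. ricci A g (\<gamma> t) (vel \<gamma> t) (vel \<gamma> t))" by (simp add: tr)
  note it = index_trace[OF K Kmat_sym[OF geo E] nc norm_ucomp[OF \<gamma> E] Kmat_ucomp[OF geo E], unfolded tr]
  show "?I \<le> ?c"
    by (rule it(1))
  assume eq: "?I = ?c"
    and w: "w \<in> TS (\<gamma> 0)" "g (\<gamma> 0) w (vel \<gamma> 0) = 0"
  let ?w = "\<chi> i. g (\<gamma> 0) w (E i 0)"
  have we: "w = (\<lambda>c. \<Sum>i\<in>UNIV. ?w $ i *\<^sub>R E i 0 c)" using frame_expansion[OF parallel_frameD(2)[OF E] w(1)] by simp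
  have "0 = g (\<gamma> 0) (vel \<gamma> 0) w" using w g_sym[OF w(1) geodesicD(2)[OF geo]] by simp
  also have "\<dots> = g (\<gamma> 0) (\<lambda>c. \<Sum>i\<in>UNIV. ucomp \<gamma> E $ i *\<^sub>R E i 0 c) w" using velocity_expand[OF geo E, of 0] by simp
  also have "\<dots> = (\<Sum>i\<in>UNIV. ucomp \<gamma> E $ i * g (\<gamma> 0) (E i 0) w)" by (rule g_linear_left[OF w(1) parallel_frameD(3)[OF E]])
  also have "\<dots> = ?w \<bullet> ucomp \<gamma> E" using g_sym[OF w(1) parallel_frameD(3)[OF E]] by (simp add: inner_vec_def mult.commute)
  finally have "?K 0 *v ?w = ?w" by (intro it(2)[OF eq]) simp
  then show "curv (\<gamma> 0) w (vel \<gamma> 0) (vel \<gamma> 0) = w"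
    using curvature_components[OF geo E, of 0 ?w] we by simp
qed

text \<open>A distance below \<pi> lies below some member of the set whose supremum is the conjugate
  radius, and that member is a lower bound for all conjugate distances.\<close>

lemma conj_free_of_radius:
  assumes "ereal pi \<le> conjugate_radius A g" shows conj_free
  unfolding conj_free_def
proof (intro allI impI, rule ccontr)
  fix \<gamma> s t assume *: "ugeod \<gamma>" "conjugate_along A g \<gamma> s t" "\<not> pi \<le> \<bar>s - t\<bar>"
  have "ereal \<bar>s - t\<bar> < conjugate_radius A g" using * assms by (intro less_le_trans[OF _ assms]) simp
  then obtain r where "ereal \<bar>s - t\<bar> < ereal r" "\<forall>\<gamma>. ugeod \<gamma> \<longrightarrow>
      (\<forall>s t. conjugate_along A g \<gamma> s t \<longrightarrow> r \<le> \<bar>s - t\<bar>)"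
    unfolding conjugate_radius_def less_Sup_iff by blast
  then show False using * by fastforce
qed

text \<open>Sectional curvature 1 fixes the quadratic form of the Jacobi operator of
  \<open>b\<close> on vectors independent of \<open>b\<close>; for dependent ones both sides vanish.
  Polarisation, by the self-adjointness \<open>Rm_swap\<close>, recovers the operator from its
  quadratic form.\<close>

lemma constant_curvature_1_iff:
  "constant_sectional_curvature A g 1 \<longleftrightarrow>
    (\<forall>c\<in>A. \<forall>x\<in>cimg c. \<forall>a b. Rm c x a b b = ip c x b b *\<^sub>R a - ip c x a b *\<^sub>R b)" (is "?L \<longleftrightarrow> ?R")
proof
  assume L: ?L
  show ?R
  proof (intro ballI allI)
    fix c x a b assume c: "c \<in> A" "x \<in> cimg c"
    let ?p = "cinv c x"
    have p: "?p \<in> cdom c" "cmap c ?p = x" using c by (auto simp: chartD)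
    have q: "ip c x (Rm c x a b b) a = ip c x a a * ip c x b b - (ip c x a b)\<^sup>2" for a
    proof (cases "\<exists>r s. r *\<^sub>R a + s *\<^sub>R b = 0 \<and> \<not> (r = 0 \<and> s = 0)")
      case True
      then obtain r s where rs: "r *\<^sub>R a + s *\<^sub>R b = 0" "\<not> (r = 0 \<and> s = 0)" by blast
      have Rbb: "Rm c x b b b = 0" "ip c x (Rm c x a b b) b = 0"
        using Rm_skew[OF c, of a b b b] ip_sym[OF c, of b "Rm c x a b b"] by (simp_all add: Rm_def)
      show ?thesis
      proof (cases "r = 0")
        case True
        then have "b = 0" using rs by auto
        then show ?thesis by (simp add: ip_simps linear_0[OF Rm_linear(3)[OF c]])
      next
        case False
        then have "a = (1 / r) *\<^sub>R (r *\<^sub>R a)" by simp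
        also have "r *\<^sub>R a = - (s *\<^sub>R b)" using rs(1) by (simp add: eq_neg_iff_add_eq_0)
        finally have "a = (- s / r) *\<^sub>R b" by simp
        then show ?thesis
          by (simp add: ip_simps linear_cmul[OF Rm_linear(1)[OF c]] linear_neg[OF Rm_linear(1)[OF c]] Rbb power2_eq_square)
      qed
    next
      case False
      let ?u = "tv c ?p a" and ?v = "tv c ?p b"
      have "\<forall>r s. lincomb2 r ?u s ?v = (\<lambda>_. 0) \<longrightarrow> r = 0 \<and> s = 0"
      proof (intro allI impI)
        fix r s assume "lincomb2 r ?u s ?v = (\<lambda>_. 0)"
        from fun_cong[OF this, of c] show "r = 0 \<and> s = 0" using False c p by (auto simp: lincomb2_def)
      qed
      then have "sectional_curvature A g ?p ?u ?v = 1"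
        using L c p unfolding constant_sectional_curvature_def by simp
      then have "ip c x (Rm c x a b b) a / (ip c x a a * ip c x b b - (ip c x a b)\<^sup>2) = 1"
        using c p by (simp add: sectional_curvature_def g_curvature[of c] g_tvec_of)
      then show ?thesis by (metis divide_eq_1_iff)
    qed
    show "Rm c x a b b = ip c x b b *\<^sub>R a - ip c x a b *\<^sub>R b"
    proof (rule ip_eqI[OF c])
      fix w
      have "2 * ip c x (Rm c x a b b) w = ip c x (Rm c x (a + w) b b) (a + w) - ip c x (Rm c x a b b) a - ip c x (Rm c x w b b) w"
        using Rm_swap[OF c, of a b w] by (simp add: ip_simps linear_add[OF Rm_linear(1)[OF c]])
      also have "\<dots> = 2 * ip c x (ip c x b b *\<^sub>R a - ip c x a b *\<^sub>R b) w"
        unfolding q using ip_sym[OF c, of w a] ip_sym[OF c, of w b]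
        by (simp add: ip_simps power2_eq_square algebra_simps)
      finally show "ip c x (Rm c x a b b) w = ip c x (ip c x b b *\<^sub>R a - ip c x a b *\<^sub>R b) w" by simp
    qed
  qed
next
  assume R: ?R
  show ?L
    unfolding constant_sectional_curvature_def
  proof (intro allI ballI impI)
    fix p u v assume u: "u \<in> TS p" and v: "v \<in> TS p"
      and ind: "\<forall>a b. lincomb2 a u b v = (\<lambda>_. 0) \<longrightarrow> a = 0 \<and> b = 0"
    obtain c where c: "c \<in> A" "p \<in> cdom c" by (rule chart_around)
    let ?x = "cmap c p" and ?a = "u c" and ?b = "v c"
    have x: "?x \<in> cimg c" using c by simp
    note cx = c(1) x
    have ind': "r = 0 \<and> s = 0" if "r *\<^sub>R ?a + s *\<^sub>R ?b = 0" for r s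
    proof -
      have "lincomb2 r u s v = (\<lambda>_. 0)"
        by (rule tangent_eqI[OF lincomb2_tangent[OF u v] zero_tangent c]) (use that in \<open>simp add: lincomb2_def\<close>)
      then show ?thesis using ind by blast
    qed
    have b: "?b \<noteq> 0" using ind'[of 0 1] by auto
    then have bb: "ip c ?x ?b ?b > 0" by (rule ip_pos[OF cx])
    \<comment> \<open>A multiple of the component of \<open>?a\<close> orthogonal to
      \<open>?b\<close>. Its square is \<open>ip c ?x ?b ?b\<close> times the Gram determinant, so
      the denominator of the sectional curvature is not 0.\<close>
    define w where "w = ip c ?x ?b ?b *\<^sub>R ?a - ip c ?x ?a ?b *\<^sub>R ?b"
    have "w \<noteq> 0" using ind'[of "ip c ?x ?b ?b" "- ip c ?x ?a ?b"] bb by (auto simp: w_def)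
    then have "0 < ip c ?x w w" by (rule ip_pos[OF cx])
    also have "ip c ?x w w = ip c ?x ?b ?b * (ip c ?x ?a ?a * ip c ?x ?b ?b - (ip c ?x ?a ?b)\<^sup>2)"
      using ip_sym[OF cx, of ?b ?a] by (simp add: w_def ip_simps power2_eq_square algebra_simps)
    finally have den: "ip c ?x ?a ?a * ip c ?x ?b ?b - (ip c ?x ?a ?b)\<^sup>2 \<noteq> 0" by auto
    have "ip c ?x (Rm c ?x ?a ?b ?b) ?a = ip c ?x ?a ?a * ip c ?x ?b ?b - (ip c ?x ?a ?b)\<^sup>2"
    proof -
      have "Rm c ?x ?a ?b ?b = ip c ?x ?b ?b *\<^sub>R ?a - ip c ?x ?a ?b *\<^sub>R ?b" using R cx by blast
      then show ?thesis using ip_sym[OF cx, of ?b ?a] by (simp add: ip_simps power2_eq_square)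
    qed
    then show "sectional_curvature A g p u v = 1"
      using den by (simp add: sectional_curvature_def g_curvature[OF c u v v u] g_eq_ip[OF c u v] g_eq_ip[OF c u u] g_eq_ip[OF c v v]
        del: curvature_tangent)
  qed
qed

lemma constant_curvature_Kmat:
  assumes cc: "constant_sectional_curvature A g 1" and \<gamma>: "ugeod \<gamma>" and E: "parallel_frame \<gamma> E"
  shows "Kmat \<gamma> E t *v y = y - (y \<bullet> ucomp \<gamma> E) *\<^sub>R ucomp \<gamma> E"
proof -
  have geo: "geod \<gamma>" using \<gamma> by (simp add: unit_speed_geodesic_def)
  let ?u = "ucomp \<gamma> E"
  define z where "z = y - (y \<bullet> ?u) *\<^sub>R ?u"
  obtain c where c: "c \<in> A" "\<gamma> t \<in> cdom c" by (rule chart_around)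
  let ?x = "cmap c (\<gamma> t)" and ?v = "vel \<gamma> t"
  let ?Y = "\<lambda>y c. \<Sum>i\<in>UNIV. y $ i *\<^sub>R E i t c"
  have x: "?x \<in> cimg c" using c by simp
  note cx = c(1) x
  note v = geodesicD(2)[OF geo] and e = parallel_frameD(3)[OF E]
  have Y: "?Y y \<in> TS (\<gamma> t)" for y using e by (intro tangent_sum)
  have vv: "ip c ?x (?v c) (?v c) = 1" using \<gamma> g_eq_ip[OF c v v] by (simp add: unit_speed_geodesic_def)
  have yv: "ip c ?x (?Y y c) (?v c) = y \<bullet> ?u"
  proof -
    have "g (\<gamma> t) (?Y y) ?v = g (\<gamma> t) (\<lambda>c. \<Sum>i\<in>UNIV. ?u $ i *\<^sub>R E i t c) (?Y y)"
      using g_sym[OF Y v] velocity_expand[OF geo E, of t] by simp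
    also have "\<dots> = (\<Sum>i\<in>UNIV. ?u $ i * g (\<gamma> t) (E i t) (?Y y))" by (rule g_linear_left[OF Y e])
    also have "\<dots> = (\<Sum>i\<in>UNIV. ?u $ i * y $ i)"
      using frame_inner[OF parallel_frameD(2)[OF E]] g_sym[OF e Y] by simp
    finally show ?thesis using g_eq_ip[OF c Y v] by (simp add: inner_vec_def mult.commute)
  qed
  have "curv (\<gamma> t) (?Y y) ?v ?v = ?Y z"
  proof (rule tangent_eqI[OF curvature_tangent[OF Y v v] Y c])
    have "curv (\<gamma> t) (?Y y) ?v ?v c = ?Y y c - (y \<bullet> ?u) *\<^sub>R ?v c"
    proof -
      have "Rm c ?x (?Y y c) (?v c) (?v c) = ip c ?x (?v c) (?v c) *\<^sub>R ?Y y c - ip c ?x (?Y y c) (?v c) *\<^sub>R ?v c"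
        using cc cx unfolding constant_curvature_1_iff by blast
      then show ?thesis unfolding curvature_eq_Rm[OF c] vv yv by simp
    qed
    also have "?v c = ?Y ?u c" using velocity_expand[OF geo E, of t] by simp
    also have "?Y y c - (y \<bullet> ?u) *\<^sub>R ?Y ?u c = ?Y z c"
      by (simp add: z_def scaleR_sum_right sum_subtractf scaleR_diff_left)
    finally show "curv (\<gamma> t) (?Y y) ?v ?v c = ?Y z c" .
  qed
  then have "?Y (Kmat \<gamma> E t *v y) = ?Y z" using curvature_components[OF geo E, of t y] by simp
  then show ?thesis unfolding z_def by (rule frame_comb_inj[OF geo E])
qed
end

section \<open>Constant curvature 1\<close>

text \<open>The combination \<open>?f\<close> is a first integral of the harmonic oscillator. Its
  value 0 at \<open>s\<close> gives \<open>y' t = 0\<close>, since the sine of \<open>t - s\<close>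
  is nonzero; then the energy vanishes.\<close>

lemma harmonic_zero:
  fixes y :: "real \<Rightarrow> 'b::real_inner"
  assumes y: "\<And>t. (y has_vector_derivative y' t) (at t)" "\<And>t. (y' has_vector_derivative - y t) (at t)"
    and s: "y s = 0" and t: "y t = 0" "\<bar>s - t\<bar> < pi" "s \<noteq> t"
  shows "y r = 0"
proof -
  let ?f = "\<lambda>\<tau>. cos (\<tau> - s) *\<^sub>R y \<tau> - sin (\<tau> - s) *\<^sub>R y' \<tau>"
  have "(?f has_vector_derivative 0) (at \<tau>)" for \<tau>
  proof -
    have 1: "((\<lambda>\<tau>. cos (\<tau> - s)) has_real_derivative - sin (\<tau> - s)) (at \<tau>)" "((\<lambda>\<tau>. sin (\<tau> - s)) has_real_derivative cos (\<tau> - s)) (at \<tau>)"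
      by (auto intro!: derivative_eq_intros)
    show ?thesis
      using has_vector_derivative_diff[OF has_vector_derivative_scaleR[OF 1(1) y(1)] has_vector_derivative_scaleR[OF 1(2) y(2)]]
      by (simp add: algebra_simps)
  qed
  then obtain c where "\<And>\<tau>. ?f \<tau> = c" using has_vector_derivative_zero_constant[of UNIV ?f] by auto
  from this[of s] this[of t] have "sin (t - s) *\<^sub>R y' t = 0" using s t(1) by simp
  moreover have "sin (t - s) \<noteq> 0"
  proof (cases "s < t")
    case True
    then have "0 < sin (t - s)" using t by (intro sin_gt_zero) auto
    then show ?thesis by simp
  next
    case False
    then have "0 < sin (s - t)" using t by (intro sin_gt_zero) auto
    then show ?thesis using sin_minus[of "s - t"] by simp
  qed
  ultimately have y't: "y' t = 0" by simp
  let ?e = "\<lambda>\<tau>. y \<tau> \<bullet> y \<tau> + y' \<tau> \<bullet> y' \<tau>"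
  have "(?e has_vector_derivative 0) (at \<tau>)" for \<tau>
    using has_vector_derivative_add[OF has_vector_derivative_inner[OF y(1) y(1)] has_vector_derivative_inner[OF y(2) y(2)]]
    by (simp add: inner_commute)
  then obtain c where "\<And>\<tau>. ?e \<tau> = c" using has_vector_derivative_zero_constant[of UNIV ?e] by auto
  from this[of r] this[of t] have "y r \<bullet> y r + y' r \<bullet> y' r = 0" using t y't by simp
  then show ?thesis by (simp add: add_nonneg_eq_0_iff)
qed

context riem
begin

lemma jacobi_field_expand:
  assumes \<gamma>: "geod \<gamma>" and E: "parallel_frame \<gamma> E" and J: "jacobi_field A g \<gamma> J"
  shows "J t = (\<lambda>c. \<Sum>i\<in>UNIV. (\<chi> i. g (\<gamma> t) (J t) (E i t)) $ i *\<^sub>R E i t c)"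
proof -
  have "differentiable_field_along A \<gamma> J" using J by (simp add: jacobi_field_def Let_def)
  then have "J t \<in> TS (\<gamma> t)" by (simp add: differentiable_field_along_def)
  from frame_expansion[OF parallel_frameD(2)[OF E] this] show ?thesis by simp
qed

lemma constant_curvature_conj_free:
  assumes cc: "constant_sectional_curvature A g 1" shows conj_free
  unfolding conj_free_def
proof (intro allI impI, rule ccontr)
  fix \<gamma> s t assume \<gamma>: "ugeod \<gamma>" and "conjugate_along A g \<gamma> s t" and lt: "\<not> pi \<le> \<bar>s - t\<bar>"
  then obtain J u where J: "s \<noteq> t" "jacobi_field A g \<gamma> J" "J s = (\<lambda>_. 0)" "J t = (\<lambda>_. 0)" "J u \<noteq> (\<lambda>_. 0)"
    unfolding conjugate_along_def by blast
  have geo: "geod \<gamma>" using \<gamma> by (simp add: unit_speed_geodesic_def)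
  obtain E where E: "parallel_frame \<gamma> E" using parallel_frame_exists[OF geo] by blast
  define y where "y t = (\<chi> i. g (\<gamma> t) (J t) (E i t))" for t
  define y' where "y' t = (\<chi> i. g (\<gamma> t) (covd \<gamma> J t) (E i t))" for t
  let ?u = "ucomp \<gamma> E"
  have sol: "jacobi_solution (Kmat \<gamma> E) y y'"
    using jacobi_field_solution[OF geo E J(2)] by (simp add: y_def[abs_def] y'_def[abs_def])
  have d: "(y has_vector_derivative y' t) (at t)" "(y' has_vector_derivative - (y t - (y t \<bullet> ?u) *\<^sub>R ?u)) (at t)" for t
    using sol constant_curvature_Kmat[OF cc \<gamma> E] by (auto simp: jacobi_solution_def)
  have uu: "?u \<bullet> ?u = 1" using norm_ucomp[OF \<gamma> E] by (simp add: norm_eq_1)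
  have y0: "y s = 0" "y t = 0" using J(3,4) parallel_frameD(3)[OF E] by (auto simp: y_def vec_eq_iff)
  have a: "((\<lambda>t. y t \<bullet> ?u) has_vector_derivative y' t \<bullet> ?u) (at t)" "((\<lambda>t. y' t \<bullet> ?u) has_vector_derivative 0) (at t)" for t
    using bounded_linear.has_vector_derivative[OF bounded_linear_inner_left d(1)]
      bounded_linear.has_vector_derivative[OF bounded_linear_inner_left d(2), of ?u t]
    by (auto simp: inner_diff_left uu)
  obtain k where k: "\<And>t. y' t \<bullet> ?u = k" using has_vector_derivative_zero_constant[of UNIV "\<lambda>t. y' t \<bullet> ?u"] a(2) by auto
  have "((\<lambda>t. y t \<bullet> ?u - k * t) has_vector_derivative 0) (at t)" for t
    using has_vector_derivative_diff[OF a(1) has_vector_derivative_mult_right[OF has_vector_derivative_id], of k t] by (simp add: k)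
  then obtain b where b: "\<And>t. y t \<bullet> ?u - k * t = b" using has_vector_derivative_zero_constant[of UNIV "\<lambda>t. y t \<bullet> ?u - k * t"] by auto
  \<comment> \<open>The component along the velocity is affine in time and vanishes at two times.
    What remains is orthogonal to the velocity and oscillates with frequency 1.\<close>
  have "k = 0" "b = 0" using b[of s] b[of t] y0 J(1) by auto
  then have yu: "y t \<bullet> ?u = 0" for t using b[of t] by simp
  have "y u = 0"
    by (rule harmonic_zero[of y y' s t u]) (use d yu y0 J(1) lt in auto)
  then have "J u = (\<lambda>_. 0)" using jacobi_field_expand[OF geo E J(2), of u] by (simp add: y_def[symmetric])
  then show False using J(5) by simp
qed

lemma unit_speedI:
  assumes "geod \<gamma>" "g (\<gamma> 0) (vel \<gamma> 0) (vel \<gamma> 0) = 1"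
  shows "ugeod \<gamma>"
  unfolding unit_speed_geodesic_def
  using assms parallel_inner_const[OF assms(1) cov_at_velocity[OF assms(1)] cov_at_velocity[OF assms(1)], where s=0] by simp

lemma constant_curvature_conjugate_radius:
  assumes cc: "constant_sectional_curvature A g 1" and compl: "complete_metric A g" and n: "CARD('n) \<ge> 2"
  shows "conjugate_radius A g = ereal pi"
proof (rule antisym)
  fix p :: 'a
  obtain i :: 'n where True by simp
  note e = orthonormal_frameD[OF frame_orthonormal, of p]
  obtain \<gamma> where geo: "geod \<gamma>" and "\<gamma> 0 = p" "vel \<gamma> 0 = fr p i"
    using compl e(1)[of i] unfolding complete_metric_def by blast
  then have \<gamma>: "ugeod \<gamma>" using e(2)[of i i] by (intro unit_speedI) auto
  obtain E where E: "parallel_frame \<gamma> E" using parallel_frame_exists[OF geo] by blast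
  \<comment> \<open>Here dimension at least 2 enters: a direction orthogonal to the velocity carries
    the Jacobi field sin t \<open>w\<close>, with zeros at 0 and \<pi>.\<close>
  obtain w where w: "w \<noteq> 0" "orthogonal (ucomp \<gamma> E) w"
    using orthogonal_to_vector_exists[of "ucomp \<gamma> E"] n by auto
  let ?y = "\<lambda>t. sin t *\<^sub>R w" and ?y' = "\<lambda>t. cos t *\<^sub>R w"
  have sol: "jacobi_solution (Kmat \<gamma> E) ?y ?y'"
    unfolding jacobi_solution_def
  proof (intro allI conjI)
    fix t
    show "(?y has_vector_derivative ?y' t) (at t)"
      by (auto intro!: derivative_eq_intros simp: DERIV_iff_vector[symmetric])
    have "(?y' has_vector_derivative - ?y t) (at t)"
      by (auto intro!: derivative_eq_intros simp: DERIV_iff_vector[symmetric])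
    then show "(?y' has_vector_derivative - (Kmat \<gamma> E t *v ?y t)) (at t)"
      using w by (simp add: constant_curvature_Kmat[OF cc \<gamma> E] orthogonal_def inner_commute)
  qed
  let ?J = "\<lambda>t c. \<Sum>i\<in>UNIV. ?y t $ i *\<^sub>R E i t c"
  have "jacobi_field A g \<gamma> ?J" by (rule jacobi_solution_field[OF geo E sol])
  moreover have "?J 0 = (\<lambda>_. 0)" "?J pi = (\<lambda>_. 0)" by auto
  moreover have "?J (pi / 2) \<noteq> (\<lambda>_. 0)"
  proof
    assume "?J (pi / 2) = (\<lambda>_. 0)"
    then have "?y (pi / 2) = 0" by (rule frame_comb_eq_0[OF geo E])
    then show False using w by simp
  qed
  ultimately have "conjugate_along A g \<gamma> 0 pi"
    unfolding conjugate_along_def using pi_neq_zero by (intro conjI exI[of _ ?J] exI[of _ "pi / 2"]) simp_all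
  then show "conjugate_radius A g \<le> ereal pi"
    unfolding conjugate_radius_def using \<gamma> by (intro Sup_least) fastforce
  show "ereal pi \<le> conjugate_radius A g"
    unfolding conjugate_radius_def using constant_curvature_conj_free[OF cc] by (intro Sup_upper) (auto simp: conj_free_def)
qed

end

section \<open>Riemannian volume\<close>

lemma suminf_swap_ennreal:
  fixes a :: "nat \<Rightarrow> nat \<Rightarrow> ennreal"
  shows "(\<Sum>k. \<Sum>i. a i k) = (\<Sum>i. \<Sum>k. a i k)"
  using nn_integral_suminf[of "\<lambda>i k. a i k" "count_space UNIV"]
  by (simp add: nn_integral_count_space_nat)

context riem
begin

definition dens where "dens c x = sqrt (det (G c x))"

lemma det_frame_square:
  assumes c: "c \<in> A" "p \<in> cdom c"
  shows "(det (fmat (fr p) c))\<^sup>2 * det (G c (cmap c p)) = 1"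
  using arg_cong[OF fmat_orthonormal(1)[OF frame_orthonormal c], of det]
  by (simp add: det_mul det_transpose power2_eq_square mult_ac)

lemma det_G_pos: assumes c: "c \<in> A" "x \<in> cimg c" shows "det (G c x) > 0"
  using det_frame_square[of c "cinv c x"] c by (simp add: chartD) (metis zero_less_mult_iff zero_less_one zero_le_power2 not_less)

lemma dens_pos: "c \<in> A \<Longrightarrow> x \<in> cimg c \<Longrightarrow> dens c x > 0"
  by (simp add: dens_def det_G_pos)

text \<open>An orthonormal frame spans a parallelepiped of volume 1.\<close>

lemma dens_frame:
  assumes c: "c \<in> A" "p \<in> cdom c"
  shows "dens c (cmap c p) * \<bar>det (fmat (fr p) c)\<bar> = 1"
  using arg_cong[OF det_frame_square[OF c], of sqrt] by (simp add: dens_def real_sqrt_mult mult.commute)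

lemma continuous_on_dens: "c \<in> A \<Longrightarrow> continuous_on (cimg c) (dens c)"
  unfolding dens_def[abs_def] by (intro continuous_intros C1_onD(4)[OF C1_on_det] G_C1)

lemma matrix_ip_transition:
  assumes c: "c \<in> A" "d \<in> A" "x \<in> overlap c d"
  shows "G c x = transpose (matrix (dtau c d x)) ** G d (\<tau> c d x) ** matrix (dtau c d x)"
proof -
  let ?M = "matrix (dtau c d x)"
  have M: "?M *v v = dtau c d x v" for v by (rule matrix_mult_linear[OF linear_dtau[OF c]])
  have "u \<bullet> (G c x *v v) = u \<bullet> ((transpose ?M ** G d (\<tau> c d x) ** ?M) *v v)" for u v
  proof -
    have "u \<bullet> (G c x *v v) = (?M *v u) \<bullet> (G d (\<tau> c d x) *v (?M *v v))"
      using ip_transition[OF c, of u v] by (simp only: M ip_def G_def)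
    also have "\<dots> = u \<bullet> (transpose ?M *v (G d (\<tau> c d x) *v (?M *v v)))"
      using dot_lmul_matrix[of "G d (\<tau> c d x) *v (?M *v v)" ?M u]
      by (simp only: transpose_matrix_vector inner_commute)
    finally show ?thesis by (simp only: matrix_vector_mul_assoc matrix_mul_assoc)
  qed
  then show ?thesis unfolding matrix_eq by (metis vector_eq_ldot)
qed

lemma dens_transition:
  assumes c: "c \<in> A" "d \<in> A" "x \<in> overlap c d"
  shows "dens c x = dens d (\<tau> c d x) * \<bar>det (matrix (dtau c d x))\<bar>"
  unfolding dens_def matrix_ip_transition[OF c]
  by (simp add: det_mul det_transpose real_sqrt_mult mult_ac)

text \<open>Extended by a constant so as to be Borel on the whole space; \<open>dens0\<close> gives
  weight 0 to the extension.\<close>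

definition chart_inv where "chart_inv c x = (if x \<in> cimg c then cinv c x else cinv c (SOME y. y \<in> cimg c))"

lemma measurable_chart_inv [measurable]: assumes "c \<in> A" shows "chart_inv c \<in> borel_measurable borel"
proof -
  have "(\<lambda>x. if x \<in> cimg c then cinv c x else cinv c (SOME y. y \<in> cimg c)) \<in> borel \<rightarrow>\<^sub>M borel"
    by (rule borel_measurable_continuous_on_if) (use chartD[OF assms] in auto)
  then show ?thesis by (simp add: chart_inv_def[abs_def])
qed

definition dens0 where "dens0 c x = (if x \<in> cimg c then ennreal (dens c x) else 0)"

lemma measurable_dens0 [measurable]: assumes "c \<in> A" shows "dens0 c \<in> borel_measurable borel"
proof -
  have "(\<lambda>x. if x \<in> cimg c then dens c x else 0) \<in> borel \<rightarrow>\<^sub>M borel"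
    by (rule borel_measurable_continuous_on_if) (use chartD[OF assms] continuous_on_dens[OF assms] in auto)
  then have "(\<lambda>x. ennreal (if x \<in> cimg c then dens c x else 0)) \<in> borel \<rightarrow>\<^sub>M borel" by measurable
  moreover have "(\<lambda>x. ennreal (if x \<in> cimg c then dens c x else 0)) = dens0 c" by (auto simp: dens0_def)
  ultimately show ?thesis by simp
qed

definition chart_vol where "chart_vol c = distr (density lborel (dens0 c)) borel (chart_inv c)"

lemma sets_chart_vol [simp, measurable_cong]: "sets (chart_vol c) = sets borel" by (simp add: chart_vol_def)
lemma space_chart_vol [simp]: "space (chart_vol c) = UNIV" by (simp add: chart_vol_def)

lemma nn_integral_chart_vol:
  assumes c: "c \<in> A" and h [measurable]: "h \<in> borel_measurable borel"
  shows "(\<integral>\<^sup>+p. h p \<partial>chart_vol c) = (\<integral>\<^sup>+x. dens0 c x * h (chart_inv c x) \<partial>lborel)"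
proof -
  note [measurable] = measurable_chart_inv[OF c] measurable_dens0[OF c]
  show ?thesis unfolding chart_vol_def by (simp add: nn_integral_distr nn_integral_density)
qed

lemma emeasure_chart_vol:
  assumes c: "c \<in> A" and "E \<in> sets borel"
  shows "emeasure (chart_vol c) E = (\<integral>\<^sup>+x. dens0 c x * indicator E (chart_inv c x) \<partial>lborel)"
  using nn_integral_chart_vol[OF c, of "indicator E"] assms(2) by simp

lemma emeasure_chart_vol_sub:
  assumes c: "c \<in> A" and E: "E \<in> sets borel" "E \<subseteq> cdom c"
  shows "emeasure (chart_vol c) E = (\<integral>\<^sup>+ x \<in> cmap c ` E. ennreal (sqrt (det (gram A g c x))) \<partial>lborel)"
proof -
  have "dens0 c x * indicator E (chart_inv c x) = ennreal (sqrt (det (gram A g c x))) * indicator (cmap c ` E) x" for x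
  proof (cases "x \<in> cimg c")
    case True
    then have "cinv c x \<in> E \<longleftrightarrow> x \<in> cmap c ` E" using E(2) by (auto simp: chartD[OF c] image_iff)
    then show ?thesis using True by (simp add: dens0_def chart_inv_def dens_def G_def indicator_def)
  next
    case False
    then have "x \<notin> cmap c ` E" using E(2) by auto
    with False show ?thesis by (simp add: dens0_def)
  qed
  then show ?thesis by (simp add: emeasure_chart_vol[OF c E(1)])
qed

text \<open>Change of variables: the Jacobian of the coordinate change compensates the change of
  density, by \<open>dens_transition\<close>.\<close>

lemma chart_vol_change:
  assumes c: "c \<in> A" "d \<in> A" and E: "E \<in> sets borel" "E \<subseteq> cdom c" "E \<subseteq> cdom d"
  shows "emeasure (chart_vol c) E = emeasure (chart_vol d) E"
proof -
  let ?S = "overlap c d" and ?u = "\<lambda>y. dens0 d y * indicator E (chart_inv d y)"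
  have img: "\<tau> c d ` ?S = overlap d c"
  proof safe
    fix y assume y: "y \<in> overlap d c"
    then have "\<tau> d c y \<in> ?S" "\<tau> c d (\<tau> d c y) = y" using c by (auto simp: transition_in transition_inverse)
    then show "y \<in> \<tau> c d ` ?S" by (metis imageI)
  qed (use c in \<open>auto simp: transition_in\<close>)
  note [measurable] = measurable_chart_inv[OF c(2)] measurable_dens0[OF c(2)] E(1)
  have u: "?u \<in> borel_measurable borel" by measurable
  have cov: "(\<integral>\<^sup>+y. ?u y * indicator (\<tau> c d ` ?S) y \<partial>lborel) =
         (\<integral>\<^sup>+x. ?u (\<tau> c d x) * ennreal \<bar>det (matrix (dtau c d x))\<bar> * indicator ?S x \<partial>lborel)"
  proof (rule nn_integral_change_of_variables)
    show "inj_on (\<tau> c d) ?S" using c by (intro inj_on_inverseI[of _ "\<tau> d c"] transition_inverse)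
    have "C1_on ?S (\<lambda>x. dtau c d x (axis j 1) $ i)" for i j
    proof (rule C1_onI)
      show "((\<lambda>x. dtau c d x (axis j 1) $ i) has_derivative (\<lambda>v. fd (\<lambda>x. dtau c d x (axis j 1)) x v $ i)) (at x)" if "x \<in> ?S" for x
        by (rule bounded_linear.has_derivative[OF bounded_linear_vec_nth C1_onD(2)[OF dtau_C1[OF c] that]])
      show "continuous_on ?S (\<lambda>x. fd (\<lambda>x. dtau c d x (axis j 1)) x v $ i)" for v
        by (intro continuous_intros C1_onD(3)[OF dtau_C1[OF c]])
    qed
    then show "continuous_on ?S (\<lambda>x. det (matrix (dtau c d x)))"
      by (intro C1_onD(4)[OF C1_on_det]) (simp add: matrix_def)
  qed (use c u in \<open>auto simp: open_overlap has_derivative_transition\<close>)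
  have "emeasure (chart_vol d) E = (\<integral>\<^sup>+y. ?u y * indicator (\<tau> c d ` ?S) y \<partial>lborel)"
    unfolding emeasure_chart_vol[OF c(2) E(1)]
  proof (rule nn_integral_cong)
    fix y
    show "?u y = ?u y * indicator (\<tau> c d ` ?S) y"
    proof (cases "y \<in> cimg d \<and> cinv d y \<in> E")
      case True
      then have "y \<in> overlap d c" using E(2) overlap_iff[OF c(2), of y c] by blast
      then show ?thesis by (simp add: img)
    next
      case False
      then show ?thesis by (auto simp: dens0_def chart_inv_def indicator_def)
    qed
  qed
  also have "\<dots> = emeasure (chart_vol c) E"
    unfolding cov emeasure_chart_vol[OF c(1) E(1)]
  proof (rule nn_integral_cong)
    fix x
    show "?u (\<tau> c d x) * ennreal \<bar>det (matrix (dtau c d x))\<bar> * indicator ?S x = dens0 c x * indicator E (chart_inv c x)"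
    proof (cases "x \<in> ?S")
      case True
      then have x: "x \<in> cimg c" "\<tau> c d x \<in> cimg d" "cinv d (\<tau> c d x) = cinv c x"
        using c transition_in[OF c True] overlap_iff by (auto simp: cinv_transition)
      then show ?thesis using True dens_pos[OF c(2) x(2)] dens_transition[OF c True]
        by (simp add: dens0_def chart_inv_def ennreal_mult[symmetric] mult_ac)
    next
      case False
      then have "\<not> (x \<in> cimg c \<and> cinv c x \<in> E)" using E(3) overlap_iff[OF c(1), of x d] by blast
      then show ?thesis using False by (auto simp: dens0_def chart_inv_def indicator_def)
    qed
  qed
  finally show ?thesis by simp
qed

lemma countable_charts: "\<exists>C :: nat \<Rightarrow> ('a, 'n) chart. (\<forall>k. C k \<in> A) \<and> (\<Union>k. cdom (C k)) = UNIV"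
proof -
  have "\<And>S. S \<in> cdom ` A \<Longrightarrow> open S" using chartD(1) by blast
  from Lindelof[OF this] obtain F' where F': "F' \<subseteq> cdom ` A" "countable F'" "\<Union>F' = \<Union>(cdom ` A)" .
  have U: "\<Union>F' = UNIV" using F'(3) atlas by (simp add: oriented_smooth_atlas_def)
  then have ne: "F' \<noteq> {}" by auto
  have "\<forall>k. \<exists>c. c \<in> A \<and> cdom c = from_nat_into F' k"
    using from_nat_into[OF ne] F'(1) by blast
  then obtain C where C: "\<And>k. C k \<in> A \<and> cdom (C k) = from_nat_into F' k" by metis
  have "(\<Union>k. cdom (C k)) = \<Union>(range (from_nat_into F'))" using C by auto
  also have "\<dots> = UNIV" using range_from_nat_into[OF ne F'(2)] U by simp
  finally show ?thesis using C by blast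
qed

definition cc :: "nat \<Rightarrow> ('a, 'n) chart" where
  "cc = (SOME C. (\<forall>k. C k \<in> A) \<and> (\<Union>k. cdom (C k)) = UNIV)"
text \<open>Disjoint Borel pieces covering the manifold, each inside one chart of the countable
  family \<open>cc\<close>; the volume is assembled from the chart volumes on them.\<close>

definition cell where "cell = disjointed (\<lambda>k. cdom (cc k))"

lemma cc: "cc k \<in> A" "(\<Union>k. cdom (cc k)) = UNIV"
  using someI_ex[OF countable_charts] unfolding cc_def by blast+

lemma cell: "cell k \<in> sets borel" "cell k \<subseteq> cdom (cc k)" "(\<Union>k. cell k) = UNIV" "disjoint_family cell"
proof -
  show "cell k \<in> sets borel" unfolding cell_def disjointed_def
    using chartD(1)[OF cc(1)] by (intro sets.Diff sets.finite_UN) auto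
  show "cell k \<subseteq> cdom (cc k)" unfolding cell_def by (rule disjointed_subset)
  show "(\<Union>k. cell k) = UNIV" unfolding cell_def using UN_disjointed_eq[of "\<lambda>k. cdom (cc k)"] cc(2) by simp
  show "disjoint_family cell" unfolding cell_def by (rule disjoint_family_disjointed)
qed

lemma suminf_emeasure_cell:
  assumes "sets M = sets borel" "E \<in> sets borel"
  shows "(\<Sum>k. emeasure M (E \<inter> cell k)) = emeasure M E"
proof -
  have "(\<Sum>k. emeasure M (E \<inter> cell k)) = emeasure M (\<Union>k. E \<inter> cell k)"
    by (rule suminf_emeasure) (use assms cell(1,4) in \<open>auto simp: disjoint_family_on_def, blast\<close>)
  also have "(\<Union>k. E \<inter> cell k) = E" using cell(3) by auto
  finally show ?thesis .
qed

definition is_volume where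
  "is_volume M \<longleftrightarrow> sets M = sets borel \<and>
        (\<forall>c\<in>A. \<forall>E\<in>sets borel. E \<subseteq> cdom c \<longrightarrow>
           emeasure M E = (\<integral>\<^sup>+ x \<in> cmap c ` E. ennreal (sqrt (det (gram A g c x))) \<partial>lborel))"

text \<open>The chart volumes of the cells are added up. On a set inside one chart domain,
  \<open>chart_vol_change\<close> replaces the chart of each cell by that chart, and the pieces sum
  to the prescribed integral.\<close>

lemma volume_exists: "\<exists>M. is_volume M"
proof -
  let ?\<mu> = "\<lambda>E. \<Sum>k. emeasure (chart_vol (cc k)) (E \<inter> cell k)"
  let ?M = "measure_of UNIV (sets borel) ?\<mu>"
  have sM: "sets ?M = sets borel" using sets.sigma_sets_eq[of "borel :: 'a measure"] by simp
  have eM: "emeasure ?M E = ?\<mu> E" if E: "E \<in> sets borel" for E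
  proof (rule emeasure_measure_of[OF refl])
    show "sets borel \<subseteq> Pow UNIV" by simp
    show "positive (sets ?M) ?\<mu>" by (simp add: positive_def)
    show "countably_additive (sets ?M) ?\<mu>"
      unfolding sM
    proof (rule countably_additiveI)
      fix D :: "nat \<Rightarrow> 'a set" assume D: "range D \<subseteq> sets borel" "disjoint_family D"
      have "?\<mu> (\<Union>(range D)) = (\<Sum>k. \<Sum>i. emeasure (chart_vol (cc k)) (D i \<inter> cell k))"
      proof (rule suminf_cong)
        fix k
        have "(\<Sum>i. emeasure (chart_vol (cc k)) (D i \<inter> cell k)) = emeasure (chart_vol (cc k)) (\<Union>i. D i \<inter> cell k)"
        proof (rule suminf_emeasure)
          show "range (\<lambda>i. D i \<inter> cell k) \<subseteq> sets (chart_vol (cc k))" using D(1) cell(1) by auto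
          show "disjoint_family (\<lambda>i. D i \<inter> cell k)" using D(2) unfolding disjoint_family_on_def by blast
        qed
        then show "emeasure (chart_vol (cc k)) (\<Union>(range D) \<inter> cell k) = (\<Sum>i. emeasure (chart_vol (cc k)) (D i \<inter> cell k))"
          by (simp add: Int_UN_distrib2)
      qed
      then show "(\<Sum>i. ?\<mu> (D i)) = ?\<mu> (\<Union>(range D))" by (simp add: suminf_swap_ennreal[of "\<lambda>i k. emeasure (chart_vol (cc k)) (D i \<inter> cell k)"])
    qed
    show "E \<in> sets ?M" using E sM by simp
  qed
  have "is_volume ?M"
    unfolding is_volume_def
  proof (intro conjI ballI impI sM)
    fix c E assume c: "c \<in> A" and E: "E \<in> sets borel" "E \<subseteq> cdom c"
    have "emeasure ?M E = (\<Sum>k. emeasure (chart_vol c) (E \<inter> cell k))"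
      unfolding eM[OF E(1)]
    proof (rule suminf_cong, rule chart_vol_change)
      show "E \<inter> cell k \<subseteq> cdom (cc k)" for k using cell(2)[of k] by blast
    qed (use cc(1) c E cell(1) in auto)
    then show "emeasure ?M E = (\<integral>\<^sup>+ x \<in> cmap c ` E. ennreal (sqrt (det (gram A g c x))) \<partial>lborel)"
      using emeasure_chart_vol_sub[OF c E] suminf_emeasure_cell[of "chart_vol c" E] E by simp
  qed
  then show ?thesis ..
qed

lemma volume_unique:
  assumes "is_volume M" "is_volume N" shows "M = N"
proof (rule measure_eqI)
  show s: "sets M = sets N" using assms by (simp add: is_volume_def)
  fix E assume "E \<in> sets M"
  then have E: "E \<in> sets borel" using assms by (simp add: is_volume_def)
  have "emeasure M (E \<inter> cell k) = emeasure N (E \<inter> cell k)" for k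
  proof -
    have "E \<inter> cell k \<in> sets borel" "E \<inter> cell k \<subseteq> cdom (cc k)" using E cell(1,2)[of k] by auto
    then show ?thesis using assms cc(1)[of k] unfolding is_volume_def by simp
  qed
  then have "(\<Sum>k. emeasure M (E \<inter> cell k)) = (\<Sum>k. emeasure N (E \<inter> cell k))" by simp
  then show "emeasure M E = emeasure N E" using assms E by (simp add: suminf_emeasure_cell is_volume_def)
qed

abbreviation V where "V \<equiv> riemannian_volume A g"

lemma volume: "is_volume V"
proof -
  have "V = (THE M. is_volume M)" unfolding riemannian_volume_def is_volume_def ..
  moreover have "\<exists>!M. is_volume M" using volume_exists volume_unique by blast
  ultimately show ?thesis using theI' by metis
qed

lemma sets_V [simp, measurable_cong]: "sets V = sets borel" using volume by (simp add: is_volume_def)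
lemma space_V [simp]: "space V = UNIV" using sets_eq_imp_space_eq[OF sets_V] by simp

lemma density_V:
  assumes c: "c \<in> A" shows "density V (indicator (cdom c)) = chart_vol c"
proof (rule measure_eqI)
  fix E assume "E \<in> sets (density V (indicator (cdom c)))"
  then have E [measurable]: "E \<in> sets borel" by simp
  have dm [measurable]: "cdom c \<in> sets borel" using chartD(1)[OF c] by simp
  have "emeasure (density V (indicator (cdom c))) E = emeasure V (E \<inter> cdom c)"
    by (subst emeasure_density) (auto simp: indicator_inter_arith[symmetric] Int_commute simp flip: nn_integral_indicator)
  also have "\<dots> = emeasure (chart_vol c) (E \<inter> cdom c)"
    using volume c emeasure_chart_vol_sub[OF c, of "E \<inter> cdom c"] unfolding is_volume_def by simp
  also have "\<dots> = emeasure (chart_vol c) E"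
    using c by (simp add: emeasure_chart_vol) (auto intro!: nn_integral_cong simp: dens0_def chart_inv_def indicator_def chartD)
  finally show "emeasure (density V (indicator (cdom c))) E = emeasure (chart_vol c) E" .
qed simp

lemma nn_integral_V_chart:
  assumes c: "c \<in> A" and [measurable]: "h \<in> borel_measurable borel"
  shows "(\<integral>\<^sup>+p. indicator (cdom c) p * h p \<partial>V) = (\<integral>\<^sup>+x. dens0 c x * h (chart_inv c x) \<partial>lborel)"
proof -
  have "cdom c \<in> sets borel" using chartD(1)[OF c] by simp
  then have [measurable]: "indicator (cdom c) \<in> borel_measurable V" by simp
  show ?thesis unfolding nn_integral_chart_vol[OF assms, symmetric] density_V[OF c, symmetric]
    by (subst nn_integral_density) auto
qed

section \<open>The measure on the tangent bundle\<close>

definition TMs :: "('a \<times> ('a, 'n) tvec) set" where "TMs = {(p, v). v \<in> TS p}"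
text \<open>Inverse of the bundle chart \<open>coords c\<close>: position and velocity recovered
  from their coordinates.\<close>

definition par :: "('a, 'n) chart \<Rightarrow> 'n phase \<Rightarrow> 'a \<times> ('a, 'n) tvec" where
  "par c z = (cinv c (fst z), tv c (cinv c (fst z)) (snd z))"
definition coords :: "('a, 'n) chart \<Rightarrow> 'a \<times> ('a, 'n) tvec \<Rightarrow> 'n phase" where
  "coords c w = (cmap c (fst w), snd w c)"
definition Tc :: "('a, 'n) chart \<Rightarrow> 'n phase set" where "Tc c = cimg c \<times> UNIV"
definition tm_sets where
  "tm_sets = {E. E \<subseteq> TMs \<and> (\<forall>c\<in>A. {z \<in> Tc c. par c z \<in> E} \<in> sets borel)}"

lemma open_Tc: "c \<in> A \<Longrightarrow> open (Tc c)"
  unfolding Tc_def by (intro open_Times chartD(2)) auto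

lemma Tc_borel [measurable]: "c \<in> A \<Longrightarrow> Tc c \<in> sets borel"
  using open_Tc by simp

lemma par_TMs: "c \<in> A \<Longrightarrow> z \<in> Tc c \<Longrightarrow> par c z \<in> TMs"
  by (auto simp: par_def TMs_def Tc_def chartD)

lemma coords_par [simp]: "c \<in> A \<Longrightarrow> z \<in> Tc c \<Longrightarrow> coords c (par c z) = z"
  by (auto simp: par_def coords_def Tc_def chartD)

lemma par_coords [simp]: "c \<in> A \<Longrightarrow> w \<in> TMs \<Longrightarrow> fst w \<in> cdom c \<Longrightarrow> par c (coords c w) = w"
  by (auto simp: par_def coords_def TMs_def chartD tvec_of_comp)

lemma coords_Tc: "fst w \<in> cdom c \<Longrightarrow> coords c w \<in> Tc c"
  by (auto simp: coords_def Tc_def)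

lemma fst_par: "c \<in> A \<Longrightarrow> z \<in> Tc c \<Longrightarrow> fst (par c z) \<in> cdom c"
  by (auto simp: par_def Tc_def chartD)

lemma sigma_algebra_tm: "sigma_algebra TMs tm_sets"
  unfolding sigma_algebra_iff2
proof (intro conjI ballI allI impI)
  show "tm_sets \<subseteq> Pow TMs" "{} \<in> tm_sets" by (auto simp: tm_sets_def)
  show "TMs - E \<in> tm_sets" if "E \<in> tm_sets" for E
  proof -
    have "{z \<in> Tc c. par c z \<in> TMs - E} = Tc c - {z \<in> Tc c. par c z \<in> E}" if "c \<in> A" for c
      using par_TMs[OF that] by auto
    then show ?thesis using that Tc_borel by (auto simp: tm_sets_def intro!: sets.Diff)
  qed
  show "(\<Union>i. D i) \<in> tm_sets" if "range D \<subseteq> tm_sets" for D :: "nat \<Rightarrow> _"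
  proof -
    have "{z \<in> Tc c. par c z \<in> (\<Union>i. D i)} = (\<Union>i. {z \<in> Tc c. par c z \<in> D i})" for c by auto
    moreover have "{z \<in> Tc c. par c z \<in> D i} \<in> sets borel" if "c \<in> A" for c i using that \<open>range D \<subseteq> tm_sets\<close> by (auto simp: tm_sets_def)
    ultimately show ?thesis using that by (auto simp: tm_sets_def)
  qed
qed

definition fib where "fib h p = (\<integral>\<^sup>+\<xi>. h (p, ff p \<xi>) \<partial>lborel)"

text \<open>The Liouville measure: volume of the base times Lebesgue measure of the fibres, which
  \<open>from_frame\<close> identifies with \<open>real^'n\<close>.\<close>

definition TM where
  "TM = measure_of TMs tm_sets (\<lambda>E. \<integral>\<^sup>+p. fib (indicator E) p \<partial>V)"

lemma space_TM [simp]: "space TM = TMs" and sets_TM: "sets TM = tm_sets"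
proof -
  have "tm_sets \<subseteq> Pow TMs" by (auto simp: tm_sets_def)
  then show "space TM = TMs" "sets TM = tm_sets"
    unfolding TM_def using sigma_algebra.sigma_sets_eq[OF sigma_algebra_tm] by (auto simp: space_measure_of)
qed

lemma measurable_par: assumes c: "c \<in> A" shows "par c \<in> measurable (restrict_space borel (Tc c)) TM"
proof (rule measurableI)
  show "par c z \<in> space TM" if "z \<in> space (restrict_space borel (Tc c))" for z
    using that par_TMs[OF c] by (simp add: space_restrict_space)
  fix E assume "E \<in> sets TM"
  then have "{z \<in> Tc c. par c z \<in> E} \<in> sets borel" using c by (simp add: sets_TM tm_sets_def)
  moreover have "par c -` E \<inter> space (restrict_space borel (Tc c)) = {z \<in> Tc c. par c z \<in> E}" by (auto simp: space_restrict_space)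
  ultimately show "par c -` E \<inter> space (restrict_space borel (Tc c)) \<in> sets (restrict_space borel (Tc c))"
    using c by (simp add: sets_restrict_space_iff)
qed

lemma measurable_TM_I:
  assumes f: "\<And>c. c \<in> A \<Longrightarrow> (\<lambda>z. f (par c z)) \<in> measurable (restrict_space borel (Tc c)) N"
  shows "f \<in> measurable TM N"
proof (rule measurableI)
  fix w assume "w \<in> space TM"
  then have w: "w \<in> TMs" by simp
  obtain c where c: "c \<in> A" "fst w \<in> cdom c" by (rule chart_around)
  have "coords c w \<in> Tc c" using coords_Tc[OF c(2)] .
  then have "f (par c (coords c w)) \<in> space N" using f[OF c(1)] by (intro measurable_space[OF f[OF c(1)]]) (simp add: space_restrict_space)
  then show "f w \<in> space N" using c w by simp
next
  fix E assume E: "E \<in> sets N"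
  have "{z \<in> Tc c. par c z \<in> f -` E \<inter> TMs} \<in> sets borel" if c: "c \<in> A" for c
  proof -
    have "{z \<in> Tc c. par c z \<in> f -` E \<inter> TMs} = (\<lambda>z. f (par c z)) -` E \<inter> space (restrict_space borel (Tc c))"
      using par_TMs[OF c] by (auto simp: space_restrict_space)
    moreover have "\<dots> \<in> sets (restrict_space borel (Tc c))" using measurable_sets[OF f[OF c] E] .
    ultimately show ?thesis using c by (simp add: sets_restrict_space_iff)
  qed
  then show "f -` E \<inter> space TM \<in> sets TM" by (auto simp: sets_TM tm_sets_def)
qed

definition chartfun where "chartfun c h z = h (par c z) * indicator (Tc c) z"

lemma measurable_chartfun:
  assumes c: "c \<in> A" and h: "h \<in> borel_measurable TM"
  shows "(chartfun c h :: _ \<Rightarrow> ennreal) \<in> borel_measurable borel"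
proof -
  have "(\<lambda>z. h (par c z)) \<in> borel_measurable (restrict_space borel (Tc c))"
    using measurable_comp[OF measurable_par[OF c] h] by (simp add: o_def)
  then show ?thesis unfolding chartfun_def[abs_def] using c
    by (subst (asm) borel_measurable_restrict_space_iff_ennreal) auto
qed

lemma from_frame_tvec:
  assumes c: "c \<in> A" "p \<in> cdom c"
  shows "ff p \<xi> = tv c p (fmat (fr p) c *v \<xi>)" "ff p \<xi> \<in> TS p"
proof -
  show t: "ff p \<xi> \<in> TS p"
    unfolding from_frame_def by (intro tangent_sum orthonormal_frameD(1)[OF frame_orthonormal])
  have "ff p \<xi> c = fmat (fr p) c *v \<xi>" by (simp add: from_frame_def fmat_mult)
  then show "ff p \<xi> = tv c p (fmat (fr p) c *v \<xi>)" using tvec_of_comp[OF t c] by simp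
qed

lemma pair_from_frame:
  assumes c: "c \<in> A" "p \<in> cdom c"
  shows "(p, ff p \<xi>) = par c (cmap c p, fmat (fr p) c *v \<xi>)"
  using c by (simp add: par_def from_frame_tvec[OF c] chartD)

lemma measurable_fibre:
  assumes h: "h \<in> borel_measurable TM"
  shows "(\<lambda>\<xi>. h (p, ff p \<xi>) :: ennreal) \<in> borel_measurable borel"
proof -
  obtain c where c: "c \<in> A" "p \<in> cdom c" by (rule chart_around)
  have "h (p, ff p \<xi>) = chartfun c h (cmap c p, fmat (fr p) c *v \<xi>)" for \<xi>
    using c by (simp add: pair_from_frame[OF c] chartfun_def Tc_def)
  moreover have "(\<lambda>\<xi>. chartfun c h (cmap c p, fmat (fr p) c *v \<xi>)) \<in> borel_measurable borel"
    by (rule measurable_compose[OF _ measurable_chartfun[OF c(1) h]])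
       (intro borel_measurable_continuous_onI continuous_intros)
  ultimately show ?thesis by simp
qed

text \<open>Linear substitution by the matrix of the frame, whose determinant is the inverse of the
  volume density up to sign.\<close>

lemma fib_chart:
  assumes c: "c \<in> A" "p \<in> cdom c" and h: "h \<in> borel_measurable TM"
  shows "fib h p = dens0 c (cmap c p) * (\<integral>\<^sup>+y. chartfun c h (cmap c p, y) \<partial>lborel)"
proof -
  let ?B = "fmat (fr p) c" and ?x = "cmap c p"
  let ?u = "\<lambda>y. chartfun c h (?x, y)"
  have x: "?x \<in> cimg c" using c by simp
  have dB: "det ?B \<noteq> 0" using fmat_orthonormal(3)[OF frame_orthonormal c] .
  have u: "?u \<in> borel_measurable borel"
    by (rule measurable_compose[OF _ measurable_chartfun[OF c(1) h]]) (intro borel_measurable_continuous_onI continuous_intros)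
  have lin: "linear ((*v) ?B)" by simp
  have "inj ((*v) ?B)"
    using dB by (simp add: inj_matrix_vector_mult invertible_det_nz)
  then have surj: "range ((*v) ?B) = UNIV" using linear_injective_imp_surjective[OF lin] by simp
  have "(\<integral>\<^sup>+y. ?u y \<partial>lborel) = (\<integral>\<^sup>+y. ?u y * indicator (range ((*v) ?B)) y \<partial>lborel)" by (simp add: surj)
  also have "\<dots> = (\<integral>\<^sup>+\<xi>. ?u (?B *v \<xi>) * ennreal \<bar>det (matrix ((*v) ?B))\<bar> * indicator UNIV \<xi> \<partial>lborel)"
    by (rule nn_integral_change_of_variables[OF open_UNIV _ _ _ u])
       (use \<open>inj ((*v) ?B)\<close> lin in \<open>auto intro: linear_imp_has_derivative\<close>)
  also have "\<dots> = ennreal \<bar>det ?B\<bar> * fib h p"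
    unfolding fib_def using c x measurable_fibre[OF h, of p]
    by (subst nn_integral_cmult[symmetric]) (auto intro!: nn_integral_cong simp: pair_from_frame[OF c] chartfun_def Tc_def mult.commute)
  finally have "dens0 c ?x * (\<integral>\<^sup>+y. ?u y \<partial>lborel) = (dens0 c ?x * ennreal \<bar>det ?B\<bar>) * fib h p" by (simp add: mult.assoc)
  also have "dens0 c ?x * ennreal \<bar>det ?B\<bar> = 1"
    using dens_frame[OF c] dens_pos[OF c(1) x] x by (simp add: dens0_def ennreal_mult[symmetric])
  finally show ?thesis by simp
qed

text \<open>The frame is chosen separately at every point, with no regularity in the base point.
  Measurability is drawn from the expression in \<open>fib_chart\<close>, which contains no
  frame.\<close>

lemma measurable_fib: assumes h: "h \<in> borel_measurable TM" shows "fib h \<in> borel_measurable V"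
proof -
  have "fib h \<in> borel_measurable borel"
  proof (rule measurable_piecewise_restrict[of "range (\<lambda>k. cdom (cc k))"])
    show "D \<inter> space borel \<in> sets borel" if "D \<in> range (\<lambda>k. cdom (cc k))" for D
      using that chartD(1)[OF cc(1)] by auto
    show "space borel \<subseteq> \<Union> (range (\<lambda>k. cdom (cc k)))" using cc(2) by simp
    fix D assume "D \<in> range (\<lambda>k. cdom (cc k))"
    then obtain k where D: "D = cdom (cc k)" by auto
    let ?c = "cc k"
    note c = cc(1)[of k]
    note [measurable] = measurable_dens0[OF c] measurable_chartfun[OF c h]
    have "(\<lambda>x. \<integral>\<^sup>+y. chartfun ?c h (x, y) \<partial>lborel) \<in> borel_measurable borel"
      using measurable_chartfun[OF c h] unfolding borel_prod[symmetric]
      by (intro lborel.borel_measurable_nn_integral) (simp add: split_beta')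
    then have "(\<lambda>x. dens0 ?c x * (\<integral>\<^sup>+y. chartfun ?c h (x, y) \<partial>lborel)) \<in> borel_measurable borel" by measurable
    from measurable_comp[OF borel_measurable_continuous_on_restrict[OF chartD(6)[OF c]] this]
    show "fib h \<in> borel_measurable (restrict_space borel D)"
      unfolding D
      by (rule measurable_cong[THEN iffD1, rotated]) (simp add: space_restrict_space fib_chart[OF c _ h])
  qed auto
  then show ?thesis by simp
qed

lemma emeasure_TM: assumes E: "E \<in> sets TM" shows "emeasure TM E = (\<integral>\<^sup>+p. fib (indicator E) p \<partial>V)"
proof (rule emeasure_measure_of[OF TM_def])
  show "tm_sets \<subseteq> Pow TMs" by (auto simp: tm_sets_def)
  show "positive (sets TM) (\<lambda>E. \<integral>\<^sup>+p. fib (indicator E) p \<partial>V)" by (simp add: positive_def fib_def)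
  show "countably_additive (sets TM) (\<lambda>E. \<integral>\<^sup>+p. fib (indicator E) p \<partial>V)"
  proof (rule countably_additiveI)
    fix D :: "nat \<Rightarrow> _" assume D: "range D \<subseteq> sets TM" "disjoint_family D" "(\<Union>i. D i) \<in> sets TM"
    have m: "indicator (D i) \<in> borel_measurable TM" for i using D by auto
    have "(\<Sum>i. \<integral>\<^sup>+p. fib (indicator (D i)) p \<partial>V) = (\<integral>\<^sup>+p. (\<Sum>i. fib (indicator (D i)) p) \<partial>V)"
      by (rule nn_integral_suminf[symmetric]) (rule measurable_fib[OF m])
    also have "\<dots> = (\<integral>\<^sup>+p. fib (indicator (\<Union>i. D i)) p \<partial>V)"
      using D(2) unfolding fib_def
      by (intro nn_integral_cong, subst nn_integral_suminf[symmetric])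
         (auto intro!: nn_integral_cong measurable_fibre m simp: suminf_indicator)
    finally show "(\<Sum>i. \<integral>\<^sup>+p. fib (indicator (D i)) p \<partial>V) = (\<integral>\<^sup>+p. fib (indicator (\<Union>i. D i)) p \<partial>V)" .
  qed
qed (rule E)

lemma nn_integral_TM:
  assumes f: "f \<in> borel_measurable TM"
  shows "(\<integral>\<^sup>+w. f w \<partial>TM) = (\<integral>\<^sup>+p. fib f p \<partial>V)"
  using f
proof (induction f rule: borel_measurable_induct)
  case (cong f h)
  have "fib f p = fib h p" for p
  proof -
    obtain c where c: "c \<in> A" "p \<in> cdom c" by (rule chart_around)
    have "(p, ff p \<xi>) \<in> space TM" for \<xi> using from_frame_tvec(2)[OF c] by (simp add: TMs_def)
    then show ?thesis using cong unfolding fib_def by (intro nn_integral_cong) auto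
  qed
  moreover have "(\<integral>\<^sup>+w. f w \<partial>TM) = (\<integral>\<^sup>+w. h w \<partial>TM)" using cong by (intro nn_integral_cong) auto
  ultimately show ?case using cong by simp
next
  case (set E)
  then show ?case by (simp add: emeasure_TM)
next
  case (mult u c)
  have "fib (\<lambda>x. c * u x) p = c * fib u p" for p
    unfolding fib_def using measurable_fibre[OF mult(2)] by (intro nn_integral_cmult) auto
  then show ?case using mult by (simp add: nn_integral_cmult measurable_fib)
next
  case (add u v)
  have "fib (\<lambda>x. v x + u x) p = fib v p + fib u p" for p
  proof -
    have "u \<in> borel_measurable TM" "v \<in> borel_measurable TM" using add by auto
    from measurable_fibre[OF this(1), of p] measurable_fibre[OF this(2), of p]
    show ?thesis unfolding fib_def by (intro nn_integral_add) auto
  qed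
  then show ?case using add by (simp add: nn_integral_add measurable_fib)
next
  case (seq U)
  have U: "incseq U" "\<And>i. U i \<in> borel_measurable TM" using seq by auto
  then have inc: "incseq (\<lambda>i. U i w)" for w unfolding incseq_def le_fun_def by blast
  have sa: "(SUP i. U i) w = (SUP i. U i w)" for w by (metis SUP_apply)
  have "fib (SUP i. U i) p = (SUP i. fib (U i) p)" for p
  proof -
    have "fib (SUP i. U i) p = (\<integral>\<^sup>+\<xi>. (SUP i. U i (p, ff p \<xi>)) \<partial>lborel)"
      unfolding fib_def sa ..
    also have "\<dots> = (SUP i. fib (U i) p)" unfolding fib_def
      using inc measurable_fibre[OF U(2)] by (intro nn_integral_monotone_convergence_SUP) (auto simp: incseq_def le_fun_def)
    finally show ?thesis .
  qed
  moreover have "incseq (\<lambda>i. fib (U i))"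
    using inc unfolding fib_def by (auto simp: incseq_def le_fun_def intro!: nn_integral_mono)
  ultimately have e1: "(\<integral>\<^sup>+p. fib (SUP i. U i) p \<partial>V) = (SUP i. \<integral>\<^sup>+p. fib (U i) p \<partial>V)"
    using measurable_fib[OF U(2)] by (simp add: nn_integral_monotone_convergence_SUP)
  have e2: "(\<integral>\<^sup>+w. (SUP i. U i) w \<partial>TM) = (SUP i. \<integral>\<^sup>+w. U i w \<partial>TM)"
    unfolding sa using U by (intro nn_integral_monotone_convergence_SUP) auto
  have "(\<integral>\<^sup>+w. U i w \<partial>TM) = (\<integral>\<^sup>+p. fib (U i) p \<partial>V)" for i using seq by blast
  then show ?case unfolding e1 using e2 by (simp only: seq)
qed

definition rho :: "('a, 'n) chart \<Rightarrow> 'n phase \<Rightarrow> ennreal" where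
  "rho c z = dens0 c (fst z) * dens0 c (fst z)"

lemma measurable_rho: assumes c: "c \<in> A" shows "rho c \<in> borel_measurable borel"
proof -
  have "(\<lambda>z::'n phase. dens0 c (fst z)) \<in> borel_measurable borel"
    by (rule measurable_compose[OF _ measurable_dens0[OF c]]) (intro borel_measurable_continuous_onI continuous_intros)
  then show ?thesis unfolding rho_def[abs_def] by (intro borel_measurable_times_ennreal)
qed

lemma rho_eq: "c \<in> A \<Longrightarrow> fst z \<in> cimg c \<Longrightarrow> rho c z = ennreal (det (G c (fst z)))"
  using det_G_pos[of c "fst z"] by (simp add: rho_def dens0_def dens_def ennreal_mult[symmetric] less_imp_le)

text \<open>Of the two factors in \<open>rho\<close>, one is the volume density of the base and the
  other comes from \<open>fib_chart\<close>; their product is \<open>det G\<close>.\<close>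

lemma nn_integral_TM_chart:
  assumes f: "f \<in> borel_measurable TM" and c: "c \<in> A" and supp: "\<And>w. w \<in> TMs \<Longrightarrow> fst w \<notin> cdom c \<Longrightarrow> f w = 0"
  shows "(\<integral>\<^sup>+w. f w \<partial>TM) = (\<integral>\<^sup>+z. rho c z * chartfun c f z \<partial>lborel)"
proof -
  note [measurable] = measurable_dens0[OF c] measurable_chartfun[OF c f]
  have 0: "fib f p = indicator (cdom c) p * fib f p" for p
  proof (cases "p \<in> cdom c")
    case False
    obtain d where d: "d \<in> A" "p \<in> cdom d" by (rule chart_around)
    have "(p, ff p \<xi>) \<in> TMs" for \<xi> using from_frame_tvec(2)[OF d] by (simp add: TMs_def)
    then have "fib f p = 0" using supp False unfolding fib_def by simp
    then show ?thesis by simp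
  qed simp
  have "(\<integral>\<^sup>+w. f w \<partial>TM) = (\<integral>\<^sup>+p. indicator (cdom c) p * fib f p \<partial>V)"
    unfolding nn_integral_TM[OF f] by (rule nn_integral_cong) (rule 0)
  also have "\<dots> = (\<integral>\<^sup>+x. dens0 c x * fib f (chart_inv c x) \<partial>lborel)"
    using measurable_fib[OF f] by (intro nn_integral_V_chart[OF c]) simp
  also have "\<dots> = (\<integral>\<^sup>+x. \<integral>\<^sup>+y. dens0 c x * dens0 c x * chartfun c f (x, y) \<partial>lborel \<partial>lborel)"
  proof (rule nn_integral_cong)
    fix x
    have "(\<lambda>y. chartfun c f (x, y)) \<in> borel_measurable borel"
      by (rule measurable_compose[OF _ measurable_chartfun[OF c f]]) (intro borel_measurable_continuous_onI continuous_intros)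
    then have m: "(\<lambda>y. chartfun c f (x, y)) \<in> borel_measurable lborel" by simp
    show "dens0 c x * fib f (chart_inv c x) = (\<integral>\<^sup>+y. dens0 c x * dens0 c x * chartfun c f (x, y) \<partial>lborel)"
    proof (cases "x \<in> cimg c")
      case True
      then show ?thesis using fib_chart[OF c _ f, of "cinv c x"] m
        by (simp add: chart_inv_def chartD[OF c] nn_integral_cmult mult.assoc)
    next
      case False
      then show ?thesis by (simp add: dens0_def)
    qed
  qed
  also have "\<dots> = (\<integral>\<^sup>+z. rho c z * chartfun c f z \<partial>(lborel \<Otimes>\<^sub>M lborel))"
  proof (subst lborel.nn_integral_fst[symmetric])
    have "(\<lambda>z. rho c z * chartfun c f z) \<in> borel_measurable borel"
      by (intro borel_measurable_times_ennreal measurable_rho measurable_chartfun c f)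
    then show "(\<lambda>z. rho c z * chartfun c f z) \<in> borel_measurable (lborel \<Otimes>\<^sub>M lborel)"
      by (simp add: lborel_prod)
  qed (simp add: rho_def)
  finally show ?thesis by (simp add: lborel_prod)
qed

end

section \<open>A discrete step of the geodesic flow\<close>

text \<open>A permutation other than the identity moves at least two indices, so each term of its
  derivative keeps an off-diagonal entry of the identity matrix as a factor.\<close>

lemma det_derivative_identity:
  fixes P :: "real \<Rightarrow> real^'n^'n"
  assumes P0: "P t = mat 1" and d: "\<And>i j. ((\<lambda>s. P s $ i $ j) has_real_derivative M $ i $ j) (at t)"
  shows "((\<lambda>s. det (P s)) has_real_derivative trace M) (at t)"
proof -
  let ?S = "{p. p permutes (UNIV :: 'n set)}"
  let ?T = "\<lambda>p. \<Sum>i\<in>UNIV. M $ i $ p i * (\<Prod>j\<in>UNIV - {i}. P t $ j $ p j)"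
  have "((\<lambda>s. \<Sum>p\<in>?S. of_int (sign p) * (\<Prod>i\<in>UNIV. P s $ i $ p i)) has_real_derivative
     (\<Sum>p\<in>?S. of_int (sign p) * ?T p)) (at t)"
    by (intro DERIV_sum DERIV_cmult has_field_derivative_prod d)
  moreover have "(\<Sum>p\<in>?S. of_int (sign p) * ?T p) = (\<Sum>p\<in>{id}. of_int (sign p) * ?T p)"
  proof (rule sum.mono_neutral_right)
    show "finite ?S" by (simp add: finite_permutations)
    show "{id} \<subseteq> ?S" by (simp add: permutes_id)
    show "\<forall>p\<in>?S - {id}. of_int (sign p) * ?T p = 0"
    proof
      fix p assume p: "p \<in> ?S - {id}"
      then obtain a where a: "p a \<noteq> a" by (auto simp: fun_eq_iff)
      have inj: "inj p" using p permutes_inj by auto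
      have z: "(\<Prod>j\<in>UNIV - {i}. P t $ j $ p j) = 0" for i
      proof (cases "i = a")
        case True
        have "p (p a) \<noteq> p a" using a inj by (auto dest: injD)
        then have "P t $ (p a) $ p (p a) = 0" "p a \<in> UNIV - {i}" using a True by (auto simp: P0 mat_def)
        then show ?thesis by (intro prod_zero) auto
      next
        case False
        then have "P t $ a $ p a = 0" "a \<in> UNIV - {i}" using a by (auto simp: P0 mat_def)
        then show ?thesis by (intro prod_zero) auto
      qed
      show "of_int (sign p) * ?T p = 0" by (simp only: z mult_zero_right sum.neutral_const)
    qed
  qed
  moreover have "?T id = trace M" by (simp add: P0 mat_def trace_def)
  ultimately show ?thesis by (simp add: det_def)
qed

text \<open>Jacobi's formula, reduced to the identity matrix by splitting off the factor
  \<open>P t\<close>.\<close>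

lemma det_derivative_path:
  fixes P :: "real \<Rightarrow> real^'n^'n"
  assumes nz: "det (P t) \<noteq> 0" and d: "\<And>i j. ((\<lambda>s. P s $ i $ j) has_real_derivative M $ i $ j) (at t)"
  shows "((\<lambda>s. det (P s)) has_real_derivative det (P t) * trace (matrix_inv (P t) ** M)) (at t)"
proof -
  have "((\<lambda>s. det (matrix_inv (P t) ** P s)) has_real_derivative trace (matrix_inv (P t) ** M)) (at t)"
  proof (rule det_derivative_identity)
    show "matrix_inv (P t) ** P t = mat 1" by (rule matrix_inv_mult(2)[OF nz])
    show "((\<lambda>s. (matrix_inv (P t) ** P s) $ i $ j) has_real_derivative (matrix_inv (P t) ** M) $ i $ j) (at t)" for i j
      unfolding matrix_matrix_mult_def by (simp, intro DERIV_sum DERIV_cmult d)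
  qed
  from DERIV_cmult[OF this, of "det (P t)"]
  have "((\<lambda>s. det (P t) * det (matrix_inv (P t) ** P s)) has_real_derivative det (P t) * trace (matrix_inv (P t) ** M)) (at t)" .
  moreover have "det (P t) * det (matrix_inv (P t) ** P s) = det (P s)" for s
  proof -
    have "det (P t) * det (matrix_inv (P t)) = 1" using matrix_inv_mult(1)[OF nz] det_mul[of "P t" "matrix_inv (P t)"] by simp
    then show ?thesis by (simp add: det_mul)
  qed
  ultimately show ?thesis by simp
qed

context riem
begin

definition Gmat where "Gmat c x y = matrix (Gam c x y)"

text \<open>The step map \<open>(x, y) \<mapsto> (x + h \<eta>, \<eta>)\<close> with \<open>\<eta> = y - h \<Gamma>\<^sub>x(y, y)\<close>
  approximates the geodesic flow; \<open>step_weight\<close> is the density of the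
  pull-back of the measure \<open>det G dx dy\<close> under it.\<close>

definition eta where "eta c h z = snd z - h *\<^sub>R Gam c (fst z) (snd z) (snd z)"
definition step_map where "step_map c h z = (fst z + h *\<^sub>R eta c h z, eta c h z)"
definition step_weight where
  "step_weight c q = det (G c (fst (step_map c (fst q) (snd q)))) * det (mat 1 - (2 * fst q) *\<^sub>R Gmat c (fst (snd q)) (snd (snd q)))"
definition step_dom where
  "step_dom c = {q :: real \<times> 'n phase. fst (snd q) \<in> cimg c \<and> fst (step_map c (fst q) (snd q)) \<in> cimg c}"

lemma C1_Gam_q:
  assumes c: "c \<in> A"
  shows "C1_on (UNIV \<times> cimg c \<times> UNIV) (\<lambda>q :: real \<times> 'n phase. Gam c (fst (snd q)) (snd (snd q)) (snd (snd q)))"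
    "C1_on (UNIV \<times> cimg c \<times> UNIV) (\<lambda>q :: real \<times> 'n phase. Gmat c (fst (snd q)) (snd (snd q)) $ i $ j)"
proof -
  let ?U = "UNIV \<times> cimg c \<times> UNIV :: (real \<times> 'n phase) set"
  have x: "C1_on ?U (\<lambda>q. christoffel A g c k i j (fst (snd q)))" for k i j
    by (rule C1_on_compose[OF C1_on_linear christoffel_C1[OF c]])
       (auto intro!: bounded_linear_compose[OF bounded_linear_fst bounded_linear_snd])
  have y: "C1_on ?U (\<lambda>q. snd (snd q) $ i)" for i
    by (rule C1_on_linear)
       (intro bounded_linear_compose[OF bounded_linear_vec_nth] bounded_linear_compose[OF bounded_linear_snd bounded_linear_snd])
  show "C1_on ?U (\<lambda>q. Gam c (fst (snd q)) (snd (snd q)) (snd (snd q)))"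
    unfolding Gam_def by (intro C1_on_vec C1_on_sum C1_on_mult x y)
  have "Gmat c x y $ i $ j = (\<Sum>a\<in>UNIV. y $ a * christoffel A g c i a j x)" for x y
  proof -
    have "Gam c x y (axis j 1) = (\<Sum>a\<in>UNIV. y $ a *\<^sub>R Gam c x (axis a 1) (axis j 1))"
      by (rule linear_axis_sum[OF Gam_linear(2)])
    then show ?thesis by (simp add: Gmat_def matrix_def Gam_axis)
  qed
  then show "C1_on ?U (\<lambda>q. Gmat c (fst (snd q)) (snd (snd q)) $ i $ j)"
    by (simp only:) (intro C1_on_sum C1_on_mult x y)
qed

lemma C1_step:
  assumes c: "c \<in> A"
  shows "C1_on (UNIV \<times> cimg c \<times> UNIV) (\<lambda>q. eta c (fst q) (snd q))"
    "C1_on (UNIV \<times> cimg c \<times> UNIV) (\<lambda>q. step_map c (fst q) (snd q))"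
proof -
  let ?U = "UNIV \<times> cimg c \<times> UNIV :: (real \<times> 'n phase) set"
  have lin: "C1_on ?U fst" "C1_on ?U (\<lambda>q. fst (snd q))" "C1_on ?U (\<lambda>q. snd (snd q))"
    by (auto intro!: C1_on_linear bounded_linear_fst bounded_linear_compose[OF bounded_linear_fst bounded_linear_snd]
        bounded_linear_compose[OF bounded_linear_snd bounded_linear_snd])
  have sc: "C1_on ?U (\<lambda>q. f q *\<^sub>R v q)" if "C1_on ?U f" "C1_on ?U v" for f and v :: "_ \<Rightarrow> real^'n"
    by (rule C1_onI[where f'="\<lambda>x h. f x *\<^sub>R fd v x h + fd f x h *\<^sub>R v x"])
       (auto intro!: derivative_eq_intros continuous_intros C1_onD(2-)[OF that(1)] C1_onD(2-)[OF that(2)])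
  show e: "C1_on ?U (\<lambda>q. eta c (fst q) (snd q))"
    unfolding eta_def by (intro C1_on_diff sc lin C1_Gam_q c)
  show "C1_on ?U (\<lambda>q. step_map c (fst q) (snd q))"
    unfolding step_map_def by (intro C1_on_Pair C1_on_add sc lin e)
qed

lemma open_step_dom: assumes c: "c \<in> A" shows "open (step_dom c)"
proof -
  let ?U = "UNIV \<times> cimg c \<times> UNIV :: (real \<times> 'n phase) set"
  have "open ?U" by (intro open_Times chartD(2)[OF c] open_UNIV)
  moreover have "continuous_on ?U (\<lambda>q. fst (step_map c (fst q) (snd q)))"
    by (intro continuous_on_fst C1_onD(4)[OF C1_step(2)[OF c]])
  ultimately have "open ((\<lambda>q. fst (step_map c (fst q) (snd q))) -` cimg c \<inter> ?U)"
    using chartD(2)[OF c] by (simp add: continuous_on_open_vimage)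
  moreover have "(\<lambda>q. fst (step_map c (fst q) (snd q))) -` cimg c \<inter> ?U = step_dom c" by (auto simp: step_dom_def)
  ultimately show ?thesis by simp
qed

lemma C1_step_weight: assumes c: "c \<in> A" shows "C1_on (step_dom c) (step_weight c)"
proof -
  have sub: "step_dom c \<subseteq> UNIV \<times> cimg c \<times> UNIV" by (auto simp: step_dom_def)
  have 1: "C1_on (step_dom c) (\<lambda>q. fst (step_map c (fst q) (snd q)))"
    by (rule C1_on_compose[OF C1_on_subset[OF C1_step(2)[OF c] sub] C1_on_linear[OF bounded_linear_fst], of UNIV]) simp
  have 2: "C1_on (step_dom c) (\<lambda>q. G c (fst (step_map c (fst q) (snd q))) $ i $ j)" for i j
    by (rule C1_on_compose[OF 1 G_C1[OF c]]) (auto simp: step_dom_def)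
  have 3: "C1_on (step_dom c) (\<lambda>q. (mat 1 - (2 * fst q) *\<^sub>R Gmat c (fst (snd q)) (snd (snd q))) $ i $ j)" for i j
    by (simp, intro C1_on_diff C1_on_mult C1_on_const C1_on_linear[OF bounded_linear_fst] C1_on_subset[OF C1_Gam_q(2)[OF c] sub])
  show ?thesis unfolding step_weight_def[abs_def]
    by (intro C1_on_mult C1_on_det 2 3)
qed

lemma step_map_0 [simp]: "step_map c 0 z = z" "eta c 0 z = snd z"
  by (simp_all add: step_map_def eta_def)

lemma step_weight_0: "step_weight c (0, z) = det (G c (fst z))"
  by (simp add: step_weight_def)

text \<open>The infinitesimal form of Liouville's theorem: \<open>det G\<close> along the step
  contributes twice the trace of \<open>Gmat\<close>, the Jacobian of the velocity update minus the
  same amount.\<close>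

lemma step_weight_derivative:
  assumes c: "c \<in> A" and z: "fst z \<in> cimg c"
  shows "fd (step_weight c) (0, z) (1, 0) = 0"
proof -
  let ?x = "fst z" and ?y = "snd z"
  note cx = c z
  let ?\<Gamma> = "Gmat c ?x ?y" and ?G = "G c ?x"
  have q: "(0, z) \<in> step_dom c" using z by (simp add: step_dom_def)
  have path: "((\<lambda>h. (h, z)) has_derivative (\<lambda>k. (k, 0))) (at 0)"
    by (auto intro!: derivative_eq_intros)
  note dW = C1_onD(2)[OF C1_step_weight[OF c] q]
  have e: "(\<lambda>k. fd (step_weight c) (0, z) (k, 0)) = (*) (fd (step_weight c) (0, z) (1, 0))"
  proof
    fix k show "fd (step_weight c) (0, z) (k, 0) = fd (step_weight c) (0, z) (1, 0) * k"
      using linear_cmul[OF has_derivative_linear[OF dW], of k "(1, 0)"] by (simp add: mult.commute)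
  qed
  have D: "((\<lambda>h. step_weight c (h, z)) has_real_derivative fd (step_weight c) (0, z) (1, 0)) (at 0)"
    using has_derivative_compose[OF path dW] unfolding has_field_derivative_def e .
  define M where "M = (\<chi> i j. dip c ?x ?y (axis i 1) (axis j 1))"
  have "((\<lambda>h. det (G c (fst (step_map c h z)))) has_real_derivative
      det (G c (fst (step_map c 0 z))) * trace (matrix_inv (G c (fst (step_map c 0 z))) ** M)) (at 0)"
  proof (rule det_derivative_path)
    show "det (G c (fst (step_map c 0 z))) \<noteq> 0" using det_G_nz[OF cx] by simp
    fix i j
    have 1: "((\<lambda>h. fst (step_map c h z)) has_derivative (\<lambda>k. k *\<^sub>R ?y)) (at 0)"
      unfolding step_map_def eta_def by (auto intro!: derivative_eq_intros)
    have this': "((\<lambda>x. G c x $ i $ j) has_derivative (\<lambda>w. dip c ?x w (axis i 1) (axis j 1))) (at (fst (step_map c 0 z)))"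
      using has_derivative_ip(1)[OF cx, of "axis i 1" "axis j 1"]
      by (simp add: ip_def G_def inner_axis' matrix_vector_mult_basis column_def)
    have "(\<lambda>k. dip c ?x (k *\<^sub>R ?y) (axis i 1) (axis j 1)) = (*) (M $ i $ j)"
      by (simp add: fun_eq_iff M_def linear_cmul[OF dip_linear(1)[OF cx]])
    then show "((\<lambda>h. G c (fst (step_map c h z)) $ i $ j) has_real_derivative M $ i $ j) (at 0)"
      using has_derivative_compose[OF 1 this'] unfolding has_field_derivative_def by simp
  qed
  moreover have "trace (matrix_inv ?G ** M) = 2 * trace ?\<Gamma>"
  proof -
    have Gv: "Gam c ?x ?y v = ?\<Gamma> *v v" for v unfolding Gmat_def by (rule matrix_mult_linear[OF Gam_linear(1), symmetric])
    \<comment> \<open>Metric compatibility in matrix form. After multiplication by the inverse of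
      \<open>G\<close>, both summands have the trace of \<open>?\<Gamma>\<close>.\<close>
    have "M = transpose ?\<Gamma> ** ?G + ?G ** ?\<Gamma>"
    proof -
      have "ip c ?x (?\<Gamma> *v axis i 1) (axis j 1) = (transpose ?\<Gamma> ** ?G) $ i $ j" for i j
        by (simp add: ip_def G_def matrix_vector_mult_basis column_def inner_vec_def matrix_matrix_mult_def transpose_def)
      moreover have "ip c ?x (axis i 1) (?\<Gamma> *v axis j 1) = (?G ** ?\<Gamma>) $ i $ j" for i j
        by (simp add: ip_def G_def inner_axis' matrix_vector_mult_basis column_def matrix_matrix_mult_def matrix_vector_mult_def[of "gram A g c (fst z)"])
      ultimately show ?thesis by (simp add: M_def vec_eq_iff dip_compat[OF cx] Gv)
    qed
    then have "trace (matrix_inv ?G ** M) = trace (matrix_inv ?G ** (transpose ?\<Gamma> ** ?G)) + trace (matrix_inv ?G ** (?G ** ?\<Gamma>))"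
      by (simp add: matrix_add_ldistrib trace_add)
    also have "trace (matrix_inv ?G ** (transpose ?\<Gamma> ** ?G)) = trace ?\<Gamma>"
      by (subst trace_mul_sym) (simp add: matrix_mul_assoc[symmetric] matrix_inv_mult(1)[OF det_G_nz[OF cx]] trace_def transpose_def)
    also have "trace (matrix_inv ?G ** (?G ** ?\<Gamma>)) = trace ?\<Gamma>"
      by (simp add: matrix_mul_assoc matrix_inv_mult(2)[OF det_G_nz[OF cx]])
    finally show ?thesis by simp
  qed
  moreover have "((\<lambda>h. det (mat 1 - (2 * h) *\<^sub>R ?\<Gamma>)) has_real_derivative trace (- 2 *\<^sub>R ?\<Gamma>)) (at 0)"
    by (rule det_derivative_identity) (auto intro!: derivative_eq_intros)
  moreover have "trace (- 2 *\<^sub>R ?\<Gamma>) = - 2 * trace ?\<Gamma>" by (simp add: trace_def sum_distrib_left)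
  ultimately have "((\<lambda>h. det (G c (fst (step_map c h z))) * det (mat 1 - (2 * h) *\<^sub>R ?\<Gamma>)) has_real_derivative
      det ?G * (2 * trace ?\<Gamma>) * det (mat 1 - (2 * 0) *\<^sub>R ?\<Gamma>) + (- 2 * trace ?\<Gamma>) * det ?G) (at 0)"
    by (intro DERIV_mult'[THEN DERIV_cong]) (auto simp: mult.commute)
  then have "((\<lambda>h. step_weight c (h, z)) has_real_derivative 0) (at 0)"
    by (simp add: step_weight_def)
  with D show ?thesis using DERIV_unique by blast
qed

text \<open>The derivative in \<open>h\<close> vanishes at \<open>h = 0\<close> on the compact set,
  so it is below \<open>e\<close> on a tube of uniform width; the mean value bound does the
  rest.\<close>

lemma step_weight_uniform:
  assumes c: "c \<in> A" and K: "compact K" "K \<subseteq> cimg c \<times> UNIV" and e: "0 < e"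
  shows "\<exists>d>0. \<forall>h z. \<bar>h\<bar> \<le> d \<longrightarrow> z \<in> K \<longrightarrow> (h, z) \<in> step_dom c \<and> \<bar>step_weight c (h, z) - det (G c (fst z))\<bar> \<le> e * \<bar>h\<bar>"
proof -
  have sub: "{0} \<times> K \<subseteq> step_dom c" using K(2) by (auto simp: step_dom_def)
  have cont: "continuous_on (step_dom c) (\<lambda>q. fd (step_weight c) q (1, 0))" by (rule C1_onD(3)[OF C1_step_weight[OF c]])
  let ?W = "{q \<in> step_dom c. \<bar>fd (step_weight c) q (1, 0)\<bar> < e}"
  have opn: "open ?W"
  proof -
    have "?W = (\<lambda>q. fd (step_weight c) q (1, 0)) -` ball 0 e \<inter> step_dom c" by auto
    then show ?thesis using cont open_step_dom[OF c] by (simp add: continuous_on_open_vimage)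
  qed
  have sW: "{0} \<times> K \<subseteq> ?W" using sub step_weight_derivative[OF c] K(2) e by auto
  have cp: "compact ({0::real} \<times> K)" using K(1) by (intro compact_Times) auto
  obtain d where d': "0 < d" "(\<Union>q\<in>{0} \<times> K. ball q d) \<subseteq> ?W"
    by (rule compact_subset_open_imp_ball_epsilon_subset[OF cp opn sW])
  then have d: "0 < d" "\<And>q. q \<in> {0} \<times> K \<Longrightarrow> ball q d \<subseteq> ?W" by blast+
  have inW: "(h, z) \<in> ?W" if "\<bar>h\<bar> \<le> d / 2" "z \<in> K" for h z
  proof -
    have "(h, z) \<in> ball (0, z) d" using that d(1) by (simp add: dist_Pair_Pair)
    then show ?thesis using d(2)[of "(0, z)"] that by blast
  qed
  have "\<bar>step_weight c (h, z) - det (G c (fst z))\<bar> \<le> e * \<bar>h\<bar>" if h: "\<bar>h\<bar> \<le> d / 2" and z: "z \<in> K" for h z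
  proof -
    let ?I = "{- (d/2)..d/2}"
    have "norm (step_weight c (h, z) - step_weight c (0, z)) \<le> e * norm (h - 0)"
    proof (rule differentiable_bound[of ?I "\<lambda>h. step_weight c (h, z)" "\<lambda>h k. fd (step_weight c) (h, z) (k, 0)"])
      fix s assume s: "s \<in> ?I"
      then have sW: "(s, z) \<in> ?W" using inW[of s z] z by auto
      have dW: "(step_weight c has_derivative fd (step_weight c) (s, z)) (at (s, z))" using sW C1_onD(2)[OF C1_step_weight[OF c]] by auto
      have "((\<lambda>h. (h, z)) has_derivative (\<lambda>k. (k, 0))) (at s within ?I)" by (auto intro!: derivative_eq_intros)
      from has_derivative_compose[OF this dW]
      show "((\<lambda>h. step_weight c (h, z)) has_derivative (\<lambda>k. fd (step_weight c) (s, z) (k, 0))) (at s within ?I)" .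
      show "onorm (\<lambda>k. fd (step_weight c) (s, z) (k, 0)) \<le> e"
      proof (rule onorm_bound)
        fix k
        have "fd (step_weight c) (s, z) (k, 0) = k * fd (step_weight c) (s, z) (1, 0)"
          using linear_cmul[OF has_derivative_linear[OF dW], of k "(1, 0)"] by simp
        then show "norm (fd (step_weight c) (s, z) (k, 0)) \<le> e * norm k"
          using sW mult_left_mono[of "\<bar>fd (step_weight c) (s, z) (1, 0)\<bar>" e "\<bar>k\<bar>"] by (simp add: abs_mult mult.commute[of e])
      qed (use e in simp)
    qed (use h d in auto)
    then show ?thesis by (simp add: step_weight_0)
  qed
  then show ?thesis using inW d by (intro exI[of _ "d/2"]) auto
qed

section \<open>The geodesic flow\<close>

text \<open>The geodesic spray in bundle coordinates; geodesics are its integral curves.\<close>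

definition Xf where "Xf c z = (snd z, - Gam c (fst z) (snd z) (snd z))"
definition state where "state \<gamma> t = (\<gamma> t, vel \<gamma> t)"

lemma state_TMs: "geod \<gamma> \<Longrightarrow> state \<gamma> t \<in> TMs"
  using geodesicD(2) by (auto simp: state_def TMs_def)

lemma fst_state [simp]: "fst (state \<gamma> t) = \<gamma> t" by (simp add: state_def)

lemma coords_state_derivative:
  assumes "geod \<gamma>" "c \<in> A" "\<gamma> t \<in> cdom c"
  shows "((\<lambda>t. coords c (state \<gamma> t)) has_vector_derivative Xf c (coords c (state \<gamma> t))) (at t)"
  using has_vector_derivative_Pair[OF geodesicD(3)[OF assms] geodesicD(4)[OF assms]]
  by (simp add: coords_def state_def Xf_def)

lemma geodesicI:
  assumes cont: "continuous_on UNIV \<gamma>" and W: "\<And>t. W t \<in> TS (\<gamma> t)"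
    and d1: "\<And>t c. c \<in> A \<Longrightarrow> \<gamma> t \<in> cdom c \<Longrightarrow> ((\<lambda>t. cmap c (\<gamma> t)) has_vector_derivative W t c) (at t)"
    and d2: "\<And>t c. c \<in> A \<Longrightarrow> \<gamma> t \<in> cdom c \<Longrightarrow> ((\<lambda>t. W t c) has_vector_derivative - Gam c (cmap c (\<gamma> t)) (W t c) (W t c)) (at t)"
  shows "geod \<gamma>" "vel \<gamma> = W"
proof -
  show vel: "vel \<gamma> = W"
  proof (intro ext)
    fix t c show "vel \<gamma> t c = W t c"
    proof (cases "c \<in> A \<and> \<gamma> t \<in> cdom c")
      case True
      then show ?thesis using vector_derivative_at[OF d1] by (simp add: velocity_def o_def)
    next
      case False
      then show ?thesis using tangent_outside[OF W] by (auto simp: velocity_def)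
    qed
  qed
  show "geod \<gamma>"
    unfolding geodesic_def vel
  proof (intro conjI allI)
    show "differentiable_curve A \<gamma>"
      using cont d1 unfolding differentiable_curve_def differentiable_def has_vector_derivative_def o_def by blast
    show "differentiable_field_along A \<gamma> W"
      using W d2 unfolding differentiable_field_along_def differentiable_def has_vector_derivative_def by blast
    fix t
    show "covd \<gamma> W t = (\<lambda>_. 0)"
    proof
      fix c show "covd \<gamma> W t c = 0"
        using vector_derivative_at[OF d2, of c t] by (auto simp: covariant_derivative_def vel Gam_def)
    qed
  qed
qed

lemma geodesic_affine:
  assumes \<gamma>: "geod \<gamma>"
  shows "geod (\<lambda>t. \<gamma> (a + k * t))" "vel (\<lambda>t. \<gamma> (a + k * t)) = (\<lambda>t c. k *\<^sub>R vel \<gamma> (a + k * t) c)"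
proof -
  let ?V = "\<lambda>t c. k *\<^sub>R vel \<gamma> (a + k * t) c"
  have cont: "continuous_on UNIV (\<lambda>t. \<gamma> (a + k * t))"
    by (intro continuous_on_compose2[OF geodesicD(1)[OF \<gamma>]] continuous_intros) auto
  have V: "?V t \<in> TS (\<gamma> (a + k * t))" for t
    using lincomb2_tangent[OF geodesicD(2)[OF \<gamma>] zero_tangent, of k "a + k * t" 0] by (simp add: lincomb2_def)
  have l: "((\<lambda>t. a + k * t) has_vector_derivative k) (at t)" for t
    by (auto intro!: derivative_eq_intros simp: DERIV_iff_vector[symmetric])
  have d1: "((\<lambda>t. cmap c (\<gamma> (a + k * t))) has_vector_derivative ?V t c) (at t)" if "c \<in> A" "\<gamma> (a + k * t) \<in> cdom c" for t c
    using vector_diff_chain_at[OF l geodesicD(3)[OF \<gamma> that]] by (simp add: o_def)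
  have d2: "((\<lambda>t. ?V t c) has_vector_derivative - Gam c (cmap c (\<gamma> (a + k * t))) (?V t c) (?V t c)) (at t)"
    if "c \<in> A" "\<gamma> (a + k * t) \<in> cdom c" for t c
    using bounded_linear.has_vector_derivative[OF bounded_linear_scaleR_right vector_diff_chain_at[OF l geodesicD(4)[OF \<gamma> that]], of k]
    by (simp add: o_def Gam_simps)
  show "geod (\<lambda>t. \<gamma> (a + k * t))" "vel (\<lambda>t. \<gamma> (a + k * t)) = ?V"
    using geodesicI[OF cont V d1 d2] by auto
qed

lemma Xf_C1: assumes c: "c \<in> A" shows "C1_on (Tc c) (Xf c)"
proof -
  have "C1_on (Tc c) (\<lambda>z. Gam c (fst (snd (0::real, z))) (snd (snd (0::real, z))) (snd (snd (0::real, z))))"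
    by (rule C1_on_compose[OF C1_on_linear C1_Gam_q(1)[OF c]])
       (auto intro!: bounded_linear_Pair bounded_linear_zero bounded_linear_ident simp: Tc_def)
  then show ?thesis unfolding Xf_def[abs_def]
    by (intro C1_on_Pair C1_on_minus) (auto intro!: C1_on_linear bounded_linear_snd)
qed

end

text \<open>A ball in a bundle chart on which the spray has Lipschitz constant \<open>L\<close> and
  norm at most \<open>C\<close>. Curves start in the ball of radius 2 R; within time
  \<open>\<epsilon>\<close> they move by at most R / 4, hence stay in the ball of radius 3
  R.\<close>

locale chart_box = riem A g
  for A :: "('a::{t2_space, second_countable_topology}, 'n::finite) chart set" and g :: "('a, 'n) metric" +
  fixes c :: "('a, 'n) chart" and z0 :: "'n phase" and R \<epsilon> L C :: real
  assumes c: "c \<in> A" and R: "0 < R" and \<epsilon>: "0 < \<epsilon>" and L0: "0 < L" and C0: "0 < C"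
    and sub: "cball z0 (3 * R) \<subseteq> Tc c"
    and L: "\<And>z z'. z \<in> cball z0 (3 * R) \<Longrightarrow> z' \<in> cball z0 (3 * R) \<Longrightarrow> norm (Xf c z - Xf c z') \<le> L * norm (z - z')"
    and C: "\<And>z. z \<in> cball z0 (3 * R) \<Longrightarrow> norm (Xf c z) \<le> C" and C\<epsilon>: "C * \<epsilon> \<le> R / 4"
begin

text \<open>Escape argument at the first bad time \<open>b\<close>. Compactness shows that the curve
  is still in the chart at \<open>b\<close>, and the speed bound puts it in the interior of the
  ball; so all times near \<open>b\<close> are good.\<close>

lemma flow_stays:
  assumes \<gamma>: "geod \<gamma>" and start: "\<gamma> t0 \<in> cdom c" "coords c (state \<gamma> t0) \<in> cball z0 (2 * R)" and t: "\<bar>t - t0\<bar> \<le> \<epsilon>"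
  shows "\<gamma> t \<in> cdom c" "norm (coords c (state \<gamma> t) - coords c (state \<gamma> t0)) \<le> C * \<bar>t - t0\<bar>" "C * \<bar>t - t0\<bar> \<le> R / 4"
    "coords c (state \<gamma> t) \<in> cball z0 (3 * R)"
proof -
  define s where "s = t - t0"
  have s: "\<bar>s\<bar> \<le> \<epsilon>" using t by (simp add: s_def)
  \<comment> \<open>Multiplying by the sign of the elapsed time treats both time directions with a
    parameter that runs upwards from 0.\<close>
  define \<sigma> where "\<sigma> = sgn s"
  have \<sigma>: "\<bar>\<sigma>\<bar> \<le> 1" "\<sigma> * \<bar>s\<bar> = s" by (auto simp: \<sigma>_def sgn_if abs_if)
  define \<beta> where "\<beta> r = \<gamma> (t0 + \<sigma> * r)" for r
  define z where "z r = coords c (state \<gamma> (t0 + \<sigma> * r))" for r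
  define good where "good r \<longleftrightarrow> \<beta> r \<in> cdom c \<and> z r \<in> cball z0 (3 * R)" for r
  have c\<beta>: "continuous_on UNIV \<beta>"
    unfolding \<beta>_def by (intro continuous_on_compose2[OF geodesicD(1)[OF \<gamma>]] continuous_intros) auto
  have dz: "(z has_vector_derivative \<sigma> *\<^sub>R Xf c (z r)) (at r)" if "\<beta> r \<in> cdom c" for r
  proof -
    have l: "((\<lambda>r. t0 + \<sigma> * r) has_vector_derivative \<sigma>) (at r)"
      by (auto intro!: derivative_eq_intros simp: DERIV_iff_vector[symmetric])
    show ?thesis
      using vector_diff_chain_at[OF l coords_state_derivative[OF \<gamma> c]] that by (simp add: o_def z_def[abs_def] \<beta>_def)
  qed
  have bound: "norm (z b - z 0) \<le> C * b" if b: "0 \<le> b" "\<And>r. 0 \<le> r \<Longrightarrow> r \<le> b \<Longrightarrow> good r" for b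
  proof -
    have "norm (z b - z 0) \<le> C * norm (b - 0)"
    proof (rule differentiable_bound[of "{0..b}" z "\<lambda>r h. h *\<^sub>R (\<sigma> *\<^sub>R Xf c (z r))"])
      fix r assume r: "r \<in> {0..b}"
      then have g: "good r" using b by auto
      then show "(z has_derivative (\<lambda>h. h *\<^sub>R (\<sigma> *\<^sub>R Xf c (z r)))) (at r within {0..b})"
        using dz[of r] by (auto simp: good_def has_vector_derivative_def intro: has_derivative_at_withinI)
      show "onorm (\<lambda>h. h *\<^sub>R (\<sigma> *\<^sub>R Xf c (z r))) \<le> C"
      proof (rule onorm_bound[OF less_imp_le[OF C0]])
        fix h :: real
        have "norm (Xf c (z r)) \<le> C" using g C by (simp add: good_def)
        then have "\<bar>\<sigma>\<bar> * norm (Xf c (z r)) \<le> 1 * C" using \<sigma> by (intro mult_mono) auto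
        then have "\<bar>h\<bar> * (\<bar>\<sigma>\<bar> * norm (Xf c (z r))) \<le> \<bar>h\<bar> * C" by (intro mult_left_mono) auto
        then show "norm (h *\<^sub>R \<sigma> *\<^sub>R Xf c (z r)) \<le> C * norm h" by (simp add: mult.commute[of C] abs_mult mult.assoc mult.left_commute)
      qed
    qed (use b in auto)
    then show ?thesis using b by simp
  qed
  have z0: "z 0 \<in> cball z0 (2 * R)" "\<beta> 0 \<in> cdom c" using start by (auto simp: z_def \<beta>_def)
  have all_good: "good r" if "0 \<le> r" "r \<le> \<bar>s\<bar>" for r
  proof (rule ccontr)
    assume nr: "\<not> good r"
    define B where "B = {r. 0 \<le> r \<and> r \<le> \<bar>s\<bar> \<and> \<not> good r}"
    define b where "b = Inf B"
    have B: "r \<in> B" "bdd_below B" "B \<noteq> {}" using nr that by (auto simp: B_def intro: bdd_belowI[of _ 0])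
    have b: "0 \<le> b" "b \<le> \<bar>s\<bar>"
      unfolding b_def using B cInf_lower[OF B(1,2)] that by (auto intro!: cInf_greatest simp: B_def)
    have lt: "good r" if "0 \<le> r" "r < b" for r
      using that b cInf_lower[of r B] B by (auto simp: b_def B_def)
    have b1: "\<beta> b \<in> cdom c \<and> z b \<in> cball z0 (3 * R)"
    proof (cases "b = 0")
      case True
      then show ?thesis using z0 R by auto
    next
      case False
      then have bp: "0 < b" using b by simp
      \<comment> \<open>The preimage of the ball in the manifold is compact, hence closed by the
        Hausdorff property, so the limit point \<open>\<beta> b\<close> cannot leave the chart
        domain.\<close>
      let ?K = "cinv c ` (fst ` cball z0 (3 * R))"
      have f: "fst ` cball z0 (3 * R) \<subseteq> cimg c" using sub by (auto simp: Tc_def)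
      have "compact ?K"
        by (intro compact_continuous_image continuous_on_subset[OF chartD(7)[OF c] f] continuous_on_fst continuous_on_id compact_cball)
      then have "closed ?K" by (rule compact_imp_closed)
      then have "closed (\<beta> -` ?K)" using c\<beta> by (simp add: closed_vimage)
      moreover have "{0..<b} \<subseteq> \<beta> -` ?K"
      proof
        fix r assume "r \<in> {0..<b}"
        then have "good r" using lt by auto
        then have "cinv c (fst (z r)) = \<beta> r" "z r \<in> cball z0 (3 * R)"
          using c by (auto simp: good_def z_def coords_def \<beta>_def chartD)
        then show "r \<in> \<beta> -` ?K" by (metis imageI vimageI)
      qed
      ultimately have "closure {0..<b} \<subseteq> \<beta> -` ?K" by (simp add: closure_minimal)
      moreover have "b \<in> closure {0..<b}" using bp by simp
      ultimately have "\<beta> b \<in> ?K" by blast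
      then have 1: "\<beta> b \<in> cdom c" using f chartD(5)[OF c] by auto
      have "closed (z -` cball z0 (3 * R) \<inter> {0..b})"
      proof (rule continuous_on_closed_vimage[THEN iffD1, rule_format])
        show "continuous_on {0..b} z"
        proof (rule continuous_on_vector_derivative, rule has_vector_derivative_at_within, rule dz)
          fix r assume "r \<in> {0..b}" then show "\<beta> r \<in> cdom c" using lt[of r] 1 by (cases "r = b") (auto simp: good_def)
        qed
      qed auto
      moreover have "{0..<b} \<subseteq> z -` cball z0 (3 * R) \<inter> {0..b}" using lt by (auto simp: good_def)
      ultimately have "closure {0..<b} \<subseteq> z -` cball z0 (3 * R) \<inter> {0..b}" by (simp only: closure_minimal)
      moreover have "b \<in> closure {0..<b}" using bp by simp
      ultimately have "b \<in> z -` cball z0 (3 * R)" by blast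
      then show ?thesis using 1 by auto
    qed
    then have gb: "good r" if "0 \<le> r" "r \<le> b" for r using lt[of r] that by (cases "r = b") (auto simp: good_def)
    have "norm (z b - z 0) \<le> C * b" using bound[OF b(1) gb] .
    also have "\<dots> \<le> C * \<epsilon>" using b s C0 by (intro mult_left_mono) auto
    also have "\<dots> \<le> R / 4" by (rule C\<epsilon>)
    finally have "dist (z b) (z 0) \<le> R / 4" by (simp add: dist_norm)
    then have "dist z0 (z b) < 3 * R" using z0(1) R dist_triangle[of z0 "z b" "z 0"] by (simp add: dist_commute)
    then have zb: "z b \<in> ball z0 (3 * R)" by simp
    have "isCont z b" using dz[of b] b1 by (auto intro: has_vector_derivative_continuous)
    then have "\<forall>\<^sub>F r in nhds b. z r \<in> ball z0 (3 * R)"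
      using zb by (auto simp: isCont_def tendsto_at_iff_tendsto_nhds dest!: topological_tendstoD[where S="ball z0 (3 * R)"])
    moreover have "\<forall>\<^sub>F r in nhds b. r \<in> \<beta> -` cdom c"
      using b1 chartD(1)[OF c] c\<beta> by (intro eventually_nhds_in_open open_vimage) auto
    ultimately have "\<forall>\<^sub>F r in nhds b. good r" by eventually_elim (auto simp: good_def)
    then obtain d where d: "0 < d" "\<And>r. dist r b < d \<Longrightarrow> good r" unfolding eventually_nhds_metric by blast
    obtain r where r: "r \<in> B" "r < b + d" using cInf_lessD[OF B(3), of "b + d"] d(1) by (auto simp: b_def)
    then have "b \<le> r" using cInf_lower[OF r(1) B(2)] by (simp add: b_def)
    then have "good r" using r d(2)[of r] by (simp add: dist_real_def)
    then show False using r by (simp add: B_def)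
  qed
  have "good \<bar>s\<bar>" by (rule all_good) auto
  moreover have "norm (z \<bar>s\<bar> - z 0) \<le> C * \<bar>s\<bar>" by (rule bound) (auto intro: all_good)
  moreover have ts: "t0 + s = t" by (simp add: s_def)
  ultimately show 1: "\<gamma> t \<in> cdom c" "norm (coords c (state \<gamma> t) - coords c (state \<gamma> t0)) \<le> C * \<bar>t - t0\<bar>"
    by (simp_all add: good_def z_def \<beta>_def \<sigma> ts flip: s_def)
  show 2: "C * \<bar>t - t0\<bar> \<le> R / 4" using mult_left_mono[OF t, of C] C0 C\<epsilon> by linarith
  show "coords c (state \<gamma> t) \<in> cball z0 (3 * R)"
    using 1 2 start(2) R dist_triangle[of z0 "coords c (state \<gamma> t)" "coords c (state \<gamma> t0)"]
    by (simp add: dist_norm norm_minus_commute)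
qed

lemma geodesic_eq_propagate:
  assumes \<gamma>1: "geod \<gamma>1" and \<gamma>2: "geod \<gamma>2" and eq: "state \<gamma>1 a = state \<gamma>2 a"
    and start: "\<gamma>1 a \<in> cdom c" "coords c (state \<gamma>1 a) \<in> cball z0 (2 * R)" and s: "\<bar>b - a\<bar> \<le> \<epsilon>"
  shows "state \<gamma>1 b = state \<gamma>2 b"
proof -
  have "\<gamma>2 a = \<gamma>1 a" using eq by (simp add: state_def)
  then have start2: "\<gamma>2 a \<in> cdom c" "coords c (state \<gamma>2 a) \<in> cball z0 (2 * R)" using start eq by auto
  have seg: "\<bar>r - a\<bar> \<le> \<epsilon>" if "r \<in> closed_segment a b" for r
    using that s by (auto simp: closed_segment_eq_real_ivl split: if_splits)
  note s1 = flow_stays(1,4)[OF \<gamma>1 start] and s2 = flow_stays(1,4)[OF \<gamma>2 start2]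
  have "norm (coords c (state \<gamma>1 b) - coords c (state \<gamma>2 b)) \<le> exp (L * \<bar>b - a\<bar>) * norm (coords c (state \<gamma>1 a) - coords c (state \<gamma>2 a))"
    by (rule gronwall[of _ _ _ "\<lambda>r. Xf c (coords c (state \<gamma>1 r)) - Xf c (coords c (state \<gamma>2 r))"])
       (use s1 s2 seg \<gamma>1 \<gamma>2 c L in \<open>auto intro!: has_vector_derivative_diff coords_state_derivative\<close>)
  then have "coords c (state \<gamma>1 b) = coords c (state \<gamma>2 b)" using eq by simp
  then have "par c (coords c (state \<gamma>1 b)) = par c (coords c (state \<gamma>2 b))" by simp
  then show ?thesis using s1[OF s] s2[OF s] c state_TMs[OF \<gamma>1] state_TMs[OF \<gamma>2] by simp
qed

end

section \<open>Uniqueness of geodesics\<close>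

context riem
begin

text \<open>A third of the available radius leaves room for the balls of radius up to 3 R;
  \<open>R / (4 * C0)\<close> is a time in which speed at most \<open>C0\<close> covers at most R /
  4.\<close>

lemma flow_box:
  assumes c: "c \<in> A" and z0: "z0 \<in> Tc c"
  obtains R \<epsilon> L C where "chart_box A g c z0 R \<epsilon> L C"
proof -
  obtain r where r: "0 < r" "cball z0 r \<subseteq> Tc c" using open_Tc[OF c] z0 open_contains_cball by blast
  define R where "R = r / 3"
  have R: "0 < R" "cball z0 (3 * R) \<subseteq> Tc c" using r by (auto simp: R_def)
  obtain L where L: "0 < L" "\<And>z z'. z \<in> cball z0 (3 * R) \<Longrightarrow> z' \<in> cball z0 (3 * R) \<Longrightarrow> norm (Xf c z - Xf c z') \<le> L * norm (z - z')"
    using C1_on_Lipschitz[OF Xf_C1[OF c] compact_cball convex_cball R(2)] by metis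
  have "compact (Xf c ` cball z0 (3 * R))"
    by (intro compact_continuous_image continuous_on_subset[OF C1_onD(4)[OF Xf_C1[OF c]] R(2)] compact_cball)
  then have "bounded (Xf c ` cball z0 (3 * R))" by (rule compact_imp_bounded)
  then obtain C0 where C0: "0 < C0" "\<And>z. z \<in> cball z0 (3 * R) \<Longrightarrow> norm (Xf c z) \<le> C0"
    unfolding bounded_pos by blast
  show ?thesis
    by (rule that[of R "R / (4 * C0)" L C0], unfold_locales) (use c R L C0 in auto)
qed

text \<open>As an equivalence between the two ends, the claim composes over adjacent intervals, as
  \<open>Bolzano\<close> requires, and covers both time directions.\<close>

lemma geodesic_unique_forward:
  assumes \<gamma>1: "geod \<gamma>1" and \<gamma>2: "geod \<gamma>2" and ab: "a \<le> b"
  shows "state \<gamma>1 a = state \<gamma>2 a \<longleftrightarrow> state \<gamma>1 b = state \<gamma>2 b"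
  using ab
proof (induction rule: Bolzano)
  case (local x)
  obtain c where cx: "c \<in> A" "\<gamma>1 x \<in> cdom c" by (rule chart_around)
  let ?z0 = "coords c (state \<gamma>1 x)"
  have "?z0 \<in> Tc c" using cx by (intro coords_Tc) simp
  then obtain R \<epsilon> L C where "chart_box A g c ?z0 R \<epsilon> L C" using flow_box[OF cx(1)] by metis
  then interpret chart_box A g c ?z0 R \<epsilon> L C .
  show ?case
  proof (intro exI[of _ \<epsilon>] conjI allI impI)
    fix a b assume ab: "a \<le> x \<and> x \<le> b \<and> b - a < \<epsilon>"
    have near: "\<gamma>1 r \<in> cdom c \<and> coords c (state \<gamma>1 r) \<in> cball ?z0 (2 * R)" if "\<bar>r - x\<bar> \<le> \<epsilon>" for r
      using flow_stays(1-3)[OF \<gamma>1 cx(2) _ that] R by (simp add: dist_norm norm_minus_commute)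
    have s: "\<bar>b - a\<bar> \<le> \<epsilon>" "\<bar>a - b\<bar> \<le> \<epsilon>" using ab by auto
    show "state \<gamma>1 a = state \<gamma>2 a \<longleftrightarrow> state \<gamma>1 b = state \<gamma>2 b"
      using geodesic_eq_propagate[OF \<gamma>1 \<gamma>2 _ _ _ s(1)] geodesic_eq_propagate[OF \<gamma>1 \<gamma>2 _ _ _ s(2)] near[of a] near[of b] ab by auto
  qed (rule \<epsilon>)
qed auto

lemma geodesic_unique:
  assumes "geod \<gamma>1" "geod \<gamma>2" "state \<gamma>1 a = state \<gamma>2 a"
  shows "state \<gamma>1 b = state \<gamma>2 b"
  using geodesic_unique_forward[OF assms(1,2), of a b] geodesic_unique_forward[OF assms(1,2), of b a] assms(3)
  by (cases "a \<le> b") auto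

end

section \<open>The flow of a complete metric\<close>

locale complete_riem = riem A g
  for A :: "('a::{t2_space, second_countable_topology}, 'n::finite) chart set" and g :: "('a, 'n) metric" +
  assumes complete: "complete_metric A g"
begin

definition geo where "geo w = (SOME \<gamma>. geod \<gamma> \<and> state \<gamma> 0 = w)"
definition flow where "flow t w = state (geo w) t"

lemma geo: assumes "w \<in> TMs" shows "geod (geo w)" "state (geo w) 0 = w"
proof -
  have "\<exists>\<gamma>. geod \<gamma> \<and> state \<gamma> 0 = w"
    using complete assms unfolding complete_metric_def TMs_def state_def by blast
  then show "geod (geo w)" "state (geo w) 0 = w"
    unfolding geo_def by (metis (mono_tags, lifting) someI_ex)+
qed

lemma flow_0: "w \<in> TMs \<Longrightarrow> flow 0 w = w" by (simp add: flow_def geo)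

lemma flow_TMs: "w \<in> TMs \<Longrightarrow> flow t w \<in> TMs" by (simp add: flow_def geo state_TMs)

text \<open>The flow follows a chosen geodesic. Uniqueness identifies it with the shift of any given
  one, and this yields the group law.\<close>

lemma flow_state: assumes \<gamma>: "geod \<gamma>" shows "flow t (state \<gamma> s) = state \<gamma> (s + t)"
proof -
  have shift: "geod (\<lambda>t. \<gamma> (s + t))" "state (\<lambda>t. \<gamma> (s + t)) t = state \<gamma> (s + t)" for t
    using geodesic_affine[OF \<gamma>, of s 1] by (auto simp: state_def)
  have "state (geo (state \<gamma> s)) t = state (\<lambda>t. \<gamma> (s + t)) t"
    by (rule geodesic_unique[OF geo(1)[OF state_TMs[OF \<gamma>]] shift(1), where a=0]) (simp add: geo(2)[OF state_TMs[OF \<gamma>]] shift(2))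
  then show ?thesis by (simp add: flow_def shift(2))
qed

lemma flow_add: "w \<in> TMs \<Longrightarrow> flow s (flow t w) = flow (t + s) w"
  unfolding flow_def[of t] by (simp add: flow_state geo(1)) (simp add: flow_def)

lemma flow_inverse: "w \<in> TMs \<Longrightarrow> flow (- t) (flow t w) = w" "w \<in> TMs \<Longrightarrow> flow t (flow (- t) w) = w"
  by (simp_all add: flow_add flow_0)

definition sqn where "sqn w = g (fst w) (snd w) (snd w)"

lemma sqn_flow: assumes "w \<in> TMs" shows "sqn (flow t w) = sqn w"
proof -
  note \<gamma> = geo(1)[OF assms]
  have "sqn (state (geo w) t) = sqn (state (geo w) 0)"
    using parallel_inner_const[OF \<gamma> cov_at_velocity[OF \<gamma>] cov_at_velocity[OF \<gamma>], of t 0] by (simp add: sqn_def state_def)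
  then show ?thesis using geo(2)[OF assms] by (simp add: flow_def)
qed

end

section \<open>Invariance of the measure under the flow\<close>

locale flow_cell = complete_riem A g + chart_box A g c z0 R \<epsilon> L C
  for A :: "('a::{t2_space, second_countable_topology}, 'n::finite) chart set" and g :: "('a, 'n) metric" and c z0 R \<epsilon> L C
begin

definition phi where "phi t z = coords c (flow t (par c z))"

lemma ball_sub: "s \<le> 3 * R \<Longrightarrow> ball z0 s \<subseteq> Tc c" "s \<le> 3 * R \<Longrightarrow> cball z0 s \<subseteq> Tc c"
  using sub ball_subset_cball[of z0 s] subset_cball[of s "3*R" z0] by blast+

lemma flow_coords:
  assumes w: "w \<in> TMs" "fst w \<in> cdom c" "coords c w \<in> cball z0 (2 * R)" and t: "\<bar>t\<bar> \<le> \<epsilon>"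
  shows "fst (flow t w) \<in> cdom c" "norm (coords c (flow t w) - coords c w) \<le> C * \<bar>t\<bar>" "C * \<bar>t\<bar> \<le> R / 4"
    "coords c (flow t w) \<in> cball z0 (3 * R)"
proof -
  have "geo w 0 = fst w" using geo(2)[OF w(1)] by (metis fst_state)
  then show "fst (flow t w) \<in> cdom c" "norm (coords c (flow t w) - coords c w) \<le> C * \<bar>t\<bar>" "C * \<bar>t\<bar> \<le> R / 4"
    "coords c (flow t w) \<in> cball z0 (3 * R)"
    using w t flow_stays[OF geo(1)[OF w(1)], of 0 t] by (simp_all add: flow_def geo(2))
qed

lemma par_box: assumes "z \<in> cball z0 (2 * R)"
  shows "par c z \<in> TMs" "fst (par c z) \<in> cdom c" "coords c (par c z) = z"
  using ball_sub(2)[of "2*R"] assms R c by (auto intro!: par_TMs fst_par coords_par)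

lemma phi_box:
  assumes z: "z \<in> cball z0 (2 * R)" and t: "\<bar>t\<bar> \<le> \<epsilon>"
  shows "norm (phi t z - z) \<le> C * \<bar>t\<bar>" "norm (phi t z - z) \<le> R / 4" "phi t z \<in> cball z0 (3 * R)" "par c (phi t z) = flow t (par c z)"
proof -
  note w = par_box[OF z]
  note f = flow_coords[OF w(1,2) _ t, unfolded w(3), OF z]
  show "norm (phi t z - z) \<le> C * \<bar>t\<bar>" "norm (phi t z - z) \<le> R / 4" "phi t z \<in> cball z0 (3 * R)"
    using f by (auto simp: phi_def)
  show "par c (phi t z) = flow t (par c z)"
    unfolding phi_def by (rule par_coords[OF c flow_TMs[OF w(1)] f(1)])
qed

lemma phi_add:
  assumes z: "z \<in> cball z0 (2 * R)" and s: "\<bar>s\<bar> \<le> \<epsilon>"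
  shows "phi t (phi s z) = phi (s + t) z"
  unfolding phi_def[of t] phi_box(4)[OF z s] using par_box(1)[OF z] by (simp add: flow_add phi_def)

lemma phi_derivative:
  assumes z: "z \<in> cball z0 (2 * R)" and t: "\<bar>t\<bar> \<le> \<epsilon>"
  shows "((\<lambda>t. phi t z) has_vector_derivative Xf c (phi t z)) (at t)"
  unfolding phi_def flow_def
  by (rule coords_state_derivative[OF geo(1)[OF par_box(1)[OF z]] c])
     (use flow_coords(1)[OF par_box(1,2)[OF z] _ t] par_box[OF z] z in \<open>simp add: flow_def\<close>)

lemma phi_0: "z \<in> cball z0 (2 * R) \<Longrightarrow> phi 0 z = z"
  using par_box by (simp add: phi_def flow_0)

text \<open>Gronwall. This estimate takes the place of differentiability of the flow in the initial
  point.\<close>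

lemma phi_Lipschitz:
  assumes z: "z \<in> cball z0 (2 * R)" "z' \<in> cball z0 (2 * R)" and t: "\<bar>t\<bar> \<le> \<epsilon>"
  shows "norm (phi t z - phi t z') \<le> exp (L * \<epsilon>) * norm (z - z')"
proof -
  have seg: "\<bar>r\<bar> \<le> \<epsilon>" if "r \<in> closed_segment 0 t" for r
    using that t by (auto simp: closed_segment_eq_real_ivl split: if_splits)
  have "norm (phi t z - phi t z') \<le> exp (L * \<bar>t - 0\<bar>) * norm (phi 0 z - phi 0 z')"
    by (rule gronwall[of _ _ _ "\<lambda>r. Xf c (phi r z) - Xf c (phi r z')"])
       (intro has_vector_derivative_diff phi_derivative z seg | assumption | intro L phi_box z seg | assumption)+
  also have "\<dots> \<le> exp (L * \<epsilon>) * norm (z - z')"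
    using t L0 z by (intro mult_mono) (auto simp: phi_0)
  finally show ?thesis .
qed

text \<open>Flow and Euler step both agree to first order with \<open>z\<close> moved along
  \<open>Xf c z\<close>. The flow deviates by the Lipschitz bound of the spray, the step by the
  square of \<open>h\<close> times a Christoffel term.\<close>

lemma phi_step:
  assumes z: "z \<in> cball z0 (2 * R)" and h: "\<bar>h\<bar> \<le> \<epsilon>"
  shows "norm (phi h z - step_map c h z) \<le> (L * C + C) * h\<^sup>2"
proof -
  have seg: "\<bar>r\<bar> \<le> \<epsilon>" "\<bar>r\<bar> \<le> \<bar>h\<bar>" if "r \<in> closed_segment 0 h" for r
    using that h by (auto simp: closed_segment_eq_real_ivl split: if_splits)
  have zz: "z \<in> cball z0 (3 * R)" using z R by auto
  have "norm ((phi h z - h *\<^sub>R Xf c z) - (phi 0 z - 0 *\<^sub>R Xf c z)) \<le> (L * (C * \<bar>h\<bar>)) * norm (h - 0)"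
  proof (rule differentiable_bound[of "closed_segment 0 h" "\<lambda>r. phi r z - r *\<^sub>R Xf c z" "\<lambda>r k. k *\<^sub>R (Xf c (phi r z) - Xf c z)"])
    fix r assume r: "r \<in> closed_segment 0 h"
    have "((\<lambda>r. phi r z - r *\<^sub>R Xf c z) has_vector_derivative Xf c (phi r z) - Xf c z) (at r)"
      using phi_derivative[OF z seg(1)[OF r]] by (auto intro!: derivative_eq_intros)
    then show "((\<lambda>r. phi r z - r *\<^sub>R Xf c z) has_derivative (\<lambda>k. k *\<^sub>R (Xf c (phi r z) - Xf c z))) (at r within closed_segment 0 h)"
      by (auto simp: has_vector_derivative_def intro: has_derivative_at_withinI)
    show "onorm (\<lambda>k. k *\<^sub>R (Xf c (phi r z) - Xf c z)) \<le> L * (C * \<bar>h\<bar>)"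
    proof (rule onorm_bound)
      fix k
      have "norm (Xf c (phi r z) - Xf c z) \<le> L * norm (phi r z - z)" by (rule L[OF phi_box(3)[OF z seg(1)[OF r]] zz])
      also have "\<dots> \<le> L * (C * \<bar>r\<bar>)" using L0 phi_box(1)[OF z seg(1)[OF r]] by (intro mult_left_mono) auto
      also have "\<dots> \<le> L * (C * \<bar>h\<bar>)" using L0 C0 seg(2)[OF r] by (intro mult_left_mono) auto
      finally have "\<bar>k\<bar> * norm (Xf c (phi r z) - Xf c z) \<le> \<bar>k\<bar> * (L * (C * \<bar>h\<bar>))" by (rule mult_left_mono) auto
      then show "norm (k *\<^sub>R (Xf c (phi r z) - Xf c z)) \<le> L * (C * \<bar>h\<bar>) * norm k" by (simp add: mult_ac)
    qed (use L0 C0 in auto)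
  qed auto
  then have 1: "norm (phi h z - h *\<^sub>R Xf c z - z) \<le> L * C * h\<^sup>2" by (simp add: phi_0[OF z] power2_eq_square mult_ac)
  let ?\<Gamma> = "Gam c (fst z) (snd z) (snd z)"
  have "norm ?\<Gamma> \<le> norm (Xf c z)" unfolding Xf_def by (simp add: norm_Pair real_le_rsqrt)
  then have 2: "norm ?\<Gamma> \<le> C" using C[OF zz] by linarith
  have "step_map c h z = h *\<^sub>R Xf c z + z - (h\<^sup>2 *\<^sub>R ?\<Gamma>, 0)"
    by (simp add: step_map_def eta_def Xf_def prod_eq_iff algebra_simps power2_eq_square)
  then have "phi h z - step_map c h z = (phi h z - h *\<^sub>R Xf c z - z) + (h\<^sup>2 *\<^sub>R ?\<Gamma>, 0)" by simp
  then have "norm (phi h z - step_map c h z) \<le> L * C * h\<^sup>2 + norm (h\<^sup>2 *\<^sub>R ?\<Gamma>, 0::real^'n)"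
    by (simp only: norm_triangle_mono[OF 1 order_refl])
  also have "norm (h\<^sup>2 *\<^sub>R ?\<Gamma>, 0::real^'n) \<le> h\<^sup>2 * C" using 2 by (simp add: norm_Pair mult_left_mono)
  finally show ?thesis by (simp add: algebra_simps)
qed

text \<open>For a fixed base point the map \<open>eta\<close> is injective on the slice when \<open>\<bar>h\<bar>\<close> is
  small, and the shift of the base point by a multiple of \<open>\<eta>\<close> preserves Lebesgue measure.\<close>

lemma step_integral:
  assumes h: "\<bar>h\<bar> * L < 1" and dom: "\<And>z. z \<in> ball z0 R \<Longrightarrow> (h, z) \<in> step_dom c"
    and u: "u \<in> borel_measurable borel"
  shows "(\<integral>\<^sup>+z. u (step_map c h z) * ennreal \<bar>step_weight c (h, z)\<bar> * indicator (ball z0 R) z \<partial>lborel)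
     \<le> (\<integral>\<^sup>+z. u z * rho c z \<partial>lborel)" (is "(\<integral>\<^sup>+z. ?I z \<partial>lborel) \<le> _")
    "(\<lambda>z. u (step_map c h z) * ennreal \<bar>step_weight c (h, z)\<bar> * indicator (ball z0 R) z) \<in> borel_measurable borel"
proof -
  define v where "v z = u z * rho c z" for z
  note [measurable] = u measurable_rho[OF c]
  have v: "v \<in> borel_measurable borel" unfolding v_def[abs_def] by measurable
  have cs: "continuous_on (ball z0 R) (\<lambda>z. step_map c h z)" "continuous_on (ball z0 R) (\<lambda>z. step_weight c (h, z))"
  proof -
    have bs: "ball z0 R \<subseteq> Tc c" using ball_sub R by simp
    show "continuous_on (ball z0 R) (\<lambda>z. step_map c h z)"
      using bs by (intro continuous_on_compose2[OF C1_onD(4)[OF C1_step(2)[OF c]], where f="\<lambda>z. (h, z)", simplified])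
         (auto intro!: continuous_intros simp: Tc_def)
    show "continuous_on (ball z0 R) (\<lambda>z. step_weight c (h, z))"
      using dom by (intro continuous_on_compose2[OF C1_onD(4)[OF C1_step_weight[OF c]], where f="\<lambda>z. (h, z)"])
         (auto intro!: continuous_intros)
  qed
  show mI: "?I \<in> borel_measurable borel"
  proof -
    have "(\<lambda>z. u (step_map c h z) * ennreal \<bar>step_weight c (h, z)\<bar>) \<in> borel_measurable (restrict_space borel (ball z0 R))"
      using borel_measurable_continuous_on_restrict[OF cs(1)] borel_measurable_continuous_on_restrict[OF cs(2)]
      by measurable
    then show ?thesis by (subst (asm) borel_measurable_restrict_space_iff_ennreal) auto
  qed
  have slice: "(\<integral>\<^sup>+y. ?I (x, y) \<partial>lborel) \<le> (\<integral>\<^sup>+w. v (x + h *\<^sub>R w, w) \<partial>lborel)" for x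
  proof -
    let ?S = "{y. (x, y) \<in> ball z0 R}" and ?f = "\<lambda>y. y - h *\<^sub>R Gam c x y y"
    let ?f' = "\<lambda>y k. k - (2 * h) *\<^sub>R Gam c x y k" and ?v = "\<lambda>w. v (x + h *\<^sub>R w, w)"
    have opn: "open ?S"
      using open_vimage[of "ball z0 R" "\<lambda>y. (x, y)"] by (simp add: vimage_def continuous_intros)
    show ?thesis
    proof (cases "?S = {}")
      case True
      then have "?I (x, y) = 0" for y by (metis (no_types, lifting) Collect_empty_eq indicator_simps(2) mult_zero_right)
      then show ?thesis by (simp only: nn_integral_const) simp
    next
      case False
      then have x: "x \<in> cimg c" using ball_sub(1)[of R] R by (auto simp: Tc_def)
      have G1: "C1_on UNIV (\<lambda>y. Gam c x y y)"
        by (rule C1_on_compose[OF _ C1_Gam_q(1)[OF c], where f="\<lambda>y. (0, x, y)", simplified])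
           (use x in \<open>auto intro!: C1_on_Pair C1_on_const C1_on_linear[OF bounded_linear_ident]\<close>)
      have dG: "((\<lambda>y. Gam c x y y) has_derivative (\<lambda>k. Gam c x y k + Gam c x k y)) (at y)" for y
      proof -
        interpret bounded_bilinear "Gam c x"
          using Gam_linear[of c x] by (auto intro!: bilinear_conv_bounded_bilinear[THEN iffD1] simp: bilinear_def)
        show ?thesis by (auto intro!: derivative_eq_intros FDERIV)
      qed
      have der: "(?f has_derivative ?f' y) (at y)" for y
      proof -
        have "(?f has_derivative (\<lambda>k. k - h *\<^sub>R (Gam c x y k + Gam c x k y))) (at y)"
          by (intro has_derivative_diff has_derivative_ident has_derivative_scaleR_right dG)
        moreover have "k - h *\<^sub>R (Gam c x y k + Gam c x k y) = ?f' y k" for k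
          by (simp only: Gam_sym[OF c x, of k y] scaleR_right_distrib scaleR_left_distrib mult_2)
        ultimately show ?thesis by simp
      qed
      have mat: "matrix (?f' y) = mat 1 - (2 * h) *\<^sub>R Gmat c x y" for y
        by (simp add: Gmat_def matrix_def vec_eq_iff mat_def axis_def)
      \<comment> \<open>Two velocities with equal image differ by \<open>h\<close> times a
        difference of Christoffel terms, a component of \<open>Xf\<close>; the Lipschitz bound and
        |h| L < 1 force them to coincide.\<close>
      have inj: "inj_on ?f ?S"
      proof (rule inj_onI)
        fix y y' assume y: "y \<in> ?S" "y' \<in> ?S" and eq: "?f y = ?f y'"
        have "norm (Gam c x y y - Gam c x y' y') \<le> norm (Xf c (x, y) - Xf c (x, y'))"
          by (simp add: Xf_def norm_Pair real_le_rsqrt norm_minus_commute)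
        also have "\<dots> \<le> L * norm (y - y')" using L[of "(x, y)" "(x, y')"] y R by (simp add: norm_Pair)
        finally have "norm (Gam c x y y - Gam c x y' y') \<le> L * norm (y - y')" .
        then have "\<bar>h\<bar> * norm (Gam c x y y - Gam c x y' y') \<le> \<bar>h\<bar> * (L * norm (y - y'))" by (rule mult_left_mono) simp
        moreover have "y - y' = h *\<^sub>R (Gam c x y y - Gam c x y' y')" using eq by (simp add: algebra_simps)
        then have "norm (y - y') = \<bar>h\<bar> * norm (Gam c x y y - Gam c x y' y')" by (metis norm_scaleR)
        ultimately have "norm (y - y') * (1 - \<bar>h\<bar> * L) \<le> 0" by (simp add: algebra_simps)
        then have "norm (y - y') \<le> 0" using h by (simp add: mult_le_0_iff)
        then show "y = y'" by simp
      qed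
      have cont: "continuous_on ?S (\<lambda>y. det (matrix (?f' y)))"
      proof -
        have "continuous_on ?S (\<lambda>y. Gmat c x y $ i $ j)" for i j
          using x by (intro continuous_on_compose2[OF C1_onD(4)[OF C1_Gam_q(2)[OF c]], where f="\<lambda>y. (0, x, y)", simplified])
             (auto intro!: continuous_intros)
        then have "continuous_on ?S (\<lambda>y. (mat 1 - (2 * h) *\<^sub>R Gmat c x y) $ i $ j)" for i j
          unfolding vector_minus_component vector_scaleR_component
          by (intro continuous_on_diff continuous_on_const continuous_on_scaleR)
        then show ?thesis unfolding mat det_def
          by (intro continuous_on_sum continuous_on_mult continuous_on_prod continuous_on_const)
      qed
      have v': "?v \<in> borel_measurable borel"
        by (rule measurable_compose[OF _ v]) (intro borel_measurable_continuous_onI continuous_intros)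
      have "(\<integral>\<^sup>+y. ?I (x, y) \<partial>lborel) = (\<integral>\<^sup>+y. ?v (?f y) * ennreal \<bar>det (matrix (?f' y))\<bar> * indicator ?S y \<partial>lborel)"
      proof (intro nn_integral_cong)
        fix y
        show "?I (x, y) = ?v (?f y) * ennreal \<bar>det (matrix (?f' y))\<bar> * indicator ?S y"
        proof (cases "y \<in> ?S")
          case True
          then have "fst (step_map c h (x, y)) \<in> cimg c" using dom by (auto simp: step_dom_def)
          moreover have "(x + h *\<^sub>R ?f y, ?f y) = step_map c h (x, y)" by (simp add: step_map_def eta_def)
          ultimately show ?thesis using True det_G_pos[OF c, of "fst (step_map c h (x, y))"]
            by (simp add: v_def rho_eq[OF c] step_weight_def mat abs_mult ennreal_mult mult.assoc)
        qed simp
      qed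
      also have "\<dots> = (\<integral>\<^sup>+w. ?v w * indicator (?f ` ?S) w \<partial>lborel)"
        by (rule nn_integral_change_of_variables[OF opn der inj cont v', symmetric])
      \<comment> \<open>Only an inequality, as the slice need not map onto the whole space. Used for
        both signs of the time step it suffices in \<open>mass_constant\<close>.\<close>
      also have "\<dots> \<le> (\<integral>\<^sup>+w. ?v w \<partial>lborel)" by (intro nn_integral_mono) (auto simp: indicator_def)
      finally show ?thesis .
    qed
  qed
  have pair: "(\<integral>\<^sup>+z. f z \<partial>lborel) = (\<integral>\<^sup>+x. \<integral>\<^sup>+y. f (x, y) \<partial>lborel \<partial>lborel)"
     "(\<integral>\<^sup>+z. f z \<partial>lborel) = (\<integral>\<^sup>+y. \<integral>\<^sup>+x. f (x, y) \<partial>lborel \<partial>lborel)"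
    if "f \<in> borel_measurable borel" for f :: "'n phase \<Rightarrow> ennreal"
    using that lborel.nn_integral_fst[of f lborel] lborel_pair.nn_integral_snd[of f]
    by (simp_all add: lborel_prod)
  have vs: "(\<lambda>z. v (fst z + h *\<^sub>R snd z, snd z)) \<in> borel_measurable borel"
    by (rule measurable_compose[OF _ v]) (intro borel_measurable_continuous_onI continuous_intros)
  have "(\<integral>\<^sup>+z. ?I z \<partial>lborel) = (\<integral>\<^sup>+x. \<integral>\<^sup>+y. ?I (x, y) \<partial>lborel \<partial>lborel)" by (rule pair[OF mI])
  also have "\<dots> \<le> (\<integral>\<^sup>+x. \<integral>\<^sup>+w. v (x + h *\<^sub>R w, w) \<partial>lborel \<partial>lborel)" by (intro nn_integral_mono slice)
  also have "\<dots> = (\<integral>\<^sup>+z. v (fst z + h *\<^sub>R snd z, snd z) \<partial>lborel)" by (subst pair(1)[OF vs]) simp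
  also have "\<dots> = (\<integral>\<^sup>+w. \<integral>\<^sup>+x. v (x + h *\<^sub>R w, w) \<partial>lborel \<partial>lborel)" by (subst pair(2)[OF vs]) simp
  also have "\<dots> = (\<integral>\<^sup>+w. \<integral>\<^sup>+x. v (x, w) \<partial>lborel \<partial>lborel)"
  proof (rule nn_integral_cong)
    fix w :: "real^'n"
    have m: "(\<lambda>x. v (x, w)) \<in> borel_measurable borel"
      by (rule measurable_compose[OF _ v]) (intro borel_measurable_continuous_onI continuous_intros)
    have "(\<integral>\<^sup>+x. v (x, w) \<partial>lborel) = (\<integral>\<^sup>+x. v (x, w) \<partial>distr lborel borel ((+) (h *\<^sub>R w)))"
      by (simp only: lborel_distr_plus)
    also have "\<dots> = (\<integral>\<^sup>+x. v (h *\<^sub>R w + x, w) \<partial>lborel)" using m by (subst nn_integral_distr) auto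
    finally show "(\<integral>\<^sup>+x. v (x + h *\<^sub>R w, w) \<partial>lborel) = (\<integral>\<^sup>+x. v (x, w) \<partial>lborel)" by (simp add: add.commute)
  qed
  also have "\<dots> = (\<integral>\<^sup>+z. v z \<partial>lborel)" by (rule pair(2)[OF v, symmetric])
  finally show "(\<integral>\<^sup>+z. ?I z \<partial>lborel) \<le> (\<integral>\<^sup>+z. u z * rho c z \<partial>lborel)" by (simp add: v_def)
qed

text \<open>Composition with the flow, cut off to the ball in which \<open>phi\<close> is
  controlled. For \<open>f\<close> supported in the ball of radius R / 2 the composition already
  vanishes between the balls of radius R and 2 R; see \<open>pull_support\<close>.\<close>

definition pull where "pull f t z = (if z \<in> cball z0 (2 * R) then f (phi t z) else (0::real))"
definition mass where "mass f t = (\<integral>\<^sup>+z. ennreal (pull f t z) * rho c z \<partial>lborel)"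

lemma measurable_phi:
  assumes t: "\<bar>t\<bar> \<le> \<epsilon>"
  shows "(\<lambda>z. if z \<in> cball z0 (2 * R) then phi t z else a) \<in> borel_measurable borel" "continuous_on (cball z0 (2 * R)) (phi t)"
proof -
  show 1: "continuous_on (cball z0 (2 * R)) (phi t)"
    by (rule lipschitz_on_continuous_on[of "exp (L * \<epsilon>)"], rule lipschitz_onI)
       (use phi_Lipschitz[OF _ _ t] in \<open>auto simp: dist_norm\<close>)
  show "(\<lambda>z. if z \<in> cball z0 (2 * R) then phi t z else a) \<in> borel_measurable borel"
    by (rule borel_measurable_continuous_on_if[OF _ 1]) auto
qed

lemma G_bound: obtains D where "0 < D" "\<And>z. z \<in> cball z0 R \<Longrightarrow> det (G c (fst z)) \<le> D"
proof -
  have bs: "cball z0 R \<subseteq> Tc c" using ball_sub(2)[of R] R by simp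
  have "continuous_on (cball z0 R) (\<lambda>z. det (G c (fst z)))"
    unfolding det_def using bs
    by (intro continuous_on_sum continuous_on_mult continuous_on_prod continuous_on_const
        continuous_on_compose2[OF C1_onD(4)[OF G_C1[OF c]]] continuous_on_fst continuous_on_id) (auto simp: Tc_def)
  then have "compact ((\<lambda>z. det (G c (fst z))) ` cball z0 R)" by (intro compact_continuous_image) auto
  then have "bounded ((\<lambda>z. det (G c (fst z))) ` cball z0 R)" by (rule compact_imp_bounded)
  then obtain D where D: "0 < D" "\<And>z. z \<in> cball z0 R \<Longrightarrow> norm (det (G c (fst z))) \<le> D" unfolding bounded_pos by blast
  show ?thesis by (rule that[OF D(1)]) (use D(2) in force)
qed

lemma rho_ball_finite: "(\<integral>\<^sup>+z. rho c z * indicator (ball z0 R) z \<partial>lborel) < \<infinity>"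
proof -
  obtain D where D: "0 < D" "\<And>z. z \<in> cball z0 R \<Longrightarrow> det (G c (fst z)) \<le> D" using G_bound by metis
  have "(\<integral>\<^sup>+z. rho c z * indicator (ball z0 R) z \<partial>lborel) \<le> (\<integral>\<^sup>+z. ennreal D * indicator (ball z0 R) z \<partial>lborel)"
  proof (rule nn_integral_mono)
    fix z
    show "rho c z * indicator (ball z0 R) z \<le> ennreal D * indicator (ball z0 R) z"
      using D(2)[of z] ball_sub(1)[of R] R rho_eq[OF c, of z]
      by (auto simp: Tc_def intro!: ennreal_leI split: split_indicator)
  qed
  also have "\<dots> < \<infinity>" using emeasure_lborel_ball_finite[of z0 R] by (simp add: nn_integral_cmult_indicator ennreal_mult_less_top)
  finally show ?thesis .
qed

context
  fixes f :: "'n phase \<Rightarrow> real" and M :: real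
  assumes f: "\<And>z. 0 \<le> f z" "\<And>z. f z \<le> 1" "\<And>z. z \<notin> ball z0 (R / 2) \<Longrightarrow> f z = 0"
    and M: "0 \<le> M" "\<And>z z'. \<bar>f z - f z'\<bar> \<le> M * norm (z - z')"
begin

lemma pull_bounds: "0 \<le> pull f t z" "pull f t z \<le> 1"
  using f by (auto simp: pull_def)

lemma pull_support: assumes t: "\<bar>t\<bar> \<le> \<epsilon>" and z: "z \<notin> ball z0 R" shows "pull f t z = 0"
proof (cases "z \<in> cball z0 (2 * R)")
  case True
  have "phi t z \<notin> ball z0 (R / 2)"
    using phi_box(2)[OF True t] z R dist_triangle[of z0 z "phi t z"] by (auto simp: dist_norm)
  then show ?thesis using f(3) by (simp add: pull_def)
qed (simp add: pull_def)

lemma continuous_f: "continuous_on S f"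
  by (rule lipschitz_on_continuous_on[of M], rule lipschitz_onI) (use M in \<open>auto simp: dist_norm\<close>)

lemma measurable_pull: assumes t: "\<bar>t\<bar> \<le> \<epsilon>" shows "pull f t \<in> borel_measurable borel"
  unfolding pull_def[abs_def]
  by (rule borel_measurable_continuous_on_if[OF _ continuous_on_compose2[OF continuous_f measurable_phi(2)[OF t]]]) auto

text \<open>The group law moves the first \<open>h\<close> units of time inside. Replacing them by
  the Euler step costs the error of \<open>phi_step\<close>, enlarged by the Lipschitz constants of
  \<open>phi t\<close> and of \<open>f\<close>.\<close>

lemma pull_step:
  assumes t: "\<bar>t\<bar> \<le> \<epsilon>" "\<bar>t + h\<bar> \<le> \<epsilon>" and h: "\<bar>h\<bar> \<le> \<epsilon>" "(L * C + C) * h\<^sup>2 \<le> R / 4" and z: "z \<in> ball z0 R"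
  shows "pull f (t + h) z \<le> pull f t (step_map c h z) + M * exp (L * \<epsilon>) * (L * C + C) * h\<^sup>2"
proof -
  have z2: "z \<in> cball z0 (2 * R)" using z R by auto
  note st = phi_step[OF z2 h(1)]
  have p: "dist z0 (phi h z) \<le> R + R / 4"
    using phi_box(2)[OF z2 h(1)] z dist_triangle[of z0 "phi h z" z] by (auto simp: dist_norm norm_minus_commute)
  then have p2: "phi h z \<in> cball z0 (2 * R)" using R by auto
  have "dist z0 (step_map c h z) \<le> dist z0 (phi h z) + norm (phi h z - step_map c h z)"
    using dist_triangle[of z0 "step_map c h z" "phi h z"] by (simp add: dist_norm)
  then have s2: "step_map c h z \<in> cball z0 (2 * R)" using p st h(2) R by auto
  have "pull f (t + h) z - pull f t (step_map c h z) = f (phi t (phi h z)) - f (phi t (step_map c h z))"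
    using z2 s2 by (simp add: pull_def phi_add[OF z2 h(1)] add.commute)
  also have "\<dots> \<le> M * norm (phi t (phi h z) - phi t (step_map c h z))" using M(2) by (smt (verit))
  also have "\<dots> \<le> M * (exp (L * \<epsilon>) * ((L * C + C) * h\<^sup>2))"
    using phi_Lipschitz[OF p2 s2 t(1)] st M(1) by (intro mult_left_mono order_trans[OF phi_Lipschitz[OF p2 s2 t(1)]]) auto
  finally show ?thesis by (simp add: mult.assoc)
qed

text \<open>Trading the flow over time \<open>h\<close> for the Euler step costs an error of order
  two in \<open>h\<close>, and trading \<open>det G\<close> for \<open>step_weight\<close> costs at
  most \<open>e' * \<bar>h\<bar>\<close>. What is left is bounded by \<open>step_integral\<close>.
  The bound \<open>d\<close> does not depend on \<open>t\<close>.\<close>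

lemma mass_step:
  assumes e: "0 < e"
  shows "\<exists>d>0. \<forall>t h. \<bar>t\<bar> \<le> \<epsilon> \<longrightarrow> \<bar>t + h\<bar> \<le> \<epsilon> \<longrightarrow> \<bar>h\<bar> \<le> d \<longrightarrow> mass f (t + h) \<le> mass f t + ennreal (e * \<bar>h\<bar>)"
proof -
  obtain D where D: "0 < D" "\<And>z. z \<in> cball z0 R \<Longrightarrow> det (G c (fst z)) \<le> D"
    using G_bound by metis
  let ?B = "ball z0 R"
  define b where "b = measure lborel ?B"
  have b: "emeasure lborel ?B = ennreal b" "0 \<le> b"
    unfolding b_def by (use emeasure_lborel_ball_finite[of z0 R] in \<open>auto intro!: emeasure_eq_ennreal_measure\<close>)
  define K where "K = M * exp (L * \<epsilon>) * (L * C + C)"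
  have K: "0 \<le> K" using M L0 C0 by (simp add: K_def)
  \<comment> \<open>Over a ball of volume \<open>b\<close> the error of the weight then contributes
    at most half of \<open>e * \<bar>h\<bar>\<close>.\<close>
  define e' where "e' = e / (2 * (b + 1))"
  have e': "0 < e'" "e' * b \<le> e / 2" using e b(2) by (auto simp: e'_def field_simps)
  obtain d1 where d1: "0 < d1" "\<And>h z. \<bar>h\<bar> \<le> d1 \<Longrightarrow> z \<in> cball z0 R \<Longrightarrow> (h, z) \<in> step_dom c \<and> \<bar>step_weight c (h, z) - det (G c (fst z))\<bar> \<le> e' * \<bar>h\<bar>"
    using step_weight_uniform[OF c compact_cball, of z0 R e'] ball_sub(2)[of R] R e' unfolding Tc_def by auto
  have LC: "0 < L * C + C" using L0 C0 by (simp add: add_pos_pos)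
  have KDb: "0 \<le> K * D * b" using K D(1) b(2) by simp
  \<comment> \<open>In this order: control of \<open>step_weight\<close>, validity of the flow, two
    bounds that keep the Euler error below R / 4, separated by the injectivity bound |h| L < 1, and
    a bound that makes the Lipschitz error at most half of \<open>e * \<bar>h\<bar>\<close>.\<close>
  let ?S = "{d1, \<epsilon>, 1, 1 / (2 * L), R / (4 * (L * C + C)), e / (2 * (K * D * b + 1))}"
  define d where "d = Min ?S"
  have "0 < e / (2 * (K * D * b + 1))" "0 < R / (4 * (L * C + C))" "0 < 1 / (2 * L)"
    using e KDb R LC L0 by (auto intro!: divide_pos_pos)
  then have d0: "0 < d" using d1(1) \<epsilon> by (simp add: d_def)
  show ?thesis
  proof (intro exI[of _ d] conjI allI impI d0)
    fix t h assume t: "\<bar>t\<bar> \<le> \<epsilon>" "\<bar>t + h\<bar> \<le> \<epsilon>" and h: "\<bar>h\<bar> \<le> d"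
    have "\<forall>x\<in>?S. \<bar>h\<bar> \<le> x" by (rule ballI, rule order_trans[OF h]) (simp only: d_def, rule Min_le, simp_all)
    then have h1: "\<bar>h\<bar> \<le> d1" "\<bar>h\<bar> \<le> \<epsilon>" "\<bar>h\<bar> \<le> 1" "\<bar>h\<bar> \<le> 1 / (2 * L)" "\<bar>h\<bar> \<le> R / (4 * (L * C + C))" "\<bar>h\<bar> \<le> e / (2 * (K * D * b + 1))"
      by (simp_all only: ball_simps simp_thms)
    have hL: "\<bar>h\<bar> * L < 1" using h1(4) L0 by (simp add: field_simps)
    have "(L * C + C) * h\<^sup>2 = (L * C + C) * \<bar>h\<bar> * \<bar>h\<bar>" by (simp add: power2_eq_square)
    also have "\<dots> \<le> (L * C + C) * \<bar>h\<bar> * 1" using LC h1(3) by (intro mult_left_mono) auto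
    also have "\<dots> \<le> R / 4" using h1(5) LC by (simp add: field_simps)
    finally have hh: "(L * C + C) * h\<^sup>2 \<le> R / 4" .
    have dom: "(h, z) \<in> step_dom c" "\<bar>step_weight c (h, z) - det (G c (fst z))\<bar> \<le> e' * \<bar>h\<bar>" if "z \<in> ?B" for z
      using d1(2)[OF h1(1), of z] that by auto
    have Kh: "K * h\<^sup>2 * D * b \<le> e / 2 * \<bar>h\<bar>"
    proof -
      have "\<bar>h\<bar> * (K * D * b + 1) \<le> e / 2" using h1(6) KDb by (simp add: field_simps)
      moreover have "\<bar>h\<bar> * (K * D * b) \<le> \<bar>h\<bar> * (K * D * b + 1)" by (intro mult_left_mono) auto
      ultimately have "\<bar>h\<bar> * (K * D * b) \<le> e / 2" by linarith
      then have "\<bar>h\<bar> * (\<bar>h\<bar> * (K * D * b)) \<le> \<bar>h\<bar> * (e / 2)" by (intro mult_left_mono) auto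
      then show ?thesis by (simp add: power2_eq_square mult_ac)
    qed
    let ?I = "\<lambda>z. ennreal (pull f t (step_map c h z)) * ennreal \<bar>step_weight c (h, z)\<bar> * indicator ?B z"
    let ?k = "K * h\<^sup>2 * D + e' * \<bar>h\<bar>"
    have pw: "ennreal (pull f (t + h) z) * rho c z \<le> ?I z + ennreal ?k * indicator ?B z" for z
    proof (cases "z \<in> ?B")
      case True
      let ?u' = "pull f (t + h) z" and ?u = "pull f t (step_map c h z)" and ?W = "\<bar>step_weight c (h, z)\<bar>" and ?r = "det (G c (fst z))"
      have zi: "fst z \<in> cimg c" using True ball_sub(1)[of R] R by (auto simp: Tc_def)
      have r: "0 < ?r" "?r \<le> D" "?r \<le> ?W + e' * \<bar>h\<bar>" using det_G_pos[OF c zi] D(2)[of z] dom(2)[OF True] True by auto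
      have "?u' * ?r \<le> (?u + K * h\<^sup>2) * ?r" using pull_step[OF t h1(2) hh True] r by (intro mult_right_mono) (auto simp: K_def mult_ac)
      also have "\<dots> = ?u * ?r + K * h\<^sup>2 * ?r" by (simp add: algebra_simps)
      also have "\<dots> \<le> (?u * ?W + 1 * (e' * \<bar>h\<bar>)) + K * h\<^sup>2 * D"
      proof (rule add_mono)
        have "?u * ?r \<le> ?u * (?W + e' * \<bar>h\<bar>)" using r pull_bounds(1) by (intro mult_left_mono)
        also have "\<dots> \<le> ?u * ?W + 1 * (e' * \<bar>h\<bar>)"
          unfolding distrib_left using pull_bounds(2)[of t "step_map c h z"] e' by (intro add_left_mono mult_right_mono) auto
        finally show "?u * ?r \<le> ?u * ?W + 1 * (e' * \<bar>h\<bar>)" .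
        show "K * h\<^sup>2 * ?r \<le> K * h\<^sup>2 * D" using K r by (intro mult_left_mono) auto
      qed
      finally have "?u' * ?r \<le> ?u * ?W + ?k" by simp
      then have "ennreal (?u' * ?r) \<le> ennreal (?u * ?W + ?k)" by (rule ennreal_leI)
      also have "\<dots> = ennreal ?u * ennreal ?W + ennreal ?k"
        using pull_bounds K D(1) e' by (subst ennreal_plus) (auto simp: ennreal_mult)
      finally show ?thesis using True pull_bounds r by (simp add: rho_eq[OF c zi] ennreal_mult)
    next
      case False
      then show ?thesis using pull_support[OF t(2) False] by simp
    qed
    have k0: "0 \<le> ?k" using K D(1) e' by simp
    have mI: "(\<lambda>z. ennreal (pull f t z)) \<in> borel_measurable borel" using measurable_pull[OF t(1)] by measurable
    have "mass f (t + h) \<le> (\<integral>\<^sup>+z. ?I z + ennreal ?k * indicator ?B z \<partial>lborel)"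
      unfolding mass_def by (intro nn_integral_mono pw)
    also have "\<dots> = (\<integral>\<^sup>+z. ?I z \<partial>lborel) + (\<integral>\<^sup>+z. ennreal ?k * indicator ?B z \<partial>lborel)"
      using step_integral(2)[OF hL dom(1) mI] by (intro nn_integral_add) (auto intro!: borel_measurable_times_ennreal borel_measurable_indicator)
    also have "(\<integral>\<^sup>+z. ennreal ?k * indicator ?B z \<partial>lborel) = ennreal (?k * b)"
      using k0 b by (simp add: nn_integral_cmult_indicator ennreal_mult)
    also have "(\<integral>\<^sup>+z. ?I z \<partial>lborel) \<le> mass f t"
      unfolding mass_def by (rule step_integral(1)[OF hL dom(1) mI])
    also have "?k * b \<le> e * \<bar>h\<bar>"
    proof -
      have "e' * b * \<bar>h\<bar> \<le> e / 2 * \<bar>h\<bar>" using e' by (intro mult_right_mono) auto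
      then show ?thesis using Kh by (simp add: algebra_simps)
    qed
    finally show "mass f (t + h) \<le> mass f t + ennreal (e * \<bar>h\<bar>)"
      by (auto intro: ennreal_leI add_mono order_trans)
  qed
qed

lemma mass_finite: assumes t: "\<bar>t\<bar> \<le> \<epsilon>" shows "mass f t < \<infinity>"
proof -
  have "mass f t \<le> (\<integral>\<^sup>+z. rho c z * indicator (ball z0 R) z \<partial>lborel)"
    unfolding mass_def
  proof (rule nn_integral_mono)
    fix z
    show "ennreal (pull f t z) * rho c z \<le> rho c z * indicator (ball z0 R) z"
      using mult_right_mono[of "ennreal (pull f t z)" 1 "rho c z"] pull_bounds(2)[of t z] pull_support[OF t, of z]
      by (cases "z \<in> ball z0 R") auto
  qed
  then show ?thesis using rho_ball_finite by (rule le_less_trans)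
qed

text \<open>The one-sided estimate \<open>mass_step\<close>, applied from \<open>r\<close> to
  \<open>s\<close> and from \<open>s\<close> to \<open>r\<close>, bounds the difference quotient by
  every positive number.\<close>

lemma mass_constant: assumes t: "\<bar>t\<bar> \<le> \<epsilon>" shows "mass f t = mass f 0"
proof -
  define m where "m t = enn2real (mass f t)" for t
  have m: "mass f t = ennreal (m t)" if "\<bar>t\<bar> \<le> \<epsilon>" for t
    using mass_finite[OF that] by (simp add: m_def)
  have m0: "0 \<le> m t" for t by (simp add: m_def)
  have der: "(m has_field_derivative 0) (at s within {-\<epsilon>..\<epsilon>})" if s: "s \<in> {-\<epsilon>..\<epsilon>}" for s
    unfolding has_field_derivative_iff tendsto_iff eventually_at
  proof (intro allI impI)
    fix e :: real assume e: "0 < e"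
    obtain d where d: "0 < d" "\<And>t h. \<bar>t\<bar> \<le> \<epsilon> \<Longrightarrow> \<bar>t + h\<bar> \<le> \<epsilon> \<Longrightarrow> \<bar>h\<bar> \<le> d \<Longrightarrow> mass f (t + h) \<le> mass f t + ennreal (e / 2 * \<bar>h\<bar>)"
      using mass_step[of "e / 2"] e by auto
    have step: "m r' \<le> m r + e / 2 * \<bar>r' - r\<bar>" if "\<bar>r\<bar> \<le> \<epsilon>" "\<bar>r'\<bar> \<le> \<epsilon>" "\<bar>r' - r\<bar> \<le> d" for r r'
    proof -
      have "ennreal (m r') \<le> ennreal (m r + e / 2 * \<bar>r' - r\<bar>)"
        using d(2)[of r "r' - r"] that m m0 e by (simp add: ennreal_plus)
      then show ?thesis using m0 e by (subst (asm) ennreal_le_iff) auto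
    qed
    show "\<exists>d>0. \<forall>r\<in>{-\<epsilon>..\<epsilon>}. r \<noteq> s \<and> dist r s < d \<longrightarrow> dist ((m r - m s) / (r - s)) 0 < e"
    proof (intro exI[of _ d] conjI ballI impI d)
      fix r assume r: "r \<in> {-\<epsilon>..\<epsilon>}" "r \<noteq> s \<and> dist r s < d"
      have "\<bar>r - s\<bar> \<le> d" "\<bar>s - r\<bar> \<le> d" "\<bar>r\<bar> \<le> \<epsilon>" "\<bar>s\<bar> \<le> \<epsilon>" using r s by (auto simp: dist_real_def)
      then have "\<bar>m r - m s\<bar> \<le> e / 2 * \<bar>r - s\<bar>"
        using step[of r s] step[of s r] by (simp only: abs_minus_commute[of s r]) linarith
      also have "\<dots> < e * \<bar>r - s\<bar>" using e r by simp
      finally show "dist ((m r - m s) / (r - s)) 0 < e" using r by (simp add: divide_simps)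
    qed
  qed
  obtain k where k: "\<forall>s\<in>{-\<epsilon>..\<epsilon>}. m s = k"
    using has_field_derivative_zero_constant[OF convex_real_interval(5) der] by blast
  have "t \<in> {-\<epsilon>..\<epsilon>}" "0 \<in> {-\<epsilon>..\<epsilon>}" using t \<epsilon> by auto
  then have "m t = m 0" using k by metis
  then show ?thesis using m[OF t] m[of 0] \<epsilon> by simp
qed

end

text \<open>The indicator of an open set is the increasing limit of Lipschitz functions, to which
  \<open>mass_constant\<close> applies; monotone convergence does the rest.\<close>

lemma mass_open:
  assumes U: "open U" "U \<subseteq> ball z0 (R / 2)" and t: "\<bar>t\<bar> \<le> \<epsilon>"
  shows "(\<integral>\<^sup>+z. indicator {z \<in> cball z0 (2 * R). phi t z \<in> U} z * rho c z \<partial>lborel) = (\<integral>\<^sup>+z. indicator U z * rho c z \<partial>lborel)"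
proof -
  define f where "f k z = min 1 (real k * infdist z (- U))" for k z
  \<comment> \<open>\<open>infdist\<close> to the empty set is 0 by convention, so the complement
    must be nonempty; it is, because \<open>U\<close> is bounded.\<close>
  have ne: "- U \<noteq> {}"
  proof
    assume "- U = {}"
    then have "U = UNIV" by auto
    then have "bounded (UNIV :: 'n phase set)" using U(2) bounded_ball bounded_subset by metis
    then show False by simp
  qed
  have f: "0 \<le> f k z" "f k z \<le> 1" for k z by (auto simp: f_def infdist_nonneg)
  have f0: "f k z = 0" if "z \<notin> U" for k z using that by (simp add: f_def)
  have lip: "\<bar>f k z - f k z'\<bar> \<le> real k * norm (z - z')" for k z z'
  proof -
    have "real k * \<bar>infdist z (- U) - infdist z' (- U)\<bar> \<le> real k * dist z z'"
      by (rule mult_left_mono[OF infdist_triangle_abs]) simp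
    then have "\<bar>real k * infdist z (- U) - real k * infdist z' (- U)\<bar> \<le> real k * norm (z - z')"
      by (simp add: dist_norm abs_mult right_diff_distrib[symmetric])
    then show ?thesis unfolding f_def by linarith
  qed
  have mono: "incseq (\<lambda>k. ennreal (f k z))" for z
    unfolding f_def by (auto intro!: incseq_SucI ennreal_leI min.mono mult_right_mono infdist_nonneg)
  have lim: "(SUP k. ennreal (f k z)) = indicator U z" for z
  proof (cases "z \<in> U")
    case True
    have "0 < infdist z (- U)"
      using True U(1) ne in_closed_iff_infdist_zero[of "- U" z] infdist_nonneg[of z "- U"] by (auto simp: less_le)
    then obtain k where "1 < real k * infdist z (- U)" using reals_Archimedean3 by blast
    then have "ennreal (f k z) = 1" by (simp add: f_def)
    then have "1 \<le> (SUP k. ennreal (f k z))" by (intro SUP_upper2[of k]) auto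
    moreover have "ennreal (f k z) \<le> 1" for k using f(2)[of k z] by simp
    then have "(SUP k. ennreal (f k z)) \<le> 1" by (intro SUP_least)
    ultimately have "(SUP k. ennreal (f k z)) = 1" by (rule antisym[rotated])
    then show ?thesis using True by simp
  qed (simp add: f0)
  have fz: "f k z = 0" if "z \<notin> ball z0 (R / 2)" for k z using f0 U(2) that by blast
  have pull: "(SUP k. ennreal (pull (f k) s z)) = indicator {z \<in> cball z0 (2 * R). phi s z \<in> U} z" for s z
    using lim[of "phi s z"] by (cases "z \<in> cball z0 (2 * R)") (simp_all add: pull_def indicator_def)
  have eq: "(SUP k. mass (f k) s) = (\<integral>\<^sup>+z. indicator {z \<in> cball z0 (2 * R). phi s z \<in> U} z * rho c z \<partial>lborel)"
    if s: "\<bar>s\<bar> \<le> \<epsilon>" for s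
  proof -
    have "(SUP k. mass (f k) s) = (\<integral>\<^sup>+z. (SUP k. ennreal (pull (f k) s z) * rho c z) \<partial>lborel)"
      unfolding mass_def
    proof (rule nn_integral_monotone_convergence_SUP[symmetric])
      show "incseq (\<lambda>k z. ennreal (pull (f k) s z) * rho c z)"
      proof (unfold incseq_def le_fun_def, intro allI impI mult_right_mono)
        fix i j :: nat and z assume "i \<le> j"
        then show "ennreal (pull (f i) s z) \<le> ennreal (pull (f j) s z)"
          using monoD[OF mono[of "phi s z"], of i j] by (simp add: pull_def)
      qed simp
      show "(\<lambda>z. ennreal (pull (f k) s z) * rho c z) \<in> borel_measurable lborel" for k
        using measurable_pull[OF f fz _ lip s] measurable_rho[OF c] by (simp add: borel_measurable_times_ennreal)
    qed
    then show ?thesis by (simp add: SUP_mult_right_ennreal[symmetric] pull)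
  qed
  have "(SUP k. mass (f k) t) = (SUP k. mass (f k) 0)"
    using mass_constant[OF f fz _ lip t] by simp
  moreover have "indicator {z \<in> cball z0 (2 * R). phi 0 z \<in> U} z = (indicator U z :: ennreal)" for z
    using U(2) R by (auto simp: phi_0 split: split_indicator)
  ultimately show ?thesis using eq[OF t] eq[of 0] \<epsilon> by simp
qed

lemma mass_borel:
  assumes E: "E \<in> sets borel" "E \<subseteq> ball z0 (R / 2)" and t: "\<bar>t\<bar> \<le> \<epsilon>"
  shows "(\<integral>\<^sup>+z. indicator {z \<in> cball z0 (2 * R). phi t z \<in> E} z * rho c z \<partial>lborel) = (\<integral>\<^sup>+z. indicator E z * rho c z \<partial>lborel)"
proof -
  let ?B = "ball z0 (R / 2)" and ?B2 = "cball z0 (2 * R)"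
  let ?\<phi> = "\<lambda>z. if z \<in> ?B2 then phi t z else z0"
  note m = measurable_phi(1)[OF t, of z0]
  have mi: "(indicator S :: _ \<Rightarrow> ennreal) \<in> borel_measurable borel" if "S \<in> sets borel" for S :: "'n phase set"
    using that by (rule borel_measurable_indicator)
  have B: "?B \<in> sets borel" "?B2 \<in> sets borel" by auto
  note mB = mi[OF B(1)] mi[OF B(2)]
  have mr: "(\<lambda>z. indicator S z * rho c z) \<in> borel_measurable borel" if "S \<in> sets borel" for S
    by (rule borel_measurable_times_ennreal[OF mi[OF that] measurable_rho[OF c]])
  \<comment> \<open>Two finite Borel measures, concentrated on the ball of radius R / 2. They agree
    on open sets, a generator closed under intersection, and hence coincide.\<close>
  define N1 where "N1 = density (distr (density lborel (\<lambda>z. indicator ?B2 z * rho c z)) borel ?\<phi>) (indicator ?B)"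
  define N2 where "N2 = density lborel (\<lambda>z. indicator ?B z * rho c z)"
  have e1: "emeasure N1 E = (\<integral>\<^sup>+z. indicator {z \<in> ?B2. phi t z \<in> E \<inter> ?B} z * rho c z \<partial>lborel)" if "E \<in> sets borel" for E
  proof -
    have "emeasure N1 E = (\<integral>\<^sup>+z. indicator ?B z * indicator E z \<partial>distr (density lborel (\<lambda>z. indicator ?B2 z * rho c z)) borel ?\<phi>)"
      unfolding N1_def using that mB by (subst emeasure_density) auto
    also have "\<dots> = (\<integral>\<^sup>+z. indicator ?B (?\<phi> z) * indicator E (?\<phi> z) \<partial>density lborel (\<lambda>z. indicator ?B2 z * rho c z))"
      using m borel_measurable_times_ennreal[OF mB(1) mi[OF that]] by (subst nn_integral_distr) (simp_all del: mem_cball)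
    also have "\<dots> = (\<integral>\<^sup>+z. (indicator ?B2 z * rho c z) * (indicator ?B (?\<phi> z) * indicator E (?\<phi> z)) \<partial>lborel)"
      using mr[OF B(2)] borel_measurable_times_ennreal[OF measurable_compose[OF m mB(1)] measurable_compose[OF m mi[OF that]]]
      by (subst nn_integral_density) (simp_all del: mem_cball)
    finally show ?thesis by (auto intro!: nn_integral_cong elim!: trans split: split_indicator)
  qed
  have e2: "emeasure N2 E = (\<integral>\<^sup>+z. indicator (E \<inter> ?B) z * rho c z \<partial>lborel)" if "E \<in> sets borel" for E
    unfolding N2_def using that
    using mr[OF B(1)] by (subst emeasure_density) (auto intro!: nn_integral_cong split: split_indicator)
  have "emeasure N2 UNIV \<le> (\<integral>\<^sup>+z. rho c z * indicator (ball z0 R) z \<partial>lborel)"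
    using R by (subst e2) (auto intro!: nn_integral_mono split: split_indicator)
  then have fin: "emeasure N2 UNIV < \<infinity>" using rho_ball_finite by (rule le_less_trans)
  have op: "emeasure N1 U = emeasure N2 U" if "open U" for U
    using mass_open[of "U \<inter> ?B", OF _ _ t] that e1[of U] e2[of U] by auto
  have "N1 = N2"
  proof (rule measure_eqI_generator_eq[of "{U. open U}" UNIV _ _ "\<lambda>_::nat. UNIV"])
    show "sets N1 = sigma_sets UNIV {U. open U}" "sets N2 = sigma_sets UNIV {U. open U}"
      by (auto simp: N1_def N2_def borel_def)
    show "emeasure N1 UNIV \<noteq> \<infinity>" for i :: nat using op[of UNIV] fin by auto
  qed (auto simp: Int_stable_def op)
  moreover have "E \<inter> ?B = E" using E by auto
  ultimately show ?thesis using e1[OF E(1)] e2[OF E(1)] by simp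
qed

end

section \<open>Continuity and measurability of the flow\<close>

context riem
begin

text \<open>The topology of the tangent bundle, given as a predicate because the bundle is a set of
  pairs and not a type of its own.\<close>

definition TM_open where "TM_open S \<longleftrightarrow> S \<subseteq> TMs \<and> (\<forall>c\<in>A. open {z \<in> Tc c. par c z \<in> S})"
definition box where "box c Z = {w \<in> TMs. fst w \<in> cdom c \<and> coords c w \<in> Z}"

lemma TM_open_sets: "TM_open S \<Longrightarrow> S \<in> sets TM"
  by (auto simp: TM_open_def sets_TM tm_sets_def)

lemma TM_open_Int: "TM_open S \<Longrightarrow> TM_open T \<Longrightarrow> TM_open (S \<inter> T)"
proof -
  have "{z \<in> Tc c. par c z \<in> S \<inter> T} = {z \<in> Tc c. par c z \<in> S} \<inter> {z \<in> Tc c. par c z \<in> T}" for c by auto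
  then show "TM_open S \<Longrightarrow> TM_open T \<Longrightarrow> TM_open (S \<inter> T)" by (auto simp: TM_open_def)
qed

lemma TM_open_Union:
  assumes "\<And>S. S \<in> \<S> \<Longrightarrow> TM_open S" shows "TM_open (\<Union>\<S>)"
proof -
  have "{z \<in> Tc c. par c z \<in> \<Union>\<S>} = (\<Union>S\<in>\<S>. {z \<in> Tc c. par c z \<in> S})" for c by auto
  then show ?thesis using assms unfolding TM_open_def by (simp add: Sup_least open_UN)
qed

lemma TM_open_box:
  assumes c: "c \<in> A" and Z: "open Z" shows "TM_open (box c Z)"
  unfolding TM_open_def
proof (intro conjI ballI)
  fix d assume d: "d \<in> A"
  let ?f = "\<lambda>z. (transition d c (fst z), dtau d c (fst z) (snd z))"
  have ov: "open (overlap d c \<times> (UNIV :: (real^'n) set))" by (intro open_Times open_overlap d c open_UNIV)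
  have "{z \<in> Tc d. par d z \<in> box c Z} = ?f -` Z \<inter> overlap d c \<times> UNIV"
    using par_TMs[OF d] chartD[OF d]
    by (auto simp: box_def Tc_def overlap_iff[OF d] par_def coords_def transition_def tvec_of_apply[OF c])
  moreover have "continuous_on (overlap d c \<times> UNIV) ?f"
  proof (intro continuous_intros)
    show "continuous_on (overlap d c \<times> UNIV) (\<lambda>z. transition d c (fst z))"
      by (rule continuous_on_compose2[OF C1_onD(4)[OF transition_C1[OF d c]]]) (auto intro: continuous_on_fst continuous_on_id)
    have "continuous_on (overlap d c \<times> UNIV) (\<lambda>z. \<Sum>i\<in>UNIV. snd z $ i *\<^sub>R dtau d c (fst z) (axis i 1))"
      by (intro continuous_on_sum continuous_on_scaleR continuous_on_compose2[OF C1_onD(4)[OF dtau_C1[OF d c]]]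
          continuous_on_fst continuous_on_id continuous_intros) auto
    then show "continuous_on (overlap d c \<times> UNIV) (\<lambda>z. dtau d c (fst z) (snd z))"
      by (rule continuous_on_eq) (auto simp: linear_axis_sum[OF linear_dtau[OF d c], symmetric])
  qed
  ultimately show "open {z \<in> Tc d. par d z \<in> box c Z}" using Z ov by (simp add: continuous_on_open_vimage)
qed (auto simp: box_def)

end

context complete_riem
begin

definition flow_cont where
  "flow_cont t w \<longleftrightarrow> (\<forall>S. TM_open S \<longrightarrow> flow t w \<in> S \<longrightarrow> (\<exists>T. TM_open T \<and> w \<in> T \<and> (\<forall>u\<in>T. flow t u \<in> S)))"

lemma cell_at:
  assumes "w \<in> TMs"
  obtains c R \<epsilon> L C where "flow_cell A g c (coords c w) R \<epsilon> L C" "fst w \<in> cdom c"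
proof -
  obtain c where c: "c \<in> A" "fst w \<in> cdom c" by (rule chart_around)
  obtain R \<epsilon> L C where "chart_box A g c (coords c w) R \<epsilon> L C" using flow_box[OF c(1) coords_Tc[OF c(2)]] by metis
  then have "flow_cell A g c (coords c w) R \<epsilon> L C" by (rule flow_cell.intro[OF complete_riem_axioms])
  then show ?thesis using that c by blast
qed

text \<open>Properties of the flow that are stable under composition need only be checked for short
  times and inside a chart.\<close>

lemma flow_induct [consumes 1, case_names trans loc]:
  assumes w: "w \<in> TMs"
    and trans: "\<And>s t u. u \<in> TMs \<Longrightarrow> P s u \<Longrightarrow> P t (flow s u) \<Longrightarrow> P (s + t) u"
    and loc: "\<And>c z0 R \<epsilon> L C u t. flow_cell A g c z0 R \<epsilon> L C \<Longrightarrow> u \<in> box c (ball z0 (R / 2)) \<Longrightarrow>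
      flow t u \<in> box c (ball z0 (R / 2)) \<Longrightarrow> \<bar>t\<bar> \<le> \<epsilon> \<Longrightarrow> P t u"
  shows "P t w"
proof -
  have fl: "flow (b - a) (flow a w) = flow b w" for a b using w by (simp add: flow_add)
  \<comment> \<open>Both time directions are carried along, since \<open>Bolzano\<close> speaks only
    of ordered pairs of times.\<close>
  have Q: "P (b - a) (flow a w) \<and> P (a - b) (flow b w)" if "a \<le> b" for a b
    using that
  proof (induction rule: Bolzano)
    case (trans a b c)
    then show ?case
      using assms(2)[OF flow_TMs[OF w], of "b - a" a "c - b"] assms(2)[OF flow_TMs[OF w], of "b - c" c "a - b"]
      by (simp add: fl)
  next
    case (local x)
    let ?u = "flow x w"
    have u: "?u \<in> TMs" using flow_TMs[OF w] .
    obtain c R \<epsilon> L C where cell: "flow_cell A g c (coords c ?u) R \<epsilon> L C" and uc: "fst ?u \<in> cdom c"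
      using cell_at[OF u] by metis
    interpret cell: flow_cell A g c "coords c ?u" R \<epsilon> L C by (rule cell)
    have near: "flow r w \<in> box c (ball (coords c ?u) (R / 2))" if "\<bar>r - x\<bar> \<le> \<epsilon>" for r
    proof -
      note f = cell.flow_coords[OF u uc _ that, unfolded fl]
      have "coords c ?u \<in> cball (coords c ?u) (2 * R)" using cell.R by simp
      from f(1-3)[OF this] show ?thesis using cell.R flow_TMs[OF w]
        by (auto simp: box_def dist_norm norm_minus_commute)
    qed
    show ?case
    proof (intro exI[of _ \<epsilon>] conjI allI impI)
      fix a b assume ab: "a \<le> x \<and> x \<le> b \<and> b - a < \<epsilon>"
      then have "flow a w \<in> box c (ball (coords c ?u) (R / 2))" "flow b w \<in> box c (ball (coords c ?u) (R / 2))"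
        by (auto intro!: near)
      then show "P (b - a) (flow a w)" "P (a - b) (flow b w)"
        using ab by (auto intro!: loc[OF cell] simp: fl)
    qed (rule cell.\<epsilon>)
  qed
  show ?thesis
    using Q[of 0 t] Q[of t 0] w by (cases "0 \<le> t") (auto simp: flow_0)
qed

end

context flow_cell
begin

lemma flow_cont_local:
  assumes w: "w \<in> box c (ball z0 (R / 2))" and t: "\<bar>t\<bar> \<le> \<epsilon>" shows "flow_cont t w"
  unfolding flow_cont_def
proof (intro allI impI)
  fix S assume S: "TM_open S" "flow t w \<in> S"
  let ?Z = "phi t -` {z \<in> Tc c. par c z \<in> S} \<inter> ball z0 (2 * R)"
  have cont: "continuous_on (ball z0 (2 * R)) (phi t)"
    using continuous_on_subset[OF measurable_phi(2)[OF t]] by auto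
  have opn: "open ?Z" using S(1) c cont unfolding TM_open_def by (meson continuous_on_open_vimage open_ball)
  have "coords c w \<in> ?Z"
  proof -
    have b: "coords c w \<in> ball z0 (2 * R)" "coords c w \<in> cball z0 (2 * R)" using w R by (auto simp: box_def)
    have "par c (coords c w) = w" using w c by (auto simp: box_def)
    then have "par c (phi t (coords c w)) = flow t w" using phi_box(4)[OF b(2) t] by simp
    then show ?thesis using phi_box(3)[OF b(2) t] sub b S(2) by auto
  qed
  then have "w \<in> box c ?Z" using w by (simp add: box_def)
  moreover have "flow t u \<in> S" if "u \<in> box c ?Z" for u
  proof -
    have u: "u \<in> TMs" "fst u \<in> cdom c" "coords c u \<in> cball z0 (2 * R)" "par c (phi t (coords c u)) \<in> S"
      using that by (auto simp: box_def)
    then show ?thesis using phi_box(4)[OF u(3) t] c by simp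
  qed
  ultimately show "\<exists>T. TM_open T \<and> w \<in> T \<and> (\<forall>u\<in>T. flow t u \<in> S)"
    using TM_open_box[OF c opn] by blast
qed

end

context complete_riem
begin

lemma flow_continuous: assumes "w \<in> TMs" shows "flow_cont t w"
  using assms
proof (induction rule: flow_induct)
  case (trans s t u)
  show ?case
    unfolding flow_cont_def
  proof (intro allI impI)
    fix S assume S: "TM_open S" "flow (s + t) u \<in> S"
    then obtain T where T: "TM_open T" "flow s u \<in> T" "\<forall>v\<in>T. flow t v \<in> S"
      using trans(3)[unfolded flow_cont_def, rule_format, of S] flow_add[OF trans(1)] by auto
    then obtain T' where T': "TM_open T'" "u \<in> T'" "\<forall>v\<in>T'. flow s v \<in> T"
      using trans(2)[unfolded flow_cont_def, rule_format, of T] by auto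
    have "flow (s + t) v \<in> S" if "v \<in> T'" for v
    proof -
      have "v \<in> TMs" using T'(1) that by (auto simp: TM_open_def)
      then show ?thesis using T(3) T'(3) that flow_add[of v t s] by metis
    qed
    then show "\<exists>T. TM_open T \<and> u \<in> T \<and> (\<forall>v\<in>T. flow (s + t) v \<in> S)" using T' by blast
  qed
next
  case (loc c z0 R \<epsilon> L C u t)
  then show ?case using flow_cell.flow_cont_local by metis
qed

lemma TM_open_flow: assumes S: "TM_open S" shows "TM_open {w \<in> TMs. flow t w \<in> S}"
proof -
  let ?\<T> = "{T. TM_open T \<and> (\<forall>u\<in>T. flow t u \<in> S)}"
  have "{w \<in> TMs. flow t w \<in> S} \<subseteq> \<Union>?\<T>"
    using flow_continuous S unfolding flow_cont_def by blast
  moreover have "\<Union>?\<T> \<subseteq> {w \<in> TMs. flow t w \<in> S}" by (auto simp: TM_open_def)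
  ultimately have "{w \<in> TMs. flow t w \<in> S} = \<Union>?\<T>" by blast
  moreover have "TM_open (\<Union>?\<T>)" by (rule TM_open_Union) simp
  ultimately show ?thesis by simp
qed

text \<open>Continuity settles preimages of boxes over open sets, induction over the Borel sets
  those of all boxes in a chart, and countably many charts cut any measurable set into such
  boxes.\<close>

lemma measurable_flow [measurable]: "flow t \<in> measurable TM TM"
proof (rule measurableI)
  show "flow t w \<in> space TM" if "w \<in> space TM" for w using that flow_TMs by simp
  fix E assume E: "E \<in> sets TM"
  let ?pre = "\<lambda>E. {w \<in> TMs. flow t w \<in> E}"
  have b: "?pre (box c Z) \<in> sets TM" if "c \<in> A" "Z \<in> sets borel" for c Z
  proof -
    have "Z \<in> sigma_sets UNIV {U. open U}" using that(2) by (simp add: borel_def)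
    then show ?thesis
    proof induction
      case (Basic U)
      then show ?case using TM_open_flow[OF TM_open_box[OF that(1)]] TM_open_sets by blast
    next
      case Empty
      then show ?case by (simp add: box_def)
    next
      case (Compl Z)
      have "?pre (box c (UNIV - Z)) = ?pre (box c UNIV) - ?pre (box c Z)" by (auto simp: box_def)
      then show ?case using Compl TM_open_sets[OF TM_open_flow[OF TM_open_box[OF that(1) open_UNIV]]] by auto
    next
      case (Union Z)
      have "?pre (box c (\<Union>i. Z i)) = (\<Union>i. ?pre (box c (Z i)))" by (auto simp: box_def)
      then show ?case using Union by auto
    qed
  qed
  have "E = (\<Union>k. box (cc k) {z \<in> Tc (cc k). par (cc k) z \<in> E})"
  proof -
    have ET: "E \<subseteq> TMs" using E by (auto simp: sets_TM tm_sets_def)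
    have "\<exists>k. fst w \<in> cdom (cc k)" for w :: "'a \<times> ('a, 'n) tvec" using cc(2) by blast
    then show ?thesis using ET cc(1) by (fastforce simp: box_def coords_Tc)
  qed
  then have "?pre E = (\<Union>k. ?pre (box (cc k) {z \<in> Tc (cc k). par (cc k) z \<in> E}))" by blast
  moreover have "?pre (box (cc k) {z \<in> Tc (cc k). par (cc k) z \<in> E}) \<in> sets TM" for k
    using E cc(1)[of k] by (intro b) (auto simp: sets_TM tm_sets_def)
  ultimately have "?pre E \<in> sets TM" by auto
  moreover have "flow t -` E \<inter> space TM = ?pre E" by auto
  ultimately show "flow t -` E \<inter> space TM \<in> sets TM" by simp
qed

text \<open>Openness of \<open>S\<close> allows the passage to a countable cover, and quantifying
  over all measurable subsets allows disjoint pieces to be cut from that cover.\<close>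

definition good where
  "good t S \<longleftrightarrow> TM_open S \<and> (\<forall>E\<in>sets TM. E \<subseteq> S \<longrightarrow> emeasure TM (flow t -` E \<inter> TMs) = emeasure TM E)"
lemma goodD: "good t S \<Longrightarrow> E \<in> sets TM \<Longrightarrow> E \<subseteq> S \<Longrightarrow> emeasure TM (flow t -` E \<inter> TMs) = emeasure TM E"
  by (simp add: good_def)

text \<open>The neighbourhood is taken around the image point because \<open>good\<close> compares a
  set with its preimage; in this form the property is stable under composition of flows.\<close>

definition nice where "nice t w \<longleftrightarrow> (\<exists>S. good t S \<and> flow t w \<in> S)"

lemma flow_vimage_sets: "E \<in> sets TM \<Longrightarrow> flow t -` E \<inter> TMs \<in> sets TM"
  using measurable_sets[OF measurable_flow] by simp

end

context flow_cell
begin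

text \<open>A point that flows into the ball of radius R / 2 starts in the ball of radius 2 R, as
  the backward flow shows. So the whole preimage is seen in the one chart, where
  \<open>mass_borel\<close> applies.\<close>

lemma nice_local:
  assumes w: "flow t w \<in> box c (ball z0 (R / 2))" and t: "\<bar>t\<bar> \<le> \<epsilon>" shows "nice t w"
  unfolding nice_def good_def
proof (intro exI[of _ "box c (ball z0 (R / 2))"] conjI ballI impI)
  show "TM_open (box c (ball z0 (R / 2)))" by (rule TM_open_box[OF c]) simp
  fix E assume E: "E \<in> sets TM" "E \<subseteq> box c (ball z0 (R / 2))"
  let ?pre = "flow t -` E \<inter> TMs" and ?E = "{z \<in> Tc c. par c z \<in> E}"
  have pre: "fst u \<in> cdom c \<and> coords c u \<in> cball z0 (2 * R)" if "u \<in> ?pre" for u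
  proof -
    let ?v = "flow t u"
    have v: "?v \<in> TMs" "fst ?v \<in> cdom c" "coords c ?v \<in> ball z0 (R / 2)" using that E(2) by (auto simp: box_def)
    have "coords c ?v \<in> cball z0 (2 * R)" using v(3) R by auto
    from flow_coords[OF v(1,2) this, of "- t"]
    show ?thesis using t that v(3) R flow_inverse(1)[of u t] dist_triangle[of z0 "coords c u" "coords c ?v"]
      by (auto simp: dist_norm norm_minus_commute)
  qed
  have E': "fst u \<in> cdom c" if "u \<in> E" for u using that E(2) by (auto simp: box_def)
  have Eb: "?E \<in> sets borel" "?E \<subseteq> ball z0 (R / 2)"
    using E c by (auto simp: sets_TM tm_sets_def box_def)
  have ind: "emeasure TM E = (\<integral>\<^sup>+z. indicator {z \<in> Tc c. par c z \<in> E} z * rho c z \<partial>lborel)"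
    if "E \<in> sets TM" "\<And>u. u \<in> E \<Longrightarrow> fst u \<in> cdom c" for E
  proof -
    have "emeasure TM E = (\<integral>\<^sup>+u. indicator E u \<partial>TM)" using that by simp
    also have "\<dots> = (\<integral>\<^sup>+z. rho c z * chartfun c (indicator E) z \<partial>lborel)"
      using that by (intro nn_integral_TM_chart c) (auto simp: indicator_def)
    finally show ?thesis
      by (auto intro!: nn_integral_cong elim!: trans simp: chartfun_def split: split_indicator)
  qed
  have "{z \<in> Tc c. par c z \<in> ?pre} = {z \<in> cball z0 (2 * R). phi t z \<in> ?E}"
  proof (intro set_eqI iffI)
    fix z assume z: "z \<in> {z \<in> Tc c. par c z \<in> ?pre}"
    then have z2: "z \<in> cball z0 (2 * R)" using pre[of "par c z"] c by auto
    show "z \<in> {z \<in> cball z0 (2 * R). phi t z \<in> ?E}"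
      using z z2 phi_box(3,4)[OF z2 t] sub by auto
  next
    fix z assume "z \<in> {z \<in> cball z0 (2 * R). phi t z \<in> ?E}"
    then have z2: "z \<in> cball z0 (2 * R)" and e: "par c (phi t z) \<in> E" by auto
    then show "z \<in> {z \<in> Tc c. par c z \<in> ?pre}"
      using phi_box(4)[OF z2 t] ball_sub(2)[of "2 * R"] R par_box(1)[OF z2] by auto
  qed
  then show "emeasure TM ?pre = emeasure TM E"
    using mass_borel[OF Eb t] ind[OF flow_vimage_sets[OF E(1)]] pre ind[OF E(1)] E' by simp
qed (rule w)

end

context complete_riem
begin

lemma nice: assumes "w \<in> TMs" shows "nice t w"
  using assms
proof (induction rule: flow_induct)
  case (loc c z0 R \<epsilon> L C u t)
  then show ?case using flow_cell.nice_local by metis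
next
  case (trans s t u)
  obtain S T where S: "good s S" "flow s u \<in> S" and T: "good t T" "flow t (flow s u) \<in> T"
    using trans(2,3) unfolding nice_def by blast
  then have ST: "TM_open S" "TM_open T" by (simp_all add: good_def)
  \<comment> \<open>For a measurable subset of this set the preimage under time \<open>t\<close>
    lies in \<open>S\<close>, where time \<open>s\<close> preserves the measure.\<close>
  let ?S = "T \<inter> {v \<in> TMs. flow (- t) v \<in> S}"
  show ?case unfolding nice_def good_def
  proof (intro exI[of _ ?S] conjI ballI impI)
    show "TM_open ?S" by (intro TM_open_Int ST TM_open_flow)
    show "flow (s + t) u \<in> ?S"
      using S(2) T(2) trans(1) flow_TMs[OF trans(1)] by (simp add: flow_add flow_inverse)
    fix E assume E: "E \<in> sets TM" "E \<subseteq> ?S"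
    have "flow (s + t) -` E \<inter> TMs = flow s -` (flow t -` E \<inter> TMs) \<inter> TMs"
    proof (rule set_eqI)
      fix v show "v \<in> flow (s + t) -` E \<inter> TMs \<longleftrightarrow> v \<in> flow s -` (flow t -` E \<inter> TMs) \<inter> TMs"
        by (cases "v \<in> TMs") (simp_all add: flow_add flow_TMs)
    qed
    moreover have "flow t -` E \<inter> TMs \<subseteq> S"
    proof
      fix v assume "v \<in> flow t -` E \<inter> TMs"
      then have "v \<in> TMs" "flow (- t) (flow t v) \<in> S" using E(2) by blast+
      then show "v \<in> S" by (simp add: flow_inverse)
    qed
    ultimately show "emeasure TM (flow (s + t) -` E \<inter> TMs) = emeasure TM E"
      using goodD[OF S(1) flow_vimage_sets[OF E(1)]] goodD[OF T(1) E(1)] E(2) by auto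
  qed
qed

text \<open>The Lindelof property of Euclidean space, used in each of the countably many bundle
  charts.\<close>

lemma TM_Lindelof:
  assumes \<S>: "\<And>S. S \<in> \<S> \<Longrightarrow> TM_open S" "\<Union>\<S> = TMs"
  obtains \<T> where "\<T> \<subseteq> \<S>" "countable \<T>" "\<Union>\<T> = TMs"
proof -
  define cover where "cover k \<T> \<longleftrightarrow> \<T> \<subseteq> \<S> \<and> countable \<T> \<and> Tc (cc k) \<subseteq> (\<Union>S\<in>\<T>. {z \<in> Tc (cc k). par (cc k) z \<in> S})" for k \<T>
  have "\<exists>\<T>. cover k \<T>" for k
  proof -
    let ?U = "\<lambda>S. {z \<in> Tc (cc k). par (cc k) z \<in> S}"
    have "open (?U S)" if "S \<in> \<S>" for S
      using \<S>(1)[OF that] cc(1)[of k] unfolding TM_open_def by blast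
    then have "\<And>S. S \<in> ?U ` \<S> \<Longrightarrow> open S" by blast
    then obtain \<F> where \<F>: "\<F> \<subseteq> ?U ` \<S>" "countable \<F>" "\<Union>\<F> = \<Union>(?U ` \<S>)" by (rule Lindelof)
    obtain \<T> where \<T>: "countable \<T>" "\<T> \<subseteq> \<S>" "\<F> = ?U ` \<T>"
      using countable_subset_image[THEN iffD1, OF conjI[OF \<F>(2,1)]] by blast
    have "Tc (cc k) \<subseteq> \<Union>(?U ` \<S>)"
    proof
      fix z assume z: "z \<in> Tc (cc k)"
      then obtain S where "S \<in> \<S>" "par (cc k) z \<in> S" using par_TMs[OF cc(1)[of k] z] \<S>(2) by auto
      then show "z \<in> \<Union>(?U ` \<S>)" using z by auto
    qed
    then show ?thesis using \<T> \<F>(3) by (intro exI[of _ \<T>]) (simp add: cover_def)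
  qed
  then obtain \<T> where "\<And>k. cover k (\<T> k)" by metis
  then have \<T>: "\<And>k. \<T> k \<subseteq> \<S>" "\<And>k. countable (\<T> k)" "\<And>k. Tc (cc k) \<subseteq> (\<Union>S\<in>\<T> k. {z \<in> Tc (cc k). par (cc k) z \<in> S})"
    unfolding cover_def by blast+
  show ?thesis
  proof (rule that[of "\<Union>k. \<T> k"])
    show "(\<Union>k. \<T> k) \<subseteq> \<S>" "countable (\<Union>k. \<T> k)" using \<T> by auto
    then have "\<Union>(\<Union>k. \<T> k) \<subseteq> TMs" using \<S>(2) by blast
    moreover have "w \<in> \<Union>(\<Union>k. \<T> k)" if w: "w \<in> TMs" for w
    proof -
      obtain k where k: "fst w \<in> cdom (cc k)" using cc(2) by blast
      have "coords (cc k) w \<in> Tc (cc k)" using coords_Tc[OF k] .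
      then obtain S where "S \<in> \<T> k" "par (cc k) (coords (cc k) w) \<in> S" using \<T>(3)[of k] by blast
      then show ?thesis using w k cc(1)[of k] by auto
    qed
    ultimately show "\<Union>(\<Union>k. \<T> k) = TMs" by blast
  qed
qed

theorem Liouville: assumes E: "E \<in> sets TM" shows "emeasure TM (flow t -` E \<inter> TMs) = emeasure TM E"
proof -
  have "\<exists>S. good t S \<and> w \<in> S" if "w \<in> TMs" for w
    using nice[OF flow_TMs[OF that], of t "- t"] that unfolding nice_def good_def by (auto simp: flow_inverse)
  then have "\<Union>(Collect (good t)) = TMs" by (auto simp: good_def TM_open_def)
  then obtain \<T> where \<T>: "\<T> \<subseteq> Collect (good t)" "countable \<T>" "\<Union>\<T> = TMs"
    using TM_Lindelof[of "Collect (good t)"] by (auto simp: good_def)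
  \<comment> \<open>The empty set is added to the cover so that the family is nonempty and can be
    enumerated by the natural numbers.\<close>
  have "good t {}"
  proof -
    have "TM_open {}" by (simp add: TM_open_def)
    then show ?thesis by (auto simp: good_def)
  qed
  then have \<T>': "insert {} \<T> \<subseteq> Collect (good t)" "countable (insert {} \<T>)" "\<Union>(insert {} \<T>) = TMs" using \<T> by auto
  then obtain S :: "nat \<Rightarrow> _" where S: "range S = insert {} \<T>"
    using range_from_nat_into[OF insert_not_empty \<T>'(2)] by blast
  have gS: "good t (S i)" for i using \<T>'(1) S by blast
  define D where "D = disjointed (\<lambda>i. E \<inter> S i)"
  have DS: "D i \<subseteq> S i" for i using disjointed_subset[of "\<lambda>i. E \<inter> S i" i] by (auto simp: D_def)
  have Dm: "range D \<subseteq> sets TM"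
    unfolding D_def using E gS TM_open_sets by (intro sets.range_disjointed_sets) (auto simp: good_def)
  have dis: "disjoint_family D" by (simp add: D_def disjoint_family_disjointed)
  have UD: "(\<Union>i. D i) = E"
  proof -
    have "(\<Union>i. D i) = (\<Union>i. E \<inter> S i)" unfolding D_def by (rule UN_disjointed_eq)
    also have "\<dots> = E \<inter> TMs" using S \<T>'(3) by auto
    also have "\<dots> = E" using E by (auto simp: sets_TM tm_sets_def)
    finally show ?thesis .
  qed
  have "emeasure TM (flow t -` E \<inter> TMs) = emeasure TM (\<Union>i. flow t -` D i \<inter> TMs)"
    by (rule arg_cong[of _ _ "emeasure TM"]) (auto simp: UD[symmetric])
  also have "\<dots> = (\<Sum>i. emeasure TM (flow t -` D i \<inter> TMs))"
  proof (rule suminf_emeasure[symmetric])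
    show "range (\<lambda>i. flow t -` D i \<inter> TMs) \<subseteq> sets TM" using Dm flow_vimage_sets by blast
    show "disjoint_family (\<lambda>i. flow t -` D i \<inter> TMs)" using dis unfolding disjoint_family_on_def by blast
  qed
  also have "\<dots> = (\<Sum>i. emeasure TM (D i))"
    using gS Dm DS unfolding good_def by (intro suminf_cong) blast
  also have "\<dots> = emeasure TM E" unfolding UD[symmetric] using Dm dis by (intro suminf_emeasure)
  finally show ?thesis .
qed

lemma nn_integral_flow:
  assumes f: "f \<in> borel_measurable TM"
  shows "(\<integral>\<^sup>+w. f (flow t w) \<partial>TM) = (\<integral>\<^sup>+w. f w \<partial>TM)"
proof -
  have "distr TM TM (flow t) = TM"
    by (rule measure_eqI) (simp_all add: emeasure_distr Liouville)
  then show ?thesis using nn_integral_distr[OF measurable_flow, of f t] f by simp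
qed

end

section \<open>Averages over unit spheres\<close>

lemma orthogonal_signed_permutation:
  fixes \<sigma> :: "'n::finite \<Rightarrow> real"
  assumes \<sigma>: "\<And>k. \<sigma> k * \<sigma> k = 1" and \<pi>: "bij \<pi>"
  shows "orthogonal_transformation (\<lambda>\<xi>::real^'n. \<chi> k. \<sigma> k * \<xi> $ \<pi> k)"
  unfolding orthogonal_transformation_def
proof (intro conjI allI)
  show "linear (\<lambda>\<xi>::real^'n. \<chi> k. \<sigma> k * \<xi> $ \<pi> k)" by (intro linearI) (auto simp: vec_eq_iff algebra_simps)
  fix v w :: "real^'n"
  have "(\<chi> k. \<sigma> k * v $ \<pi> k) \<bullet> (\<chi> k. \<sigma> k * w $ \<pi> k) = (\<Sum>k\<in>UNIV. (\<sigma> k * \<sigma> k) * (v $ \<pi> k * w $ \<pi> k))"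
    by (simp add: inner_vec_def mult_ac)
  also have "\<dots> = (\<Sum>k\<in>UNIV. v $ \<pi> k * w $ \<pi> k)" by (simp add: \<sigma>)
  also have "\<dots> = v \<bullet> w" using sum.reindex_bij_betw[OF \<pi>, of "\<lambda>k. v $ k * w $ k"] by (simp add: inner_vec_def)
  finally show "(\<chi> k. \<sigma> k * v $ \<pi> k) \<bullet> (\<chi> k. \<sigma> k * w $ \<pi> k) = v \<bullet> w" .
qed

lemma lborel_distr_orthogonal:
  fixes f :: "real^'n::finite \<Rightarrow> real^'n"
  assumes f: "orthogonal_transformation f" shows "distr lborel borel f = lborel"
proof (rule measure_eqI)
  have lin: "linear f" and inj: "inj f" and surj: "surj f"
    using f by (auto simp: orthogonal_transformation_linear orthogonal_transformation_inj orthogonal_transformation_surj)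
  have m: "f \<in> borel_measurable borel" using linear_continuous_on[OF linear_conv_bounded_linear[THEN iffD1, OF lin]] by (rule borel_measurable_continuous_onI)
  fix E assume E: "E \<in> sets (distr lborel borel f)"
  have "emeasure (distr lborel borel f) E = (\<integral>\<^sup>+x. indicator E (f x) \<partial>lborel)"
    using E m by (simp add: nn_integral_distr flip: nn_integral_indicator)
  also have "\<dots> = (\<integral>\<^sup>+x. indicator E (f x) * ennreal \<bar>det (matrix f)\<bar> * indicator UNIV x \<partial>lborel)" using f by simp
  also have "\<dots> = (\<integral>\<^sup>+x. indicator E x * indicator (range f) x \<partial>lborel)"
    by (rule nn_integral_change_of_variables[OF open_UNIV _ inj, where f'="\<lambda>_. f", symmetric])
       (use lin E in \<open>auto intro: linear_imp_has_derivative\<close>)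
  finally show "emeasure (distr lborel borel f) E = emeasure lborel E" using surj E by simp
qed simp

text \<open>The off-diagonal moments vanish by reflection in a coordinate hyperplane, the diagonal ones
  are equal by permuting coordinates.\<close>

lemma sphere_moment:
  fixes i j :: "'n::finite"
  defines "m \<equiv> \<lambda>i j (\<xi>::real^'n). indicator (ball 0 1) \<xi> * (sgn \<xi> $ i * sgn \<xi> $ j)"
  shows "integrable lborel (m i j)"
    "integral\<^sup>L lborel (m i j) = (if i = j then measure lborel (ball (0::real^'n) 1) / real CARD('n) else 0)"
proof -
  let ?v = "measure lborel (ball (0::real^'n) 1)"
  have meas: "m i j \<in> borel_measurable borel" for i j
    unfolding m_def by (intro borel_measurable_times borel_measurable_indicator)
      (auto simp: sgn_div_norm intro!: borel_measurable_times borel_measurable_divide borel_measurable_continuous_onI continuous_intros)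
  have bnd: "\<bar>m i j \<xi>\<bar> \<le> indicator (ball 0 1) \<xi>" for i j \<xi>
  proof -
    have "\<bar>sgn \<xi> $ i\<bar> \<le> 1" for i
      using component_le_norm_cart[of "sgn \<xi>" i] norm_sgn[of \<xi>] by (auto split: if_splits)
    then have "\<bar>sgn \<xi> $ i\<bar> * \<bar>sgn \<xi> $ j\<bar> \<le> 1 * 1" by (intro mult_mono) auto
    then show ?thesis by (auto simp: m_def abs_mult split: split_indicator)
  qed
  have iball: "integrable lborel (indicator (ball 0 1) :: real^'n \<Rightarrow> real)"
    using emeasure_lborel_ball_finite[of "0::real^'n" 1] by (intro integrable_real_indicator) auto
  show int: "integrable lborel (m i j)" for i j
    by (rule Bochner_Integration.integrable_bound[OF iball]) (use meas bnd in auto)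
  have inv: "integral\<^sup>L lborel (\<lambda>\<xi>. m i j (\<chi> k. \<sigma> k * \<xi> $ \<pi> k)) = integral\<^sup>L lborel (m i j)"
    if "\<And>k. \<sigma> k * \<sigma> k = 1" "bij \<pi>" for i j and \<sigma> :: "'n \<Rightarrow> real" and \<pi> :: "'n \<Rightarrow> 'n"
  proof -
    note T = orthogonal_signed_permutation[OF that]
    have "(\<lambda>\<xi>::real^'n. \<chi> k. \<sigma> k * \<xi> $ \<pi> k) \<in> borel_measurable borel"
      using linear_continuous_on[OF linear_conv_bounded_linear[THEN iffD1, OF orthogonal_transformation_linear[OF T]]]
      by (rule borel_measurable_continuous_onI)
    then have "integral\<^sup>L (distr lborel borel (\<lambda>\<xi>. \<chi> k. \<sigma> k * \<xi> $ \<pi> k)) (m i j) = integral\<^sup>L lborel (\<lambda>\<xi>. m i j (\<chi> k. \<sigma> k * \<xi> $ \<pi> k))"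
      using meas[of i j] by (subst integral_distr) auto
    then show ?thesis by (simp add: lborel_distr_orthogonal[OF T])
  qed
  have mT: "m i j (\<chi> k. \<sigma> k * \<xi> $ \<pi> k) = \<sigma> i * \<sigma> j * m (\<pi> i) (\<pi> j) \<xi>"
    if "\<And>k. \<sigma> k * \<sigma> k = 1" "bij \<pi>" for i j and \<sigma> :: "'n \<Rightarrow> real" and \<pi> :: "'n \<Rightarrow> 'n" and \<xi>
    using orthogonal_transformation_norm[OF orthogonal_signed_permutation[OF that], where x=\<xi>]
    by (simp add: m_def sgn_div_norm indicator_def)
  have off: "integral\<^sup>L lborel (m i j) = 0" if "i \<noteq> j" for i j
  proof -
    let ?\<sigma> = "\<lambda>k. if k = i then - 1 else 1 :: real"
    have "integral\<^sup>L lborel (m i j) = integral\<^sup>L lborel (\<lambda>\<xi>. - m i j \<xi>)"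
      using inv[of ?\<sigma> id i j] mT[of ?\<sigma> id i j] that by simp
    then show ?thesis by simp
  qed
  have diag: "integral\<^sup>L lborel (m i i) = integral\<^sup>L lborel (m j j)" for i j
    using inv[of "\<lambda>_. 1" "Transposition.transpose i j" i i] mT[of "\<lambda>_. 1" "Transposition.transpose i j" i i] by simp
  \<comment> \<open>The diagonal moments add up to the volume of the ball because
    \<open>sgn \<xi>\<close> is a unit vector away from 0; this fixes their common value.\<close>
  have "(\<Sum>k\<in>UNIV. integral\<^sup>L lborel (m k k)) = integral\<^sup>L lborel (\<lambda>\<xi>. \<Sum>k\<in>UNIV. m k k \<xi>)"
    by (rule Bochner_Integration.integral_sum[symmetric]) (rule int)
  also have "(\<lambda>\<xi>. \<Sum>k\<in>UNIV. m k k \<xi>) = indicator (ball 0 1 - {0})"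
  proof
    fix \<xi> :: "real^'n"
    have "(\<Sum>k\<in>UNIV. m k k \<xi>) = indicator (ball 0 1) \<xi> * (sgn \<xi> \<bullet> sgn \<xi>)"
      by (simp add: m_def inner_vec_def sum_distrib_left)
    then show "(\<Sum>k\<in>UNIV. m k k \<xi>) = indicator (ball 0 1 - {0}) \<xi>"
      by (cases "\<xi> = 0") (auto simp: dot_square_norm norm_sgn indicator_def)
  qed
  also have "integral\<^sup>L lborel (indicator (ball 0 1 - {0::real^'n})) = ?v"
    by (simp add: measure_def emeasure_Diff_null_set null_setsI)
  finally have *: "(\<Sum>k\<in>UNIV. integral\<^sup>L lborel (m k k)) = ?v" .
  have "(\<Sum>k\<in>UNIV. integral\<^sup>L lborel (m k k)) = (\<Sum>k\<in>(UNIV::'n set). integral\<^sup>L lborel (m i i))" for i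
    by (intro sum.cong refl diag)
  then have "real CARD('n) * integral\<^sup>L lborel (m i i) = ?v" for i
    using * by simp
  then have "integral\<^sup>L lborel (m i i) = ?v / real CARD('n)" for i
    by (simp add: field_simps)
  then show "integral\<^sup>L lborel (m i j) = (if i = j then ?v / real CARD('n) else 0)"
    using off by simp
qed

section \<open>The punctured unit ball bundle\<close>

context complete_riem
begin

text \<open>Unit vectors are replaced by the vectors of norm between 0 and 1: \<open>q\<close> is \<open>Ric\<close> extended to be
  homogeneous of degree 0, and \<open>BM\<close> is the punctured unit ball bundle.\<close>

definition ric where "ric w = ricci A g (fst w) (snd w) (snd w)"
definition q where "q w = ric w / sqn w"
definition BM where "BM = {w \<in> TMs. 0 < sqn w \<and> sqn w < 1}"
definition nrm where "nrm w = (fst w, \<lambda>c. snd w c /\<^sub>R sqrt (sqn w))"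

lemma par_chart:
  assumes c: "c \<in> A" and z: "z \<in> Tc c"
  shows "ric (par c z) = Ricm c (fst z) (snd z)" "sqn (par c z) = ip c (fst z) (snd z) (snd z)"
    "nrm (par c z) = par c (fst z, snd z /\<^sub>R sqrt (sqn (par c z)))"
proof -
  have p: "cinv c (fst z) \<in> cdom c" "cmap c (cinv c (fst z)) = fst z" using z chartD[OF c] by (auto simp: Tc_def)
  show "ric (par c z) = Ricm c (fst z) (snd z)" "sqn (par c z) = ip c (fst z) (snd z) (snd z)"
    using c p by (simp_all add: ric_def sqn_def par_def ricci_eq[OF c] g_tvec_of)
  let ?k = "inverse (sqrt (sqn (par c z)))" and ?v = "tv c (cinv c (fst z)) (snd z)"
  have "(\<lambda>d. ?k *\<^sub>R ?v d) = lincomb2 ?k ?v 0 (\<lambda>_. 0)" by (simp add: lincomb2_def)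
  then have "(\<lambda>d. ?k *\<^sub>R ?v d) \<in> TS (cinv c (fst z))" using c p by simp
  then have "(\<lambda>d. ?k *\<^sub>R ?v d) = tv c (cinv c (fst z)) (?k *\<^sub>R ?v c)" by (rule tvec_of_comp[OF _ c p(1), symmetric])
  then show "nrm (par c z) = par c (fst z, snd z /\<^sub>R sqrt (sqn (par c z)))"
    using c p by (simp add: nrm_def par_def)
qed

lemma continuous_chart:
  assumes c: "c \<in> A"
  shows "continuous_on (Tc c) (\<lambda>z. Ricm c (fst z) (snd z))" "continuous_on (Tc c) (\<lambda>z. ip c (fst z) (snd z) (snd z))"
proof -
  have "continuous_on (Tc c) (\<lambda>z. Rm c (fst z) (axis i 1) (snd z) (snd z))" for i
    by (rule continuous_on_Rm[OF c]) (auto intro!: continuous_intros simp: Tc_def)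
  then show "continuous_on (Tc c) (\<lambda>z. Ricm c (fst z) (snd z))"
    unfolding Ricm_def by (intro continuous_on_sum continuous_on_component)
  show "continuous_on (Tc c) (\<lambda>z. ip c (fst z) (snd z) (snd z))"
    by (rule continuous_on_ip[OF c]) (auto intro!: continuous_intros simp: Tc_def)
qed

lemma measurable_ric [measurable]: "ric \<in> borel_measurable TM"
proof (rule measurable_TM_I)
  fix c assume c: "c \<in> A"
  show "(\<lambda>z. ric (par c z)) \<in> borel_measurable (restrict_space borel (Tc c))"
    by (rule measurable_cong[THEN iffD1, OF _ borel_measurable_continuous_on_restrict[OF continuous_chart(1)[OF c]]])
       (simp add: space_restrict_space par_chart[OF c])
qed

lemma measurable_sqn [measurable]: "sqn \<in> borel_measurable TM"
proof (rule measurable_TM_I)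
  fix c assume c: "c \<in> A"
  show "(\<lambda>z. sqn (par c z)) \<in> borel_measurable (restrict_space borel (Tc c))"
    by (rule measurable_cong[THEN iffD1, OF _ borel_measurable_continuous_on_restrict[OF continuous_chart(2)[OF c]]])
       (simp add: space_restrict_space par_chart[OF c])
qed

lemma measurable_q [measurable]: "q \<in> borel_measurable TM"
  unfolding q_def[abs_def] by measurable

lemma BM_sets [measurable]: "BM \<in> sets TM"
proof -
  have "BM = sqn -` {0<..<1} \<inter> space TM" by (auto simp: BM_def)
  then show ?thesis using measurable_sets[OF measurable_sqn, of "{0<..<1}"] by simp
qed

lemma BM_TMs [simp]: "BM \<inter> TMs = BM" by (auto simp: BM_def)

lemma measurable_nrm [measurable]: "nrm \<in> measurable TM TM"
proof (rule measurable_TM_I)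
  fix c assume c: "c \<in> A"
  let ?R = "restrict_space borel (Tc c) :: 'n phase measure"
  have "(\<lambda>z. (fst z, snd z /\<^sub>R sqrt (sqn (par c z)))) \<in> measurable ?R borel"
  proof -
    have "(\<lambda>z. sqn (par c z)) \<in> borel_measurable ?R"
      using measurable_comp[OF measurable_par[OF c] measurable_sqn] by (simp add: o_def)
    moreover have "fst \<in> measurable ?R borel" "snd \<in> measurable ?R borel"
      by (auto intro!: borel_measurable_continuous_on_restrict continuous_intros)
    ultimately show ?thesis by measurable
  qed
  then have "(\<lambda>z. (fst z, snd z /\<^sub>R sqrt (sqn (par c z)))) \<in> measurable ?R ?R"
    by (intro measurable_restrict_space2) (auto simp: space_restrict_space Tc_def)
  from measurable_comp[OF this measurable_par[OF c]]
  have "(\<lambda>z. par c (fst z, snd z /\<^sub>R sqrt (sqn (par c z)))) \<in> measurable ?R TM" by (simp add: o_def)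
  then show "(\<lambda>z. nrm (par c z)) \<in> measurable ?R TM"
    by (rule measurable_cong[THEN iffD1, rotated]) (simp add: space_restrict_space par_chart[OF c])
qed

lemma tangent_scale: assumes "v \<in> TS p" shows "(\<lambda>c. k *\<^sub>R v c) \<in> TS p"
  using lincomb2_tangent[OF assms zero_tangent, of k 0] by (simp add: lincomb2_def)

lemma scale_sqn: assumes "(p, v) \<in> TMs" shows "sqn (p, \<lambda>c. k *\<^sub>R v c) = k\<^sup>2 * sqn (p, v)" "ric (p, \<lambda>c. k *\<^sub>R v c) = k\<^sup>2 * ric (p, v)"
proof -
  obtain c where c: "c \<in> A" "p \<in> cdom c" by (rule chart_around)
  have x: "cmap c p \<in> cimg c" using c by simp
  have v: "v \<in> TS p" using assms by (simp add: TMs_def)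
  show "sqn (p, \<lambda>c. k *\<^sub>R v c) = k\<^sup>2 * sqn (p, v)"
    using c v tangent_scale[OF v, of k] by (simp add: sqn_def g_eq_ip[OF c] ip_simps power2_eq_square)
  show "ric (p, \<lambda>c. k *\<^sub>R v c) = k\<^sup>2 * ric (p, v)"
    using v tangent_scale[OF v, of k] linear_cmul[OF Rm_linear(2)[OF c(1) x]] linear_cmul[OF Rm_linear(3)[OF c(1) x]]
    by (simp add: ric_def ricci_eq[OF c] Ricm_def sum_distrib_left power2_eq_square mult.assoc)
qed

lemma nrm: assumes w: "w \<in> TMs" "0 < sqn w" shows "nrm w \<in> TMs" "sqn (nrm w) = 1" "ric (nrm w) = q w"
proof -
  obtain p v where [simp]: "w = (p, v)" by (cases w)
  have v: "(p, v) \<in> TMs" using w by simp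
  show "nrm w \<in> TMs" using v tangent_scale[of v p "inverse (sqrt (sqn w))"] by (simp add: nrm_def TMs_def)
  show "sqn (nrm w) = 1" "ric (nrm w) = q w"
    using w(2) by (simp_all add: nrm_def q_def scale_sqn[OF v] power_inverse) (simp add: field_simps)
qed

lemma from_frame_TMs: "(p, ff p \<xi>) \<in> TMs"
  using chart_around from_frame_tvec(2) unfolding TMs_def by blast

lemma sqn_from_frame: "sqn (p, ff p \<xi>) = \<xi> \<bullet> \<xi>"
proof -
  note e = frame_orthonormal[of p]
  have "g p (fr p i) (ff p \<xi>) = \<xi> $ i" for i
    using frame_inner[OF e, of "\<lambda>i. \<xi> $ i" i] g_sym[of "fr p i" p "ff p \<xi>"] orthonormal_frameD(1)[OF e]
      from_frame_TMs[of p \<xi>] by (simp add: from_frame_def[symmetric] TMs_def)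
  then show ?thesis
    using g_linear_left[of "ff p \<xi>" p UNIV "fr p" "\<lambda>i. \<xi> $ i"] orthonormal_frameD(1)[OF e] from_frame_TMs[of p \<xi>]
    by (simp add: sqn_def from_frame_def[symmetric] TMs_def inner_vec_def)
qed

lemma nrm_from_frame: "nrm (p, ff p \<xi>) = (p, ff p (sgn \<xi>))"
  unfolding nrm_def sqn_from_frame by (simp add: norm_eq_sqrt_inner[symmetric] from_frame_def sgn_div_norm scaleR_sum_right)

lemma BM_from_frame: "(p, ff p \<xi>) \<in> BM \<longleftrightarrow> \<xi> \<in> ball 0 1 - {0}"
  by (auto simp: BM_def from_frame_TMs sqn_from_frame dot_square_norm power_less_one_iff)

text \<open>\<open>sphere_measure\<close> is n times the push-forward of Lebesgue measure on the
  punctured ball under \<open>sgn\<close>. Fibre by fibre, the measure of the sphere bundle is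
  therefore n times the push-forward of \<open>TM\<close> on \<open>BM\<close> under
  \<open>nrm\<close>.\<close>

lemma usb_integral:
  assumes h: "h \<in> borel_measurable TM"
  shows "(\<integral>\<^sup>+w. h w \<partial>usb_measure A g) = of_nat CARD('n) * (\<integral>\<^sup>+w. h (nrm w) * indicator BM w \<partial>TM)"
proof -
  let ?U = "unit_sphere_bundle A g"
  have U: "?U = {w \<in> TMs. sqn w = 1}" by (auto simp: unit_sphere_bundle_def sqn_def TMs_def)
  then have "?U = sqn -` {1} \<inter> space TM" by auto
  then have Us: "?U \<in> sets TM" using measurable_sets[OF measurable_sqn, of "{1}"] by simp
  define S where "S = restrict_space TM ?U"
  have spS: "space S = ?U" using U by (auto simp: S_def space_restrict_space)
  have "?U \<inter> space TM = ?U" using U by auto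
  then have seS0: "E \<in> sets S \<longleftrightarrow> E \<subseteq> ?U \<and> E \<in> sets TM" for E
    unfolding S_def using sets_restrict_space_iff[of ?U TM E] Us by simp
  have seS: "sets S = usb_sets A g"
  proof -
    have "sets S = {E \<in> tm_sets. E \<subseteq> ?U}" using seS0 by (auto simp: sets_TM)
    also have "\<dots> = usb_sets A g"
    proof -
      have "{(x, y). x \<in> cimg c \<and> (cinv c x, tv c (cinv c x) y) \<in> E} = {z \<in> Tc c. par c z \<in> E}" for c E
        by (auto simp: Tc_def par_def)
      then show ?thesis using U by (auto simp: tm_sets_def usb_sets_def)
    qed
    finally show ?thesis .
  qed
  define D where "D = distr (restrict_space TM BM) S nrm"
  have mn: "nrm \<in> measurable (restrict_space TM BM) S"
    unfolding S_def using nrm U by (intro measurable_restrict_space2 measurable_restrict_space1 measurable_nrm)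
      (auto simp: space_restrict_space BM_def)
  have D: "space D = ?U" "sets D = usb_sets A g" by (simp_all add: D_def spS seS)
  have em: "emeasure (scale_measure (of_nat CARD('n)) D) E =
      (\<integral>\<^sup>+p. emeasure sphere_measure {x \<in> sphere 0 1. (p, ff p x) \<in> E} \<partial>V)" if E: "E \<in> usb_sets A g" for E
  proof -
    have ET: "E \<in> sets TM" "E \<subseteq> ?U" using E seS seS0 by auto
    let ?h = "\<lambda>w. indicator E (nrm w) * indicator BM w :: ennreal"
    have h: "?h \<in> borel_measurable TM" using ET(1) by measurable
    have "emeasure D E = (\<integral>\<^sup>+w. indicator E w \<partial>D)" using E D by simp
    also have "\<dots> = (\<integral>\<^sup>+w. indicator E (nrm w) \<partial>restrict_space TM BM)"
      unfolding D_def using E seS by (intro nn_integral_distr mn borel_measurable_indicator) simp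
    also have "\<dots> = (\<integral>\<^sup>+p. fib ?h p \<partial>V)"
      by (subst nn_integral_restrict_space) (simp_all add: nn_integral_TM[OF h])
    finally have 1: "emeasure D E = (\<integral>\<^sup>+p. fib ?h p \<partial>V)" .
    have 2: "of_nat CARD('n) * fib ?h p = emeasure sphere_measure {x \<in> sphere 0 1. (p, ff p x) \<in> E}" for p
    proof -
      let ?X = "{x \<in> sphere 0 1. (p, ff p x) \<in> E}" and ?B = "ball 0 1 - {0::real^'n}"
      have "(indicator {x. (p, ff p x) \<in> E} :: _ \<Rightarrow> ennreal) \<in> borel_measurable borel"
        using measurable_fibre[of "indicator E" p] ET by (simp add: indicator_def[abs_def])
      then have "{x. (p, ff p x) \<in> E} \<in> sets borel" by (simp add: borel_measurable_indicator_iff)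
      then have "sphere 0 1 \<inter> {x. (p, ff p x) \<in> E} \<in> sets borel" by (intro sets.Int) auto
      moreover have "sphere 0 1 \<inter> {x. (p, ff p x) \<in> E} = ?X" by blast
      ultimately have X: "?X \<in> sets borel" by (simp only:)
      have ms: "sgn \<in> measurable (restrict_space lborel ?B) borel"
        by (rule measurable_restrict_space1)
           (auto simp: sgn_div_norm intro!: borel_measurable_scaleR borel_measurable_inverse borel_measurable_norm)
      have "emeasure sphere_measure ?X = of_nat CARD('n) * emeasure (distr (restrict_space lborel ?B) borel sgn) ?X"
        by (simp add: sphere_measure_def)
      also have "emeasure (distr (restrict_space lborel ?B) borel sgn) ?X = (\<integral>\<^sup>+\<xi>. indicator ?X \<xi> \<partial>distr (restrict_space lborel ?B) borel sgn)"
        using X by simp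
      also have "\<dots> = (\<integral>\<^sup>+\<xi>. indicator ?X (sgn \<xi>) \<partial>restrict_space lborel ?B)"
        using X by (intro nn_integral_distr ms) auto
      also have "\<dots> = (\<integral>\<^sup>+\<xi>. indicator ?X (sgn \<xi>) * indicator ?B \<xi> \<partial>lborel)"
        by (rule nn_integral_restrict_space) simp
      also have "\<dots> = fib ?h p"
        unfolding fib_def by (intro nn_integral_cong) (auto simp: BM_from_frame nrm_from_frame norm_sgn split: split_indicator)
      finally show ?thesis ..
    qed
    have "emeasure (scale_measure (of_nat CARD('n)) D) E = of_nat CARD('n) * (\<integral>\<^sup>+p. fib ?h p \<partial>V)"
      by (simp add: 1)
    also have "\<dots> = (\<integral>\<^sup>+p. of_nat CARD('n) * fib ?h p \<partial>V)"
      by (rule nn_integral_cmult[symmetric]) (rule measurable_fib[OF h])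
    finally show ?thesis by (simp add: 2)
  qed
  \<comment> \<open>The set function in \<open>usb_measure\<close> agrees with that of an actual
    measure, so \<open>measure_of\<close> takes the values prescribed by it.\<close>
  have "usb_measure A g = measure_of ?U (usb_sets A g) (emeasure (scale_measure (of_nat CARD('n)) D))"
    unfolding usb_measure_def
  proof (rule measure_of_eq)
    show "usb_sets A g \<subseteq> Pow ?U" by (auto simp: usb_sets_def)
    fix E assume "E \<in> sigma_sets ?U (usb_sets A g)"
    then have "E \<in> usb_sets A g" using sets.sigma_sets_eq[of S] by (simp add: spS seS)
    then show "(\<integral>\<^sup>+p. emeasure sphere_measure {x \<in> sphere 0 1. (p, ff p x) \<in> E} \<partial>V)
        = emeasure (scale_measure (of_nat CARD('n)) D) E" using em by simp
  qed
  also have "\<dots> = scale_measure (of_nat CARD('n)) D"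
    using measure_of_of_measure[of "scale_measure (of_nat CARD('n)) D"] by (simp only: space_scale_measure sets_scale_measure D)
  finally have "(\<integral>\<^sup>+w. h w \<partial>usb_measure A g) = of_nat CARD('n) * (\<integral>\<^sup>+w. h w \<partial>D)"
    using measurable_restrict_space1[OF h, of ?U] by (simp add: nn_integral_scale_measure D_def S_def)
  also have "(\<integral>\<^sup>+w. h w \<partial>D) = (\<integral>\<^sup>+w. h (nrm w) \<partial>restrict_space TM BM)"
    unfolding D_def using measurable_restrict_space1[OF h, of ?U] by (intro nn_integral_distr mn) (simp add: S_def)
  also have "\<dots> = (\<integral>\<^sup>+w. h (nrm w) * indicator BM w \<partial>TM)"
    by (rule nn_integral_restrict_space) simp
  finally show ?thesis .
qed

end

lemma unit_ball:
  "0 < measure lborel (ball (0::real^'n::finite) 1)"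
  "emeasure lborel (ball (0::real^'n) 1) = ennreal (measure lborel (ball (0::real^'n) 1))"
proof -
  have "emeasure lborel (ball (0::real^'n) 1) \<noteq> top" using emeasure_lborel_ball_finite[of "0::real^'n" 1] by simp
  then show "emeasure lborel (ball (0::real^'n) 1) = ennreal (measure lborel (ball (0::real^'n) 1))" by (rule emeasure_eq_ennreal_measure)
  show "0 < measure lborel (ball (0::real^'n::finite) 1)" by (simp add: content_ball_pos)
qed

section \<open>Scalar curvature as a fibre average of the Ricci curvature\<close>

context complete_riem
begin

abbreviation scal where "scal \<equiv> scalar_curvature A g"

text \<open>The two parts are integrated separately in \<open>ennreal\<close>: without the index
  inequality the integral of \<open>qpos\<close> may be infinite.\<close>

definition qpos where "qpos w = ennreal (q w) * indicator BM w"
definition qneg where "qneg w = ennreal (- q w) * indicator BM w"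

lemma measurable_qpos [measurable]: "qpos \<in> borel_measurable TM" "qneg \<in> borel_measurable TM"
  unfolding qpos_def[abs_def] qneg_def[abs_def] by measurable

lemma fibre_ricci:
  obtains \<beta> where "\<forall>\<xi>. ric (p, ff p \<xi>) = (\<Sum>i\<in>UNIV. \<Sum>j\<in>UNIV. \<beta> i j * (\<xi> $ i * \<xi> $ j))"
    "(\<Sum>i\<in>UNIV. \<beta> i i) = scal p"
proof -
  obtain c where c: "c \<in> A" "p \<in> cdom c" by (rule chart_around)
  have x: "cmap c p \<in> cimg c" using c by simp
  note e = orthonormal_frameD(1)[OF frame_orthonormal, of p]
  define \<beta> where "\<beta> i j = (\<Sum>k\<in>UNIV. Rm c (cmap c p) (axis k 1) (fr p i c) (fr p j c) $ k)" for i j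
  show ?thesis
  proof (rule that[of \<beta>], intro allI)
    fix \<xi> :: "real^'n"
    have 1: "Rm c (cmap c p) a (\<Sum>i\<in>UNIV. \<xi> $ i *\<^sub>R u i) (\<Sum>j\<in>UNIV. \<xi> $ j *\<^sub>R u j)
        = (\<Sum>i\<in>UNIV. \<Sum>j\<in>UNIV. (\<xi> $ i * \<xi> $ j) *\<^sub>R Rm c (cmap c p) a (u i) (u j))" for a u
      by (simp only: linear_sum[OF Rm_linear(2)[OF c(1) x]] linear_cmul[OF Rm_linear(2)[OF c(1) x]])
        (simp add: linear_sum[OF Rm_linear(3)[OF c(1) x]] linear_cmul[OF Rm_linear(3)[OF c(1) x]] scaleR_sum_right)
    have "ric (p, ff p \<xi>) = Ricm c (cmap c p) (\<Sum>i\<in>UNIV. \<xi> $ i *\<^sub>R fr p i c)"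
      using from_frame_TMs[of p \<xi>] by (simp add: ric_def ricci_eq[OF c] TMs_def) (simp add: from_frame_def)
    also have "\<dots> = (\<Sum>k\<in>UNIV. \<Sum>i\<in>UNIV. \<Sum>j\<in>UNIV. Rm c (cmap c p) (axis k 1) (fr p i c) (fr p j c) $ k * (\<xi> $ i * \<xi> $ j))"
      by (simp add: Ricm_def 1 mult.commute)
    also have "\<dots> = (\<Sum>i\<in>UNIV. \<Sum>j\<in>UNIV. \<beta> i j * (\<xi> $ i * \<xi> $ j))"
      unfolding \<beta>_def sum_distrib_right by (subst sum.swap, rule sum.cong[OF refl], rule sum.swap)
    finally show "ric (p, ff p \<xi>) = (\<Sum>i\<in>UNIV. \<Sum>j\<in>UNIV. \<beta> i j * (\<xi> $ i * \<xi> $ j))" .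
  qed (simp add: scalar_curvature_def \<beta>_def ricci_eq[OF c e] Ricm_def)
qed

text \<open>Only the diagonal moments contribute, hence the scalar curvature times
  \<open>\<kappa>\<close>. The two truncated differences show that the scalar curvature is
  measurable; the last identity contains no subtraction of integrals and can be integrated over the
  base without finiteness of the positive part.\<close>

lemma fibre_moment:
  defines "\<kappa> \<equiv> measure lborel (ball (0::real^'n) 1) / real CARD('n)"
  shows "fib qpos p - fib qneg p = ennreal (\<kappa> * scal p)" "fib qneg p - fib qpos p = ennreal (- (\<kappa> * scal p))"
    "fib qpos p + ennreal (- (\<kappa> * scal p)) = fib qneg p + ennreal (\<kappa> * scal p)"
proof -
  obtain \<beta> where \<beta>: "\<forall>\<xi>. ric (p, ff p \<xi>) = (\<Sum>i\<in>UNIV. \<Sum>j\<in>UNIV. \<beta> i j * (\<xi> $ i * \<xi> $ j))"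
    "(\<Sum>i\<in>UNIV. \<beta> i i) = scal p" by (rule fibre_ricci[of p])
  let ?m = "\<lambda>i j (\<xi>::real^'n). indicator (ball 0 1) \<xi> * (sgn \<xi> $ i * sgn \<xi> $ j)"
  define F where "F \<xi> = (\<Sum>i\<in>UNIV. \<Sum>j\<in>UNIV. \<beta> i j * ?m i j \<xi>)" for \<xi>
  have qF: "q (p, ff p \<xi>) * indicator BM (p, ff p \<xi>) = F \<xi>" for \<xi>
  proof (cases "\<xi> \<in> ball 0 1 - {0}")
    case True
    then have "F \<xi> = (\<Sum>i\<in>UNIV. \<Sum>j\<in>UNIV. \<beta> i j * (\<xi> $ i * \<xi> $ j)) / (norm \<xi> * norm \<xi>)"
      by (simp add: F_def sgn_div_norm sum_divide_distrib divide_inverse mult_ac sum_distrib_left sum_distrib_right)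
    then show ?thesis using True by (simp add: q_def sqn_from_frame \<beta>(1)[rule_format] BM_from_frame dot_square_norm power2_eq_square)
  next
    case False
    then have "F \<xi> = 0" by (cases "\<xi> = 0") (auto simp: F_def)
    then show ?thesis using False by (simp add: BM_from_frame indicator_def)
  qed
  have int: "integrable lborel F" unfolding F_def
    by (intro Bochner_Integration.integrable_sum integrable_mult_right sphere_moment(1))
  have "integral\<^sup>L lborel F = (\<Sum>i\<in>UNIV. \<Sum>j\<in>UNIV. \<beta> i j * integral\<^sup>L lborel (?m i j))"
    unfolding F_def
    by (subst Bochner_Integration.integral_sum, intro Bochner_Integration.integrable_sum integrable_mult_right sphere_moment(1))
      (intro sum.cong refl, subst Bochner_Integration.integral_sum, auto intro!: integrable_mult_right sphere_moment(1) sum.cong)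
  also have "\<dots> = (\<Sum>i\<in>UNIV. \<beta> i i * \<kappa>)"
    unfolding sphere_moment(2) by (simp add: if_distrib[of "(*) _"] \<kappa>_def cong: if_cong)
  also have "\<dots> = \<kappa> * scal p" unfolding \<beta>(2)[symmetric] by (simp add: sum_distrib_left mult.commute)
  finally have I: "integral\<^sup>L lborel F = \<kappa> * scal p" .
  have a: "fib qpos p = (\<integral>\<^sup>+\<xi>. ennreal (F \<xi>) \<partial>lborel)" and b: "fib qneg p = (\<integral>\<^sup>+\<xi>. ennreal (- F \<xi>) \<partial>lborel)"
    unfolding fib_def qpos_def qneg_def qF[symmetric]
    by (auto intro!: nn_integral_cong split: split_indicator)
  have fin: "fib qpos p < \<infinity>" "fib qneg p < \<infinity>"
    unfolding a b using int integrable_minus[OF int] by (auto simp: real_integrable_def top.not_eq_extremum)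
  define a' b' where "a' = enn2real (fib qpos p)" and "b' = enn2real (fib qneg p)"
  have ab: "fib qpos p = ennreal a'" "fib qneg p = ennreal b'" "0 \<le> a'" "0 \<le> b'"
    using fin by (simp_all add: a'_def b'_def)
  have d: "\<kappa> * scal p = a' - b'"
    using real_lebesgue_integral_def[OF int] I by (simp add: a'_def b'_def a b)
  show "fib qpos p - fib qneg p = ennreal (\<kappa> * scal p)" "fib qneg p - fib qpos p = ennreal (- (\<kappa> * scal p))"
    unfolding ab d using ab(3,4) by (simp_all add: ennreal_minus)
  show "fib qpos p + ennreal (- (\<kappa> * scal p)) = fib qneg p + ennreal (\<kappa> * scal p)"
    unfolding ab d using ab(3,4)
    by (cases "a' \<le> b'") (simp_all add: ennreal_neg ennreal_plus[symmetric] del: ennreal_plus)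
qed

lemma emeasure_BM: "emeasure TM BM = emeasure lborel (ball (0::real^'n) 1) * emeasure V UNIV"
proof -
  have "emeasure TM BM = (\<integral>\<^sup>+p. fib (indicator BM) p \<partial>V)" by (rule emeasure_TM) simp
  also have "\<dots> = (\<integral>\<^sup>+p. emeasure lborel (ball (0::real^'n) 1) \<partial>V)"
  proof (rule nn_integral_cong)
    fix p
    have "fib (indicator BM) p = (\<integral>\<^sup>+\<xi>. indicator (ball 0 1 - {0::real^'n}) \<xi> \<partial>lborel)"
      unfolding fib_def using BM_from_frame[of p] by (intro nn_integral_cong) (auto simp: indicator_def)
    then show "fib (indicator BM) p = emeasure lborel (ball (0::real^'n) 1)"
      by (simp add: emeasure_Diff_null_set null_setsI)
  qed
  finally show ?thesis by simp
qed

text \<open>The hypothesis on the average, moved to the ball bundle by \<open>fibre_moment\<close>: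
  on average \<open>q\<close> is at least n - 1. The negative part stands on the left because only
  that part is known to be finite.\<close>

lemma ricci_average:
  assumes n: "CARD('n) \<ge> 2" and vol: "emeasure V UNIV < \<infinity>"
    and neg: "(\<integral>\<^sup>+w. qneg w \<partial>TM) < \<infinity>"
    and avg: "average_scalar_curvature A g \<ge> ereal (real CARD('n) * (real CARD('n) - 1))"
  shows "(\<integral>\<^sup>+w. qneg w \<partial>TM) + ennreal (real CARD('n) - 1) * emeasure TM BM \<le> (\<integral>\<^sup>+w. qpos w \<partial>TM)"
proof -
  define \<omega> where "\<omega> = measure lborel (ball (0::real^'n) 1)"
  note \<omega> = unit_ball[where 'n='n, folded \<omega>_def]
  define \<kappa> where "\<kappa> = \<omega> / real CARD('n)"
  have \<kappa>: "0 < \<kappa>" using \<omega> by (simp add: \<kappa>_def)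
  note fm = fibre_moment[folded \<omega>_def, folded \<kappa>_def]
  have [measurable]: "fib qpos \<in> borel_measurable V" "fib qneg \<in> borel_measurable V" by (simp_all add: measurable_fib)
  have ms: "(\<lambda>p. ennreal (\<kappa> * scal p)) \<in> borel_measurable V" "(\<lambda>p. ennreal (- (\<kappa> * scal p))) \<in> borel_measurable V"
    unfolding fm(1,2)[symmetric] by measurable
  define Q1 Q2 P N where "Q1 = (\<integral>\<^sup>+w. qpos w \<partial>TM)" and "Q2 = (\<integral>\<^sup>+w. qneg w \<partial>TM)"
    and "P = (\<integral>\<^sup>+p. ennreal (scal p) \<partial>V)" and "N = (\<integral>\<^sup>+p. ennreal (- scal p) \<partial>V)"
  have sc: "ennreal (scal p) = ennreal (1 / \<kappa>) * ennreal (\<kappa> * scal p)" "ennreal (- scal p) = ennreal (1 / \<kappa>) * ennreal (- (\<kappa> * scal p))" for p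
    using \<kappa> by (simp_all add: ennreal_mult'[symmetric])
  have kP: "ennreal \<kappa> * P = (\<integral>\<^sup>+p. ennreal (\<kappa> * scal p) \<partial>V)" "ennreal \<kappa> * N = (\<integral>\<^sup>+p. ennreal (- (\<kappa> * scal p)) \<partial>V)"
    unfolding P_def N_def sc using ms \<kappa> by (simp_all add: nn_integral_cmult mult.assoc[symmetric] ennreal_mult[symmetric])
  have eq: "Q1 + ennreal \<kappa> * N = Q2 + ennreal \<kappa> * P"
    unfolding Q1_def Q2_def kP using ms fm(3)
    by (simp add: nn_integral_TM nn_integral_add[symmetric])
  \<comment> \<open>The negative part of the scalar curvature is dominated by that of the Ricci
    curvature. So \<open>N\<close> is finite and can be cancelled at the end.\<close>
  have "ennreal \<kappa> * N \<le> Q2" unfolding kP Q2_def nn_integral_TM[OF measurable_qpos(2)]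
    by (intro nn_integral_mono) (simp add: fm(2)[symmetric] diff_le_self_ennreal)
  then have kN: "ennreal \<kappa> * N < \<infinity>" using neg by (simp add: Q2_def le_less_trans)
  then have Nfin: "N < \<infinity>" using \<kappa> by (auto simp: ennreal_mult_less_top)
  define v where "v = enn2real (emeasure V UNIV)"
  have v: "emeasure V UNIV = ennreal v" "0 \<le> v" using vol by (simp_all add: v_def)
  define N' where "N' = enn2real N"
  have N': "N = ennreal N'" "0 \<le> N'" using Nfin by (simp_all add: N'_def)
  define d where "d = real CARD('n)"
  have d: "2 \<le> d" using n by (simp add: d_def)
  have avg': "ereal (d * (d - 1)) \<le> (enn2ereal P - ereal N') / ereal v"
    using avg v N' by (simp add: average_scalar_curvature_def P_def N_def d_def enn2ereal_ennreal)
  \<comment> \<open>For volume 0 the average is 0 divided by 0, which is 0 in \<open>ereal\<close>,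
    below the positive bound n (n - 1).\<close>
  have "0 < v"
  proof (rule ccontr)
    assume "\<not> 0 < v"
    then have "v = 0" using v by simp
    then have "emeasure V UNIV = 0" using v by simp
    then have "P = 0" "N = 0" unfolding P_def N_def
      by (auto intro!: nn_integral_null_set[of UNIV V, simplified] simp: null_sets_def)
    then have "ereal (d * (d - 1)) \<le> 0" using avg' \<open>v = 0\<close> N' by (simp add: zero_ennreal.rep_eq divide_ereal_def)
    then have "d * (d - 1) \<le> 0" by (simp add: zero_ereal_def del: ereal_eq_0)
    moreover have "0 < d * (d - 1)" using d by simp
    ultimately show False by linarith
  qed
  have main: "N + ennreal (d * (d - 1)) * ennreal v \<le> P"
  proof (cases "P = \<infinity>")
    case False
    define P' where "P' = enn2real P"
    have P': "P = ennreal P'" "0 \<le> P'" using False by (simp_all add: P'_def top.not_eq_extremum)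
    have "d * (d - 1) \<le> (P' - N') / v" using avg' P' \<open>0 < v\<close> by (simp add: enn2ereal_ennreal)
    then have "N' + d * (d - 1) * v \<le> P'" using \<open>0 < v\<close> by (simp add: field_simps)
    then have "ennreal (N' + d * (d - 1) * v) \<le> ennreal P'" by (rule ennreal_leI)
    then show ?thesis using N' P' v d by (simp add: ennreal_plus ennreal_mult)
  qed simp
  \<comment> \<open>The factor n in the bound n (n - 1) cancels against the denominator of
    \<open>\<kappa>\<close>, and the volume of the ball bundle appears.\<close>
  have "ennreal \<kappa> * ennreal (d * (d - 1)) * ennreal v = ennreal (d - 1) * emeasure TM BM"
    unfolding emeasure_BM v \<omega>(2) using \<omega> v d \<kappa> by (simp add: \<kappa>_def d_def ennreal_mult[symmetric])
  then have "ennreal \<kappa> * N + (Q2 + ennreal (d - 1) * emeasure TM BM) = Q2 + ennreal \<kappa> * (N + ennreal (d * (d - 1)) * ennreal v)"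
    by (simp add: distrib_left mult.assoc add_ac)
  also have "\<dots> \<le> Q2 + ennreal \<kappa> * P" by (intro add_left_mono mult_left_mono main) simp
  also have "\<dots> = ennreal \<kappa> * N + Q1" using eq by (simp add: add.commute)
  finally show ?thesis using less_imp_neq[OF kN] by (simp add: ennreal_add_left_cancel_le Q1_def Q2_def d_def)
qed

section \<open>Averaging the index inequality\<close>

lemma sqn_nonneg: assumes "w \<in> TMs" shows "0 \<le> sqn w"
proof -
  obtain c where c: "c \<in> A" "fst w \<in> cdom c" by (rule chart_around)
  have "sqn w = ip c (cmap c (fst w)) (snd w c) (snd w c)"
    using assms g_eq_ip[OF c] by (auto simp: sqn_def TMs_def)
  then show ?thesis using ip_pos[of c "cmap c (fst w)" "snd w c"] c by (cases "snd w c = 0") (auto simp: ip_simps)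
qed

text \<open>The geodesic with initial vector \<open>w\<close> has constant speed
  \<open>sqrt (sqn w)\<close>; dividing time by it gives a unit speed geodesic. As \<open>q\<close>
  is homogeneous of degree 0, it is Ric of the unit velocity along that geodesic, and
  \<open>index_inequality\<close> applies.\<close>

lemma unit_flow:
  assumes cf: conj_free and w: "w \<in> TMs" "0 < sqn w"
  defines "\<phi> \<equiv> \<lambda>t. q (flow (t / sqrt (sqn w)) w)"
  shows "continuous_on UNIV \<phi>"
    and "integral {0..pi} (\<lambda>t. (sin t)\<^sup>2 * \<phi> t) \<le> (real CARD('n) - 1) * pi / 2" (is "?I \<le> ?c")
    and "integral {0..pi} (\<lambda>t. (sin t)\<^sup>2 * \<phi> t) = (real CARD('n) - 1) * pi / 2 \<Longrightarrow>
      c \<in> A \<Longrightarrow> fst w \<in> cdom c \<Longrightarrow> ip c (cmap c (fst w)) a (snd w c) = 0 \<Longrightarrow>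
      Rm c (cmap c (fst w)) a (snd w c) (snd w c) = sqn w *\<^sub>R a"
proof -
  define \<rho> where "\<rho> = sqrt (sqn w)"
  have \<rho>: "0 < \<rho>" "\<rho>\<^sup>2 = sqn w" using w by (simp_all add: \<rho>_def)
  define \<gamma> where "\<gamma> = (\<lambda>t. geo w (0 + 1 / \<rho> * t))"
  note geo = geo(1)[OF w(1)]
  have \<gamma>: "geod \<gamma>" "vel \<gamma> t = (\<lambda>c. (1 / \<rho>) *\<^sub>R vel (geo w) (t / \<rho>) c)" for t
    using geodesic_affine[OF geo, of 0 "1 / \<rho>"] by (simp_all add: \<gamma>_def)
  have st: "(\<gamma> t, vel (geo w) (t / \<rho>)) = flow (t / \<rho>) w" for t by (simp add: \<gamma>_def flow_def state_def)
  have sc: "sqn (\<gamma> t, vel \<gamma> t) = 1" "ric (\<gamma> t, vel \<gamma> t) = \<phi> t" for t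
  proof -
    have T: "(\<gamma> t, vel (geo w) (t / \<rho>)) \<in> TMs" unfolding st using flow_TMs[OF w(1)] .
    show "sqn (\<gamma> t, vel \<gamma> t) = 1"
      unfolding \<gamma>(2) scale_sqn(1)[OF T] st sqn_flow[OF w(1)] \<rho>(2)[symmetric] using \<rho>(1) by (simp add: power_one_over)
    show "ric (\<gamma> t, vel \<gamma> t) = \<phi> t"
      unfolding \<gamma>(2) scale_sqn(2)[OF T] st \<phi>_def q_def sqn_flow[OF w(1)] \<rho>_def[symmetric] \<rho>(2)[symmetric] using \<rho>(1) by (simp add: power_one_over)
  qed
  have us: "ugeod \<gamma>"
    using \<gamma>(1) sc(1) by (simp add: unit_speed_geodesic_def sqn_def)
  have r: "ricci A g (\<gamma> t) (vel \<gamma> t) (vel \<gamma> t) = \<phi> t" for t using sc(2)[of t] by (simp add: ric_def)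
  note ii = index_inequality[OF cf us, unfolded r]
  show "continuous_on UNIV \<phi>" "?I \<le> ?c"
    using ii(1,2) by auto
  assume eq: "?I = ?c"
    and c: "c \<in> A" "fst w \<in> cdom c" and orth: "ip c (cmap c (fst w)) a (snd w c) = 0"
  let ?x = "cmap c (fst w)" and ?y = "snd w c" and ?u = "tv c (fst w) a" and ?w = "\<lambda>c. (1 / \<rho>) *\<^sub>R snd w c"
  have x: "?x \<in> cimg c" using c by simp
  have g0: "\<gamma> 0 = fst w" "vel \<gamma> 0 = ?w"
    using st[of 0] \<gamma>(2)[of 0] flow_0[OF w(1)] by (auto simp: prod_eq_iff)
  have v: "snd w \<in> TS (fst w)" using w by (auto simp: TMs_def)
  have "g (fst w) ?u ?w = 0"
    using orth c g_eq_ip[OF c _ tangent_scale[OF v], of ?u "1 / \<rho>"] by (simp add: ip_simps)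
  then have "curv (fst w) ?u ?w ?w = ?u"
    using ii(3)[OF eq, of ?u] c unfolding g0 by simp
  then have "curv (fst w) ?u ?w ?w c = a" using c by simp
  then have "Rm c ?x a ((1 / \<rho>) *\<^sub>R ?y) ((1 / \<rho>) *\<^sub>R ?y) = a" using c by (simp add: curvature_eq_Rm)
  then have "(1 / \<rho>) *\<^sub>R (1 / \<rho>) *\<^sub>R Rm c ?x a ?y ?y = a"
    by (simp add: linear_cmul[OF Rm_linear(2)[OF c(1) x]] linear_cmul[OF Rm_linear(3)[OF c(1) x]])
  then have "\<rho> *\<^sub>R \<rho> *\<^sub>R (1 / \<rho>) *\<^sub>R (1 / \<rho>) *\<^sub>R Rm c ?x a ?y ?y = \<rho> *\<^sub>R \<rho> *\<^sub>R a" by simp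
  then show "Rm c ?x a ?y ?y = sqn w *\<^sub>R a" using \<rho> by (simp add: power2_eq_square)
qed

lemma continuous_q_flow:
  assumes cf: conj_free and w: "w \<in> TMs" shows "continuous_on UNIV (\<lambda>s. q (flow s w))"
proof (cases "sqn w = 0")
  \<comment> \<open>On zero vectors \<open>q\<close> is a quotient with denominator 0, hence 0 along
    the whole orbit.\<close>
  case True
  then show ?thesis using w by (simp add: q_def sqn_flow)
next
  case False
  then have s: "0 < sqn w" using sqn_nonneg[OF w] by simp
  have "continuous_on UNIV (\<lambda>s. q (flow ((s * sqrt (sqn w)) / sqrt (sqn w)) w))"
    by (intro continuous_on_compose2[OF unit_flow(1)[OF cf w s]] continuous_intros) auto
  then show ?thesis using s by simp
qed

text \<open>Continuity in time and measurability at each fixed time give joint measurability: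
  rounding time down to multiples of 1 / (k + 1) involves only countably many of the maps
  \<open>flow s\<close>.\<close>

lemma measurable_q_flow:
  assumes cf: conj_free shows "(\<lambda>x. q (flow (fst x) (snd x))) \<in> borel_measurable (borel \<Otimes>\<^sub>M TM)"
proof (rule borel_measurable_LIMSEQ_real)
  let ?s = "\<lambda>k s. real_of_int \<lfloor>real (Suc k) * s\<rfloor> / real (Suc k)"
  fix x :: "real \<times> 'a \<times> ('a, 'n) tvec" assume "x \<in> space (borel \<Otimes>\<^sub>M TM)"
  then have w: "snd x \<in> TMs" by (auto simp: space_pair_measure)
  have "(\<lambda>k. ?s k (fst x)) \<longlonglongrightarrow> fst x"
  proof (rule tendsto_sandwich)
    show "(\<lambda>k. fst x + - inverse (real (Suc k))) \<longlonglongrightarrow> fst x" by (rule LIMSEQ_inverse_real_of_nat_add_minus)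
    show "(\<lambda>k. fst x) \<longlonglongrightarrow> fst x" by simp
    have "fst x + - inverse (real (Suc k)) \<le> ?s k (fst x)" "?s k (fst x) \<le> fst x" for k
    proof -
      have "real (Suc k) * fst x - 1 \<le> \<lfloor>real (Suc k) * fst x\<rfloor>" "\<lfloor>real (Suc k) * fst x\<rfloor> \<le> real (Suc k) * fst x" by linarith+
      moreover have "0 < real (Suc k)" by simp
      ultimately show "fst x + - inverse (real (Suc k)) \<le> ?s k (fst x)" "?s k (fst x) \<le> fst x"
        by (simp_all only: pos_le_divide_eq pos_divide_le_eq) (auto simp add: algebra_simps simp del: of_nat_Suc)
    qed
    then show "\<forall>\<^sub>F k in sequentially. fst x + - inverse (real (Suc k)) \<le> ?s k (fst x)"
      "\<forall>\<^sub>F k in sequentially. ?s k (fst x) \<le> fst x" by auto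
  qed
  moreover have "isCont (\<lambda>s. q (flow s (snd x))) (fst x)"
    using continuous_q_flow[OF cf w] by (simp add: continuous_on_eq_continuous_at)
  ultimately show "(\<lambda>k. q (flow (?s k (fst x)) (snd x))) \<longlonglongrightarrow> q (flow (fst x) (snd x))"
    using isCont_tendsto_compose by blast
next
  fix k
  have "(\<lambda>x. q (flow (real_of_int i / real (Suc k)) (snd x))) \<in> borel_measurable (borel \<Otimes>\<^sub>M TM)" for i
    by (rule measurable_compose[OF measurable_snd]) measurable
  moreover have "(\<lambda>x. \<lfloor>real (Suc k) * fst x\<rfloor>) \<in> measurable (borel \<Otimes>\<^sub>M TM) (count_space UNIV)" by measurable
  ultimately show "(\<lambda>x. q (flow (real_of_int \<lfloor>real (Suc k) * fst x\<rfloor> / real (Suc k)) (snd x))) \<in> borel_measurable (borel \<Otimes>\<^sub>M TM)"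
    by (rule measurable_compose_countable)
qed

definition kern where "kern t = ennreal ((sin t)\<^sup>2) * indicator {0..pi} t"
text \<open>The integral of \<open>F\<close> along the unit speed geodesic with weight
  \<open>kern\<close>, substituted back to flow time. In this form the flow time \<open>s\<close> is
  independent of \<open>w\<close>, so the integrals over \<open>s\<close> and \<open>w\<close> can
  be exchanged.\<close>

definition orbit where "orbit F w = (\<integral>\<^sup>+s. ennreal (sqrt (sqn w)) * kern (sqrt (sqn w) * s) * F (flow s w) \<partial>lborel)"

lemma measurable_kern [measurable]: "kern \<in> borel_measurable borel"
  unfolding kern_def[abs_def] by measurable

lemma kern_integral: "(\<integral>\<^sup>+t. kern t \<partial>lborel) = ennreal (pi / 2)"
  unfolding kern_def using has_integral_sin_cos_square by (intro nn_integral_has_integral_lebesgue') auto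

text \<open>For fixed \<open>s\<close> the weight and the set \<open>BM\<close> depend on
  \<open>w\<close> only through \<open>sqn\<close>, which the flow preserves. Invariance of the
  measure thus replaces \<open>flow s w\<close> by \<open>w\<close>, and the integral of
  \<open>kern\<close> remains.\<close>

lemma orbit_average:
  assumes F: "F \<in> borel_measurable TM" and joint: "(\<lambda>x. F (flow (fst x) (snd x))) \<in> borel_measurable (borel \<Otimes>\<^sub>M TM)"
    and fin: "emeasure TM BM < \<infinity>"
  shows "(\<integral>\<^sup>+w. orbit F w * indicator BM w \<partial>TM) = ennreal (pi / 2) * (\<integral>\<^sup>+w. F w * indicator BM w \<partial>TM)"
    and "orbit F \<in> borel_measurable TM"
    and "w \<in> TMs \<Longrightarrow> 0 < sqn w \<Longrightarrow> orbit F w = (\<integral>\<^sup>+t. kern t * F (flow (t / sqrt (sqn w)) w) \<partial>lborel)"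
proof -
  \<comment> \<open>Restricted to \<open>BM\<close> the measure is finite, which supplies the
    sigma-finiteness for the exchange of integrals.\<close>
  define M where "M = density TM (indicator BM)"
  have sM [measurable_cong, simp]: "sets M = sets TM" "space M = TMs" by (simp_all add: M_def)
  have M: "(\<integral>\<^sup>+w. f w \<partial>M) = (\<integral>\<^sup>+w. f w * indicator BM w \<partial>TM)" if "f \<in> borel_measurable TM" for f
    using that by (simp add: M_def nn_integral_density mult.commute)
  have "emeasure M (space M) = emeasure TM BM"
    using M[of "\<lambda>_. 1"] by simp
  then interpret fm: finite_measure M using fin by (intro finite_measureI) auto
  interpret P: pair_sigma_finite lborel M ..
  have flM: "(\<integral>\<^sup>+w. f (flow s w) \<partial>M) = (\<integral>\<^sup>+w. f w \<partial>M)" if f: "f \<in> borel_measurable TM" for f s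
  proof -
    note [measurable] = f
    have "(\<integral>\<^sup>+w. f (flow s w) \<partial>M) = (\<integral>\<^sup>+w. f (flow s w) * indicator BM (flow s w) \<partial>TM)"
      by (subst M, measurable) (auto intro!: nn_integral_cong simp: indicator_def BM_def sqn_flow flow_TMs)
    then show ?thesis using nn_integral_flow[of "\<lambda>w. f w * indicator BM w" s] by (simp add: M)
  qed
  note [measurable] = F joint
  let ?r = "\<lambda>w. sqrt (sqn w)"
  let ?k = "\<lambda>w s. ennreal (?r w) * kern (?r w * s)"
  have j1: "(\<lambda>(s, w). ?k w s * F (flow s w)) \<in> borel_measurable (borel \<Otimes>\<^sub>M TM)"
    using joint unfolding split_beta' by measurable
  have j1': "(\<lambda>(w, s). ?k w s * F (flow s w)) \<in> borel_measurable (TM \<Otimes>\<^sub>M borel)"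
    using measurable_compose[OF measurable_pair_swap' j1] by (simp add: split_beta')
  have j2: "(\<lambda>(s, w). ?k w s * F w) \<in> borel_measurable (borel \<Otimes>\<^sub>M TM)"
    unfolding split_beta' by measurable
  have sb: "sets (lborel \<Otimes>\<^sub>M M) = sets (borel \<Otimes>\<^sub>M TM)" by (intro sets_pair_measure_cong) auto
  show mo: "orbit F \<in> borel_measurable TM"
    unfolding orbit_def[abs_def]
    by (rule lborel.borel_measurable_nn_integral) (use j1' in \<open>simp add: measurable_cong_sets[OF sets_pair_measure_cong[OF refl sets_lborel] refl]\<close>)
  have shift: "(\<integral>\<^sup>+s. ?k w s * u s \<partial>lborel) = (\<integral>\<^sup>+t. kern t * u (t / ?r w) \<partial>lborel)"
    if w: "0 < sqn w" and u: "u \<in> borel_measurable borel" for u w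
  proof -
    note [measurable] = u
    have "(\<integral>\<^sup>+t. kern t * u (t / ?r w) \<partial>lborel) = \<bar>?r w\<bar> * (\<integral>\<^sup>+s. kern (0 + ?r w * s) * u ((0 + ?r w * s) / ?r w) \<partial>lborel)"
      using w by (intro nn_integral_real_affine) auto
    also have "\<dots> = (\<integral>\<^sup>+s. ennreal (?r w) * (kern (?r w * s) * u s) \<partial>lborel)"
      using w by (subst nn_integral_cmult) auto
    finally show ?thesis by (simp add: mult.assoc)
  qed
  show "orbit F w = (\<integral>\<^sup>+t. kern t * F (flow (t / ?r w) w) \<partial>lborel)" if "w \<in> TMs" "0 < sqn w"
  proof -
    have "(\<lambda>s. F (flow s w)) \<in> borel_measurable borel"
      using measurable_compose[OF measurable_Pair2', of w TM "\<lambda>x. F (flow (fst x) (snd x))" borel borel] that joint by simp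
    then show ?thesis unfolding orbit_def by (rule shift[OF that(2)])
  qed
  have "(\<integral>\<^sup>+w. orbit F w * indicator BM w \<partial>TM) = (\<integral>\<^sup>+w. \<integral>\<^sup>+s. ?k w s * F (flow s w) \<partial>lborel \<partial>M)"
    using M[OF mo] by (simp add: orbit_def)
  also have "\<dots> = (\<integral>\<^sup>+s. \<integral>\<^sup>+w. ?k w s * F (flow s w) \<partial>M \<partial>lborel)"
    by (rule P.Fubini') (use j1 in \<open>simp add: measurable_cong_sets[OF sb refl]\<close>)
  also have "\<dots> = (\<integral>\<^sup>+s. \<integral>\<^sup>+w. ?k w s * F w \<partial>M \<partial>lborel)"
  proof (rule nn_integral_cong)
    fix s
    have "(\<lambda>w. ?k w s * F w) \<in> borel_measurable TM" by measurable
    from flM[OF this, of s]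
    have "(\<integral>\<^sup>+w. ?k (flow s w) s * F (flow s w) \<partial>M) = (\<integral>\<^sup>+w. ?k w s * F w \<partial>M)" .
    moreover have "(\<integral>\<^sup>+w. ?k (flow s w) s * F (flow s w) \<partial>M) = (\<integral>\<^sup>+w. ?k w s * F (flow s w) \<partial>M)"
      by (intro nn_integral_cong) (simp add: sqn_flow)
    ultimately show "(\<integral>\<^sup>+w. ?k w s * F (flow s w) \<partial>M) = (\<integral>\<^sup>+w. ?k w s * F w \<partial>M)" by simp
  qed
  also have "\<dots> = (\<integral>\<^sup>+w. \<integral>\<^sup>+s. ?k w s * F w \<partial>lborel \<partial>M)"
    by (rule P.Fubini'[symmetric]) (use j2 in \<open>simp add: measurable_cong_sets[OF sb refl]\<close>)
  also have "\<dots> = (\<integral>\<^sup>+w. ennreal (pi / 2) * F w * indicator BM w \<partial>TM)"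
  proof (subst M)
    show "(\<lambda>w. \<integral>\<^sup>+s. ?k w s * F w \<partial>lborel) \<in> borel_measurable TM"
      by (rule lborel.borel_measurable_nn_integral) (unfold split_beta', measurable)
    show "(\<integral>\<^sup>+w. (\<integral>\<^sup>+s. ?k w s * F w \<partial>lborel) * indicator BM w \<partial>TM) = (\<integral>\<^sup>+w. ennreal (pi / 2) * F w * indicator BM w \<partial>TM)"
    proof (rule nn_integral_cong)
      fix w
      show "(\<integral>\<^sup>+s. ?k w s * F w \<partial>lborel) * indicator BM w = ennreal (pi / 2) * F w * indicator BM w"
      proof (cases "w \<in> BM")
        case True
        then have "0 < sqn w" by (simp add: BM_def)
        from shift[OF this, of "\<lambda>_. F w"]
        show ?thesis by (simp add: nn_integral_multc kern_integral)
      qed simp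
    qed
  qed
  also have "\<dots> = ennreal (pi / 2) * (\<integral>\<^sup>+w. F w * indicator BM w \<partial>TM)"
    by (subst nn_integral_cmult[symmetric]) (auto simp: mult.assoc)
  finally show "(\<integral>\<^sup>+w. orbit F w * indicator BM w \<partial>TM) = ennreal (pi / 2) * (\<integral>\<^sup>+w. F w * indicator BM w \<partial>TM)" .
qed

text \<open>The index inequality with the negative part moved to the other side. On a single orbit
  both parts are finite by continuity, so equality in \<open>ennreal\<close> returns equality of the
  real integral.\<close>

lemma orbit_parts:
  assumes cf: conj_free and w: "w \<in> TMs" "0 < sqn w" and fin: "emeasure TM BM < \<infinity>"
  defines "\<phi> \<equiv> \<lambda>t. q (flow (t / sqrt (sqn w)) w)" and "P \<equiv> orbit (\<lambda>w. ennreal (q w)) w" and "N \<equiv> orbit (\<lambda>w. ennreal (- q w)) w"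
    and "k \<equiv> (real CARD('n) - 1) * pi / 2"
  shows "P \<le> N + ennreal k" and "N + ennreal k \<le> P \<Longrightarrow> integral {0..pi} (\<lambda>t. (sin t)\<^sup>2 * \<phi> t) = k"
proof -
  have k0: "0 \<le> k" by (simp add: k_def)
  let ?h = "\<lambda>t. (sin t)\<^sup>2 * \<phi> t"
  have uf: "continuous_on UNIV \<phi>" "integral {0..pi} ?h \<le> k"
    unfolding \<phi>_def k_def by (rule unit_flow[OF cf w])+
  have ch: "continuous_on {0..pi} ?h" by (intro continuous_intros continuous_on_subset[OF uf(1)]) auto
  have i: "(\<lambda>t. max (r * ?h t) 0) integrable_on {0..pi}" for r
    by (intro integrable_continuous_interval continuous_intros ch)
  \<comment> \<open>The values \<open>r = 1\<close> and \<open>r = - 1\<close> give the positive and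
    the negative part.\<close>
  have *: "orbit (\<lambda>w. ennreal (r * q w)) w = ennreal (integral {0..pi} (\<lambda>t. max (r * ?h t) 0))" for r
  proof -
    have "(\<lambda>x. ennreal (r * q (flow (fst x) (snd x)))) \<in> borel_measurable (borel \<Otimes>\<^sub>M TM)"
      using measurable_q_flow[OF cf] by measurable
    then have "orbit (\<lambda>w. ennreal (r * q w)) w = (\<integral>\<^sup>+t. kern t * ennreal (r * \<phi> t) \<partial>lborel)"
      unfolding \<phi>_def by (intro orbit_average(3)[OF _ _ fin w]) simp_all
    also have "\<dots> = (\<integral>\<^sup>+t. ennreal (max (r * ?h t) 0) * indicator {0..pi} t \<partial>lborel)"
    proof (rule nn_integral_cong)
      fix t
      have "ennreal (max x 0) = ennreal x" for x :: real by (cases "0 \<le> x") (simp_all add: max_def ennreal_neg)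
      moreover have "(sin t)\<^sup>2 * (r * \<phi> t) = r * ?h t" by simp
      ultimately show "kern t * ennreal (r * \<phi> t) = ennreal (max (r * ?h t) 0) * indicator {0..pi} t"
        by (simp add: kern_def ennreal_mult'[symmetric] mult.left_commute split: split_indicator)
    qed
    also have "\<dots> = ennreal (integral {0..pi} (\<lambda>t. max (r * ?h t) 0))"
      using integrable_integral[OF i] by (intro nn_integral_has_integral_lebesgue') auto
    finally show ?thesis .
  qed
  define a b where a_b_def: "a = integral {0..pi} (\<lambda>t. max (?h t) 0)" "b = integral {0..pi} (\<lambda>t. max (- ?h t) 0)"
  have P: "P = ennreal a" and N: "N = ennreal b"
    using *[of 1] *[of "- 1"] by (simp_all add: P_def N_def a_b_def)
  note i = i[of 1, simplified] i[of "- 1", simplified]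
  have b0: "0 \<le> b" unfolding a_b_def by (rule integral_nonneg[OF i(2)]) auto
  have "integral {0..pi} ?h = integral {0..pi} (\<lambda>t. max (?h t) 0 - max (- ?h t) 0)"
    by (intro integral_cong) (auto simp: max_def)
  also have "\<dots> = a - b" unfolding a_b_def by (rule integral_diff[OF i])
  finally have I: "integral {0..pi} ?h = a - b" .
  have le: "a \<le> b + k" using uf(2) I by simp
  have NK: "N + ennreal k = ennreal (b + k)" unfolding N using b0 k0 by simp
  show "P \<le> N + ennreal k" unfolding NK P using le by (rule ennreal_leI)
  assume "N + ennreal k \<le> P"
  then have "ennreal (b + k) \<le> ennreal a" unfolding NK P .
  moreover have "0 \<le> a" unfolding a_b_def by (rule integral_nonneg[OF i(1)]) auto
  ultimately have "b + k \<le> a" by (simp add: ennreal_le_iff)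
  then show "integral {0..pi} ?h = k" using I le by simp
qed

text \<open>Integrated over \<open>BM\<close>, \<open>orbit_parts\<close> and
  \<open>ricci_average\<close> are opposite inequalities between the same two finite quantities. The
  pointwise inequality is then an equality almost everywhere.\<close>

theorem average_rigidity:
  assumes cf: conj_free and n: "CARD('n) \<ge> 2" and vol: "emeasure V UNIV < \<infinity>"
    and neg: "(\<integral>\<^sup>+w. qneg w \<partial>TM) < \<infinity>"
    and avg: "average_scalar_curvature A g \<ge> ereal (real CARD('n) * (real CARD('n) - 1))"
  shows "constant_sectional_curvature A g 1"
proof -
  define k where "k = (real CARD('n) - 1) * pi / 2"
  have k0: "0 \<le> k" by (simp add: k_def)
  define P N where "P = orbit (\<lambda>w. ennreal (q w))" and "N = orbit (\<lambda>w. ennreal (- q w))"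
  have fin: "emeasure TM BM < \<infinity>"
    unfolding emeasure_BM using vol emeasure_lborel_ball_finite[of "0::real^'n" 1] by (simp add: ennreal_mult_less_top)
  have jq: "(\<lambda>x. ennreal (q (flow (fst x) (snd x)))) \<in> borel_measurable (borel \<Otimes>\<^sub>M TM)"
    "(\<lambda>x. ennreal (- q (flow (fst x) (snd x)))) \<in> borel_measurable (borel \<Otimes>\<^sub>M TM)"
    using measurable_q_flow[OF cf] by measurable
  have mq: "(\<lambda>w. ennreal (q w)) \<in> borel_measurable TM" "(\<lambda>w. ennreal (- q w)) \<in> borel_measurable TM" by measurable
  note oP = orbit_average[OF mq(1) jq(1) fin, folded P_def] and oN = orbit_average[OF mq(2) jq(2) fin, folded N_def]
  note [measurable] = oP(2) oN(2)
  let ?iN = "\<integral>\<^sup>+w. (N w + ennreal k) * indicator BM w \<partial>TM" and ?iP = "\<integral>\<^sup>+w. P w * indicator BM w \<partial>TM"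
  \<comment> \<open>The gap in the inequality \<open>pw\<close>. Its integral is 0, hence it
    vanishes almost everywhere.\<close>
  let ?D = "\<lambda>w. (N w + ennreal k) * indicator BM w - P w * indicator BM w"
  have pw: "P w * indicator BM w \<le> (N w + ennreal k) * indicator BM w" for w
    using orbit_parts(1)[OF cf _ _ fin, of w] by (auto simp: BM_def P_def N_def k_def split: split_indicator)
  have iN: "?iN = ennreal (pi / 2) * (\<integral>\<^sup>+w. qneg w \<partial>TM) + ennreal k * emeasure TM BM"
    unfolding qneg_def oN(1)[symmetric] by (simp add: distrib_right nn_integral_add nn_integral_cmult_indicator)
  also have "\<dots> = ennreal (pi / 2) * ((\<integral>\<^sup>+w. qneg w \<partial>TM) + ennreal (real CARD('n) - 1) * emeasure TM BM)"
    by (simp add: distrib_left mult.assoc[symmetric] ennreal_mult[symmetric] k_def mult.commute[of pi])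
  also have "\<dots> \<le> ennreal (pi / 2) * (\<integral>\<^sup>+w. qpos w \<partial>TM)"
    by (intro mult_left_mono ricci_average[OF n vol neg avg]) simp
  also have "\<dots> = ?iP" unfolding oP(1) qpos_def ..
  finally have le: "?iN \<le> ?iP" .
  have fN: "?iN < \<infinity>"
    unfolding iN using neg fin by (simp add: ennreal_mult_less_top)
  have fP: "?iP < \<infinity>" by (rule le_less_trans[OF nn_integral_mono[OF pw] fN])
  have "(\<integral>\<^sup>+w. ?D w \<partial>TM) = ?iN - ?iP"
    using pw fP by (intro nn_integral_diff) auto
  also have "\<dots> = 0" using le fN by (intro diff_eq_0_ennreal) auto
  finally have AE: "AE w in TM. ?D w = 0" by (subst (asm) nn_integral_0_iff_AE) auto
  define E where "E = {w \<in> BM. N w + ennreal k \<le> P w}"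
  have AE_E: "AE w in TM. w \<in> BM \<longrightarrow> w \<in> E"
    using AE by eventually_elim (auto simp: E_def diff_eq_0_iff_ennreal)
  have rigid: "Rm c (fst z) a (snd z) (snd z) = ip c (fst z) (snd z) (snd z) *\<^sub>R a - ip c (fst z) a (snd z) *\<^sub>R snd z"
    if c: "c \<in> A" and z: "z \<in> Tc c" and w: "par c z \<in> E" for c z a
  proof -
    let ?w = "par c z" and ?x = "fst z" and ?y = "snd z"
    let ?r = "ip c ?x ?y ?y"
    have x: "?x \<in> cimg c" using z by (auto simp: Tc_def mem_Times_iff)
    have w': "?w \<in> TMs" "0 < sqn ?w" "fst ?w \<in> cdom c" using w par_TMs[OF c z] fst_par[OF c z] by (auto simp: E_def BM_def)
    have cw: "cmap c (fst ?w) = ?x" "snd ?w c = ?y" using coords_par[OF c z] by (auto simp: coords_def prod_eq_iff)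
    have r: "sqn ?w = ?r" "0 < ?r" using par_chart(2)[OF c z] w' by auto
    have "integral {0..pi} (\<lambda>t. (sin t)\<^sup>2 * q (flow (t / sqrt (sqn ?w)) ?w)) = (real CARD('n) - 1) * pi / 2"
      using orbit_parts(2)[OF cf w'(1,2) fin] w by (simp add: E_def P_def N_def k_def)
    note eq = unit_flow(3)[OF cf w'(1,2) this c w'(3), unfolded cw r(1)]
    \<comment> \<open>The component of \<open>a\<close> orthogonal to \<open>?y\<close>; the
      curvature operator does not see the part along \<open>?y\<close>.\<close>
    let ?b = "a - (ip c ?x a ?y / ?r) *\<^sub>R ?y"
    have "ip c ?x ?b ?y = 0" using r(2) by (simp add: ip_simps)
    from eq[OF this] have "Rm c ?x a ?y ?y - (ip c ?x a ?y / ?r) *\<^sub>R Rm c ?x ?y ?y ?y = ?r *\<^sub>R ?b"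
      by (simp only: linear_diff[OF Rm_linear(1)[OF c x]] linear_cmul[OF Rm_linear(1)[OF c x]])
    moreover have "Rm c ?x ?y ?y ?y = 0" using Rm_antisym[of c ?x ?y ?y ?y] by (simp add: eq_neg_iff_add_eq_0 flip: scaleR_2)
    ultimately show ?thesis using r(2) by (simp add: scaleR_diff_right)
  qed
  let ?def = "\<lambda>c a z. Rm c (fst z) a (snd z) (snd z) - (ip c (fst z) (snd z) (snd z) *\<^sub>R a - ip c (fst z) a (snd z) *\<^sub>R snd z)"
  have small: "?def c a z = 0" if c: "c \<in> A" and z: "z \<in> Tc c" and r: "0 < ip c (fst z) (snd z) (snd z)" "ip c (fst z) (snd z) (snd z) < 1" for c a z
  proof (rule ccontr)
    assume nz: "?def c a z \<noteq> 0"
    let ?F = "\<lambda>z. (ip c (fst z) (snd z) (snd z), ?def c a z)"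
    \<comment> \<open>The exceptional vectors form an open set by continuity. It is null for
      \<open>TM\<close>, hence for Lebesgue measure since \<open>rho\<close> is positive there, and
      a null open set is empty.\<close>
    define Z where "Z = {z \<in> Tc c. ?F z \<in> {0<..<1} \<times> (- {0})}"
    have cont: "continuous_on (Tc c) ?F"
    proof -
      have f: "continuous_on (Tc c) fst" "continuous_on (Tc c) snd" "\<And>z. z \<in> Tc c \<Longrightarrow> fst z \<in> cimg c"
        by (auto intro!: continuous_intros simp: Tc_def)
      show ?thesis
        by (intro continuous_on_Pair continuous_on_diff continuous_on_scaleR continuous_on_const f
          continuous_on_ip[OF c] continuous_on_Rm[OF c]) assumption+
    qed
    have "open (?F -` ({0<..<1} \<times> (- {0})) \<inter> Tc c)"
      by (rule continuous_on_open_vimage[OF open_Tc[OF c], THEN iffD1, OF cont, rule_format]) (intro open_Times open_greaterThanLessThan open_Compl closed_singleton)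
    moreover have "?F -` ({0<..<1} \<times> (- {0})) \<inter> Tc c = Z" by (auto simp: Z_def)
    ultimately have Z: "open Z" by simp
    have zZ: "z \<in> Z" using z r nz by (simp add: Z_def)
    have bs: "box c Z \<in> sets TM" by (rule TM_open_sets[OF TM_open_box[OF c Z]])
    have bad: "w \<in> BM \<and> w \<notin> E" if "w \<in> box c Z" for w
    proof -
      have w: "w \<in> TMs" "fst w \<in> cdom c" "coords c w \<in> Z" using that by (auto simp: box_def)
      have cw: "coords c w \<in> Tc c" "par c (coords c w) = w" using w c coords_Tc by auto
      have "sqn w = ip c (fst (coords c w)) (snd (coords c w)) (snd (coords c w))" using par_chart(2)[OF c cw(1)] cw(2) by simp
      then have "w \<in> BM" using w by (simp add: Z_def BM_def)
      moreover have "w \<notin> E" using rigid[OF c cw(1), of a] cw(2) w(3) by (auto simp: Z_def)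
      ultimately show ?thesis by blast
    qed
    have "AE w in TM. w \<notin> box c Z" using AE_E by eventually_elim (use bad in blast)
    moreover have "{w \<in> space TM. \<not> w \<notin> box c Z} = box c Z" by (auto simp: box_def)
    ultimately have "emeasure TM (box c Z) = 0" using AE_iff_measurable[OF bs, of "\<lambda>w. w \<notin> box c Z"] by simp
    moreover have "emeasure TM (box c Z) = (\<integral>\<^sup>+z. rho c z * chartfun c (indicator (box c Z)) z \<partial>lborel)"
      unfolding nn_integral_indicator[OF bs, symmetric]
      by (rule nn_integral_TM_chart[OF borel_measurable_indicator[OF bs] c]) (simp add: box_def)
    moreover have "(\<lambda>z. rho c z * chartfun c (indicator (box c Z)) z) \<in> borel_measurable borel"
      using bs by (intro borel_measurable_times_ennreal measurable_rho measurable_chartfun c) auto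
    ultimately have "AE z in lborel. rho c z * chartfun c (indicator (box c Z)) z = 0"
      by (simp add: nn_integral_0_iff_AE)
    then have "AE z in lborel. z \<notin> Z"
    proof eventually_elim
      fix z assume 0: "rho c z * chartfun c (indicator (box c Z)) z = 0"
      show "z \<notin> Z"
      proof
        assume zZ: "z \<in> Z"
        then have zT: "z \<in> Tc c" by (simp add: Z_def)
        then have "rho c z \<noteq> 0" using det_G_pos[OF c, of "fst z"] rho_eq[OF c, of z] by (auto simp: Tc_def)
        moreover have "par c z \<in> box c Z" using zZ zT par_TMs[OF c zT] fst_par[OF c zT] c by (simp add: box_def)
        ultimately show False using 0 zT by (simp add: chartfun_def)
      qed
    qed
    then have "emeasure lborel Z = 0" using Z by (subst (asm) AE_iff_measurable[OF _ refl]) auto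
    then have "negligible Z" using Z by (simp add: negligible_iff_null_sets null_sets_completionI null_setsI)
    then show False using open_not_negligible[OF Z] zZ by blast
  qed
  show ?thesis
    unfolding constant_curvature_1_iff
  proof (intro ballI allI)
    fix c x a b assume c: "c \<in> A" and x: "x \<in> cimg c"
    show "Rm c x a b b = ip c x b b *\<^sub>R a - ip c x a b *\<^sub>R b"
    proof (cases "b = 0")
      case True
      then show ?thesis using linear_0[OF Rm_linear(2)[OF c x]] by (simp add: ip_simps)
    next
      case False
      define r where "r = ip c x b b"
      have r: "0 < r" using ip_pos[OF c x False] by (simp add: r_def)
      \<comment> \<open>Scaling \<open>b\<close> to squared length 1/2 brings it into the punctured
        unit ball; the identity is homogeneous of degree 2 in \<open>b\<close>.\<close>
      define s where "s = 1 / sqrt (2 * r)"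
      have s: "s \<noteq> 0" "s * s * r = 1 / 2" using r by (auto simp: s_def real_sqrt_mult field_simps)
      have "ip c x (s *\<^sub>R b) (s *\<^sub>R b) = 1 / 2" using s(2) by (simp add: ip_simps r_def mult.assoc)
      then have "?def c a (x, s *\<^sub>R b) = 0" using x by (intro small[OF c]) (auto simp: Tc_def)
      moreover have "?def c a (x, s *\<^sub>R b) = (s * s) *\<^sub>R (Rm c x a b b - (ip c x b b *\<^sub>R a - ip c x a b *\<^sub>R b))"
        by (simp add: ip_simps linear_cmul[OF Rm_linear(2)[OF c x]] linear_cmul[OF Rm_linear(3)[OF c x]] scaleR_diff_right mult_ac)
      ultimately show ?thesis using s(1) by simp
    qed
  qed
qed

text \<open>On \<open>BM\<close> the function \<open>q\<close> is Ric of the normalised vector, so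
  by \<open>usb_integral\<close> the two integrals differ by the factor n.\<close>

lemma qneg_finite:
  assumes "(\<integral>\<^sup>+ (p, \<theta>). ennreal (max (- ricci A g p \<theta> \<theta>) 0) \<partial>usb_measure A g) < \<infinity>"
  shows "(\<integral>\<^sup>+w. qneg w \<partial>TM) < \<infinity>"
proof -
  let ?h = "\<lambda>w. ennreal (max (- ric w) 0)"
  have "(\<integral>\<^sup>+w. qneg w \<partial>TM) = (\<integral>\<^sup>+w. ?h (nrm w) * indicator BM w \<partial>TM)"
  proof (rule nn_integral_cong)
    fix w
    have "ennreal (max x 0) = ennreal x" for x :: real by (cases "0 \<le> x") (simp_all add: max_def ennreal_neg)
    then show "qneg w = ?h (nrm w) * indicator BM w"
      using nrm(3)[of w] by (simp add: qneg_def BM_def indicator_def)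
  qed
  moreover have "of_nat CARD('n) * (\<integral>\<^sup>+w. ?h (nrm w) * indicator BM w \<partial>TM) = (\<integral>\<^sup>+w. ?h w \<partial>usb_measure A g)"
    by (rule usb_integral[symmetric]) measurable
  moreover have "\<dots> < \<infinity>" using assms by (simp add: ric_def split_beta')
  ultimately have "of_nat CARD('n) * (\<integral>\<^sup>+w. qneg w \<partial>TM) < \<infinity>" by (simp only:)
  then show ?thesis by (cases "(\<integral>\<^sup>+w. qneg w \<partial>TM) = \<infinity>") (auto simp: ennreal_mult_top top.not_eq_extremum)
qed

end

theorem theorem2:
  fixes A :: "('a::{t2_space, second_countable_topology}, 'n::finite) chart set"
    and g :: "('a, 'n) metric"
  assumes "CARD('n) \<ge> 2"
    and "oriented_smooth_atlas A"
    and "riemannian_metric A g"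
    and "complete_metric A g"
    and "emeasure (riemannian_volume A g) UNIV < \<infinity>"
    and "(\<integral>\<^sup>+ (p, \<theta>). ennreal (max (- ricci A g p \<theta> \<theta>) 0) \<partial>usb_measure A g) < \<infinity>"
    and "average_scalar_curvature A g \<ge> ereal (real CARD('n) * (real CARD('n) - 1))"
  shows "conjugate_radius A g \<le> ereal pi \<and>
         (conjugate_radius A g = ereal pi \<longleftrightarrow> constant_sectional_curvature A g 1)"
proof -
  interpret complete_riem A g by unfold_locales fact+
  have radius: "constant_sectional_curvature A g 1 \<Longrightarrow> conjugate_radius A g = ereal pi"
    using constant_curvature_conjugate_radius assms(4,1) by blast
  have rigid: "ereal pi \<le> conjugate_radius A g \<Longrightarrow> constant_sectional_curvature A g 1"
    by (rule average_rigidity) (use assms conj_free_of_radius qneg_finite in auto)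
  \<comment> \<open>A radius above \<pi> is impossible: it would give constant curvature 1 and
    therefore radius exactly \<pi>.\<close>
  show ?thesis using radius rigid by (cases "ereal pi \<le> conjugate_radius A g") auto
qed

end
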